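(* Assume that for every $\theta\in\Theta$: (1.i) $\mathbb{E}^{\theta}|\log\rho_0|<\infty$; (1.ii) $\mathbb{E}^{\theta}(\log\rho_0)<0$; (1.iii) $\mathbb{E}^{\theta}(\rho_0)\in[1,+\infty)$. Assume: (2.i) for any $(x,y)\in\mathbb{Z}_+^2$, the map $\theta\mapsto\phi_\theta(x,y)$ is continuous on $\Theta$; (2.ii) for any $(\theta,\theta')\in\Theta^2$, $\nu_\theta\neq\nu_{\theta'}\iff\theta\neq\theta'$; (2.iii) for any $\theta\in\Theta$, $\tilde\pi_\theta\big(\sup_{\theta'\in\Theta}|\phi_{\theta'}-\phi_{\theta_0}|\big)<\infty$. Assume moreover: (3.i) for any $(x,y)\in\mathbb{Z}_+^2$, the map $\theta\mapsto\phi_\theta(x,y)$ is twice continuously differentiable on $\Theta$; (3.ii) for any $\theta\in\Theta$, there exists some $q>1$ such that $\tilde\pi_\theta\big(\|\dot\phi_\theta\|^{2q}\big)<+\infty$; (3.iii) for any $\theta\in\Theta$ and any $u\in\mathbb{Z}_+$, $\sum_{v\in\mathbb{Z}_+}\dot Q_\theta(u,v)=\partial_\theta\big(\sum_{v\in\mathbb{Z}_+}Q_\theta(u,v)\big)$; (3.iv) for any $\theta\in\Theta$ there exists a neighborhood $\mathcal{V}(\theta)$ of $\theta$ such that $\tilde\pi_\theta\big(\sup_{\theta'\in\mathcal{V}(\theta)}\|\dot\phi_{\theta'}\|^2\big)<+\infty$ and $\tilde\pi_\theta\big(\sup_{\theta'\in\mathcal{V}(\theta)}\|\ddot\phi_{\theta'}\|\big)<+\infty$;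 (3.v) for any $\theta\in\Theta$, the matrix $\Sigma_\theta=\tilde\pi_\theta\big(\dot\phi_\theta\dot\phi_\theta^{\top}\big)=-\tilde\pi_\theta(\ddot\phi_\theta)$ is nonsingular. Then, for any choice of estimators $\widehat\theta_n$ that are measurable and satisfy $\widehat\theta_n\in\mathrm{Argmax}_{\theta\in\Theta}\,\ell_n^{\mathrm{sb}}(\theta)$, the sequence $\sqrt{n}(\widehat\theta_n-\theta^\star)$ converges in $\mathbf{P}^\star$-distribution, as $n\to\infty$, to a centered Gaussian random vector with covariance matrix $\Sigma_{\theta^\star}^{-1}$.
   Context: Notation: $\mathbb{Z}_+=\{0,1,2,\dots\}$. Let $\Theta\subset\mathbb{R}^d$ be compact and, for each $\theta\in\Theta$, let $\nu_\theta$ be a probability measure on $(0,1)$. Let $\omega=(\omega_x)_{x\in\mathbb{Z}}$ be the environment, with law $\mathbb{P}^\theta=\nu_\theta^{\otimes\mathbb{Z}}$ on $(0,1)^{\mathbb{Z}}$ and expectation $\mathbb{E}^\theta$, and let $\rho_x=(1-\omega_x)/\omega_x$. For fixed $\omega$, let $X=(X_t)_{t\in\mathbb{Z}_+}$ be the Markov chain on $\mathbb{Z}$ with $X_0=0$ which jumps from $x$ to $x+1$ with probability $\omega_x$ and to $x-1$ with probability $1-\omega_x$; its law is $P_\omega$. The annealed law is $\mathbf{P}^\theta(\cdot)=\int P_\omega(\cdot)\,d\mathbb{P}^\theta(\omega)$. The process $X$ is generated under a true parameter $\theta^\star$, an interior point of $\Theta$, and $\mathbf{P}^\star=\mathbf{P}^{\theta^\star}$.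 Hitting times: $T_n=\inf\{t: X_t=n\}$. Numbers of left steps: $L_x^n=\sum_{t=0}^{T_n-1}\mathbf{1}\{X_t=x,\,X_{t+1}=x-1\}$ for $x\in\{0,\dots,n\}$. For $u,v\in\mathbb{Z}_+$: $\phi_\theta(u,v)=\log\int_0^1 a^{u+1}(1-a)^v\,d\nu_\theta(a)$ and $Q_\theta(u,v)=\binom{u+v}{v}\int_0^1a^{u+1}(1-a)^v\,d\nu_\theta(a)=\binom{u+v}{v}e^{\phi_\theta(u,v)}$. Let $S=(1+\rho_1+\rho_1\rho_2+\cdots+\rho_1\cdots\rho_k+\cdots)^{-1}$, $\pi_\theta(u)=\mathbb{E}^\theta[S(1-S)^u]$, $\tilde\pi_\theta(u,v)=\pi_\theta(u)Q_\theta(u,v)$, and $\tilde\pi_\theta(g)=\sum_{(x,y)\in\mathbb{Z}_+^2}\tilde\pi_\theta(x,y)g(x,y)$ (entrywise for vector- or matrix-valued $g$). Fix an arbitrary $\theta_0\in\Theta$ and define the criterion $\ell_n^{\mathrm{sb}}(\theta)=\sum_{x=0}^{n-1}\big[\phi_\theta(L_{x+1}^n,L_x^n)-\phi_{\theta_0}(L_{x+1}^n,L_x^n)\big]$. For a function $g_\theta$ of $\theta$, $\dot g_\theta$ or $\partial_\theta g_\theta$ denotes the (column) gradient and $\ddot g_\theta$ the Hessian matrix with respect to $\theta$; $Y^{\top}$ is the transpose of $Y$. *)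

theory Defs
  imports "HOL-Probability.Probability"
begin

section \<open>Random walk in an i.i.d. random environment\<close>

text \<open>The single-site law is a measure \<open>\<mu>\<close> whose underlying space is the open unit interval.\<close>

definition unit_law :: "real measure \<Rightarrow> bool" where
  "unit_law \<mu> \<longleftrightarrow> prob_space \<mu> \<and> sets \<mu> = sets (restrict_space borel {0<..<1})"

type_synonym environment = "int \<Rightarrow> real"
type_synonym path = "nat \<Rightarrow> int"

definition env_law :: "real measure \<Rightarrow> environment measure" where
  "env_law \<mu> = (\<Pi>\<^sub>M x\<in>(UNIV :: int set). \<mu>)"

definition rho :: "environment \<Rightarrow> int \<Rightarrow> real" where
  "rho \<omega> x = (1 - \<omega> x) / \<omega> x"

definition jump_law :: "environment \<Rightarrow> int \<Rightarrow> int pmf" where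
  "jump_law \<omega> x = map_pmf (\<lambda>right. if right then x + 1 else x - 1) (bernoulli_pmf (\<omega> x))"

definition path_space :: "path measure" where
  "path_space = (\<Pi>\<^sub>M t\<in>(UNIV :: nat set). count_space UNIV)"

text \<open>The conditional law of \<open>X\<^sub>t\<close> given \<open>X\<^sub>0, \<dots>, X\<^bsub>t-1\<^esub>\<close>.\<close>

definition next_law :: "environment \<Rightarrow> nat \<Rightarrow> path \<Rightarrow> int measure" where
  "next_law \<omega> t X = measure_pmf (case t of 0 \<Rightarrow> return_pmf 0 | Suc s \<Rightarrow> jump_law \<omega> (X s))"

text \<open>The law on path space obtained from these kernels by the Ionescu-Tulcea theorem.\<close>

definition quenched_law :: "environment \<Rightarrow> path measure" where
  "quenched_law \<omega> =
     projective_family.lim UNIV (Ionescu_Tulcea.CI (next_law \<omega>) (\<lambda>_. count_space UNIV))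
       (\<lambda>_. count_space UNIV)"

definition annealed_law :: "real measure \<Rightarrow> path measure" where
  "annealed_law \<mu> = env_law \<mu> \<bind> quenched_law"

definition hitting_time :: "path \<Rightarrow> nat \<Rightarrow> enat" where
  "hitting_time X n = Inf {enat t | t. X t = int n}"

text \<open>If \<open>T\<^sub>n = \<infinity>\<close> and there are infinitely many such left steps, the value is \<open>0\<close>.\<close>

definition left_steps :: "path \<Rightarrow> nat \<Rightarrow> nat \<Rightarrow> nat" where
  "left_steps X n x =
     card {t. enat t < hitting_time X n \<and> X t = int x \<and> X (Suc t) = int x - 1}"


section \<open>The criterion and the invariant law\<close>

definition phi :: "real measure \<Rightarrow> nat \<Rightarrow> nat \<Rightarrow> real" where
  "phi \<mu> u v = ln (\<integral>a. a ^ (u + 1) * (1 - a) ^ v \<partial>\<mu>)"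

definition Q :: "real measure \<Rightarrow> nat \<Rightarrow> nat \<Rightarrow> real" where
  "Q \<mu> u v = real ((u + v) choose v) * (\<integral>a. a ^ (u + 1) * (1 - a) ^ v \<partial>\<mu>)"

text \<open>The series is taken in \<open>[0,\<infinity>]\<close>, so that \<open>S = 0\<close> where it diverges.\<close>

definition S :: "environment \<Rightarrow> real" where
  "S \<omega> = enn2real (inverse (\<Sum>k. ennreal (\<Prod>j=1..k. rho \<omega> (int j))))"

definition inv_law :: "real measure \<Rightarrow> nat \<Rightarrow> real" where
  "inv_law \<mu> u = (\<integral>\<omega>. S \<omega> * (1 - S \<omega>) ^ u \<partial>env_law \<mu>)"

definition inv_pair :: "real measure \<Rightarrow> nat \<Rightarrow> nat \<Rightarrow> real" where
  "inv_pair \<mu> u v = inv_law \<mu> u * Q \<mu> u v"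

text \<open>
  The functional \<open>g \<mapsto> \<pi>\<tilde>(g)\<close>, for \<open>[0,\<infinity>]\<close>-valued \<open>g\<close> and, entrywise, for matrix-valued \<open>g\<close>.
\<close>

definition inv_nn :: "real measure \<Rightarrow> (nat \<Rightarrow> nat \<Rightarrow> ennreal) \<Rightarrow> ennreal" where
  "inv_nn \<mu> g = (\<Sum>\<^sub>\<infinity>(x, y)\<in>UNIV. ennreal (inv_pair \<mu> x y) * g x y)"

definition inv_mat ::
  "real measure \<Rightarrow> (nat \<Rightarrow> nat \<Rightarrow> real ^ 'd ^ 'd) \<Rightarrow> real ^ 'd ^ 'd" where
  "inv_mat \<mu> g = (\<chi> i j. \<Sum>\<^sub>\<infinity>(x, y)\<in>UNIV. inv_pair \<mu> x y * g x y $ i $ j)"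

text \<open>\<open>v v\<^sup>T\<close>\<close>

definition outer :: "real ^ 'd \<Rightarrow> real ^ 'd ^ 'd" where
  "outer v = (\<chi> i j. v $ i * v $ j)"

definition criterion ::
  "('p \<Rightarrow> real measure) \<Rightarrow> 'p \<Rightarrow> nat \<Rightarrow> path \<Rightarrow> 'p \<Rightarrow> real" where
  "criterion \<nu> \<theta>\<^sub>0 n X \<theta> =
     (\<Sum>x<n. phi (\<nu> \<theta>) (left_steps X n (x + 1)) (left_steps X n x)
           - phi (\<nu> \<theta>\<^sub>0) (left_steps X n (x + 1)) (left_steps X n x))"


section \<open>Convergence in distribution and Gaussian laws\<close>

definition conv_in_distr ::
  "'a measure \<Rightarrow> (nat \<Rightarrow> 'a \<Rightarrow> 'b::topological_space) \<Rightarrow> 'b measure \<Rightarrow> bool" where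
  "conv_in_distr M Y N \<longleftrightarrow>
     (\<forall>f :: 'b \<Rightarrow> real. continuous_on UNIV f \<and> bounded (range f) \<longrightarrow>
        (\<lambda>n. \<integral>x. f (Y n x) \<partial>M) \<longlonglongrightarrow> (\<integral>y. f y \<partial>N))"

text \<open>
  The centered Gaussian law with (symmetric, positive definite) covariance matrix \<open>C\<close>.
\<close>

definition centered_gaussian :: "real ^ 'd ^ 'd \<Rightarrow> (real ^ 'd) measure" where
  "centered_gaussian C = density lborel
     (\<lambda>z. ennreal (exp (- (z \<bullet> (matrix_inv C *v z)) / 2)
                    / sqrt ((2 * pi) ^ CARD('d) * det C)))"

end

theory Submission
  imports Defs "HOL-Real_Asymp.Real_Asymp"
begin

text \<open>
  Read backwards from the site \<open>n\<close>, the numbers of left steps form a Markov chain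
  (a branching process in random environment, averaged) with transition probabilities \<open>Q\<close>,
  started at \<open>0\<close>. Its invariant law is \<open>\<pi>\<close>, which charges every state, and this alone gives the
  laws of large numbers: every initial state is seen from \<open>0\<close> with positive probability. The
  identification of the chain goes through generating functions, using that both sides satisfy the
  same continued-fraction recursion.

  The criterion is then a log-likelihood along an ergodic chain. Strict positivity of the
  Kullback--Leibler divergence and compactness give consistency; the score is a martingale
  difference, since \<open>\<Sum>\<^sub>v Q(u,v) = 1\<close>; and a Taylor expansion of the score equation
  together with a martingale central limit theorem (proved through McLeish's product) give the limit
  of the characteristic functions of the rescaled error. Convergence of characteristic functions is
  turned into weak convergence by Gaussian smoothing.
\<close>

section \<open>Gaussian laws and characteristic functions\<close>

text \<open>The data enter through one finite list per n: the counts at the sites 0 to n, in the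
  order in which the reversed chain writes them, newest first. All limit theorems are therefore
  about the laws \<open>chain n\<close> on lists, with no infinite trajectory of the chain and no
  almost sure convergence; exceptional sets of lists have probability tending to 0. Of the
  estimator, which may depend on the whole path, only measurability and maximality are used.

  The obstacle is that positive transitions alone give no uniform mixing, and that the chain starts
  at 0 and not in equilibrium. Domination answers both: the point mass at 0 is at most 1 / pi(0)
  times the invariant law, and every transition preserves this bound, so expectations along
  \<open>chain n\<close> are controlled by stationary ones with a constant free of n. Convergence in
  L1 under the invariant law is then enough, and every 1 / \<open>pmf p 0\<close> below comes from
  here. Working with second moments only is also what asks for a stopped product, bounded in L2, in
  the central limit theorem.\<close>

lemma sum_Basis_vec: "(\<Sum>b\<in>(Basis::(real^'n) set). f b) = (\<Sum>i\<in>UNIV. f (axis i 1))"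
  unfolding Basis_vec_def by (auto simp: UNION_singleton_eq_range sum.reindex inj_on_def axis_eq_axis)

lemma prod_Basis_vec: "(\<Prod>b\<in>(Basis::(real^'n) set). f b) = (\<Prod>i\<in>UNIV. f (axis i 1))"
  unfolding Basis_vec_def by (auto simp: UNION_singleton_eq_range prod.reindex inj_on_def axis_eq_axis)

lemma all_Basis_vec: "(\<forall>b\<in>(Basis::(real^'n) set). P b) \<longleftrightarrow> (\<forall>i. P (axis i 1))"
  by (auto simp: Basis_vec_def)

lemma borel_measurable_vec_lambda [measurable (raw)]:
  fixes F :: "'a \<Rightarrow> 'n::finite \<Rightarrow> real"
  assumes "\<And>i. (\<lambda>x. F x i) \<in> borel_measurable M"
  shows "(\<lambda>x. \<chi> i. F x i) \<in> borel_measurable M"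
  using assms by (subst borel_measurable_euclidean_space) (auto simp: Basis_vec_def inner_axis)

text \<open>Makes Fubini in coordinates available for vectors. Lebesgue measure is determined by its
  values on boxes, and a box pulls back to a product of intervals.\<close>

lemma lborel_vec_eq:
  "(lborel :: (real^'n) measure) = distr (PiM UNIV (\<lambda>_. lborel)) borel (\<lambda>f. \<chi> i. f i)"
proof (rule lborel_eqI)
  interpret product_sigma_finite "\<lambda>_::'n. lborel::real measure"
    by standard
  fix l u :: "real^'n" assume "\<And>b. b \<in> Basis \<Longrightarrow> l \<bullet> b \<le> u \<bullet> b"
  then have le: "l $ i \<le> u $ i" for i
    by (metis axis_in_Basis_iff inner_axis inner_real_def mult.right_neutral Basis_real_def singletonI)
  have eq: "(\<lambda>f. \<chi> i. f i) -` box l u \<inter> space (PiM UNIV (\<lambda>_::'n. lborel)) = Pi\<^sub>E UNIV (\<lambda>i. {l $ i <..< u $ i})"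
    by (auto simp: space_PiM mem_box_cart PiE_def Pi_iff)
  show "emeasure (distr (PiM UNIV (\<lambda>_. lborel)) borel (\<lambda>f. \<chi> i. f i)) (box l u) = (\<Prod>b\<in>Basis. (u - l) \<bullet> b)"
    using le by (simp add: emeasure_distr eq emeasure_PiM prod_ennreal prod_Basis_vec inner_axis)
qed simp

lemma nn_integral_lborel_vec:
  fixes f :: "real^'n \<Rightarrow> ennreal"
  assumes [measurable]: "f \<in> borel_measurable borel"
  shows "(\<integral>\<^sup>+x. f x \<partial>lborel) = (\<integral>\<^sup>+g. f (\<chi> i. g i) \<partial>PiM UNIV (\<lambda>_. lborel))"
  by (subst lborel_vec_eq, subst nn_integral_distr) auto


lemma lborel_permute_vec:
  assumes "p permutes (UNIV :: 'n::finite set)"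
  shows "(lborel :: (real^'n) measure) = distr lborel borel (\<lambda>x. \<chi> i. x $ p i)"
proof (rule lborel_eqI)
  have m [measurable]: "(\<lambda>x::real^'n. \<chi> i. x $ p i) \<in> borel_measurable borel"
    by (intro borel_measurable_continuous_onI continuous_intros)
  fix l u :: "real^'n" assume "\<And>b. b \<in> Basis \<Longrightarrow> l \<bullet> b \<le> u \<bullet> b"
  then have le: "l $ i \<le> u $ i" for i
    by (metis axis_in_Basis_iff inner_axis inner_real_def mult.right_neutral Basis_real_def singletonI)
  have eq: "(\<lambda>x::real^'n. \<chi> i. x $ p i) -` box l u = box (\<chi> i. l $ inv p i) (\<chi> i. u $ inv p i)"
  proof -
    have "(\<forall>i. l $ i < x $ p i \<and> x $ p i < u $ i) \<longleftrightarrow>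
          (\<forall>i. l $ inv p i < x $ i \<and> x $ i < u $ inv p i)" for x :: "real^'n"
      using permutes_inverses[OF assms] by metis
    then show ?thesis by (auto simp: mem_box_cart)
  qed
  have "(\<Prod>i\<in>UNIV. u $ inv p i - l $ inv p i) = (\<Prod>i\<in>UNIV. u $ i - l $ i)"
    by (rule prod.permute[OF permutes_inv[OF assms], of "\<lambda>i. u $ i - l $ i", symmetric, unfolded comp_def])
  then show "emeasure (distr lborel borel (\<lambda>x. \<chi> i. x $ p i)) (box l u) = (\<Prod>b\<in>Basis. (u - l) \<bullet> b)"
    using le by (simp add: emeasure_distr eq emeasure_lborel_box_eq prod_Basis_vec inner_axis axis_eq_axis Basis_vec_def[symmetric] all_Basis_vec)
qed simp

text \<open>Integrate over coordinate \<open>m\<close> first: with the others frozen, adding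
  \<open>x $ k\<close> is a translation of the line.\<close>

lemma nn_integral_lborel_shear:
  fixes f :: "real^'n \<Rightarrow> ennreal" and m k :: 'n
  assumes [measurable]: "f \<in> borel_measurable borel" and "m \<noteq> k"
  shows "(\<integral>\<^sup>+x. f (\<chi> i. if i = m then x $ m + x $ k else x $ i) \<partial>lborel) = (\<integral>\<^sup>+x. f x \<partial>lborel)"
proof -
  interpret product_sigma_finite "\<lambda>_::'n. lborel::real measure"
    by standard
  have eqU: "PiM UNIV (\<lambda>_::'n. lborel :: real measure) = PiM (insert m (UNIV - {m})) (\<lambda>_. lborel)"
    by (simp add: insert_absorb)
  have u: "insert m (UNIV - {m}) = UNIV"
    by auto
  have "(\<integral>\<^sup>+x. f (\<chi> i. if i = m then x $ m + x $ k else x $ i) \<partial>lborel) =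
        (\<integral>\<^sup>+g. f (\<chi> i. if i = m then g m + g k else g i) \<partial>PiM UNIV (\<lambda>_. lborel))"
    by (subst nn_integral_lborel_vec) (auto cong: if_cong)
  also have "\<dots> = (\<integral>\<^sup>+g. (\<integral>\<^sup>+y. f (\<chi> i. if i = m then y + g k else g i) \<partial>lborel) \<partial>PiM (UNIV - {m}) (\<lambda>_. lborel))"
    unfolding eqU using \<open>m \<noteq> k\<close>
    by (subst product_nn_integral_insert)
       (auto simp: u cong: if_cong intro!: nn_integral_cong arg_cong[of _ _ f])
  also have "\<dots> = (\<integral>\<^sup>+g. (\<integral>\<^sup>+y. f (\<chi> i. if i = m then y else g i) \<partial>lborel) \<partial>PiM (UNIV - {m}) (\<lambda>_. lborel))"
  proof (rule nn_integral_cong)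
    fix g
    show "(\<integral>\<^sup>+y. f (\<chi> i. if i = m then y + g k else g i) \<partial>lborel) = (\<integral>\<^sup>+y. f (\<chi> i. if i = m then y else g i) \<partial>lborel)"
      by (subst (2) nn_integral_real_affine[where c=1 and t="g k"]) (auto simp: add.commute cong: if_cong)
  qed
  also have "\<dots> = (\<integral>\<^sup>+g. f (\<chi> i. g i) \<partial>PiM UNIV (\<lambda>_. lborel))"
    unfolding eqU
    by (subst product_nn_integral_insert)
       (auto simp: u fun_upd_def cong: if_cong intro!: nn_integral_cong arg_cong[of _ _ f])
  also have "\<dots> = (\<integral>\<^sup>+x. f x \<partial>lborel)"
    by (subst nn_integral_lborel_vec) auto
  finally show ?thesis .
qed

lemma borel_measurable_matrix_vector_mult [measurable]:
  "(\<lambda>x. (A::real^'n^'m) *v x) \<in> borel_measurable borel"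
  by (intro borel_measurable_continuous_onI matrix_vector_mult_linear_continuous_on)

text \<open>The formula is multiplicative in \<open>A\<close>, so elementary matrices suffice. It is
  proved for all \<open>f\<close> at once, because a product \<open>A ** B\<close> calls for the
  hypothesis on \<open>B\<close> at the function \<open>f\<close> composed with \<open>A\<close>.
  Matrices with a zero row satisfy it vacuously.\<close>

lemma nn_integral_lborel_linear:
  fixes f :: "real^'n \<Rightarrow> ennreal" and A :: "real^'n^'n"
  assumes "f \<in> borel_measurable borel" "det A \<noteq> 0"
  shows "(\<integral>\<^sup>+x. f x \<partial>lborel) = ennreal \<bar>det A\<bar> * (\<integral>\<^sup>+x. f (A *v x) \<partial>lborel)"
proof -
  have "det A \<noteq> 0 \<longrightarrow> (\<forall>f\<in>borel_measurable borel.
          (\<integral>\<^sup>+x. f x \<partial>lborel) = ennreal \<bar>det A\<bar> * (\<integral>\<^sup>+x. f (A *v x) \<partial>lborel))" (is "?P A")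
  proof (rule induct_matrix_elementary_alt[where P = ?P])
    fix A B :: "real^'n^'n" assume A: "?P A" and B: "?P B"
    show "?P (A ** B)"
    proof (intro impI ballI)
      fix f :: "real^'n \<Rightarrow> ennreal" assume f [measurable]: "f \<in> borel_measurable borel" and "det (A ** B) \<noteq> 0"
      then have "det A \<noteq> 0" "det B \<noteq> 0" by (auto simp: det_mul)
      have "(\<integral>\<^sup>+x. f x \<partial>lborel) = ennreal \<bar>det A\<bar> * (\<integral>\<^sup>+x. f (A *v x) \<partial>lborel)"
        using A f \<open>det A \<noteq> 0\<close> by blast
      also have "(\<integral>\<^sup>+x. f (A *v x) \<partial>lborel) = ennreal \<bar>det B\<bar> * (\<integral>\<^sup>+x. f (A *v (B *v x)) \<partial>lborel)"
        by (rule B[THEN mp, OF \<open>det B \<noteq> 0\<close>, rule_format]) simp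
      finally show "(\<integral>\<^sup>+x. f x \<partial>lborel) = ennreal \<bar>det (A ** B)\<bar> * (\<integral>\<^sup>+x. f ((A ** B) *v x) \<partial>lborel)"
        by (simp add: det_mul abs_mult ennreal_mult mult.assoc matrix_vector_mul_assoc)
    qed
  next
    fix A :: "real^'n^'n" and i assume "row i A = 0"
    then show "?P A" using det_zero_row by blast
  next
    fix A :: "real^'n^'n" assume A: "\<And>i j. i \<noteq> j \<Longrightarrow> A $ i $ j = 0"
    show "?P A"
    proof (intro impI ballI)
      fix f :: "real^'n \<Rightarrow> ennreal" assume f [measurable]: "f \<in> borel_measurable borel" and "det A \<noteq> 0"
      then have nz: "A $ i $ i \<noteq> 0" for i by (auto simp: det_diagonal[OF A])
      define c :: "real^'n \<Rightarrow> real" where "c b = b \<bullet> (A *v b)" for b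
      have c_axis: "c (axis i 1) = A $ i $ i" for i
        by (simp add: c_def inner_axis matrix_vector_mul_component inner_axis')
      have T: "(\<Sum>j\<in>Basis. (c j * (x \<bullet> j)) *\<^sub>R j) = A *v x" for x
      proof (rule vec_eq_iff[THEN iffD2], rule)
        fix i
        have "(\<Sum>j\<in>UNIV. A $ i $ j * x $ j) = (\<Sum>j\<in>UNIV. if i = j then A $ i $ i * x $ i else 0)"
          by (rule sum.cong) (auto simp: A)
        then have "(A *v x) $ i = (\<Sum>j\<in>UNIV. if i = j then A $ i $ i * x $ i else 0)"
          by (simp add: matrix_vector_mult_def)
        then show "(\<Sum>j\<in>Basis. (c j * (x \<bullet> j)) *\<^sub>R j) $ i = (A *v x) $ i"
          by (simp add: sum_Basis_vec c_axis inner_axis sum_component) (simp add: axis_def if_distrib cong: if_cong)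
      qed
      have "lborel = density (distr lborel borel (\<lambda>x. (0::real^'n) + (\<Sum>j\<in>Basis. (c j * (x \<bullet> j)) *\<^sub>R j))) (\<lambda>_. \<Prod>j\<in>Basis. \<bar>c j\<bar>)"
        using nz by (intro lborel_affine_euclidean) (auto simp: Basis_vec_def c_axis)
      then have "(\<integral>\<^sup>+x. f x \<partial>lborel) = (\<integral>\<^sup>+x. f x \<partial>density (distr lborel borel (\<lambda>x. A *v x)) (\<lambda>_. \<Prod>j\<in>Basis. \<bar>c j\<bar>))"
        by (simp add: T)
      also have "\<dots> = ennreal \<bar>det A\<bar> * (\<integral>\<^sup>+x. f (A *v x) \<partial>lborel)"
        by (simp add: nn_integral_density nn_integral_distr nn_integral_cmult prod_Basis_vec c_axis det_diagonal[OF A] abs_prod)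
      finally show "(\<integral>\<^sup>+x. f x \<partial>lborel) = ennreal \<bar>det A\<bar> * (\<integral>\<^sup>+x. f (A *v x) \<partial>lborel)" .
    qed
  next
    fix m k :: 'n assume "m \<noteq> k"
    let ?p = "Transposition.transpose m k" and ?A = "(\<chi> i j. mat 1 $ i $ Transposition.transpose m k j) :: real^'n^'n"
    have p: "?p permutes UNIV" by (simp add: permutes_swap_id)
    have d: "\<bar>det ?A\<bar> = 1"
      by (simp add: det_permute_columns permutes_swap_id sign_swap_id abs_mult)
    have mv: "?A *v x = (\<chi> i. x $ ?p i)" for x
    proof (rule vec_eq_iff[THEN iffD2], rule)
      fix i
      have "i = ?p j \<longleftrightarrow> j = ?p i" for j
        by (metis transpose_involutory)
      then show "(?A *v x) $ i = (\<chi> i. x $ ?p i) $ i"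
        by (simp add: matrix_vector_mult_def mat_def if_distrib[of "\<lambda>a. a * _"] cong: if_cong)
    qed
    have inv: "(\<integral>\<^sup>+x. f x \<partial>lborel) = (\<integral>\<^sup>+x. f (\<chi> i. x $ ?p i) \<partial>lborel)" if [measurable]: "f \<in> borel_measurable borel" for f :: "real^'n \<Rightarrow> ennreal"
    proof -
      have [measurable]: "(\<lambda>x::real^'n. \<chi> i. x $ ?p i) \<in> borel_measurable borel"
        by (intro borel_measurable_continuous_onI continuous_intros)
      show ?thesis
        by (subst lborel_permute_vec[OF p], subst nn_integral_distr) auto
    qed
    show "?P ?A"
    proof (intro impI ballI)
      fix f :: "real^'n \<Rightarrow> ennreal" assume f: "f \<in> borel_measurable borel"
      show "(\<integral>\<^sup>+x. f x \<partial>lborel) = ennreal \<bar>det ?A\<bar> * (\<integral>\<^sup>+x. f (?A *v x) \<partial>lborel)"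
        unfolding d mv ennreal_1 mult_1 by (rule inv[OF f])
    qed
  next
    fix m k :: 'n assume "m \<noteq> k"
    let ?A = "(\<chi> i j. of_bool (i = m \<and> j = k \<or> i = j)) :: real^'n^'n"
    have eqA: "?A = (\<chi> i. if i = m then row m (mat 1) + 1 *s row k (mat 1) else row i (mat 1))"
      using \<open>m \<noteq> k\<close> by (auto simp: vec_eq_iff row_def mat_def)
    have d: "\<bar>det ?A\<bar> = 1"
      unfolding eqA det_row_operation[OF \<open>m \<noteq> k\<close>] by simp
    have mv: "?A *v x = (\<chi> i. if i = m then x $ m + x $ k else x $ i)" for x
    proof (rule vec_eq_iff[THEN iffD2], rule)
      fix i
      have "(?A *v x) $ i = (\<Sum>j\<in>UNIV. (if j = i then x $ j else 0) + (if i = m then if j = k then x $ j else 0 else 0))"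
        unfolding matrix_vector_mult_def using \<open>m \<noteq> k\<close> by (auto intro!: sum.cong)
      then show "(?A *v x) $ i = (\<chi> i. if i = m then x $ m + x $ k else x $ i) $ i"
        by (simp add: sum.distrib)
    qed
    show "?P ?A"
    proof (intro impI ballI)
      fix f :: "real^'n \<Rightarrow> ennreal" assume f: "f \<in> borel_measurable borel"
      show "(\<integral>\<^sup>+x. f x \<partial>lborel) = ennreal \<bar>det ?A\<bar> * (\<integral>\<^sup>+x. f (?A *v x) \<partial>lborel)"
        unfolding d mv ennreal_1 mult_1 by (rule nn_integral_lborel_shear[OF f \<open>m \<noteq> k\<close>, symmetric])
    qed
  qed
  with assms show ?thesis by blast
qed

section \<open>Weak convergence from convergence of characteristic functions\<close>

lemma abs_integral_le:
  fixes f g :: "'a \<Rightarrow> real"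
  assumes "integrable M f" "integrable M g" "\<And>x. x \<in> space M \<Longrightarrow> \<bar>f x\<bar> \<le> g x"
  shows "\<bar>\<integral>x. f x \<partial>M\<bar> \<le> (\<integral>x. g x \<partial>M)"
proof -
  have "\<bar>\<integral>x. f x \<partial>M\<bar> \<le> (\<integral>x. \<bar>f x\<bar> \<partial>M)" by (rule integral_abs_bound)
  also have "\<dots> \<le> (\<integral>x. g x \<partial>M)" using assms by (intro integral_mono) auto
  finally show ?thesis .
qed

lemma abs_diff_chain4:
  fixes a b c d e :: real
  assumes "\<bar>a - b\<bar> \<le> e / 4" "\<bar>b - d\<bar> < e / 4" "\<bar>c - d\<bar> \<le> e / 4" "0 < e"
  shows "\<bar>a - c\<bar> < e"
  using assms unfolding abs_le_iff abs_less_iff by linarith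

text \<open>Written as a product over coordinates, so that normalisation and characteristic function
  reduce to dimension one.\<close>

definition std_gauss :: "(real^'n) measure" where
  "std_gauss = density lborel (\<lambda>x. ennreal (\<Prod>i\<in>UNIV. std_normal_density (x $ i)))"

lemma sets_std_gauss [simp, measurable_cong]: "sets std_gauss = sets borel"
  by (simp add: std_gauss_def)

lemma space_std_gauss [simp]: "space std_gauss = UNIV"
  by (simp add: std_gauss_def)

lemma prod_std_normal_density:
  "(\<Prod>i\<in>UNIV. std_normal_density ((x::real^'n) $ i)) = exp (- (x \<bullet> x) / 2) / sqrt ((2 * pi) ^ CARD('n))"
proof -
  have "(\<Prod>i\<in>UNIV. std_normal_density (x $ i)) = (\<Prod>i\<in>(UNIV :: 'n set). 1 / sqrt (2 * pi)) * (\<Prod>i\<in>UNIV. exp (- (x $ i)\<^sup>2 / 2))"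
    by (simp only: std_normal_density_def prod.distrib)
  also have "(\<Prod>i\<in>(UNIV :: 'n set). 1 / sqrt (2 * pi)) = 1 / sqrt ((2 * pi) ^ CARD('n))"
    by (simp only: prod_constant power_one_over real_sqrt_power)
  also have "(\<Prod>i\<in>UNIV. exp (- (x $ i)\<^sup>2 / 2)) = exp (- (x \<bullet> x) / 2)"
    by (simp add: exp_sum[symmetric] inner_vec_def power2_eq_square sum_negf sum_divide_distrib)
  finally show ?thesis by simp
qed

lemma prob_space_std_gauss: "prob_space (std_gauss :: (real^'n) measure)"
proof
  interpret product_sigma_finite "\<lambda>_::'n. lborel::real measure"
    by standard
  have "emeasure (std_gauss :: (real^'n) measure) (space std_gauss) =
        (\<integral>\<^sup>+x. (\<Prod>i\<in>UNIV. ennreal (std_normal_density (x $ i))) \<partial>(lborel::(real^'n) measure))"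
    by (simp add: std_gauss_def emeasure_density prod_ennreal)
  also have "\<dots> = (\<integral>\<^sup>+g. (\<Prod>i\<in>(UNIV::'n set). ennreal (std_normal_density (g i))) \<partial>PiM UNIV (\<lambda>_. lborel))"
    by (subst nn_integral_lborel_vec) auto
  also have "\<dots> = (\<Prod>i\<in>(UNIV::'n set). \<integral>\<^sup>+x. ennreal (std_normal_density x) \<partial>lborel)"
    by (rule product_nn_integral_prod) auto
  also have "(\<integral>\<^sup>+x. ennreal (std_normal_density x) \<partial>lborel) = 1"
    using prob_space.emeasure_space_1[OF prob_space_normal_density[of 1 0]] by (simp add: emeasure_density)
  finally show "emeasure (std_gauss :: (real^'n) measure) (space std_gauss) = 1"
    by simp
qed

lemma integral_iexp_std_gauss:
  fixes t :: "real^'n"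
  shows "(\<integral>x. iexp (t \<bullet> x) \<partial>std_gauss) = complex_of_real (exp (- (t \<bullet> t) / 2))"
proof -
  interpret product_sigma_finite "\<lambda>_::'n. lborel::real measure"
    by standard
  interpret N: prob_space std_normal_distribution
    by (rule prob_space_normal_density) simp
  have eq: "(\<Prod>i\<in>UNIV. std_normal_density (x $ i)) *\<^sub>R iexp (t \<bullet> x) =
        (\<Prod>i\<in>UNIV. std_normal_density (x $ i) *\<^sub>R iexp (t $ i * x $ i))" for x :: "real^'n"
    by (simp add: scaleR_conv_of_real prod.distrib inner_vec_def exp_sum[symmetric] sum_distrib_left)
  have int: "integrable lborel (\<lambda>x. std_normal_density x *\<^sub>R iexp (c * x))" for c
  proof -
    have "integrable std_normal_distribution (\<lambda>x. iexp (c * x))"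
      by (rule N.integrable_const_bound[where B = 1]) auto
    then show ?thesis by (subst (asm) integrable_density) auto
  qed
  have "(\<integral>x. iexp (t \<bullet> x) \<partial>std_gauss) =
        (\<integral>x. (\<Prod>i\<in>UNIV. std_normal_density (x $ i)) *\<^sub>R iexp (t \<bullet> x) \<partial>lborel)"
    unfolding std_gauss_def by (subst integral_density) (auto intro!: prod_nonneg)
  also have "\<dots> = (\<integral>x. (\<Prod>i\<in>UNIV. std_normal_density (x $ i) *\<^sub>R iexp (t $ i * x $ i)) \<partial>lborel)"
    by (simp only: eq)
  also have "\<dots> = (\<integral>g. (\<Prod>i\<in>UNIV. std_normal_density (g i) *\<^sub>R iexp (t $ i * g i)) \<partial>PiM UNIV (\<lambda>_. lborel))"
    by (subst lborel_vec_eq, subst integral_distr) auto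
  also have "\<dots> = (\<Prod>i\<in>UNIV. \<integral>x. std_normal_density x *\<^sub>R iexp (t $ i * x) \<partial>lborel)"
    by (rule product_integral_prod[OF finite int])
  also have "\<dots> = (\<Prod>i\<in>UNIV. char std_normal_distribution (t $ i))"
    unfolding char_def by (intro prod.cong refl, subst integral_density) auto
  also have "\<dots> = complex_of_real (exp (- (t \<bullet> t) / 2))"
    by (simp add: char_std_normal_distribution exp_sum[symmetric] inner_vec_def power2_eq_square
        sum_divide_distrib sum_negf flip: of_real_prod)
  finally show ?thesis .
qed

text \<open>The Gaussian kernel is itself a characteristic function, so its expectation is
  controlled by that of \<open>Y\<close>.\<close>

lemma (in prob_space) expectation_gauss_kernel:
  fixes Y :: "'a \<Rightarrow> real^'n"
  assumes [measurable]: "Y \<in> borel_measurable M"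
  shows "complex_of_real (expectation (\<lambda>\<omega>. exp (- (s\<^sup>2 * (norm (x - Y \<omega>))\<^sup>2) / 2))) =
         (\<integral>g. iexp (s * (x \<bullet> g)) * (CLINT \<omega>|M. iexp ((- s *\<^sub>R g) \<bullet> Y \<omega>)) \<partial>std_gauss)"
proof -
  interpret G: prob_space "std_gauss :: (real^'n) measure"
    by (rule prob_space_std_gauss)
  interpret P: pair_prob_space M "std_gauss :: (real^'n) measure" ..
  have "complex_of_real (expectation (\<lambda>\<omega>. exp (- (s\<^sup>2 * (norm (x - Y \<omega>))\<^sup>2) / 2))) =
        (CLINT \<omega>|M. complex_of_real (exp (- ((s *\<^sub>R (x - Y \<omega>)) \<bullet> (s *\<^sub>R (x - Y \<omega>))) / 2)))"
    unfolding power2_norm_eq_inner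
    by (subst integral_complex_of_real[symmetric]) (simp add: power2_eq_square mult.assoc)
  also have "\<dots> = (CLINT \<omega>|M. CLINT g|std_gauss. iexp ((s *\<^sub>R (x - Y \<omega>)) \<bullet> g))"
    by (simp only: integral_iexp_std_gauss)
  also have "\<dots> = (CLINT g|std_gauss. CLINT \<omega>|M. iexp ((s *\<^sub>R (x - Y \<omega>)) \<bullet> g))"
  proof (rule P.Fubini_integral[symmetric])
    show "integrable (M \<Otimes>\<^sub>M std_gauss) (\<lambda>(\<omega>, g). iexp ((s *\<^sub>R (x - Y \<omega>)) \<bullet> g))"
      by (rule P.P.integrable_const_bound[where B = 1]) (auto simp: split_beta)
  qed
  also have "\<dots> = (\<integral>g. iexp (s * (x \<bullet> g)) * (CLINT \<omega>|M. iexp ((- s *\<^sub>R g) \<bullet> Y \<omega>)) \<partial>std_gauss)"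
  proof (rule Bochner_Integration.integral_cong[OF refl])
    fix g :: "real^'n"
    have "iexp ((s *\<^sub>R (x - Y \<omega>)) \<bullet> g) = iexp (s * (x \<bullet> g)) * iexp ((- s *\<^sub>R g) \<bullet> Y \<omega>)" for \<omega>
      by (simp add: exp_add[symmetric] algebra_simps inner_commute)
    then show "(CLINT \<omega>|M. iexp ((s *\<^sub>R (x - Y \<omega>)) \<bullet> g)) =
        iexp (s * (x \<bullet> g)) * (CLINT \<omega>|M. iexp ((- s *\<^sub>R g) \<bullet> Y \<omega>))"
      by simp
  qed
  finally show ?thesis .
qed

text \<open>The limit is required to be the characteristic function of a given probability law;
  tightness is then a consequence, obtained in \<open>conv_in_distr\<close> below, and not an
  assumption.\<close>

locale char_conv =
  M: prob_space M + N: prob_space N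
  for M :: "'a measure" and N :: "(real^'n) measure" +
  fixes Y :: "nat \<Rightarrow> 'a \<Rightarrow> real^'n"
  assumes meas_Y [measurable]: "\<And>n. Y n \<in> borel_measurable M"
    and sets_N [simp, measurable_cong]: "sets N = sets borel"
    and char_lim: "\<And>t. (\<lambda>n. CLINT \<omega>|M. iexp (t \<bullet> Y n \<omega>)) \<longlonglongrightarrow> (CLINT y|N. iexp (t \<bullet> y))"
begin

text \<open>By \<open>expectation_gauss_kernel\<close> the expected kernel is an average of
  characteristic functions over Gaussian frequencies, so bounded pointwise convergence passes
  through.\<close>

lemma kernel_lim:
  "(\<lambda>n. \<integral>\<omega>. exp (- (s\<^sup>2 * (norm (x - Y n \<omega>))\<^sup>2) / 2) \<partial>M) \<longlonglongrightarrow> (\<integral>y. exp (- (s\<^sup>2 * (norm (x - y))\<^sup>2) / 2) \<partial>N)"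
proof -
  interpret G: prob_space "std_gauss :: (real^'n) measure"
    by (rule prob_space_std_gauss)
  have [measurable]: "(\<lambda>g. CLINT \<omega>|M. iexp ((- s *\<^sub>R g) \<bullet> Y n \<omega>)) \<in> borel_measurable borel" for n
    by (rule M.borel_measurable_lebesgue_integral) (simp add: split_beta)
  have [measurable]: "(\<lambda>g. CLINT y|N. iexp ((- s *\<^sub>R g) \<bullet> y)) \<in> borel_measurable borel"
    by (rule N.borel_measurable_lebesgue_integral) (simp add: split_beta)
  have "(\<lambda>n. \<integral>g. iexp (s * (x \<bullet> g)) * (CLINT \<omega>|M. iexp ((- s *\<^sub>R g) \<bullet> Y n \<omega>)) \<partial>std_gauss) \<longlonglongrightarrow>
        (\<integral>g. iexp (s * (x \<bullet> g)) * (CLINT y|N. iexp ((- s *\<^sub>R g) \<bullet> y)) \<partial>std_gauss)"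
  proof (rule integral_dominated_convergence[where w = "\<lambda>_. 1"])
    show "AE g in std_gauss. (\<lambda>n. iexp (s * (x \<bullet> g)) * (CLINT \<omega>|M. iexp ((- s *\<^sub>R g) \<bullet> Y n \<omega>)))
        \<longlonglongrightarrow> iexp (s * (x \<bullet> g)) * (CLINT y|N. iexp ((- s *\<^sub>R g) \<bullet> y))"
      by (intro AE_I2 tendsto_mult tendsto_const char_lim)
    show "AE g in std_gauss. norm (iexp (s * (x \<bullet> g)) * (CLINT \<omega>|M. iexp ((- s *\<^sub>R g) \<bullet> Y n \<omega>))) \<le> 1" for n
    proof (rule AE_I2)
      fix g :: "real^'n"
      have "norm (CLINT \<omega>|M. iexp ((- s *\<^sub>R g) \<bullet> Y n \<omega>)) \<le> (\<integral>\<omega>. norm (iexp ((- s *\<^sub>R g) \<bullet> Y n \<omega>)) \<partial>M)"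
        by (rule integral_norm_bound)
      then show "norm (iexp (s * (x \<bullet> g)) * (CLINT \<omega>|M. iexp ((- s *\<^sub>R g) \<bullet> Y n \<omega>))) \<le> 1"
        by (simp add: norm_mult M.prob_space)
    qed
  qed auto
  then have "(\<lambda>n. complex_of_real (\<integral>\<omega>. exp (- (s\<^sup>2 * (norm (x - Y n \<omega>))\<^sup>2) / 2) \<partial>M)) \<longlonglongrightarrow>
      complex_of_real (\<integral>y. exp (- (s\<^sup>2 * (norm (x - y))\<^sup>2) / 2) \<partial>N)"
    by (subst M.expectation_gauss_kernel, simp, subst N.expectation_gauss_kernel) simp_all
  then show ?thesis
    by (simp add: tendsto_of_real_iff)
qed

text \<open>Fubini turns the smoothed test function into a mixture of Gaussian kernels with centres
  x, weighted by \<open>f x\<close>; the integrable function \<open>\<bar>f x\<bar>\<close>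
  dominates.\<close>

lemma smoothed_lim:
  fixes f :: "real^'n \<Rightarrow> real"
  assumes f [measurable]: "integrable lborel f"
  shows "(\<lambda>n. \<integral>\<omega>. (\<integral>x. f x * exp (- (s\<^sup>2 * (norm (x - Y n \<omega>))\<^sup>2) / 2) \<partial>lborel) \<partial>M) \<longlonglongrightarrow>
         (\<integral>y. (\<integral>x. f x * exp (- (s\<^sup>2 * (norm (x - y))\<^sup>2) / 2) \<partial>lborel) \<partial>N)"
proof -
  have [measurable]: "f \<in> borel_measurable borel"
    using f by (auto dest: borel_measurable_integrable)
  let ?K = "\<lambda>x y. exp (- (s\<^sup>2 * (norm (x - y))\<^sup>2) / 2)"
  have fubini: "(\<integral>\<omega>. (\<integral>x. f x * ?K x (Z \<omega>) \<partial>lborel) \<partial>P) = (\<integral>x. f x * (\<integral>\<omega>. ?K x (Z \<omega>) \<partial>P) \<partial>lborel)"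
    if "prob_space P" and [measurable]: "Z \<in> borel_measurable P" for P :: "'c measure" and Z :: "'c \<Rightarrow> real^'n"
  proof -
    interpret P: prob_space P by fact
    interpret pair_sigma_finite P "lborel :: (real^'n) measure" ..
    have "integrable (P \<Otimes>\<^sub>M lborel) (\<lambda>(\<omega>, x). f x)"
      by (rule Fubini_integrable) (use f in auto)
    then have "integrable (P \<Otimes>\<^sub>M lborel) (\<lambda>(\<omega>, x). f x * ?K x (Z \<omega>))"
      by (rule Bochner_Integration.integrable_bound) (auto simp: abs_mult split_beta intro!: mult_left_le)
    from Fubini_integral[OF this] show ?thesis by simp
  qed
  have [measurable]: "(\<lambda>x. \<integral>\<omega>. ?K x (Y n \<omega>) \<partial>M) \<in> borel_measurable borel" for n
    by (rule M.borel_measurable_lebesgue_integral) (simp add: split_beta)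
  have [measurable]: "(\<lambda>x. \<integral>y. ?K x y \<partial>N) \<in> borel_measurable borel"
    by (rule N.borel_measurable_lebesgue_integral) (simp add: split_beta)
  have "(\<lambda>n. \<integral>x. f x * (\<integral>\<omega>. ?K x (Y n \<omega>) \<partial>M) \<partial>lborel) \<longlonglongrightarrow> (\<integral>x. f x * (\<integral>y. ?K x y \<partial>N) \<partial>lborel)"
  proof (rule integral_dominated_convergence[where w = "\<lambda>x. \<bar>f x\<bar>"])
    show "AE x in lborel. (\<lambda>n. f x * (\<integral>\<omega>. ?K x (Y n \<omega>) \<partial>M)) \<longlonglongrightarrow> f x * (\<integral>y. ?K x y \<partial>N)"
      by (intro AE_I2 tendsto_mult tendsto_const kernel_lim)
    have "(\<integral>\<omega>. ?K x (Y n \<omega>) \<partial>M) \<le> (\<integral>\<omega>. 1 \<partial>M)" for x n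
      by (intro integral_mono M.integrable_const_bound[where B = 1]) auto
    then have "\<bar>\<integral>\<omega>. ?K x (Y n \<omega>) \<partial>M\<bar> \<le> 1" for x n
      by (simp add: M.prob_space)
    then show "AE x in lborel. norm (f x * (\<integral>\<omega>. ?K x (Y n \<omega>) \<partial>M)) \<le> \<bar>f x\<bar>" for n
      by (auto simp: abs_mult intro!: mult_left_le)
  qed (use f in auto)
  moreover have "(\<integral>\<omega>. (\<integral>x. f x * ?K x (Y n \<omega>) \<partial>lborel) \<partial>M) = (\<integral>x. f x * (\<integral>\<omega>. ?K x (Y n \<omega>) \<partial>M) \<partial>lborel)" for n
    by (rule fubini) (auto simp: M.prob_space_axioms)
  moreover have "(\<integral>y. (\<integral>x. f x * ?K x y \<partial>lborel) \<partial>N) = (\<integral>x. f x * (\<integral>y. ?K x y \<partial>N) \<partial>lborel)"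
    by (rule fubini[of N "\<lambda>y. y"]) (auto simp: N.prob_space_axioms)
  ultimately show ?thesis by simp
qed

text \<open>Three-term comparison: \<open>f\<close> is replaced by its average \<open>F s\<close>
  over Gaussian displacements of size 1 / s, uniformly close to \<open>f\<close> by uniform
  continuity, and \<open>F s\<close> is a multiple of the function handled in
  \<open>smoothed_lim\<close>.\<close>

lemma lim_uniformly_continuous:
  fixes f :: "real^'n \<Rightarrow> real"
  assumes int: "integrable lborel f" and uc: "uniformly_continuous_on UNIV f" and B: "\<And>x. \<bar>f x\<bar> \<le> B"
  shows "(\<lambda>n. \<integral>\<omega>. f (Y n \<omega>) \<partial>M) \<longlonglongrightarrow> (\<integral>y. f y \<partial>N)"
proof (rule LIMSEQ_I)
  fix e :: real assume "0 < e"
  have [measurable]: "f \<in> borel_measurable borel"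
    using uniformly_continuous_imp_continuous[OF uc] by (rule borel_measurable_continuous_onI)
  interpret G: prob_space "std_gauss :: (real^'n) measure"
    by (rule prob_space_std_gauss)
  have B0: "0 \<le> B" using B[of 0] by linarith
  define F where "F s y = (\<integral>g. f (y + (1 / s) *\<^sub>R g) \<partial>std_gauss)" for s y
  \<comment> \<open>Substitution x = y + g / s; the power of s is its Jacobian.\<close>
  have F_eq: "F s y = s ^ CARD('n) / sqrt ((2 * pi) ^ CARD('n)) * (\<integral>x. f x * exp (- (s\<^sup>2 * (norm (x - y))\<^sup>2) / 2) \<partial>lborel)"
    if "0 < s" for s y
  proof -
    have "(\<integral>x. f x * exp (- (s\<^sup>2 * (norm (x - y))\<^sup>2) / 2) \<partial>lborel) =
        (\<integral>x. f x * exp (- (s\<^sup>2 * (norm (x - y))\<^sup>2) / 2) \<partial>density (distr lborel borel (\<lambda>g. y + (1 / s) *\<^sub>R g)) (\<lambda>_. \<bar>1 / s\<bar> ^ DIM(real^'n)))"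
      using that by (subst lborel_affine[of "1 / s" y]) auto
    also have "\<dots> = (\<integral>g. (1 / s) ^ CARD('n) * (f (y + (1 / s) *\<^sub>R g) * exp (- (g \<bullet> g) / 2)) \<partial>lborel)"
      using that
      by (subst integral_density, simp, simp, simp, simp, subst integral_distr)
         (auto simp: power2_norm_eq_inner power_divide)
    finally have 1: "(\<integral>x. f x * exp (- (s\<^sup>2 * (norm (x - y))\<^sup>2) / 2) \<partial>lborel) =
        (1 / s) ^ CARD('n) * (\<integral>g. f (y + (1 / s) *\<^sub>R g) * exp (- (g \<bullet> g) / 2) \<partial>lborel)"
      by simp
    have "F s y = (\<integral>g. (f (y + (1 / s) *\<^sub>R g) * exp (- (g \<bullet> g) / 2)) / sqrt ((2 * pi) ^ CARD('n)) \<partial>lborel)"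
      unfolding F_def std_gauss_def prod_std_normal_density
      by (subst integral_density) (auto simp: mult.commute)
    then show ?thesis
      unfolding 1 using that by (simp add: field_simps power_one_over)
  qed
  have F_lim: "(\<lambda>n. \<integral>\<omega>. F s (Y n \<omega>) \<partial>M) \<longlonglongrightarrow> (\<integral>y. F s y \<partial>N)" if "0 < s" for s
    unfolding F_eq[OF that] Bochner_Integration.integral_mult_right_zero
    by (intro tendsto_mult tendsto_const smoothed_lim int)
  from uc \<open>0 < e\<close> obtain d where d: "d > 0" "\<And>x y. norm (y - x) < d \<Longrightarrow> \<bar>f y - f x\<bar> < e / 8"
    unfolding uniformly_continuous_on_def dist_norm real_norm_def
    by (metis UNIV_I zero_less_divide_iff zero_less_numeral)
  \<comment> \<open>Chooses s = k + 1 so large that displacements of length at least d, which can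
    change f by up to 2 B, carry negligible Gaussian mass. Shorter displacements change f by less
    than e / 8.\<close>
  have "(\<lambda>k. \<integral>g. (if d \<le> norm g / real (Suc k) then 1 else 0 :: real) \<partial>(std_gauss::(real^'n) measure)) \<longlonglongrightarrow> (\<integral>g. 0 \<partial>(std_gauss::(real^'n) measure))"
  proof (rule integral_dominated_convergence[where w = "\<lambda>_. 1"])
    have "(\<lambda>k. if d \<le> norm g / real (Suc k) then 1 else 0 :: real) \<longlonglongrightarrow> 0" for g :: "real^'n"
    proof (rule tendsto_eventually)
      have "(\<lambda>k. norm g / real (Suc k)) \<longlonglongrightarrow> 0"
        by (rule LIMSEQ_Suc[OF lim_const_over_n])
      from order_tendstoD(2)[OF this \<open>d > 0\<close>]
      show "\<forall>\<^sub>F k in sequentially. (if d \<le> norm g / real (Suc k) then 1 else 0 :: real) = 0"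
        by eventually_elim auto
    qed
    then show "AE g in (std_gauss::(real^'n) measure). (\<lambda>k. if d \<le> norm g / real (Suc k) then 1 else 0 :: real) \<longlonglongrightarrow> 0"
      by simp
  qed auto
  then have "(\<lambda>k. 2 * B * (\<integral>g. (if d \<le> norm g / real (Suc k) then 1 else 0) \<partial>(std_gauss::(real^'n) measure))) \<longlonglongrightarrow> 2 * B * 0"
    by (intro tendsto_mult tendsto_const) simp
  then have "\<forall>\<^sub>F k in sequentially. 2 * B * (\<integral>g. (if d \<le> norm g / real (Suc k) then 1 else 0) \<partial>(std_gauss::(real^'n) measure)) < e / 8"
    using \<open>0 < e\<close> by (intro order_tendstoD(2)) auto
  then obtain k where k: "2 * B * (\<integral>g. (if d \<le> norm g / real (Suc k) then 1 else 0) \<partial>(std_gauss::(real^'n) measure)) < e / 8"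
    by (auto simp: eventually_sequentially)
  define s where "s = real (Suc k)"
  have "s > 0" by (simp add: s_def)
  have [measurable]: "F s \<in> borel_measurable borel"
    unfolding F_def by (rule G.borel_measurable_lebesgue_integral) (simp add: split_beta)
  have FB: "\<bar>F s y\<bar> \<le> B" for y
  proof -
    have "\<bar>F s y\<bar> \<le> (\<integral>g. \<bar>f (y + (1 / s) *\<^sub>R g)\<bar> \<partial>std_gauss)"
      unfolding F_def by (rule integral_abs_bound)
    also have "\<dots> \<le> (\<integral>g. B \<partial>(std_gauss::(real^'n) measure))"
      using B B0 by (intro integral_mono G.integrable_const_bound[where B = B]) auto
    finally have "\<bar>F s y\<bar> \<le> (\<integral>g. B \<partial>(std_gauss::(real^'n) measure))" .
    then show ?thesis using G.prob_space by simp
  qed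
  have [simp]: "integrable (std_gauss::(real^'n) measure) (\<lambda>g. if d \<le> norm g / real (Suc k) then 1 else 0 :: real)"
    by (intro G.integrable_const_bound[where B = 1]) auto
  have close: "\<bar>F s y - f y\<bar> \<le> e / 4" for y
  proof -
    have "F s y - f y = (\<integral>g. f (y + (1 / s) *\<^sub>R g) - f y \<partial>std_gauss)"
      unfolding F_def using B
      by (subst Bochner_Integration.integral_diff) (auto simp: G.prob_space[simplified] intro!: G.integrable_const_bound[where B = B])
    also have "\<bar>\<dots>\<bar> \<le> (\<integral>g. e / 8 + 2 * B * (if d \<le> norm g / real (Suc k) then 1 else 0) \<partial>(std_gauss::(real^'n) measure))"
    proof (rule abs_integral_le)
      show "integrable std_gauss (\<lambda>g. f (y + (1 / s) *\<^sub>R g) - f y)"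
        using B by (intro Bochner_Integration.integrable_diff G.integrable_const_bound[where B = B]) auto
      show "integrable (std_gauss::(real^'n) measure) (\<lambda>g. e / 8 + 2 * B * (if d \<le> norm g / real (Suc k) then 1 else 0))"
        by (intro Bochner_Integration.integrable_add Bochner_Integration.integrable_mult_right) (simp_all del: of_nat_Suc)
      fix g :: "real^'n"
      have "\<bar>f (y + (1 / s) *\<^sub>R g) - f y\<bar> \<le> 2 * B" using B[of y] B[of "y + (1 / s) *\<^sub>R g"] by linarith
      moreover have "\<bar>f (y + (1 / s) *\<^sub>R g) - f y\<bar> < e / 8" if "norm g / real (Suc k) < d"
        using that \<open>s > 0\<close> by (intro d(2)) (simp add: s_def)
      ultimately show "\<bar>f (y + (1 / s) *\<^sub>R g) - f y\<bar> \<le> e / 8 + 2 * B * (if d \<le> norm g / real (Suc k) then 1 else 0)"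
        using \<open>0 < e\<close> by (auto simp: not_le intro: less_imp_le)
    qed
    also have "\<dots> = e / 8 + 2 * B * (\<integral>g. (if d \<le> norm g / real (Suc k) then 1 else 0) \<partial>(std_gauss::(real^'n) measure))"
      by (subst Bochner_Integration.integral_add) (simp_all add: G.prob_space[simplified] del: of_nat_Suc)
    finally show ?thesis using k by linarith
  qed
  have 2: "\<bar>(\<integral>\<omega>. F s (Z \<omega>) \<partial>P) - (\<integral>\<omega>. f (Z \<omega>) \<partial>P)\<bar> \<le> e / 4"
    if "prob_space P" and [measurable]: "Z \<in> borel_measurable P" for P :: "'c measure" and Z :: "'c \<Rightarrow> real^'n"
  proof -
    interpret P: prob_space P by fact
    have "(\<integral>\<omega>. F s (Z \<omega>) \<partial>P) - (\<integral>\<omega>. f (Z \<omega>) \<partial>P) = (\<integral>\<omega>. F s (Z \<omega>) - f (Z \<omega>) \<partial>P)"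
      using B FB by (subst Bochner_Integration.integral_diff) (auto intro!: P.integrable_const_bound[where B = B])
    also have "\<bar>\<dots>\<bar> \<le> (\<integral>\<omega>. e / 4 \<partial>P)"
    proof (rule abs_integral_le)
      show "integrable P (\<lambda>\<omega>. F s (Z \<omega>) - f (Z \<omega>))"
        using B FB by (intro Bochner_Integration.integrable_diff P.integrable_const_bound[where B = B]) auto
    qed (use close in auto)
    finally show ?thesis by (simp add: P.prob_space)
  qed
  from LIMSEQ_D[OF F_lim[OF \<open>s > 0\<close>], of "e / 4"] \<open>0 < e\<close>
  obtain n0 where n0: "\<And>n. n \<ge> n0 \<Longrightarrow> \<bar>(\<integral>\<omega>. F s (Y n \<omega>) \<partial>M) - (\<integral>y. F s y \<partial>N)\<bar> < e / 4"
    by auto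
  show "\<exists>no. \<forall>n\<ge>no. norm ((\<integral>\<omega>. f (Y n \<omega>) \<partial>M) - (\<integral>y. f y \<partial>N)) < e"
  proof (intro exI allI impI)
    fix n assume "n \<ge> n0"
    show "norm ((\<integral>\<omega>. f (Y n \<omega>) \<partial>M) - (\<integral>y. f y \<partial>N)) < e"
      unfolding real_norm_def
    proof (rule abs_diff_chain4)
      show "\<bar>(\<integral>\<omega>. f (Y n \<omega>) \<partial>M) - (\<integral>\<omega>. F s (Y n \<omega>) \<partial>M)\<bar> \<le> e / 4"
        using 2[OF M.prob_space_axioms meas_Y[of n]] by (simp add: abs_minus_commute)
      show "\<bar>(\<integral>y. f y \<partial>N) - (\<integral>y. F s y \<partial>N)\<bar> \<le> e / 4"
        using 2[OF N.prob_space_axioms, of "\<lambda>y. y"] by (simp add: abs_minus_commute)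
    qed (use n0[OF \<open>n \<ge> n0\<close>] \<open>0 < e\<close> in auto)
  qed
qed

lemma lim_compact_support:
  fixes f :: "real^'n \<Rightarrow> real"
  assumes cont: "continuous_on UNIV f" and supp: "\<And>x. norm x \<ge> R \<Longrightarrow> f x = 0"
  shows "(\<lambda>n. \<integral>\<omega>. f (Y n \<omega>) \<partial>M) \<longlonglongrightarrow> (\<integral>y. f y \<partial>N)"
proof -
  have c: "continuous_on (cball 0 r) f" for r
    using cont continuous_on_subset by blast
  have "integrable lborel (\<lambda>x. indicator (cball 0 R) x *\<^sub>R f x)"
    by (rule borel_integrable_compact) (auto simp: c)
  moreover have "(\<lambda>x. indicator (cball 0 R) x *\<^sub>R f x) = f"
    using supp by (force simp: indicator_def)
  ultimately have int: "integrable lborel f" by simp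
  have "bounded (f ` cball 0 R)"
    by (intro compact_imp_bounded compact_continuous_image c) simp
  then obtain B where B: "\<And>x. x \<in> cball 0 R \<Longrightarrow> \<bar>f x\<bar> \<le> B"
    unfolding bounded_iff by (metis image_eqI real_norm_def)
  have B': "\<bar>f x\<bar> \<le> max B 0" for x
    using B[of x] supp[of x] by (cases "norm x \<le> R") auto
  have "uniformly_continuous_on UNIV f"
    unfolding uniformly_continuous_on_def
  proof (intro allI impI)
    fix e :: real assume "e > 0"
    have "uniformly_continuous_on (cball 0 (R + 1)) f"
      by (rule compact_uniformly_continuous[OF c]) simp
    then obtain d where d: "d > 0" "\<And>x y. x \<in> cball 0 (R + 1) \<Longrightarrow> y \<in> cball 0 (R + 1) \<Longrightarrow> dist y x < d \<Longrightarrow> dist (f y) (f x) < e"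
      using \<open>e > 0\<close> unfolding uniformly_continuous_on_def by metis
    \<comment> \<open>If one point leaves the ball of radius R + 1, the minimum with 1 keeps the
      other outside radius R, so that both values are 0.\<close>
    have "dist (f y) (f x) < e" if "dist y x < min d 1" for x y
    proof (cases "x \<in> cball 0 (R + 1) \<and> y \<in> cball 0 (R + 1)")
      case True then show ?thesis using d(2) that by simp
    next
      case False
      have "norm x \<le> norm y + dist y x" "norm y \<le> norm x + dist y x"
        using norm_triangle_sub[of x y] norm_triangle_sub[of y x] by (auto simp: dist_norm norm_minus_commute)
      with False that have "norm x \<ge> R" "norm y \<ge> R" by (auto simp: not_le)
      then show ?thesis using supp \<open>e > 0\<close> by simp
    qed
    then show "\<exists>d>0. \<forall>x\<in>UNIV. \<forall>y\<in>UNIV. dist y x < d \<longrightarrow> dist (f y) (f x) < e"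
      using \<open>d > 0\<close> by (intro exI[of _ "min d 1"]) auto
  qed
  then show ?thesis
    by (rule lim_uniformly_continuous[OF int]) (rule B')
qed

text \<open>Cutting \<open>f\<close> off by a bump reduces to compact support. The bump is itself
  such a test function, so the mass that \<open>N\<close> gives to it is asymptotically given to it
  by the \<open>Y n\<close> as well; this is where tightness comes from.\<close>

theorem conv_in_distr: "conv_in_distr M Y N"
  unfolding conv_in_distr_def
proof (intro allI impI, elim conjE)
  fix f :: "real^'n \<Rightarrow> real" assume cont: "continuous_on UNIV f" and "bounded (range f)"
  then obtain B where B: "\<And>x. \<bar>f x\<bar> \<le> B"
    unfolding bounded_iff by auto
  have B0: "0 \<le> B" using B[of 0] by linarith
  have [measurable]: "f \<in> borel_measurable borel"
    using cont by (rule borel_measurable_continuous_onI)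
  define bump where "bump R x = max 0 (min 1 (R + 1 - norm x))" for R :: real and x :: "real^'n"
  have cont_bump: "continuous_on UNIV (bump R)" for R
    unfolding bump_def by (intro continuous_intros)
  have [measurable]: "bump R \<in> borel_measurable borel" for R
    using cont_bump by (rule borel_measurable_continuous_onI)
  have bump01: "0 \<le> bump R x" "bump R x \<le> 1" for R x by (auto simp: bump_def)
  have "(\<lambda>k. \<integral>y. bump (real k) y \<partial>N) \<longlonglongrightarrow> (\<integral>y. 1 \<partial>N)"
  proof (rule integral_dominated_convergence[where w = "\<lambda>_. 1"])
    have "(\<lambda>k. bump (real k) y) \<longlonglongrightarrow> 1" for y
    proof (rule tendsto_eventually)
      from real_arch_simple obtain k0 where "norm y \<le> real k0" by blast
      then have "\<forall>k\<ge>k0. bump (real k) y = 1" by (auto simp: bump_def)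
      then show "\<forall>\<^sub>F k in sequentially. bump (real k) y = 1"
        by (auto simp: eventually_sequentially)
    qed
    then show "AE y in N. (\<lambda>k. bump (real k) y) \<longlonglongrightarrow> 1" by simp
  qed (use bump01 in auto)
  then have bump_lim: "(\<lambda>k. \<integral>y. bump (real k) y \<partial>N) \<longlonglongrightarrow> 1" by (simp add: N.prob_space)
  show "(\<lambda>n. \<integral>x. f (Y n x) \<partial>M) \<longlonglongrightarrow> (\<integral>y. f y \<partial>N)"
  proof (rule LIMSEQ_I)
    fix e :: real assume "0 < e"
    \<comment> \<open>The cut-off costs at most B times the mass outside the bump; the 1 added to B
      covers B = 0.\<close>
    define e' where "e' = e / (4 * (B + 1))"
    have "e' > 0" using \<open>0 < e\<close> B0 by (simp add: e'_def)
    have Be: "B * e' \<le> e / 4" using \<open>0 < e\<close> B0 by (simp add: e'_def field_simps)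
    from order_tendstoD(1)[OF bump_lim, of "1 - e'"] \<open>e' > 0\<close>
    obtain k where k: "(\<integral>y. bump (real k) y \<partial>N) > 1 - e'"
      by (auto simp: eventually_sequentially)
    let ?c = "bump (real k)"
    have "(\<lambda>n. \<integral>\<omega>. ?c (Y n \<omega>) \<partial>M) \<longlonglongrightarrow> (\<integral>y. ?c y \<partial>N)"
      by (rule lim_compact_support[where R = "real k + 1", OF cont_bump]) (auto simp: bump_def)
    from order_tendstoD(1)[OF this k] have ev1: "\<forall>\<^sub>F n in sequentially. (\<integral>\<omega>. ?c (Y n \<omega>) \<partial>M) > 1 - e'" .
    have "(\<lambda>n. \<integral>\<omega>. f (Y n \<omega>) * ?c (Y n \<omega>) \<partial>M) \<longlonglongrightarrow> (\<integral>y. f y * ?c y \<partial>N)"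
      by (rule lim_compact_support[where R = "real k + 1"])
         (intro continuous_on_mult cont cont_bump, simp add: bump_def)
    from LIMSEQ_D[OF this, of "e / 4"] \<open>0 < e\<close>
    have ev2: "\<forall>\<^sub>F n in sequentially. \<bar>(\<integral>\<omega>. f (Y n \<omega>) * ?c (Y n \<omega>) \<partial>M) - (\<integral>y. f y * ?c y \<partial>N)\<bar> < e / 4"
      by (auto simp: eventually_sequentially)
    have cut: "\<bar>(\<integral>\<omega>. f (Z \<omega>) \<partial>P) - (\<integral>\<omega>. f (Z \<omega>) * ?c (Z \<omega>) \<partial>P)\<bar> \<le> e / 4"
      if "prob_space P" and [measurable]: "Z \<in> borel_measurable P" and "(\<integral>\<omega>. ?c (Z \<omega>) \<partial>P) > 1 - e'" for P :: "'c measure" and Z :: "'c \<Rightarrow> real^'n"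
    proof -
      interpret P: prob_space P by fact
      have "\<bar>f x * ?c x\<bar> \<le> B" for x
        using mult_mono[OF B[of x] bump01(2)[of "real k" x]] bump01[of "real k" x] B0 by (simp add: abs_mult)
      then have [simp]: "integrable P (\<lambda>\<omega>. f (Z \<omega>) * ?c (Z \<omega>))"
        by (intro P.integrable_const_bound[where B = B]) auto
      have [simp]: "integrable P (\<lambda>\<omega>. f (Z \<omega>))"
        using B by (intro P.integrable_const_bound[where B = B]) auto
      have [simp]: "integrable P (\<lambda>\<omega>. ?c (Z \<omega>))"
        using bump01 by (intro P.integrable_const_bound[where B = 1]) auto
      have "(\<integral>\<omega>. f (Z \<omega>) \<partial>P) - (\<integral>\<omega>. f (Z \<omega>) * ?c (Z \<omega>) \<partial>P) = (\<integral>\<omega>. f (Z \<omega>) * (1 - ?c (Z \<omega>)) \<partial>P)"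
        by (subst Bochner_Integration.integral_diff[symmetric]) (auto simp: algebra_simps)
      also have "\<bar>\<dots>\<bar> \<le> (\<integral>\<omega>. B * (1 - ?c (Z \<omega>)) \<partial>P)"
      proof (rule abs_integral_le)
        show "integrable P (\<lambda>\<omega>. f (Z \<omega>) * (1 - ?c (Z \<omega>)))" by (simp add: right_diff_distrib)
        show "\<bar>f (Z \<omega>) * (1 - ?c (Z \<omega>))\<bar> \<le> B * (1 - ?c (Z \<omega>))" for \<omega>
          using B[of "Z \<omega>"] bump01[of "real k" "Z \<omega>"] by (auto simp: abs_mult intro!: mult_right_mono)
      qed simp
      also have "\<dots> = B * (1 - (\<integral>\<omega>. ?c (Z \<omega>) \<partial>P))"
        by (simp add: P.prob_space)
      also have "\<dots> \<le> B * e'"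
        using that(3) B0 by (intro mult_left_mono) auto
      finally show ?thesis using Be by linarith
    qed
    from ev1 ev2 have "\<forall>\<^sub>F n in sequentially. norm ((\<integral>x. f (Y n x) \<partial>M) - (\<integral>y. f y \<partial>N)) < e"
    proof eventually_elim
      case (elim n)
      show ?case
        unfolding real_norm_def
        by (rule abs_diff_chain4[OF cut[OF M.prob_space_axioms meas_Y elim(1)] elim(2) _ \<open>0 < e\<close>])
           (rule cut[OF N.prob_space_axioms _ k], simp)
    qed
    then show "\<exists>no. \<forall>n\<ge>no. norm ((\<integral>x. f (Y n x) \<partial>M) - (\<integral>y. f y \<partial>N)) < e"
      by (simp add: eventually_sequentially)
  qed
qed

end

section \<open>Centred Gaussian laws as linear images of the standard one\<close>

lemma inner_matrix_vector:
  fixes A :: "real^'n^'m"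
  shows "x \<bullet> (A *v y) = (transpose A *v x) \<bullet> y"
  by (simp add: dot_lmul_matrix)

text \<open>Gram-Schmidt for the inner product given by \<open>\<Sigma>\<close>; the orthonormal
  vectors become the columns of \<open>B\<close>.\<close>

lemma exists_orthonormal_matrix:
  fixes \<Sigma> :: "real^'n^'n"
  assumes sym: "transpose \<Sigma> = \<Sigma>" and pos: "\<And>x. x \<noteq> 0 \<Longrightarrow> 0 < x \<bullet> (\<Sigma> *v x)"
  obtains B :: "real^'n^'n" where "transpose B ** \<Sigma> ** B = mat 1"
proof -
  define b where "b x y = x \<bullet> (\<Sigma> *v y)" for x y
  have b_sym: "b x y = b y x" for x y
    by (metis b_def inner_commute inner_matrix_vector sym)
  have "\<exists>V. finite V \<and> card V = k \<and> (\<forall>v\<in>V. \<forall>w\<in>V. b v w = of_bool (v = w))" if "k \<le> CARD('n)" for k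
    using that
  proof (induction k)
    case 0 then show ?case by (intro exI[of _ "{}"]) auto
  next
    case (Suc k)
    then obtain V where V: "finite V" "card V = k" "\<And>v w. v \<in> V \<Longrightarrow> w \<in> V \<Longrightarrow> b v w = of_bool (v = w)"
      by auto
    have "dim V < DIM(real^'n)"
      using dim_le_card'[OF V(1)] V(2) Suc.prems by simp
    then have "span V \<noteq> UNIV"
      using dim_span by (metis dim_UNIV order_less_irrefl)
    then obtain x where x: "x \<notin> span V" by auto
    define w where "w = x - (\<Sum>v\<in>V. b v x *\<^sub>R v)"
    have "w \<noteq> 0"
    proof
      assume "w = 0"
      then have "x = (\<Sum>v\<in>V. b v x *\<^sub>R v)" by (simp add: w_def)
      also have "\<dots> \<in> span V" by (intro span_sum span_scale span_base)
      finally show False using x by simp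
    qed
    have b_lin: "b v (y - z) = b v y - b v z" "b v (c *\<^sub>R y) = c * b v y" "b v (\<Sum>u\<in>V. f u) = (\<Sum>u\<in>V. b v (f u))" for v y z c f
      by (simp_all add: b_def matrix_vector_mult_diff_distrib inner_diff_right matrix_vector_mult_scaleR
          linear_sum[OF matrix_vector_mul_linear] inner_sum_right)
    have bw: "b v w = 0" if "v \<in> V" for v
    proof -
      have "b v w = b v x - (\<Sum>u\<in>V. b u x * b v u)"
        by (simp add: w_def b_lin)
      also have "(\<Sum>u\<in>V. b u x * b v u) = (\<Sum>u\<in>V. if u = v then b v x else 0)"
        by (intro sum.cong refl) (auto simp: V(3) that)
      finally show ?thesis using that V(1) by simp
    qed
    have "0 < b w w" using pos[OF \<open>w \<noteq> 0\<close>] by (simp add: b_def)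
    define u where "u = (1 / sqrt (b w w)) *\<^sub>R w"
    have bu1: "b v u = 0" if "v \<in> V" for v
      by (simp add: u_def b_lin bw[OF that])
    then have bu2: "b u v = 0" if "v \<in> V" for v
      using that b_sym by metis
    note bu = bu1 bu2
    have b_u: "b y u = 1 / sqrt (b w w) * b y w" for y
      by (simp only: u_def b_lin)
    have "b u u = 1 / sqrt (b w w) * b w u"
      using b_u[of u] b_sym[of u w] by metis
    also have "\<dots> = 1 / sqrt (b w w) * (1 / sqrt (b w w) * b w w)"
      by (simp only: b_u)
    finally have buu: "b u u = 1"
      using \<open>0 < b w w\<close> by simp
    then have "u \<notin> V" using bu1 by fastforce
    have "b v v' = of_bool (v = v')" if "v \<in> insert u V" "v' \<in> insert u V" for v v'
      using that buu bu1 bu2 V(3) \<open>u \<notin> V\<close> by (cases "v = u"; cases "v' = u") auto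
    then show ?case
      using V(1,2) \<open>u \<notin> V\<close> by (intro exI[of _ "insert u V"]) auto
  qed
  from this[of "CARD('n)"] obtain V where V: "finite V" "card V = CARD('n)" "\<And>v w. v \<in> V \<Longrightarrow> w \<in> V \<Longrightarrow> b v w = of_bool (v = w)"
    by auto
  obtain h where h: "bij_betw h (UNIV :: 'n set) V"
    using V(1,2) finite_same_card_bij[of "UNIV :: 'n set" V] by auto
  define B :: "real^'n^'n" where "B = (\<chi> i j. h j $ i)"
  have col: "B *v axis j 1 = h j" for j
    by (simp add: B_def vec_eq_iff matrix_vector_mul_component inner_axis)
  have "transpose B ** \<Sigma> ** B = mat 1"
  proof (rule vec_eq_iff[THEN iffD2], rule, rule vec_eq_iff[THEN iffD2], rule)
    fix i j
    have "(transpose B ** \<Sigma> ** B) $ i $ j = axis i 1 \<bullet> ((transpose B ** \<Sigma> ** B) *v axis j 1)"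
      by (simp add: inner_axis' matrix_vector_mul_component inner_axis)
    also have "\<dots> = b (h i) (h j)"
      unfolding b_def col[symmetric] matrix_vector_mul_assoc[symmetric]
      by (subst inner_matrix_vector) (simp only: transpose_transpose)
    also have "\<dots> = of_bool (i = j)"
      using h by (simp add: V(3) bij_betwE bij_betw_imp_inj_on inj_eq)
    finally show "(transpose B ** \<Sigma> ** B) $ i $ j = mat 1 $ i $ j"
      by (simp add: mat_def)
  qed
  then show thesis by (rule that)
qed

lemma matrix_inv_eqI:
  fixes A B :: "real^'n^'n"
  assumes "A ** B = mat 1"
  shows "matrix_inv A = B"
proof -
  have "B ** A = mat 1" by (rule matrix_left_right_inverse[THEN iffD1, OF assms])
  with assms have "A ** B = mat 1 \<and> B ** A = mat 1" by (rule conjI)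
  then have inv: "A ** matrix_inv A = mat 1 \<and> matrix_inv A ** A = mat 1"
    unfolding matrix_inv_def by (rule someI[of "\<lambda>A'. A ** A' = mat 1 \<and> A' ** A = mat 1" B])
  have "matrix_inv A = matrix_inv A ** (A ** B)"
    by (simp only: assms matrix_mul_rid)
  also have "\<dots> = (matrix_inv A ** A) ** B"
    by (rule matrix_mul_assoc)
  also have "\<dots> = B"
    by (simp only: inv matrix_mul_lid)
  finally show ?thesis .
qed

context
  fixes \<Sigma> B :: "real^'n^'n"
  assumes B: "transpose B ** \<Sigma> ** B = mat 1"
begin

lemma factor_mult: "(B ** transpose B) ** \<Sigma> = mat 1"
  using matrix_left_right_inverse[THEN iffD1, OF B] by (simp only: matrix_mul_assoc)

lemma matrix_inv_factor: "matrix_inv \<Sigma> = B ** transpose B"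
  by (rule matrix_inv_eqI, rule matrix_left_right_inverse[THEN iffD1, OF factor_mult])

text \<open>With z = B y the quadratic form of \<open>\<Sigma>\<close> becomes the squared norm of
  y. The Jacobian \<open>\<bar>det B\<bar>\<close> cancels the determinant in the normalising
  constant, because the inverse of \<open>\<Sigma>\<close> is
  \<open>B ** transpose B\<close>.\<close>

lemma centered_gaussian_eq_distr:
  "centered_gaussian (matrix_inv \<Sigma>) = distr std_gauss borel ((*v) B)"
proof (rule measure_eqI)
  have inv2: "matrix_inv (matrix_inv \<Sigma>) = \<Sigma>"
    unfolding matrix_inv_factor by (rule matrix_inv_eqI[OF factor_mult])
  have "det (transpose B ** \<Sigma> ** B) = 1" by (simp add: B)
  then have d: "det B \<noteq> 0" by (auto simp: det_mul)
  fix X assume "X \<in> sets (centered_gaussian (matrix_inv \<Sigma>))"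
  then have [measurable]: "X \<in> sets borel" by (simp add: centered_gaussian_def)
  have q: "(B *v y) \<bullet> (\<Sigma> *v (B *v y)) = y \<bullet> y" for y
  proof -
    have "y \<bullet> ((transpose B ** \<Sigma> ** B) *v y) = (B *v y) \<bullet> (\<Sigma> *v (B *v y))"
      unfolding matrix_vector_mul_assoc[symmetric]
      by (subst inner_matrix_vector) (simp only: transpose_transpose)
    then show ?thesis by (simp add: B)
  qed
  have [measurable]: "(\<lambda>z::real^'n. z \<bullet> (\<Sigma> *v z)) \<in> borel_measurable borel"
    by measurable
  let ?c = "sqrt ((2 * pi) ^ CARD('n) * (det B)\<^sup>2)"
  have "emeasure (centered_gaussian (matrix_inv \<Sigma>)) X =
     (\<integral>\<^sup>+z. ennreal (exp (- (z \<bullet> (\<Sigma> *v z)) / 2) / ?c) * indicator X z \<partial>lborel)"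
    by (simp add: centered_gaussian_def emeasure_density inv2) (simp add: matrix_inv_factor det_mul power2_eq_square)
  also have "\<dots> = ennreal \<bar>det B\<bar> * (\<integral>\<^sup>+y. ennreal (exp (- (y \<bullet> y) / 2) / ?c) * indicator X (B *v y) \<partial>lborel)"
    by (subst nn_integral_lborel_linear[OF _ d]) (auto simp: q)
  also have "\<dots> = (\<integral>\<^sup>+y. ennreal (exp (- (y \<bullet> y) / 2) / sqrt ((2 * pi) ^ CARD('n))) * indicator X (B *v y) \<partial>lborel)"
  proof (subst nn_integral_cmult[symmetric], simp, rule nn_integral_cong)
    fix y :: "real^'n"
    have "ennreal \<bar>det B\<bar> * ennreal (exp (- (y \<bullet> y) / 2) / ?c) = ennreal (exp (- (y \<bullet> y) / 2) / sqrt ((2 * pi) ^ CARD('n)))"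
      using d by (subst ennreal_mult[symmetric]) (auto simp: real_sqrt_mult)
    then show "ennreal \<bar>det B\<bar> * (ennreal (exp (- (y \<bullet> y) / 2) / ?c) * indicator X (B *v y)) =
      ennreal (exp (- (y \<bullet> y) / 2) / sqrt ((2 * pi) ^ CARD('n))) * indicator X (B *v y)"
      by (simp only: mult.assoc[symmetric])
  qed
  also have "\<dots> = emeasure (distr std_gauss borel ((*v) B)) X"
  proof -
    have "(*v) B -` X \<inter> space borel \<in> sets borel"
      by (rule measurable_sets[OF borel_measurable_matrix_vector_mult]) simp
    then have "(*v) B -` X \<in> sets borel" by simp
    then show ?thesis
      unfolding std_gauss_def prod_std_normal_density
      by (simp add: emeasure_distr emeasure_density indicator_def)
  qed
  finally show "emeasure (centered_gaussian (matrix_inv \<Sigma>)) X = emeasure (distr std_gauss borel ((*v) B)) X" .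
qed (simp add: centered_gaussian_def)

lemma integral_iexp_centered_gaussian_aux:
  "(CLINT z|centered_gaussian (matrix_inv \<Sigma>). iexp (t \<bullet> z)) = complex_of_real (exp (- (t \<bullet> (matrix_inv \<Sigma> *v t)) / 2))"
proof -
  have "(CLINT z|centered_gaussian (matrix_inv \<Sigma>). iexp (t \<bullet> z)) = (CLINT y|std_gauss. iexp ((transpose B *v t) \<bullet> y))"
    unfolding centered_gaussian_eq_distr inner_matrix_vector[symmetric]
    by (rule integral_distr) auto
  also have "\<dots> = complex_of_real (exp (- ((transpose B *v t) \<bullet> (transpose B *v t)) / 2))"
    by (rule integral_iexp_std_gauss)
  also have "(transpose B *v t) \<bullet> (transpose B *v t) = t \<bullet> (matrix_inv \<Sigma> *v t)"
    unfolding matrix_inv_factor matrix_vector_mul_assoc[symmetric] by (rule inner_matrix_vector[symmetric])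
  finally show ?thesis .
qed

lemma prob_space_centered_gaussian_aux: "prob_space (centered_gaussian (matrix_inv \<Sigma>))"
  unfolding centered_gaussian_eq_distr
  by (intro prob_space.prob_space_distr prob_space_std_gauss) simp

end

lemma
  fixes \<Sigma> :: "real^'n^'n"
  assumes "transpose \<Sigma> = \<Sigma>" "\<And>x. x \<noteq> 0 \<Longrightarrow> 0 < x \<bullet> (\<Sigma> *v x)"
  shows integral_iexp_centered_gaussian:
      "(CLINT z|centered_gaussian (matrix_inv \<Sigma>). iexp (t \<bullet> z)) = complex_of_real (exp (- (t \<bullet> (matrix_inv \<Sigma> *v t)) / 2))"
    and prob_space_centered_gaussian: "prob_space (centered_gaussian (matrix_inv \<Sigma>))"
proof -
  obtain B :: "real^'n^'n" where B: "transpose B ** \<Sigma> ** B = mat 1"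
    using exists_orthonormal_matrix[OF assms] .
  show "(CLINT z|centered_gaussian (matrix_inv \<Sigma>). iexp (t \<bullet> z)) = complex_of_real (exp (- (t \<bullet> (matrix_inv \<Sigma> *v t)) / 2))"
    by (rule integral_iexp_centered_gaussian_aux[OF B])
  show "prob_space (centered_gaussian (matrix_inv \<Sigma>))"
    by (rule prob_space_centered_gaussian_aux[OF B])
qed

section \<open>A Markov chain that forgets its past through state 0\<close>

lemma expectation_bind_pmf_nonneg:
  fixes f :: "'b \<Rightarrow> real"
  assumes int: "integrable (bind_pmf M N) f" and nn: "\<And>x. 0 \<le> f x"
  shows "\<And>x. x \<in> set_pmf M \<Longrightarrow> integrable (N x) f"
    and "integrable M (\<lambda>x. \<integral>y. f y \<partial>N x)"
    and "(\<integral>y. f y \<partial>bind_pmf M N) = (\<integral>x. (\<integral>y. f y \<partial>N x) \<partial>M)"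
proof -
  have fin: "(\<integral>\<^sup>+x. \<integral>\<^sup>+y. f y \<partial>N x \<partial>M) < \<infinity>"
    using int nn by (simp add: integrable_iff_bounded)
  then have "AE x in M. (\<integral>\<^sup>+y. f y \<partial>N x) \<noteq> \<infinity>"
    by (intro nn_integral_PInf_AE) auto
  then have fin': "(\<integral>\<^sup>+y. f y \<partial>N x) < \<infinity>" if "x \<in> set_pmf M" for x
    using that by (auto simp: AE_measure_pmf_iff less_top)
  show i: "integrable (N x) f" if "x \<in> set_pmf M" for x
    using fin'[OF that] nn by (simp add: integrable_iff_bounded)
  have "(\<integral>\<^sup>+y. f y \<partial>N x) = ennreal (\<integral>y. f y \<partial>N x)" if "x \<in> set_pmf M" for x
    using i[OF that] nn by (intro nn_integral_eq_integral) auto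
  then have eq: "(\<integral>\<^sup>+x. \<integral>\<^sup>+y. f y \<partial>N x \<partial>M) = (\<integral>\<^sup>+x. ennreal (\<integral>y. f y \<partial>N x) \<partial>M)"
    by (intro nn_integral_cong_AE) (auto simp: AE_measure_pmf_iff)
  show "integrable M (\<lambda>x. \<integral>y. f y \<partial>N x)"
    using fin nn by (simp add: integrable_iff_bounded eq integral_nonneg_AE)
  show "(\<integral>y. f y \<partial>bind_pmf M N) = (\<integral>x. (\<integral>y. f y \<partial>N x) \<partial>M)"
    using nn eq by (simp add: integral_eq_nn_integral integral_nonneg_AE)
qed

lemma expectation_bind_pmf:
  fixes f :: "'b \<Rightarrow> real"
  assumes int: "integrable (bind_pmf M N) f"
  shows integrable_bind_pmf_inner: "\<And>x. x \<in> set_pmf M \<Longrightarrow> integrable (N x) f"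
    and integrable_bind_pmf_outer: "integrable M (\<lambda>x. \<integral>y. f y \<partial>N x)"
    and integral_bind_pmf: "(\<integral>y. f y \<partial>bind_pmf M N) = (\<integral>x. (\<integral>y. f y \<partial>N x) \<partial>M)"
proof -
  let ?p = "\<lambda>y. max (f y) 0" and ?n = "\<lambda>y. max (- f y) 0"
  have ip: "integrable (bind_pmf M N) ?p" and ineg: "integrable (bind_pmf M N) ?n"
    using int by auto
  note P = expectation_bind_pmf_nonneg[OF ip] and N = expectation_bind_pmf_nonneg[OF ineg]
  have f: "f = (\<lambda>y. ?p y - ?n y)" by (auto simp: max_def)
  show i: "integrable (N x) f" if "x \<in> set_pmf M" for x
    by (subst f) (intro Bochner_Integration.integrable_diff P(1) N(1) that; simp)
  have e: "(\<integral>y. f y \<partial>N x) = (\<integral>y. ?p y \<partial>N x) - (\<integral>y. ?n y \<partial>N x)" if "x \<in> set_pmf M" for x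
    by (subst f) (intro Bochner_Integration.integral_diff P(1) N(1) that; simp)
  have "integrable M (\<lambda>x. (\<integral>y. ?p y \<partial>N x) - (\<integral>y. ?n y \<partial>N x))"
    by (intro Bochner_Integration.integrable_diff P(2) N(2)) auto
  then show "integrable M (\<lambda>x. \<integral>y. f y \<partial>N x)"
    by (subst integrable_cong_AE[where g = "\<lambda>x. (\<integral>y. ?p y \<partial>N x) - (\<integral>y. ?n y \<partial>N x)"])
       (auto simp: AE_measure_pmf_iff e)
  have "(\<integral>y. f y \<partial>bind_pmf M N) = (\<integral>y. ?p y \<partial>bind_pmf M N) - (\<integral>y. ?n y \<partial>bind_pmf M N)"
    by (subst f) (intro Bochner_Integration.integral_diff ip ineg)
  also have "\<dots> = (\<integral>x. (\<integral>y. ?p y \<partial>N x) - (\<integral>y. ?n y \<partial>N x) \<partial>M)"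
    by (subst Bochner_Integration.integral_diff) (use P N in auto)
  also have "\<dots> = (\<integral>x. (\<integral>y. f y \<partial>N x) \<partial>M)"
    by (intro integral_cong_AE) (auto simp: AE_measure_pmf_iff e)
  finally show "(\<integral>y. f y \<partial>bind_pmf M N) = (\<integral>x. (\<integral>y. f y \<partial>N x) \<partial>M)" .
qed

lemma integrable_complexI:
  fixes f :: "'a \<Rightarrow> complex"
  assumes "integrable M (\<lambda>x. Re (f x))" "integrable M (\<lambda>x. Im (f x))"
  shows "integrable M f"
proof -
  have "integrable M (\<lambda>x. complex_of_real (Re (f x)) + \<i> * complex_of_real (Im (f x)))"
    using assms by (intro Bochner_Integration.integrable_add integrable_mult_right integrable_of_real) auto
  then show ?thesis by (simp add: complex_eq[symmetric])
qed

lemma integral_bind_pmf_complex: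
  fixes f :: "'b \<Rightarrow> complex"
  assumes int: "integrable (bind_pmf M N) f"
  shows "(\<integral>y. f y \<partial>bind_pmf M N) = (\<integral>x. (\<integral>y. f y \<partial>N x) \<partial>M)"
proof -
  have R: "integrable (bind_pmf M N) (\<lambda>y. Re (f y))" and I: "integrable (bind_pmf M N) (\<lambda>y. Im (f y))"
    using int by auto
  have i: "integrable (N x) f" if "x \<in> set_pmf M" for x
    by (rule integrable_complexI[OF integrable_bind_pmf_inner[OF R that] integrable_bind_pmf_inner[OF I that]])
  have re: "Re (\<integral>y. f y \<partial>N x) = (\<integral>y. Re (f y) \<partial>N x)" and im: "Im (\<integral>y. f y \<partial>N x) = (\<integral>y. Im (f y) \<partial>N x)"
    if "x \<in> set_pmf M" for x
    using i[OF that] by simp_all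
  have "integrable M (\<lambda>x. Re (\<integral>y. f y \<partial>N x))"
    using integrable_bind_pmf_outer[OF R]
    by (subst integrable_cong_AE[where g = "\<lambda>x. \<integral>y. Re (f y) \<partial>N x"]) (auto simp: AE_measure_pmf_iff re)
  moreover have "integrable M (\<lambda>x. Im (\<integral>y. f y \<partial>N x))"
    using integrable_bind_pmf_outer[OF I]
    by (subst integrable_cong_AE[where g = "\<lambda>x. \<integral>y. Im (f y) \<partial>N x"]) (auto simp: AE_measure_pmf_iff im)
  ultimately have o: "integrable M (\<lambda>x. \<integral>y. f y \<partial>N x)"
    by (rule integrable_complexI)
  show ?thesis
  proof (rule complex_eqI)
    have "Re (\<integral>y. f y \<partial>bind_pmf M N) = (\<integral>x. (\<integral>y. Re (f y) \<partial>N x) \<partial>M)"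
      using int integral_bind_pmf[OF R] by simp
    also have "\<dots> = (\<integral>x. Re (\<integral>y. f y \<partial>N x) \<partial>M)"
      by (intro integral_cong_AE) (auto simp: AE_measure_pmf_iff re)
    finally show "Re (\<integral>y. f y \<partial>bind_pmf M N) = Re (\<integral>x. (\<integral>y. f y \<partial>N x) \<partial>M)"
      using o by simp
    have "Im (\<integral>y. f y \<partial>bind_pmf M N) = (\<integral>x. (\<integral>y. Im (f y) \<partial>N x) \<partial>M)"
      using int integral_bind_pmf[OF I] by simp
    also have "\<dots> = (\<integral>x. Im (\<integral>y. f y \<partial>N x) \<partial>M)"
      by (intro integral_cong_AE) (auto simp: AE_measure_pmf_iff im)
    finally show "Im (\<integral>y. f y \<partial>bind_pmf M N) = Im (\<integral>x. (\<integral>y. f y \<partial>N x) \<partial>M)"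
      using o by simp
  qed
qed

lemma integrable_pmf_bounded:
  fixes f :: "'a \<Rightarrow> 'b::{banach, second_countable_topology}"
  assumes "\<And>x. x \<in> set_pmf M \<Longrightarrow> norm (f x) \<le> B"
  shows "integrable (measure_pmf M) f"
  using assms by (intro measure_pmf.integrable_const_bound[where B = B]) (auto simp: AE_measure_pmf_iff)

text \<open>Lists are written newest first, so in \<open>v # u # l\<close> the last transition goes
  from u to v, and \<open>g\<close> receives the pair (old, new). For the list of left steps this is
  the pair of counts at x + 1 and at x.\<close>

fun psum :: "(nat \<times> nat \<Rightarrow> real) \<Rightarrow> nat list \<Rightarrow> real" where
  "psum g (v # u # l) = g (u, v) + psum g (u # l)"
| "psum g _ = 0"

lemma psum_Cons: "l \<noteq> [] \<Longrightarrow> psum g (v # l) = g (hd l, v) + psum g l"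
  by (cases l) auto

lemma psum_conv_sum: "psum g l = (\<Sum>x<length l - 1. g (l ! Suc x, l ! x))"
proof (induction g l rule: psum.induct)
  case (1 g v u l)
  then show ?case by (simp add: sum.lessThan_Suc_shift del: sum.lessThan_Suc)
qed auto

lemma psum_add: "psum (\<lambda>z. g z + h z) l = psum g l + psum h l"
  by (simp add: psum_conv_sum sum.distrib)

lemma psum_diff: "psum (\<lambda>z. g z - h z) l = psum g l - psum h l"
  by (simp add: psum_conv_sum sum_subtractf)

lemma psum_const: "psum (\<lambda>_. c) l = real (length l - 1) * c"
  by (simp add: psum_conv_sum)

lemma psum_cmult: "psum (\<lambda>z. c * g z) l = c * psum g l"
  by (simp add: psum_conv_sum sum_distrib_left)

lemma psum_abs: "\<bar>psum g l\<bar> \<le> psum (\<lambda>z. \<bar>g z\<bar>) l"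
  by (simp add: psum_conv_sum)

lemma psum_nonneg: "(\<And>z. 0 \<le> g z) \<Longrightarrow> 0 \<le> psum g l"
  by (simp add: psum_conv_sum sum_nonneg)

lemma psum_mono: "(\<And>z. g z \<le> h z) \<Longrightarrow> psum g l \<le> psum h l"
  by (simp add: psum_conv_sum sum_mono)

lemma psum_telescope: "l \<noteq> [] \<Longrightarrow> psum (\<lambda>(u, v). f u - f v) l = f (last l) - f (hd l)"
  by (induction l rule: list_nonempty_induct) (auto simp: psum_Cons)

lemma psum_abs_bound:
  assumes "\<And>z. \<bar>g z\<bar> \<le> B" shows "\<bar>psum g l\<bar> \<le> real (length l - 1) * B"
proof -
  have "\<bar>psum g l\<bar> \<le> psum (\<lambda>z. \<bar>g z\<bar>) l" by (rule psum_abs)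
  also have "\<dots> \<le> psum (\<lambda>_. B) l" by (rule psum_mono) (rule assms)
  finally show ?thesis by (simp add: psum_const)
qed

text \<open>Positivity of single transitions, with no lower bound uniform in the states. Mixing is
  extracted from the row \<open>K 0\<close> and the atom of \<open>p\<close> at 0.\<close>

locale pos_chain =
  fixes K :: "nat \<Rightarrow> nat pmf" and p :: "nat pmf"
  assumes K_pos: "\<And>u v. 0 < pmf (K u) v"
    and stationary: "bind_pmf p K = p"
begin

definition P :: "(nat \<Rightarrow> real) \<Rightarrow> nat \<Rightarrow> real" where
  "P f u = (\<integral>v. f v \<partial>K u)"

definition pair :: "(nat \<times> nat) pmf" where
  "pair = bind_pmf p (\<lambda>u. map_pmf (Pair u) (K u))"

text \<open>\<open>chain n\<close> has n transitions and n + 1 states. The oldest state, at the end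
  of the list, is 0 because no left step from the target site occurs before that site is
  hit.\<close>

primrec chain :: "nat \<Rightarrow> nat list pmf" where
  "chain 0 = return_pmf [0]"
| "chain (Suc n) = bind_pmf (chain n) (\<lambda>l. map_pmf (\<lambda>v. v # l) (K (hd l)))"

lemma p_pos: "0 < pmf p v"
proof -
  obtain u where u: "u \<in> set_pmf p" using set_pmf_not_empty[of p] by auto
  have "v \<in> set_pmf (bind_pmf p K)"
    using u K_pos[of u v] by (force simp: set_pmf_iff[of v])
  then show ?thesis by (simp add: stationary pmf_positive)
qed

lemma chain_length: "l \<in> set_pmf (chain n) \<Longrightarrow> length l = Suc n"
  by (induction n arbitrary: l) auto

lemma chain_last: "l \<in> set_pmf (chain n) \<Longrightarrow> last l = 0"
proof (induction n arbitrary: l)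
  case (Suc n)
  then obtain v l' where "l' \<in> set_pmf (chain n)" "l = v # l'" by auto
  moreover from chain_length[OF this(1)] have "l' \<noteq> []" by auto
  ultimately show ?case using Suc.IH by simp
qed simp

lemma P_abs_bound: "(\<And>v. \<bar>f v\<bar> \<le> C) \<Longrightarrow> \<bar>P f u\<bar> \<le> C"
proof -
  assume b: "\<And>v. \<bar>f v\<bar> \<le> C"
  have "\<bar>P f u\<bar> \<le> (\<integral>v. \<bar>f v\<bar> \<partial>K u)" unfolding P_def by (rule integral_abs_bound)
  also have "\<dots> \<le> (\<integral>v. C \<partial>K u)" using b by (intro integral_mono integrable_pmf_bounded[where B = "\<bar>C\<bar>"]) (auto intro: order_trans[OF b abs_ge_self])
  finally show ?thesis by simp
qed

lemma P_pow_abs_bound: "(\<And>v. \<bar>f v\<bar> \<le> C) \<Longrightarrow> \<bar>(P ^^ m) f u\<bar> \<le> C"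
  by (induction m arbitrary: u) (auto intro: P_abs_bound)

lemma expectation_P:
  assumes "\<And>v. \<bar>f v\<bar> \<le> C" shows "(\<integral>u. P f u \<partial>p) = (\<integral>u. f u \<partial>p)"
proof -
  have "(\<integral>u. f u \<partial>bind_pmf p K) = (\<integral>u. P f u \<partial>p)"
    unfolding P_def using assms by (intro integral_bind_pmf integrable_pmf_bounded[where B = C]) auto
  then show ?thesis by (simp add: stationary)
qed

text \<open>Doeblin-type bound: mass seen by \<open>p\<close> is seen, to a fixed extent, from state \<open>0\<close>.\<close>

lemma minorization:
  assumes "0 < e"
  shows "\<exists>d>0. \<forall>f. (\<forall>v. 0 \<le> f v \<and> f v \<le> 1) \<longrightarrow> e \<le> (\<integral>v. f v \<partial>p) \<longrightarrow> d \<le> P f 0"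
proof -
  have "(\<lambda>n. measure p {..<n}) \<longlonglongrightarrow> measure p (\<Union>n. {..<n})"
    by (rule measure_pmf.finite_Lim_measure_incseq) (auto simp: incseq_def)
  also have "(\<Union>n. {..<n}) = (UNIV :: nat set)" by auto
  finally have "(\<lambda>n. measure p {..<n}) \<longlonglongrightarrow> 1" by simp
  from order_tendstoD(1)[OF this, of "1 - e / 2"] assms
  obtain n where n: "1 - e / 2 < measure p {..<n}" by (auto simp: eventually_sequentially)
  define d where "d = e / 2 * Min ((\<lambda>v. pmf (K 0) v) ` {..<Suc n})"
  have "0 < Min ((\<lambda>v. pmf (K 0) v) ` {..<Suc n})"
    by (subst Min_gr_iff) (use K_pos in auto)
  then have "0 < d" unfolding d_def using assms by simp
  moreover have "d \<le> P f 0" if f: "\<And>v. 0 \<le> f v \<and> f v \<le> 1" and ef: "e \<le> (\<integral>v. f v \<partial>p)" for f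
  proof -
    have "\<exists>v<n. e / 2 \<le> f v"
    proof (rule ccontr)
      assume "\<not> (\<exists>v<n. e / 2 \<le> f v)"
      then have small: "\<And>v. v < n \<Longrightarrow> f v < e / 2" by auto
      have [simp]: "integrable p (indicator {n..} :: nat \<Rightarrow> real)"
        by (intro integrable_pmf_bounded[where B = 1]) (auto simp: indicator_def)
      have "(\<integral>v. f v \<partial>p) \<le> (\<integral>v. e / 2 + indicator (- {..<n}) v \<partial>p)"
      proof (rule integral_mono)
        show "integrable p f" using f by (intro integrable_pmf_bounded[where B = 1]) auto
        show "integrable p (\<lambda>v. e / 2 + indicator (- {..<n}) v :: real)"
          by simp
        show "f v \<le> e / 2 + indicator (- {..<n}) v" for v
          using small[of v] f[of v] assms by (auto simp: indicator_def not_less)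
      qed
      also have "\<dots> = e / 2 + measure p (- {..<n})"
        by (subst Bochner_Integration.integral_add) simp_all
      also have "measure p (- {..<n}) = 1 - measure p {..<n}"
        using measure_pmf.prob_compl[of "{..<n}" p] by (simp add: Compl_eq_Diff_UNIV)
      finally show False using ef n by linarith
    qed
    then obtain v where v: "v < n" "e / 2 \<le> f v" by auto
    have "d \<le> e / 2 * pmf (K 0) v"
      unfolding d_def using v assms by (intro mult_left_mono Min_le) auto
    also have "\<dots> \<le> f v * pmf (K 0) v" using v by (intro mult_right_mono) auto
    also have "\<dots> = (\<integral>w. f v * indicator {v} w \<partial>K 0)"
      by (simp add: measure_pmf_single)
    also have "\<dots> \<le> P f 0"
      unfolding P_def using f by (intro integral_mono integrable_pmf_bounded[where B = 1]) (auto simp: indicator_def)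
    finally show ?thesis .
  qed
  ultimately show ?thesis by blast
qed

text \<open>The L1 norm decreases under \<open>P\<close> exactly by cancellation of signs. As long
  as the norm is at least 2 e, mean zero forces the positive and the negative part to have mean at
  least e each, and by \<open>minorization\<close> both are seen from state 0. The cancellation
  there costs a fixed amount at each step, which cannot go on forever.\<close>

lemma P_pow_L1_tendsto_0:
  assumes bound: "\<And>v. \<bar>h v\<bar> \<le> 1" and mean: "(\<integral>v. h v \<partial>p) = 0"
  shows "(\<lambda>m. \<integral>u. \<bar>(P ^^ m) h u\<bar> \<partial>p) \<longlonglongrightarrow> 0"
proof -
  define a where "a m = (\<integral>u. \<bar>(P ^^ m) h u\<bar> \<partial>p)" for m
  have b: "\<bar>(P ^^ m) h u\<bar> \<le> 1" for m u by (rule P_pow_abs_bound) (rule bound)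
  have mean': "(\<integral>u. (P ^^ m) h u \<partial>p) = 0" for m
    by (induction m) (simp_all add: mean expectation_P[OF b])
  have int: "integrable p (\<lambda>u. g ((P ^^ m) h u))" if "\<And>x. \<bar>x\<bar> \<le> 1 \<Longrightarrow> \<bar>g x\<bar> \<le> 1" for g :: "real \<Rightarrow> real" and m
    using that b by (intro integrable_pmf_bounded[where B = 1]) auto
  \<comment> \<open>By stationarity the loss is the mean of a nonnegative gap, \<open>P\<close> of
    the absolute value minus the absolute value of \<open>P\<close>; only the contribution of state
    0 is kept.\<close>
  have drop: "pmf p 0 * (P (\<lambda>u. \<bar>(P ^^ m) h u\<bar>) 0 - \<bar>(P ^^ Suc m) h 0\<bar>) \<le> a m - a (Suc m)" for m
  proof -
    define f where "f = (P ^^ m) h"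
    have bf: "\<bar>f u\<bar> \<le> 1" for u unfolding f_def by (rule b)
    have le: "\<bar>P f u\<bar> \<le> P (\<lambda>u. \<bar>f u\<bar>) u" for u
      unfolding P_def by (rule integral_abs_bound)
    have bP: "\<bar>P (\<lambda>u. \<bar>f u\<bar>) u\<bar> \<le> 1" "\<bar>P f u\<bar> \<le> 1" for u
      using bf by (auto intro!: P_abs_bound)
    have "pmf p 0 * (P (\<lambda>u. \<bar>f u\<bar>) 0 - \<bar>P f 0\<bar>) = (\<integral>u. (P (\<lambda>u. \<bar>f u\<bar>) 0 - \<bar>P f 0\<bar>) * indicator {0} u \<partial>p)"
      by (simp add: measure_pmf_single)
    also have "\<dots> \<le> (\<integral>u. P (\<lambda>u. \<bar>f u\<bar>) u - \<bar>P f u\<bar> \<partial>p)"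
    proof (rule integral_mono)
      show "integrable p (\<lambda>u. P (\<lambda>u. \<bar>f u\<bar>) u - \<bar>P f u\<bar>)"
        using bP by (intro Bochner_Integration.integrable_diff integrable_pmf_bounded[where B = 1]) auto
      show "integrable p (\<lambda>u. (P (\<lambda>u. \<bar>f u\<bar>) 0 - \<bar>P f 0\<bar>) * indicator {0} u)"
        by (intro integrable_pmf_bounded[where B = "\<bar>P (\<lambda>u. \<bar>f u\<bar>) 0 - \<bar>P f 0\<bar>\<bar>"]) (auto simp: indicator_def)
      show "(P (\<lambda>u. \<bar>f u\<bar>) 0 - \<bar>P f 0\<bar>) * indicator {0} u \<le> P (\<lambda>u. \<bar>f u\<bar>) u - \<bar>P f u\<bar>" for u
        using le by (auto simp: indicator_def)
    qed
    also have "\<dots> = (\<integral>u. P (\<lambda>u. \<bar>f u\<bar>) u \<partial>p) - (\<integral>u. \<bar>P f u\<bar> \<partial>p)"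
      using bP by (intro Bochner_Integration.integral_diff integrable_pmf_bounded[where B = 1]) auto
    also have "(\<integral>u. P (\<lambda>u. \<bar>f u\<bar>) u \<partial>p) = (\<integral>u. \<bar>f u\<bar> \<partial>p)"
      by (rule expectation_P[where C = 1]) (simp add: bf)
    finally show ?thesis by (simp add: a_def f_def)
  qed
  have "decseq a"
  proof (rule decseq_SucI)
    fix m
    have "\<bar>(P ^^ Suc m) h 0\<bar> \<le> P (\<lambda>u. \<bar>(P ^^ m) h u\<bar>) 0"
      by (simp add: P_def integral_abs_bound)
    then have "0 \<le> pmf p 0 * (P (\<lambda>u. \<bar>(P ^^ m) h u\<bar>) 0 - \<bar>(P ^^ Suc m) h 0\<bar>)" by simp
    then show "a (Suc m) \<le> a m" using drop[of m] by linarith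
  qed
  have a0: "0 \<le> a m" for m unfolding a_def by simp
  have small: "\<exists>m. a m < 2 * e" if "0 < e" for e
  proof (rule ccontr)
    assume "\<not> (\<exists>m. a m < 2 * e)"
    then have big: "\<And>m. 2 * e \<le> a m" by (auto simp: not_less)
    obtain d where d: "0 < d" "\<And>f. (\<And>v. 0 \<le> f v \<and> f v \<le> 1) \<Longrightarrow> e \<le> (\<integral>v. f v \<partial>p) \<Longrightarrow> d \<le> P f 0"
      using minorization[OF \<open>0 < e\<close>] by blast
    have step: "2 * d * pmf p 0 \<le> a m - a (Suc m)" for m
    proof -
      define f where "f = (P ^^ m) h"
      have bf: "\<bar>f u\<bar> \<le> 1" for u unfolding f_def by (rule b)
      have i: "integrable q (\<lambda>u. max (f u) 0)" "integrable q (\<lambda>u. max (- f u) 0)" "integrable q f" for q :: "nat pmf"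
        by (rule integrable_pmf_bounded[where B = 1], use bf in \<open>simp add: abs_le_iff\<close>)+
      have f1: "(\<integral>u. max (f u) 0 \<partial>q) - (\<integral>u. max (- f u) 0 \<partial>q) = (\<integral>u. f u \<partial>q)" for q :: "nat pmf"
        by (subst Bochner_Integration.integral_diff[symmetric], rule i, rule i, rule Bochner_Integration.integral_cong) (auto simp: max_def)
      have f2: "(\<integral>u. max (f u) 0 \<partial>q) + (\<integral>u. max (- f u) 0 \<partial>q) = (\<integral>u. \<bar>f u\<bar> \<partial>q)" for q :: "nat pmf"
        by (subst Bochner_Integration.integral_add[symmetric], rule i, rule i, rule Bochner_Integration.integral_cong) (auto simp: max_def)
      have "e \<le> (\<integral>u. max (f u) 0 \<partial>p)" "e \<le> (\<integral>u. max (- f u) 0 \<partial>p)"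
        using f1[of p] f2[of p] mean'[of m] big[of m] by (auto simp: a_def f_def)
      then have "d \<le> P (\<lambda>u. max (f u) 0) 0" "d \<le> P (\<lambda>u. max (- f u) 0) 0"
        using bf by (auto intro!: d(2) simp: abs_le_iff)
      \<comment> \<open>With A and B the averages of the two parts seen from 0, the gap is A + B -
        |A - B|, twice the smaller of the two.\<close>
      then have "2 * d \<le> P (\<lambda>u. \<bar>f u\<bar>) 0 - \<bar>P f 0\<bar>"
        using f1[of "K 0"] f2[of "K 0"] unfolding P_def by linarith
      then have "2 * d * pmf p 0 \<le> pmf p 0 * (P (\<lambda>u. \<bar>f u\<bar>) 0 - \<bar>P f 0\<bar>)"
        by (metis mult.commute mult_left_mono pmf_nonneg)
      also have "\<dots> \<le> a m - a (Suc m)" using drop[of m] by (simp add: f_def)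
      finally show ?thesis .
    qed
    have "a m \<le> a 0 - real m * (2 * d * pmf p 0)" for m
      by (induction m) (use step in \<open>auto simp: algebra_simps intro: order_trans\<close>, smt (verit) step)
    moreover obtain m where "a 0 < real m * (2 * d * pmf p 0)"
      using reals_Archimedean3[of "2 * d * pmf p 0"] d(1) p_pos[of 0] by auto
    ultimately show False using a0[of m] by (smt (verit))
  qed
  have "a \<longlonglongrightarrow> 0"
  proof (rule LIMSEQ_I)
    fix e :: real assume "0 < e"
    then obtain m where "a m < 2 * (e / 2)" using small[of "e / 2"] by auto
    then have "\<forall>k\<ge>m. norm (a k - 0) < e"
      using \<open>decseq a\<close> a0 by (auto simp: decseq_def intro: le_less_trans)
    then show "\<exists>m. \<forall>k\<ge>m. norm (a k - 0) < e" by blast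
  qed
  then show ?thesis by (simp add: a_def[abs_def])
qed

text \<open>The point mass at 0 is dominated by \<open>p\<close> divided by \<open>pmf p 0\<close>,
  and stationarity preserves this domination through every transition.\<close>

lemma nn_integral_hd_chain_le:
  "(\<integral>\<^sup>+l. F (hd l) \<partial>chain n) \<le> ennreal (1 / pmf p 0) * (\<integral>\<^sup>+u. F u \<partial>p)"
proof (induction n arbitrary: F)
  case 0
  have "F 0 = ennreal (1 / pmf p 0) * (\<integral>\<^sup>+u. F 0 * indicator {0} u \<partial>p)"
    using p_pos[of 0]
    by (simp add: nn_integral_cmult_indicator emeasure_pmf_single mult.assoc[symmetric] mult.commute[of _ "F 0"])
       (simp add: mult.assoc ennreal_mult[symmetric])
  also have "\<dots> \<le> ennreal (1 / pmf p 0) * (\<integral>\<^sup>+u. F u \<partial>p)"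
    by (intro mult_left_mono nn_integral_mono) (auto simp: indicator_def)
  finally show ?case by simp
next
  case (Suc n)
  have "(\<integral>\<^sup>+l. F (hd l) \<partial>chain (Suc n)) = (\<integral>\<^sup>+l. (\<integral>\<^sup>+v. F v \<partial>K (hd l)) \<partial>chain n)"
    by simp
  also have "\<dots> \<le> ennreal (1 / pmf p 0) * (\<integral>\<^sup>+u. (\<integral>\<^sup>+v. F v \<partial>K u) \<partial>p)"
    by (rule Suc.IH)
  also have "(\<integral>\<^sup>+u. (\<integral>\<^sup>+v. F v \<partial>K u) \<partial>p) = (\<integral>\<^sup>+u. F u \<partial>p)"
    by (subst nn_integral_bind_pmf[symmetric]) (simp only: stationary)
  finally show ?case .
qed

lemma nn_integral_pair: "(\<integral>\<^sup>+z. F z \<partial>pair) = (\<integral>\<^sup>+u. \<integral>\<^sup>+v. F (u, v) \<partial>K u \<partial>p)"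
  by (simp add: pair_def)

lemma nn_integral_psum_le:
  assumes g: "\<And>z. 0 \<le> g z"
  shows "(\<integral>\<^sup>+l. ennreal (psum g l) \<partial>chain n) \<le> ennreal (real n / pmf p 0) * (\<integral>\<^sup>+z. ennreal (g z) \<partial>pair)"
proof (induction n)
  case (Suc n)
  have "(\<integral>\<^sup>+l. ennreal (psum g l) \<partial>chain (Suc n)) =
        (\<integral>\<^sup>+l. \<integral>\<^sup>+v. ennreal (psum g (v # l)) \<partial>K (hd l) \<partial>chain n)"
    by simp
  also have "\<dots> = (\<integral>\<^sup>+l. (\<integral>\<^sup>+v. ennreal (g (hd l, v)) \<partial>K (hd l)) + ennreal (psum g l) \<partial>chain n)"
  proof (intro nn_integral_cong_AE AE_pmfI)
    fix l assume "l \<in> set_pmf (chain n)"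
    then have "l \<noteq> []" using chain_length by fastforce
    then have "(\<integral>\<^sup>+v. ennreal (psum g (v # l)) \<partial>K (hd l)) = (\<integral>\<^sup>+v. ennreal (g (hd l, v)) + ennreal (psum g l) \<partial>K (hd l))"
      using g by (simp add: psum_Cons psum_nonneg)
    then show "(\<integral>\<^sup>+v. ennreal (psum g (v # l)) \<partial>K (hd l)) = (\<integral>\<^sup>+v. ennreal (g (hd l, v)) \<partial>K (hd l)) + ennreal (psum g l)"
      by (simp add: nn_integral_add)
  qed
  also have "\<dots> = (\<integral>\<^sup>+l. (\<integral>\<^sup>+v. ennreal (g (hd l, v)) \<partial>K (hd l)) \<partial>chain n) + (\<integral>\<^sup>+l. ennreal (psum g l) \<partial>chain n)"
    by (rule nn_integral_add) auto
  also have "\<dots> \<le> ennreal (1 / pmf p 0) * (\<integral>\<^sup>+z. ennreal (g z) \<partial>pair) + ennreal (real n / pmf p 0) * (\<integral>\<^sup>+z. ennreal (g z) \<partial>pair)"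
    unfolding nn_integral_pair
    by (intro add_mono nn_integral_hd_chain_le[where F = "\<lambda>u. \<integral>\<^sup>+v. ennreal (g (u, v)) \<partial>K u"] Suc.IH[unfolded nn_integral_pair])
  also have "\<dots> = ennreal (real (Suc n) / pmf p 0) * (\<integral>\<^sup>+z. ennreal (g z) \<partial>pair)"
    using p_pos[of 0] by (simp add: distrib_right[symmetric] add_divide_distrib ennreal_plus[symmetric] del: ennreal_plus)
  finally show ?case .
qed simp

lemma
  assumes g: "\<And>z. 0 \<le> g z" and int: "integrable pair g"
  shows integrable_psum_nonneg: "integrable (chain n) (psum g)"
    and expectation_psum_le: "(\<integral>l. psum g l \<partial>chain n) \<le> real n / pmf p 0 * (\<integral>z. g z \<partial>pair)"
proof -
  have le: "(\<integral>\<^sup>+l. ennreal (psum g l) \<partial>chain n) \<le> ennreal (real n / pmf p 0 * (\<integral>z. g z \<partial>pair))"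
  proof -
    have "(\<integral>\<^sup>+z. ennreal (g z) \<partial>pair) = ennreal (\<integral>z. g z \<partial>pair)"
      using g by (intro nn_integral_eq_integral int) auto
    moreover have "0 \<le> (\<integral>z. g z \<partial>pair)" using g by simp
    ultimately show ?thesis
      using nn_integral_psum_le[of g n, OF g] p_pos[of 0] by (simp add: ennreal_mult[symmetric])
  qed
  then show *: "integrable (chain n) (psum g)"
    using g by (simp add: integrable_iff_bounded psum_nonneg le_less_trans[OF _ ennreal_less_top])
  have "ennreal (\<integral>l. psum g l \<partial>chain n) \<le> ennreal (real n / pmf p 0 * (\<integral>z. g z \<partial>pair))"
    using le g by (subst nn_integral_eq_integral[symmetric]) (auto simp: * psum_nonneg)
  moreover have "0 \<le> real n / pmf p 0 * (\<integral>z. g z \<partial>pair)"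
    using g by (intro mult_nonneg_nonneg) (auto simp: integral_nonneg_AE)
  ultimately show "(\<integral>l. psum g l \<partial>chain n) \<le> real n / pmf p 0 * (\<integral>z. g z \<partial>pair)"
    by (simp add: ennreal_le_iff)
qed

lemma integrable_psum:
  assumes "integrable pair g" shows "integrable (chain n) (psum g)"
  using integrable_psum_nonneg[of "\<lambda>z. \<bar>g z\<bar>" n] assms
  by (rule_tac Bochner_Integration.integrable_bound[where f = "psum (\<lambda>z. \<bar>g z\<bar>)"])
     (auto intro: order_trans[OF psum_abs abs_ge_self])

text \<open>Conditionally on the past the new difference has mean zero, so the cross term of the
  square vanishes.\<close>

lemma expectation_martingale_sq_le:
  assumes bound: "\<And>z. \<bar>d z\<bar> \<le> B" and mean: "\<And>u. (\<integral>v. d (u, v) \<partial>K u) = 0"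
  shows "(\<integral>l. (psum d l)\<^sup>2 \<partial>chain n) \<le> real n * B\<^sup>2"
proof (induction n)
  case (Suc n)
  have B: "0 \<le> B" using bound[of "(0, 0)"] by linarith
  have sb: "\<bar>psum d l\<bar> \<le> real m * B" if "l \<in> set_pmf (chain m)" for l m
    using psum_abs_bound[of d B l, OF bound] chain_length[OF that] by simp
  have sq: "(psum d l)\<^sup>2 \<le> (real m * B)\<^sup>2" if "l \<in> set_pmf (chain m)" for l m
    using sb[OF that] by (metis abs_ge_zero power2_abs power_mono)
  have int: "integrable (chain m) (\<lambda>l. (psum d l)\<^sup>2)" for m
    by (rule integrable_pmf_bounded[where B = "(real m * B)\<^sup>2"]) (use sq in simp)
  have "(\<integral>l. (psum d l)\<^sup>2 \<partial>chain (Suc n)) = (\<integral>l. (\<integral>v. (psum d (v # l))\<^sup>2 \<partial>K (hd l)) \<partial>chain n)"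
    using int[of "Suc n"] by (simp add: integral_bind_pmf)
  also have "\<dots> \<le> (\<integral>l. B\<^sup>2 + (psum d l)\<^sup>2 \<partial>chain n)"
  proof (rule integral_mono_AE)
    show "integrable (chain n) (\<lambda>l. \<integral>v. (psum d (v # l))\<^sup>2 \<partial>K (hd l))"
      using integrable_bind_pmf_outer[OF int[of "Suc n", unfolded chain.simps]] by simp
    show "integrable (chain n) (\<lambda>l. B\<^sup>2 + (psum d l)\<^sup>2)" using int by simp
    show "AE l in chain n. (\<integral>v. (psum d (v # l))\<^sup>2 \<partial>K (hd l)) \<le> B\<^sup>2 + (psum d l)\<^sup>2"
    proof (rule AE_pmfI)
      fix l assume l: "l \<in> set_pmf (chain n)"
      then have "l \<noteq> []" using chain_length by fastforce
      define s u where "s = psum d l" and "u = hd l"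
      have i1: "integrable (K u) (\<lambda>v. d (u, v))"
        using bound by (intro integrable_pmf_bounded[where B = B]) auto
      have dsq: "(d z)\<^sup>2 \<le> B\<^sup>2" for z
        using bound[of z] by (metis abs_ge_zero power2_abs power_mono)
      have i2: "integrable (K u) (\<lambda>v. (d (u, v))\<^sup>2)"
        using dsq by (intro integrable_pmf_bounded[where B = "B\<^sup>2"]) auto
      have "(\<integral>v. (psum d (v # l))\<^sup>2 \<partial>K (hd l)) = (\<integral>v. (d (u, v))\<^sup>2 + 2 * s * d (u, v) + s\<^sup>2 \<partial>K u)"
        using \<open>l \<noteq> []\<close> by (simp add: psum_Cons s_def u_def power2_sum algebra_simps)
      also have "\<dots> = (\<integral>v. (d (u, v))\<^sup>2 \<partial>K u) + s\<^sup>2"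
        using i1 i2 by (simp add: mean)
      also have "(\<integral>v. (d (u, v))\<^sup>2 \<partial>K u) \<le> (\<integral>v. B\<^sup>2 \<partial>K u)"
        using dsq i2 by (intro integral_mono) auto
      finally show "(\<integral>v. (psum d (v # l))\<^sup>2 \<partial>K (hd l)) \<le> B\<^sup>2 + (psum d l)\<^sup>2"
        by (simp add: s_def)
    qed
  qed
  also have "\<dots> = B\<^sup>2 + (\<integral>l. (psum d l)\<^sup>2 \<partial>chain n)"
    using int by simp
  also have "\<dots> \<le> B\<^sup>2 + real n * B\<^sup>2" using Suc.IH by simp
  finally show ?case by (simp add: algebra_simps)
qed simp

lemma expectation_pair:
  fixes g :: "nat \<times> nat \<Rightarrow> real"
  assumes "integrable pair g"
  shows "(\<integral>z. g z \<partial>pair) = (\<integral>u. (\<integral>v. g (u, v) \<partial>K u) \<partial>p)"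
  using integral_bind_pmf[OF assms[unfolded pair_def]] by (simp add: pair_def)

text \<open>Up to a small error \<open>P ^^ N\<close>, the centred \<open>g\<close> is a martingale difference plus a
  coboundary (Poisson equation).\<close>

lemma chain_LLN_bounded:
  assumes g: "\<And>z. \<bar>g z\<bar> \<le> 1"
  shows "(\<lambda>n. \<integral>l. \<bar>psum g l / real n - (\<integral>z. g z \<partial>pair)\<bar> \<partial>chain n) \<longlonglongrightarrow> 0"
proof (rule LIMSEQ_I)
  fix e :: real assume "0 < e"
  define m where "m = (\<integral>z. g z \<partial>pair)"
  define kg where "kg u = (\<integral>v. g (u, v) \<partial>K u)" for u
  have ig: "integrable pair g" using g by (intro integrable_pmf_bounded[where B = 1]) auto
  have "\<bar>m\<bar> \<le> (\<integral>z. \<bar>g z\<bar> \<partial>pair)" unfolding m_def by (rule integral_abs_bound)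
  also have "\<dots> \<le> (\<integral>z. 1 \<partial>pair)" using g ig by (intro integral_mono) auto
  finally have m1: "\<bar>m\<bar> \<le> 1" by simp
  have kg1: "\<bar>kg u\<bar> \<le> 1" for u
    unfolding kg_def using P_abs_bound[of "\<lambda>v. g (u, v)" 1 u] g by (simp add: P_def)
  define h where "h u = kg u - m" for u
  have h2: "\<bar>h u\<bar> \<le> 2" for u using m1 kg1[of u] by (simp add: h_def abs_le_iff)
  have h0: "(\<integral>u. h u \<partial>p) = 0"
  proof -
    have "(\<integral>u. h u \<partial>p) = (\<integral>u. kg u \<partial>p) - m"
      unfolding h_def using kg1 by (subst Bochner_Integration.integral_diff) (auto intro!: integrable_pmf_bounded[where B = 1])
    also have "(\<integral>u. kg u \<partial>p) = m" unfolding m_def kg_def by (rule expectation_pair[OF ig, symmetric])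
    finally show ?thesis by simp
  qed
  \<comment> \<open>\<open>P_pow_L1_tendsto_0\<close> is normalised to functions bounded by 1,
    whereas \<open>h\<close> is bounded by 2.\<close>
  have half: "(P ^^ k) (\<lambda>u. h u / 2) = (\<lambda>u. (P ^^ k) h u / 2)" for k
  proof (induction k)
    case (Suc k)
    have "P (\<lambda>u. f u / 2) = (\<lambda>u. P f u / 2)" for f
      by (simp add: P_def fun_eq_iff)
    with Suc.IH show ?case by simp
  qed simp
  have "(\<lambda>k. \<integral>u. \<bar>(P ^^ k) (\<lambda>u. h u / 2) u\<bar> \<partial>p) \<longlonglongrightarrow> 0"
    using h2 h0 by (intro P_pow_L1_tendsto_0) (auto simp: abs_le_iff)
  \<comment> \<open>Undoing the factor 1/2 gives e / 4 times \<open>pmf p 0\<close>; the division by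
    \<open>pmf p 0\<close> in \<open>expectation_psum_le\<close> then leaves e / 4.\<close>
  from LIMSEQ_D[OF this, of "e * pmf p 0 / 8"] \<open>0 < e\<close> p_pos[of 0]
  obtain N where "\<bar>\<integral>u. \<bar>(P ^^ N) (\<lambda>u. h u / 2) u\<bar> \<partial>p\<bar> < e * pmf p 0 / 8" by auto
  then have N: "(\<integral>u. \<bar>(P ^^ N) h u\<bar> \<partial>p) < e * pmf p 0 / 4" by (simp add: half)
  define r where "r = (P ^^ N) h"
  have r2: "\<bar>r u\<bar> \<le> 2" for u unfolding r_def using h2 by (rule P_pow_abs_bound)
  define f where "f u = (\<Sum>k<N. (P ^^ k) h u)" for u
  define F where "F = 2 * real N"
  have fF: "\<bar>f u\<bar> \<le> F" for u
  proof -
    have "\<bar>f u\<bar> \<le> (\<Sum>k<N. \<bar>(P ^^ k) h u\<bar>)" unfolding f_def by (rule sum_abs)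
    also have "\<dots> \<le> (\<Sum>k<N. 2)" using h2 by (intro sum_mono P_pow_abs_bound) auto
    finally show ?thesis by (simp add: F_def)
  qed
  have PfF: "\<bar>P f u\<bar> \<le> F" for u using fF by (rule P_abs_bound)
  \<comment> \<open>The truncated potential \<open>f\<close> telescopes: it solves the Poisson
    equation for \<open>h\<close> up to the remainder \<open>r\<close>.\<close>
  have Pf: "P f u = f u - h u + r u" for u
  proof -
    have "P f u = (\<integral>v. (\<Sum>k<N. (P ^^ k) h v) \<partial>K u)"
      by (simp add: P_def f_def)
    also have "\<dots> = (\<Sum>k<N. (\<integral>v. (P ^^ k) h v \<partial>K u))"
      by (rule Bochner_Integration.integral_sum, rule integrable_pmf_bounded[where B = 2])
         (use h2 in \<open>simp add: P_pow_abs_bound\<close>)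
    also have "\<dots> = (\<Sum>k<N. (P ^^ Suc k) h u)"
      by (simp add: P_def)
    also have "\<dots> = f u - h u + r u"
      using sum.lessThan_Suc_shift[of "\<lambda>k. (P ^^ k) h u" N] by (simp add: f_def r_def)
    finally show ?thesis .
  qed
  define d where "d = (\<lambda>(u, v). g (u, v) - kg u + f v - P f u)"
  define D where "D = 2 + 2 * F"
  have dD: "\<bar>d z\<bar> \<le> D" for z
    using g[of z] kg1[of "fst z"] fF[of "snd z"] PfF[of "fst z"]
    by (auto simp: d_def D_def split_beta abs_le_iff)
  have d0: "(\<integral>v. d (u, v) \<partial>K u) = 0" for u
  proof -
    have "integrable (K u) (\<lambda>v. g (u, v))" "integrable (K u) f"
      by (rule integrable_pmf_bounded[where B = 1], use g in simp)
         (rule integrable_pmf_bounded[where B = F], use fF in simp)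
    then show ?thesis by (simp add: d_def kg_def P_def)
  qed
  have dec: "psum g l - real n * m = psum d l + (f 0 - f (hd l)) + psum (\<lambda>(u, v). r u) l" if "l \<in> set_pmf (chain n)" for l n
  proof -
    have l: "l \<noteq> []" "last l = 0" using chain_length[OF that] chain_last[OF that] by auto
    have "psum g l - real n * m = psum (\<lambda>z. g z - m) l"
      by (simp add: psum_diff psum_const chain_length[OF that])
    also have "(\<lambda>z. g z - m) = (\<lambda>z. d z + (case z of (u, v) \<Rightarrow> f u - f v) + (case z of (u, v) \<Rightarrow> r u))"
      by (auto simp: d_def fun_eq_iff Pf h_def)
    also have "psum \<dots> l = psum d l + (f 0 - f (hd l)) + psum (\<lambda>(u, v). r u) l"
      by (simp only: psum_add psum_telescope[OF l(1)] l(2))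
    finally show ?thesis by simp
  qed
  have ir: "integrable pair (\<lambda>(u, v). \<bar>r u\<bar>)"
    using r2 by (intro integrable_pmf_bounded[where B = 2]) (auto simp: split_beta)
  have er: "(\<integral>z. (case z of (u, v) \<Rightarrow> \<bar>r u\<bar>) \<partial>pair) < e * pmf p 0 / 4"
    using N expectation_pair[OF ir] by (simp add: r_def)
  have main: "(\<integral>l. \<bar>psum g l / real n - m\<bar> \<partial>chain n) \<le> D / sqrt (real n) * 1 + 2 * F / real n + e / 4" if "n > 0" for n
  proof -
    have sb: "\<bar>psum d l\<bar> \<le> real n * D" if "l \<in> set_pmf (chain n)" for l
      using psum_abs_bound[of d D l, OF dD] chain_length[OF that] by simp
    have i1: "integrable (chain n) (\<lambda>l. \<bar>psum d l\<bar>)"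
      by (rule integrable_pmf_bounded[where B = "real n * D"]) (use sb in simp)
    have sq: "(psum d l)\<^sup>2 \<le> (real n * D)\<^sup>2" if "l \<in> set_pmf (chain n)" for l
      using sb[OF that] by (metis abs_ge_zero power2_abs power_mono)
    have i2: "integrable (chain n) (\<lambda>l. (psum d l)\<^sup>2)"
      by (rule integrable_pmf_bounded[where B = "(real n * D)\<^sup>2"]) (use sq in simp)
    have "0 \<le> F" by (simp add: F_def)
    then have "0 < D" by (simp add: D_def)
    have "(\<integral>l. \<bar>psum d l\<bar> \<partial>chain n)\<^sup>2 \<le> (\<integral>l. \<bar>psum d l\<bar>\<^sup>2 \<partial>chain n)"
      using measure_pmf.variance_positive[of "chain n" "\<lambda>l. \<bar>psum d l\<bar>"] measure_pmf.variance_eq[of "chain n" "\<lambda>l. \<bar>psum d l\<bar>"] i1 i2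
      by simp
    also have "\<dots> \<le> real n * D\<^sup>2"
      using expectation_martingale_sq_le[of d D n, OF dD d0] by simp
    finally have "(\<integral>l. \<bar>psum d l\<bar> \<partial>chain n) \<le> sqrt (real n * D\<^sup>2)"
      by (rule real_le_rsqrt)
    then have e1: "(\<integral>l. \<bar>psum d l\<bar> \<partial>chain n) \<le> sqrt (real n) * D"
      using \<open>0 < D\<close> by (simp add: real_sqrt_mult)
    have i3: "integrable (chain n) (psum (\<lambda>(u, v). \<bar>r u\<bar>))"
      by (rule integrable_psum_nonneg[OF _ ir]) auto
    have e3: "(\<integral>l. psum (\<lambda>(u, v). \<bar>r u\<bar>) l \<partial>chain n) \<le> real n * (e / 4)"
    proof -
      have "(\<integral>l. psum (\<lambda>(u, v). \<bar>r u\<bar>) l \<partial>chain n) \<le> real n / pmf p 0 * (\<integral>z. (case z of (u, v) \<Rightarrow> \<bar>r u\<bar>) \<partial>pair)"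
        by (rule expectation_psum_le[OF _ ir]) auto
      also have "\<dots> \<le> real n / pmf p 0 * (e * pmf p 0 / 4)"
        using er by (intro mult_left_mono) auto
      finally show ?thesis using p_pos[of 0] by simp
    qed
    have "(\<integral>l. \<bar>psum g l / real n - m\<bar> \<partial>chain n) \<le> (\<integral>l. (\<bar>psum d l\<bar> + 2 * F + psum (\<lambda>(u, v). \<bar>r u\<bar>) l) / real n \<partial>chain n)"
    proof (rule integral_mono_AE)
      show "integrable (chain n) (\<lambda>l. \<bar>psum g l / real n - m\<bar>)"
        using integrable_psum[OF ig] by simp
      show "integrable (chain n) (\<lambda>l. (\<bar>psum d l\<bar> + 2 * F + psum (\<lambda>(u, v). \<bar>r u\<bar>) l) / real n)"
        using i1 i3 by simp
      show "AE l in chain n. \<bar>psum g l / real n - m\<bar> \<le> (\<bar>psum d l\<bar> + 2 * F + psum (\<lambda>(u, v). \<bar>r u\<bar>) l) / real n"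
      proof (rule AE_pmfI)
        fix l assume l: "l \<in> set_pmf (chain n)"
        have "\<bar>psum g l / real n - m\<bar> = \<bar>psum g l - real n * m\<bar> / real n"
        proof -
          have "psum g l / real n - m = (psum g l - real n * m) / real n"
            using that by (simp add: diff_divide_distrib)
          then show ?thesis by (simp only: abs_divide abs_of_nat)
        qed
        also have "\<dots> \<le> (\<bar>psum d l\<bar> + 2 * F + psum (\<lambda>(u, v). \<bar>r u\<bar>) l) / real n"
        proof (rule divide_right_mono)
          have "\<bar>psum (\<lambda>(u, v). r u) l\<bar> \<le> psum (\<lambda>(u, v). \<bar>r u\<bar>) l"
          proof -
            have eq: "(\<lambda>z. \<bar>case z of (u, v) \<Rightarrow> r u\<bar>) = (\<lambda>(u, v). \<bar>r u\<bar>)" by auto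
            show ?thesis using psum_abs[of "\<lambda>(u, v). r u" l] unfolding eq .
          qed
          then show "\<bar>psum g l - real n * m\<bar> \<le> \<bar>psum d l\<bar> + 2 * F + psum (\<lambda>(u, v). \<bar>r u\<bar>) l"
            using fF[of 0] fF[of "hd l"] unfolding dec[OF l] by (simp add: abs_le_iff) linarith
        qed simp
        finally show "\<bar>psum g l / real n - m\<bar> \<le> (\<bar>psum d l\<bar> + 2 * F + psum (\<lambda>(u, v). \<bar>r u\<bar>) l) / real n" .
      qed
    qed
    also have "\<dots> = ((\<integral>l. \<bar>psum d l\<bar> \<partial>chain n) + 2 * F + (\<integral>l. psum (\<lambda>(u, v). \<bar>r u\<bar>) l \<partial>chain n)) / real n"
      using i1 i3 by simp
    also have "\<dots> \<le> (sqrt (real n) * D + 2 * F + real n * (e / 4)) / real n"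
      using e1 e3 by (intro divide_right_mono) auto
    also have "\<dots> = D / sqrt (real n) * 1 + 2 * F / real n + e / 4"
    proof -
      have "sqrt (real n) * D / real n = D / sqrt (real n)"
        using that by (simp add: field_simps)
      then show ?thesis using that by (simp add: add_divide_distrib)
    qed
    finally show ?thesis .
  qed
  have "(\<lambda>n. D / sqrt (real n) * 1 + 2 * F / real n + e / 4) \<longlonglongrightarrow> 0 * 1 + 0 + e / 4"
  proof (intro tendsto_add tendsto_mult tendsto_const)
    show "(\<lambda>n. D / sqrt (real n)) \<longlonglongrightarrow> 0"
      by (intro real_tendsto_divide_at_top[OF tendsto_const] filterlim_compose[OF sqrt_at_top filterlim_real_sequentially])
    show "(\<lambda>n. 2 * F / real n) \<longlonglongrightarrow> 0"
      by (rule lim_const_over_n)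
  qed
  then have "\<forall>\<^sub>F n in sequentially. D / sqrt (real n) * 1 + 2 * F / real n + e / 4 < e"
    by (rule order_tendstoD(2)) (use \<open>0 < e\<close> in simp)
  moreover have "\<forall>\<^sub>F n in sequentially. n > 0" by (rule eventually_gt_at_top)
  ultimately have "\<forall>\<^sub>F n in sequentially. norm ((\<integral>l. \<bar>psum g l / real n - m\<bar> \<partial>chain n) - 0) < e"
  proof eventually_elim
    case (elim n)
    then show ?case using main[of n] by (simp add: integral_nonneg_AE)
  qed
  then show "\<exists>no. \<forall>n\<ge>no. norm ((\<integral>l. \<bar>psum g l / real n - (\<integral>z. g z \<partial>pair)\<bar> \<partial>chain n) - 0) < e"
    by (simp add: eventually_sequentially m_def)
qed

text \<open>Truncation reduces to bounded functions. The truncation error is small in L1 under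
  \<open>pair\<close>, and \<open>expectation_psum_le\<close> carries this over to the
  chain.\<close>

theorem chain_LLN:
  assumes ig: "integrable pair g"
  shows "(\<lambda>n. \<integral>l. \<bar>psum g l / real n - (\<integral>z. g z \<partial>pair)\<bar> \<partial>chain n) \<longlonglongrightarrow> 0"
proof (rule LIMSEQ_I)
  fix e :: real assume "0 < e"
  define clip where "clip B z = max (- real (Suc B)) (min (real (Suc B)) (g z))" for B z
  have clip_le: "\<bar>clip B z\<bar> \<le> real (Suc B)" for B z by (simp add: clip_def)
  have ic: "integrable pair (clip B)" for B
    by (rule integrable_pmf_bounded[where B = "real (Suc B)"]) (simp add: clip_le del: of_nat_Suc)
  \<comment> \<open>The truncation error is paid twice: along the chain, with factor 1 /
    \<open>pmf p 0\<close>, and in the centring, with factor 1.\<close>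
  define c where "c = 1 / pmf p 0 + 1"
  have "0 < c" unfolding c_def using p_pos[of 0] by (intro add_pos_pos) auto
  have "(\<lambda>B. \<integral>z. \<bar>g z - clip B z\<bar> \<partial>pair) \<longlonglongrightarrow> (\<integral>z. 0 \<partial>pair)"
  proof (rule integral_dominated_convergence[where w = "\<lambda>z. \<bar>g z\<bar>"])
    show "AE z in pair. (\<lambda>B. \<bar>g z - clip B z\<bar>) \<longlonglongrightarrow> 0"
    proof (rule AE_pmfI)
      fix z
      obtain k where "\<bar>g z\<bar> \<le> real k" using real_arch_simple by blast
      then have "\<forall>B\<ge>k. \<bar>g z - clip B z\<bar> = 0" by (auto simp: clip_def)
      then show "(\<lambda>B. \<bar>g z - clip B z\<bar>) \<longlonglongrightarrow> 0"
        by (intro tendsto_eventually) (auto simp: eventually_sequentially)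
    qed
    show "AE z in pair. norm \<bar>g z - clip B z\<bar> \<le> \<bar>g z\<bar>" for B
      by (auto simp: clip_def)
  qed (use ig in auto)
  then have "(\<lambda>B. \<integral>z. \<bar>g z - clip B z\<bar> \<partial>pair) \<longlonglongrightarrow> 0" by simp
  from LIMSEQ_D[OF this, of "e / (2 * c)"] \<open>0 < e\<close> \<open>0 < c\<close>
  obtain B where B: "(\<integral>z. \<bar>g z - clip B z\<bar> \<partial>pair) < e / (2 * c)"
    by (auto simp: integral_nonneg_AE)
  define b where "b = real (Suc B)"
  have "0 < b" by (simp add: b_def)
  define r where "r = (\<integral>z. \<bar>g z - clip B z\<bar> \<partial>pair)"
  have ir: "integrable pair (\<lambda>z. \<bar>g z - clip B z\<bar>)" using ig ic[of B] by simp
  have "(\<lambda>n. \<integral>l. \<bar>psum (\<lambda>z. clip B z / b) l / real n - (\<integral>z. clip B z / b \<partial>pair)\<bar> \<partial>chain n) \<longlonglongrightarrow> 0"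
    by (rule chain_LLN_bounded) (use clip_le[of B] \<open>0 < b\<close> in \<open>simp add: b_def del: of_nat_Suc\<close>)
  from LIMSEQ_D[OF this, of "e / (2 * b)"] \<open>0 < e\<close> \<open>0 < b\<close>
  obtain n0 where n0: "\<And>n. n \<ge> n0 \<Longrightarrow> (\<integral>l. \<bar>psum (\<lambda>z. clip B z / b) l / real n - (\<integral>z. clip B z / b \<partial>pair)\<bar> \<partial>chain n) < e / (2 * b)"
    by (auto simp: integral_nonneg_AE)
  have "norm ((\<integral>l. \<bar>psum g l / real n - (\<integral>z. g z \<partial>pair)\<bar> \<partial>chain n) - 0) < e" if "n \<ge> max n0 1" for n
  proof -
    have "n > 0" using that by simp
    let ?A = "\<lambda>l. \<bar>psum (\<lambda>z. clip B z / b) l / real n - (\<integral>z. clip B z / b \<partial>pair)\<bar>"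
    have iA: "integrable (chain n) ?A"
      using integrable_psum[of "\<lambda>z. clip B z / b" n] ic[of B] by simp
    have iR: "integrable (chain n) (psum (\<lambda>z. \<bar>g z - clip B z\<bar>))"
      by (rule integrable_psum[OF ir])
    have "(\<integral>l. \<bar>psum g l / real n - (\<integral>z. g z \<partial>pair)\<bar> \<partial>chain n) \<le>
          (\<integral>l. b * ?A l + psum (\<lambda>z. \<bar>g z - clip B z\<bar>) l / real n + r \<partial>chain n)"
    proof (rule integral_mono)
      show "integrable (chain n) (\<lambda>l. \<bar>psum g l / real n - (\<integral>z. g z \<partial>pair)\<bar>)"
        using integrable_psum[OF ig, of n] by simp
      show "integrable (chain n) (\<lambda>l. b * ?A l + psum (\<lambda>z. \<bar>g z - clip B z\<bar>) l / real n + r)"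
        using iA iR by (intro Bochner_Integration.integrable_add integrable_mult_right integrable_divide) auto
      fix l
      have 1: "b * ?A l = \<bar>psum (clip B) l / real n - (\<integral>z. clip B z \<partial>pair)\<bar>"
      proof -
        have "psum (\<lambda>z. clip B z / b) l = psum (clip B) l / b"
          using psum_cmult[of "1 / b" "clip B" l] by simp
        then have "b * ?A l = \<bar>b * (psum (clip B) l / b / real n - (\<integral>z. clip B z \<partial>pair) / b)\<bar>"
          using \<open>0 < b\<close> by (simp add: abs_mult)
        also have "b * (psum (clip B) l / b / real n - (\<integral>z. clip B z \<partial>pair) / b) = psum (clip B) l / real n - (\<integral>z. clip B z \<partial>pair)"
          using \<open>0 < b\<close> by (simp add: right_diff_distrib)
        finally show ?thesis .
      qed
      have 2: "\<bar>psum g l / real n - psum (clip B) l / real n\<bar> \<le> psum (\<lambda>z. \<bar>g z - clip B z\<bar>) l / real n"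
        using divide_right_mono[OF psum_abs[of "\<lambda>z. g z - clip B z" l], of "real n"]
        by (simp add: psum_diff diff_divide_distrib[symmetric] del: abs_divide) (simp add: abs_divide)
      have 3: "\<bar>(\<integral>z. g z \<partial>pair) - (\<integral>z. clip B z \<partial>pair)\<bar> \<le> r"
        unfolding r_def using ig ic[of B] integral_abs_bound[of pair "\<lambda>z. g z - clip B z"] by simp
      show "\<bar>psum g l / real n - (\<integral>z. g z \<partial>pair)\<bar> \<le> b * ?A l + psum (\<lambda>z. \<bar>g z - clip B z\<bar>) l / real n + r"
        unfolding 1 using 2 3 by linarith
    qed
    also have "\<dots> = b * (\<integral>l. ?A l \<partial>chain n) + (\<integral>l. psum (\<lambda>z. \<bar>g z - clip B z\<bar>) l \<partial>chain n) / real n + r"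
      using iA iR by simp
    also have "\<dots> \<le> b * (\<integral>l. ?A l \<partial>chain n) + (real n / pmf p 0 * r) / real n + r"
      unfolding r_def
      by (intro add_mono mult_left_mono divide_right_mono order_refl expectation_psum_le ir) auto
    also have "\<dots> = b * (\<integral>l. ?A l \<partial>chain n) + c * r"
      using \<open>n > 0\<close> by (simp add: c_def field_simps)
    also have "\<dots> < b * (e / (2 * b)) + c * (e / (2 * c))"
      using n0[of n] that B \<open>0 < b\<close> \<open>0 < c\<close> by (intro add_strict_mono mult_strict_left_mono) (auto simp: r_def)
    also have "\<dots> = e" using \<open>0 < b\<close> \<open>0 < c\<close> by simp
    finally show ?thesis by (simp add: integral_nonneg_AE)
  qed
  then show "\<exists>no. \<forall>n\<ge>no. norm ((\<integral>l. \<bar>psum g l / real n - (\<integral>z. g z \<partial>pair)\<bar> \<partial>chain n) - 0) < e"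
    by blast
qed

end

section \<open>A martingale central limit theorem along the chain\<close>

text \<open>One factor of McLeish's product: 1 + i x times its Gaussian correction agrees with exp
  (i x) up to second order, so the error is cubic.\<close>

lemma cmod_iexp_approx:
  fixes x :: real
  assumes "\<bar>x\<bar> \<le> 1"
  shows "cmod (iexp x - (1 + \<i> * x) * exp (- x\<^sup>2 / 2)) \<le> 2 * \<bar>x\<bar> ^ 3"
proof -
  define y where "y = x\<^sup>2 / 2"
  have y: "0 \<le> y" by (simp add: y_def)
  define q where "q = exp (- y) - 1 + y"
  have "0 \<le> q" using exp_ge_add_one_self[of "- y"] by (simp add: q_def)
  moreover have "q \<le> y\<^sup>2"
  proof -
    have "exp (- y) * (1 + y) \<le> exp (- y) * exp y"
      using exp_ge_add_one_self[of y] by (intro mult_left_mono) auto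
    also have "\<dots> = 1" by (simp add: exp_minus)
    also have "1 \<le> (1 - y + y\<^sup>2) * (1 + y)"
      using y by (simp add: algebra_simps power2_eq_square)
    finally have "exp (- y) \<le> 1 - y + y\<^sup>2"
      using y by (simp add: mult_le_cancel_right)
    then show ?thesis by (simp add: q_def)
  qed
  ultimately have "\<bar>q\<bar> \<le> y\<^sup>2" by simp
  have x3: "x\<^sup>2 * x\<^sup>2 \<le> \<bar>x\<bar> ^ 3"
  proof -
    have "x\<^sup>2 * x\<^sup>2 = \<bar>x\<bar> ^ 3 * \<bar>x\<bar>"
      by (simp add: power2_eq_square power3_eq_cube abs_mult[symmetric])
    also have "\<dots> \<le> \<bar>x\<bar> ^ 3 * 1" using assms by (intro mult_left_mono) auto
    finally show ?thesis by simp
  qed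
  have c1: "cmod (1 + \<i> * x) \<le> 2"
    using norm_triangle_ineq[of 1 "\<i> * x"] assms by (simp add: norm_mult)
  \<comment> \<open>Insert exp (- y) = 1 - y + q: the Taylor polynomial of degree 2 cancels and
    leaves its remainder, the product term i x y and the contribution of q.\<close>
  have "iexp x - (1 + \<i> * x) * exp (- y) =
        (iexp x - (\<Sum>k\<le>2. (\<i> * x) ^ k / fact k)) + \<i> * (x ^ 3 / 2) - (1 + \<i> * x) * q"
    by (simp add: numeral_eq_Suc q_def y_def algebra_simps power_mult_distrib)
  also have "cmod \<dots> \<le> cmod (iexp x - (\<Sum>k\<le>2. (\<i> * x) ^ k / fact k)) + cmod (\<i> * (x ^ 3 / 2)) + cmod ((1 + \<i> * x) * q)"
    using norm_triangle_ineq4[of "iexp x - (\<Sum>k\<le>2. (\<i> * x) ^ k / fact k) + \<i> * (x ^ 3 / 2)" "(1 + \<i> * x) * q"]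
      norm_triangle_ineq[of "iexp x - (\<Sum>k\<le>2. (\<i> * x) ^ k / fact k)" "\<i> * (x ^ 3 / 2)"]
    by linarith
  also have "\<dots> \<le> \<bar>x\<bar> ^ 3 / 6 + \<bar>x\<bar> ^ 3 / 2 + 2 * (\<bar>x\<bar> ^ 3 / 4)"
  proof (intro add_mono)
    show "cmod (iexp x - (\<Sum>k\<le>2. (\<i> * x) ^ k / fact k)) \<le> \<bar>x\<bar> ^ 3 / 6"
      using iexp_approx1[of x 2] by (simp add: fact_numeral numeral_eq_Suc)
    show "cmod (\<i> * (x ^ 3 / 2)) \<le> \<bar>x\<bar> ^ 3 / 2"
      by (simp add: norm_mult norm_divide norm_power)
    have "\<bar>q\<bar> \<le> \<bar>x\<bar> ^ 3 / 4"
      using \<open>\<bar>q\<bar> \<le> y\<^sup>2\<close> x3 by (simp add: y_def power2_eq_square)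
    then show "cmod ((1 + \<i> * x) * q) \<le> 2 * (\<bar>x\<bar> ^ 3 / 4)"
      unfolding norm_mult norm_of_real using c1 by (intro mult_mono) auto
  qed
  also have "\<dots> \<le> 2 * \<bar>x\<bar> ^ 3" by simp
  finally show ?thesis by (simp add: y_def)
qed

lemma cmod_1_plus_i_sq: "(cmod (1 + \<i> * complex_of_real x))\<^sup>2 = 1 + x\<^sup>2"
  by (simp add: cmod_power2)

text \<open>Follows from 1 + x^2 \<le> exp (x^2). Errors made at earlier steps are therefore not
  amplified when the factors are multiplied in \<open>tprod_approx\<close>.\<close>

lemma cmod_factor_le_1: "cmod ((1 + \<i> * complex_of_real x) * exp (- x\<^sup>2 / 2)) \<le> 1"
proof (rule power2_le_imp_le)
  have "(cmod ((1 + \<i> * complex_of_real x) * exp (- x\<^sup>2 / 2)))\<^sup>2 = (1 + x\<^sup>2) * exp (- x\<^sup>2)"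
    by (simp add: norm_mult power_mult_distrib cmod_1_plus_i_sq exp_double[symmetric])
  also have "\<dots> \<le> exp (x\<^sup>2) * exp (- x\<^sup>2)"
    using exp_ge_add_one_self[of "x\<^sup>2"] by (intro mult_right_mono) auto
  also have "\<dots> = 1\<^sup>2" by (simp add: exp_minus)
  finally show "(cmod ((1 + \<i> * complex_of_real x) * exp (- x\<^sup>2 / 2)))\<^sup>2 \<le> 1\<^sup>2" .
qed simp

text \<open>McLeish's product, stopped once the accumulated square variation exceeds \<open>M\<close>.\<close>

fun tprod :: "real \<Rightarrow> (nat \<times> nat \<Rightarrow> real) \<Rightarrow> nat list \<Rightarrow> complex" where
  "tprod M X (v # u # l) = tprod M X (u # l) *
     (1 + \<i> * complex_of_real (if psum (\<lambda>z. (X z)\<^sup>2) (u # l) \<le> M then X (u, v) else 0))"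
| "tprod M X _ = 1"

lemma tprod_Cons: "l \<noteq> [] \<Longrightarrow> tprod M X (v # l) = tprod M X l *
     (1 + \<i> * complex_of_real (if psum (\<lambda>z. (X z)\<^sup>2) l \<le> M then X (hd l, v) else 0))"
  by (cases l) auto

text \<open>While the sum of squares V is at most M, each factor costs 1 + x^2 \<le> exp (x^2),
  which multiplies up to exp V. The step that crosses M is still included and adds one factor 1 +
  x^2, hence the 1 + V; afterwards the factors are 1. The bound is linear in V, so its expectation
  asks for second moments only.\<close>

lemma tprod_sq_le:
  assumes "0 \<le> M"
  shows "(cmod (tprod M X l))\<^sup>2 \<le> exp M * (1 + psum (\<lambda>z. (X z)\<^sup>2) l) \<and>
    (psum (\<lambda>z. (X z)\<^sup>2) l \<le> M \<longrightarrow> (cmod (tprod M X l))\<^sup>2 \<le> exp (psum (\<lambda>z. (X z)\<^sup>2) l))"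
proof (induction l rule: induct_list012)
  case (3 v u l)
  let ?V = "\<lambda>l. psum (\<lambda>z. (X z)\<^sup>2) l"
  have V0: "0 \<le> ?V l'" for l' by (rule psum_nonneg) simp
  have IH: "(cmod (tprod M X (u # l)))\<^sup>2 \<le> exp M * (1 + ?V (u # l))"
    "?V (u # l) \<le> M \<Longrightarrow> (cmod (tprod M X (u # l)))\<^sup>2 \<le> exp (?V (u # l))"
    using 3(2) by auto
  define x where "x = X (u, v)"
  have V: "?V (v # u # l) = x\<^sup>2 + ?V (u # l)" by (simp add: x_def)
  show ?case
  proof (cases "?V (u # l) \<le> M")
    case True
    have T: "(cmod (tprod M X (v # u # l)))\<^sup>2 = (cmod (tprod M X (u # l)))\<^sup>2 * (1 + x\<^sup>2)"
      using True by (simp add: norm_mult power_mult_distrib cmod_1_plus_i_sq x_def)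
    have "(cmod (tprod M X (u # l)))\<^sup>2 * (1 + x\<^sup>2) \<le> exp (?V (u # l)) * (1 + x\<^sup>2)"
      using IH(2)[OF True] by (intro mult_right_mono) auto
    also have "\<dots> \<le> exp (?V (u # l)) * exp (x\<^sup>2)"
      using exp_ge_add_one_self[of "x\<^sup>2"] by (intro mult_left_mono) auto
    also have "\<dots> = exp (?V (v # u # l))" unfolding V by (simp add: exp_add)
    finally have a: "(cmod (tprod M X (v # u # l)))\<^sup>2 \<le> exp (?V (v # u # l))" using T by simp
    have "(cmod (tprod M X (u # l)))\<^sup>2 * (1 + x\<^sup>2) \<le> exp M * (1 + x\<^sup>2)"
      using order_trans[OF IH(2)[OF True], of "exp M"] True by (intro mult_right_mono) auto
    also have "\<dots> \<le> exp M * (1 + ?V (v # u # l))"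
      unfolding V using V0[of "u # l"] by (intro mult_left_mono) auto
    finally show ?thesis using T a by simp
  next
    case False
    then have T: "tprod M X (v # u # l) = tprod M X (u # l)" by simp
    have "\<not> ?V (v # u # l) \<le> M" using False unfolding V by (metis add_increasing linorder_le_cases order_trans zero_le_power2 le_add_same_cancel2)
    moreover have "exp M * (1 + ?V (u # l)) \<le> exp M * (1 + ?V (v # u # l))"
      unfolding V by (intro mult_left_mono) auto
    ultimately show ?thesis unfolding T using IH(1) by linarith
  qed
qed (use assms in auto)

text \<open>If M is not crossed and no step exceeds e, the one-step errors 2 |x|^3 are at most 2 e
  x^2 and add up. That the sum of indicators is 0 says that no step exceeds e.\<close>

lemma tprod_approx:
  assumes "0 < e" "e \<le> 1"
    and "psum (\<lambda>z. (X z)\<^sup>2) l \<le> M" and "psum (\<lambda>z. of_bool (\<bar>X z\<bar> > e)) l = 0"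
  shows "cmod (iexp (psum X l) - tprod M X l * exp (- psum (\<lambda>z. (X z)\<^sup>2) l / 2)) \<le> 2 * e * psum (\<lambda>z. (X z)\<^sup>2) l"
  using assms(3,4)
proof (induction l rule: induct_list012)
  case (3 v u l)
  let ?V = "\<lambda>l. psum (\<lambda>z. (X z)\<^sup>2) l"
  define x where "x = X (u, v)"
  have V: "?V (v # u # l) = x\<^sup>2 + ?V (u # l)" by (simp add: x_def)
  have Ble: "0 \<le> psum (\<lambda>z. of_bool (\<bar>X z\<bar> > e)) (u # l)" by (rule psum_nonneg) simp
  with 3(4) have B: "psum (\<lambda>z. of_bool (\<bar>X z\<bar> > e)) (u # l) = 0" and xe: "\<bar>x\<bar> \<le> e"
    by (auto simp: x_def of_bool_def split: if_splits)
  have VM: "?V (u # l) \<le> M" using 3(3) unfolding V by (metis add_increasing linorder_le_cases order_trans zero_le_power2 le_add_same_cancel2)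
  define A C where "A = iexp (psum X (u # l))" and "C = tprod M X (u # l) * exp (- ?V (u # l) / 2)"
  define a c where "a = iexp x" and "c = (1 + \<i> * complex_of_real x) * exp (- x\<^sup>2 / 2)"
  have IH: "cmod (A - C) \<le> 2 * e * ?V (u # l)"
    using 3(2)[OF VM B] by (simp only: A_def C_def)
  have "iexp (psum X (v # u # l)) = a * A"
    by (simp add: a_def A_def x_def exp_add[symmetric] algebra_simps)
  moreover have "tprod M X (v # u # l) * exp (- ?V (v # u # l) / 2) = c * C"
  proof -
    have "exp (- ?V (v # u # l) / 2) = exp (- x\<^sup>2 / 2) * exp (- ?V (u # l) / 2)"
      unfolding V exp_add[symmetric] by (simp add: field_simps)
    then show ?thesis
      using VM by (simp add: c_def C_def x_def)
  qed
  moreover have "cmod (a * A - c * C) \<le> 2 * e * ?V (v # u # l)"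
  proof -
    have "a * A - c * C = (a - c) * A + c * (A - C)" by (simp add: algebra_simps)
    then have "cmod (a * A - c * C) \<le> cmod ((a - c) * A) + cmod (c * (A - C))"
      by (simp add: norm_triangle_ineq)
    also have "\<dots> = cmod (a - c) + cmod c * cmod (A - C)"
      by (simp add: norm_mult A_def)
    also have "\<dots> \<le> 2 * \<bar>x\<bar> ^ 3 + 1 * (2 * e * ?V (u # l))"
    proof (intro add_mono mult_mono)
      show "cmod (a - c) \<le> 2 * \<bar>x\<bar> ^ 3"
        unfolding a_def c_def using xe assms by (intro cmod_iexp_approx) auto
      show "cmod c \<le> 1" unfolding c_def by (rule cmod_factor_le_1)
    qed (use IH in auto)
    also have "\<bar>x\<bar> ^ 3 = \<bar>x\<bar> * x\<^sup>2" by (simp add: power3_eq_cube power2_eq_square)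
    also have "2 * (\<bar>x\<bar> * x\<^sup>2) + 1 * (2 * e * ?V (u # l)) \<le> 2 * (e * x\<^sup>2) + 1 * (2 * e * ?V (u # l))"
      using xe by (intro add_mono mult_left_mono mult_right_mono) auto
    also have "\<dots> = 2 * e * ?V (v # u # l)" unfolding V by (simp add: algebra_simps)
    finally show ?thesis .
  qed
  ultimately show ?case by simp
qed auto

lemma abs_exp_neg_diff_le:
  fixes a b :: real
  assumes "0 \<le> a" "0 \<le> b"
  shows "\<bar>exp (- a) - exp (- b)\<bar> \<le> \<bar>a - b\<bar>"
proof -
  have *: "exp (- a) - exp (- b) \<le> b - a" if "0 \<le> a" "a \<le> b" for a b :: real
  proof -
    have "exp (- a) - exp (- b) = exp (- a) * (1 - exp (a - b))"
      by (simp add: right_diff_distrib exp_add[symmetric])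
    also have "\<dots> \<le> 1 * (b - a)"
    proof (rule mult_mono)
      show "1 - exp (a - b) \<le> b - a"
        using exp_ge_add_one_self[of "a - b"] by linarith
    qed (use that in auto)
    finally show ?thesis by simp
  qed
  show ?thesis
  proof (cases "a \<le> b")
    case True
    then show ?thesis using *[of a b] assms by simp
  next
    case False
    then show ?thesis using *[of b a] assms by simp
  qed
qed

lemma psum_of_bool_cases: "psum (\<lambda>z. of_bool (R z)) l = 0 \<or> 1 \<le> psum (\<lambda>z. of_bool (R z)) l"
proof -
  obtain k where k: "psum (\<lambda>z. of_bool (R z)) l = real k"
  proof
    show "psum (\<lambda>z. of_bool (R z)) l = real (\<Sum>x<length l - 1. of_bool (R (l ! Suc x, l ! x)))"
      unfolding psum_conv_sum by simp
  qed
  show ?thesis unfolding k by (cases k) auto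
qed

text \<open>A deterministic inequality whose right-hand side is linear in V, |V - s| and B, so that
  expectations can be taken term by term. If |V - s| \<le> 1 and no step is large, then V \<le> M
  and \<open>tprod_approx\<close> applies; otherwise |V - s| + B \<ge> 1 serves as an indicator of
  the bad case.\<close>

lemma tprod_main_bound:
  fixes X :: "nat \<times> nat \<Rightarrow> real" and l :: "nat list"
  assumes e: "0 < e" "e \<le> 1" and lam: "0 < lam" and s: "0 \<le> s" and M: "M = s + 1"
  defines "V \<equiv> psum (\<lambda>z. (X z)\<^sup>2) l" and "B \<equiv> psum (\<lambda>z. of_bool (\<bar>X z\<bar> > e)) l"
  shows "cmod (iexp (psum X l) - tprod M X l * exp (- s / 2)) \<le>
     2 * e * M + exp (M / 2) * \<bar>V - s\<bar> + lam * (exp M * (1 + V)) + (1 + 1 / lam) * (\<bar>V - s\<bar> + B)"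
proof -
  have V0: "0 \<le> V" unfolding V_def by (rule psum_nonneg) simp
  have B0: "0 \<le> B" unfolding B_def by (rule psum_nonneg) simp
  have M0: "0 \<le> M" using s M by simp
  note T = tprod_sq_le[OF M0, of X l, folded V_def]
  show ?thesis
  proof (cases "\<bar>V - s\<bar> \<le> 1 \<and> B = 0")
    case True
    then have VM: "V \<le> M" using M by linarith
    have "cmod (tprod M X l) \<le> exp (M / 2)"
    proof (rule power2_le_imp_le)
      have "(cmod (tprod M X l))\<^sup>2 \<le> exp V" using T VM by blast
      also have "\<dots> \<le> exp M" using VM by simp
      also have "\<dots> = (exp (M / 2))\<^sup>2" by (simp add: exp_double[symmetric])
      finally show "(cmod (tprod M X l))\<^sup>2 \<le> (exp (M / 2))\<^sup>2" .
    qed simp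
    have "cmod (iexp (psum X l) - tprod M X l * exp (- s / 2)) \<le>
      cmod (iexp (psum X l) - tprod M X l * exp (- V / 2)) + cmod (tprod M X l * exp (- V / 2) - tprod M X l * exp (- s / 2))"
      using norm_triangle_ineq[of "iexp (psum X l) - tprod M X l * exp (- V / 2)" "tprod M X l * exp (- V / 2) - tprod M X l * exp (- s / 2)"]
      by simp
    also have "\<dots> \<le> 2 * e * V + exp (M / 2) * \<bar>V - s\<bar>"
    proof (rule add_mono)
      show "cmod (iexp (psum X l) - tprod M X l * exp (- V / 2)) \<le> 2 * e * V"
        using tprod_approx[OF e, of X l M] VM True by (simp add: V_def B_def)
      have "cmod (tprod M X l * exp (- V / 2) - tprod M X l * exp (- s / 2)) = cmod (tprod M X l) * \<bar>exp (- (V / 2)) - exp (- (s / 2))\<bar>"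
        by (simp add: right_diff_distrib[symmetric] norm_mult of_real_diff[symmetric] del: of_real_diff)
      also have "\<dots> \<le> exp (M / 2) * \<bar>V - s\<bar>"
      proof (rule mult_mono)
        have "\<bar>exp (- (V / 2)) - exp (- (s / 2))\<bar> \<le> \<bar>V / 2 - s / 2\<bar>"
          using V0 s by (intro abs_exp_neg_diff_le) auto
        then show "\<bar>exp (- (V / 2)) - exp (- (s / 2))\<bar> \<le> \<bar>V - s\<bar>" by linarith
      qed (use \<open>cmod (tprod M X l) \<le> exp (M / 2)\<close> in auto)
      finally show "cmod (tprod M X l * exp (- V / 2) - tprod M X l * exp (- s / 2)) \<le> exp (M / 2) * \<bar>V - s\<bar>" .
    qed
    also have "\<dots> \<le> 2 * e * M + exp (M / 2) * \<bar>V - s\<bar>"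
      using VM e by (intro add_mono mult_left_mono) auto
    also have "\<dots> \<le> 2 * e * M + exp (M / 2) * \<bar>V - s\<bar> + lam * (exp M * (1 + V)) + (1 + 1 / lam) * (\<bar>V - s\<bar> + B)"
      using lam V0 B0 by simp
    finally show ?thesis .
  next
    case False
    then have big: "1 \<le> \<bar>V - s\<bar> + B"
      using psum_of_bool_cases[of "\<lambda>z. \<bar>X z\<bar> > e" l] B0 by (auto simp: B_def[symmetric] not_le)
    define t where "t = cmod (tprod M X l)"
    have t0: "0 \<le> t" by (simp add: t_def)
    have "cmod (iexp (psum X l) - tprod M X l * exp (- s / 2)) \<le> 1 + t * exp (- s / 2)"
      using norm_triangle_ineq4[of "iexp (psum X l)" "tprod M X l * exp (- s / 2)"] by (simp add: norm_mult t_def)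
    also have "\<dots> \<le> 1 + t * 1"
      using t0 s by (intro add_mono mult_left_mono) auto
    \<comment> \<open>The modulus need not be bounded in the bad case. A small multiple of its
      square, whose mean is bounded uniformly in n, is traded against a large multiple of a small
      probability.\<close>
    also have "t \<le> lam * t\<^sup>2 + 1 / lam"
    proof -
      have "0 \<le> (lam * t - 1)\<^sup>2 / lam" using lam by simp
      also have "\<dots> = lam * t\<^sup>2 - 2 * t + 1 / lam"
        using lam by (simp add: power2_eq_square field_simps)
      finally show ?thesis using t0 by simp
    qed
    also have "1 + (lam * t\<^sup>2 + 1 / lam) * 1 \<le> lam * (exp M * (1 + V)) + (1 + 1 / lam) * 1"
      using T lam by (simp add: t_def)
    also have "\<dots> \<le> lam * (exp M * (1 + V)) + (1 + 1 / lam) * (\<bar>V - s\<bar> + B)"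
      using big lam by (intro add_mono mult_left_mono) auto
    also have "\<dots> \<le> 2 * e * M + exp (M / 2) * \<bar>V - s\<bar> + lam * (exp M * (1 + V)) + (1 + 1 / lam) * (\<bar>V - s\<bar> + B)"
      using e M0 by simp
    finally show ?thesis by simp
  qed
qed

context pos_chain
begin

lemma integrable_tprod:
  assumes "0 \<le> M" "integrable pair (\<lambda>z. (X z)\<^sup>2)"
  shows "integrable (chain n) (tprod M X)"
proof (rule Bochner_Integration.integrable_bound)
  show "integrable (chain n) (\<lambda>l. 1 + exp M * (1 + psum (\<lambda>z. (X z)\<^sup>2) l))"
    using integrable_psum[OF assms(2), of n] by simp
  show "AE l in chain n. norm (tprod M X l) \<le> norm (1 + exp M * (1 + psum (\<lambda>z. (X z)\<^sup>2) l))"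
  proof (rule AE_pmfI)
    fix l
    have V0: "0 \<le> psum (\<lambda>z. (X z)\<^sup>2) l" by (rule psum_nonneg) simp
    have "cmod (tprod M X l) \<le> 1 + (cmod (tprod M X l))\<^sup>2"
    proof -
      have "0 \<le> (cmod (tprod M X l) - 1)\<^sup>2" by simp
      then have "2 * cmod (tprod M X l) \<le> 1 + (cmod (tprod M X l))\<^sup>2"
        by (simp add: power2_eq_square algebra_simps)
      then show ?thesis using norm_ge_zero[of "tprod M X l"] by linarith
    qed
    also have "\<dots> \<le> 1 + exp M * (1 + psum (\<lambda>z. (X z)\<^sup>2) l)"
      using tprod_sq_le[OF assms(1), of X l] by simp
    finally show "norm (tprod M X l) \<le> norm (1 + exp M * (1 + psum (\<lambda>z. (X z)\<^sup>2) l))"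
      using V0 by simp
  qed
qed simp

text \<open>The stopping indicator depends on the past alone, so every factor has conditional mean
  1.\<close>

lemma expectation_tprod:
  assumes "0 \<le> M" and sq: "integrable pair (\<lambda>z. (X z)\<^sup>2)"
    and int: "\<And>u. integrable (K u) (\<lambda>v. X (u, v))" and mean: "\<And>u. (\<integral>v. X (u, v) \<partial>K u) = 0"
  shows "(\<integral>l. tprod M X l \<partial>chain n) = 1"
proof (induction n)
  case (Suc n)
  have "(\<integral>l. tprod M X l \<partial>chain (Suc n)) = (\<integral>l. (\<integral>v. tprod M X (v # l) \<partial>K (hd l)) \<partial>chain n)"
    using integrable_tprod[OF assms(1) sq, of "Suc n"] by (simp add: integral_bind_pmf_complex)
  also have "\<dots> = (\<integral>l. tprod M X l \<partial>chain n)"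
  proof (intro integral_cong_AE AE_pmfI)
    fix l assume "l \<in> set_pmf (chain n)"
    then have "l \<noteq> []" using chain_length by fastforce
    define u c where "u = hd l" and "c = (if psum (\<lambda>z. (X z)\<^sup>2) l \<le> M then 1 else 0 :: real)"
    have "(\<integral>v. tprod M X (v # l) \<partial>K (hd l)) = (\<integral>v. tprod M X l + tprod M X l * (\<i> * c) * complex_of_real (X (u, v)) \<partial>K u)"
      using \<open>l \<noteq> []\<close> by (intro Bochner_Integration.integral_cong) (auto simp: tprod_Cons u_def c_def algebra_simps)
    also have "\<dots> = tprod M X l + tprod M X l * (\<i> * c) * complex_of_real (\<integral>v. X (u, v) \<partial>K u)"
      using int[of u] by simp
    finally show "(\<integral>v. tprod M X (v # l) \<partial>K (hd l)) = tprod M X l"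
      by (simp add: mean)
  qed auto
  finally show ?case using Suc.IH by simp
qed simp

text \<open>Because the stopped product has mean exactly 1, the product times exp (- s / 2) has the
  limit as its mean; what remains is the expectation of the bound in
  \<open>tprod_main_bound\<close>.\<close>

theorem chain_CLT:
  assumes sq: "integrable pair (\<lambda>z. (\<xi> z)\<^sup>2)"
    and int: "\<And>u. integrable (K u) (\<lambda>v. \<xi> (u, v))" and mean: "\<And>u. (\<integral>v. \<xi> (u, v) \<partial>K u) = 0"
  shows "(\<lambda>n. CLINT l|chain n. iexp (psum \<xi> l / sqrt (real n))) \<longlonglongrightarrow> complex_of_real (exp (- (\<integral>z. (\<xi> z)\<^sup>2 \<partial>pair) / 2))"
proof (rule LIMSEQ_I)
  fix r :: real assume "0 < r"
  define s where "s = (\<integral>z. (\<xi> z)\<^sup>2 \<partial>pair)"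
  have s: "0 \<le> s" by (simp add: s_def)
  define M where "M = s + 1"
  have M: "0 < M" using s by (simp add: M_def)
  \<comment> \<open>Bounds the mean of exp M (1 + V), as V has mean at most s /
    \<open>pmf p 0\<close>. The choices of \<open>e\<close> and \<open>lam\<close> make the two
    terms that do not vanish with n at most r / 4 each.\<close>
  define E where "E = exp M * (1 + s / pmf p 0)"
  have E: "0 < E" unfolding E_def using s p_pos[of 0] by (intro mult_pos_pos add_pos_nonneg) auto
  define e where "e = min 1 (r / (8 * M))"
  define lam where "lam = r / (4 * E)"
  have e: "0 < e" "e \<le> 1" using \<open>0 < r\<close> M by (auto simp: e_def)
  have eM: "2 * e * M \<le> r / 4"
    using M mult_right_mono[of e "r / (8 * M)" "2 * M"] by (simp add: e_def algebra_simps)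
  have lam: "0 < lam" using \<open>0 < r\<close> E by (simp add: lam_def)
  have lamE: "lam * E = r / 4" using E by (simp add: lam_def)
  define X where "X n z = \<xi> z / sqrt (real n)" for n z
  have Xsq: "(X n z)\<^sup>2 = (\<xi> z)\<^sup>2 / real n" for n z by (simp add: X_def power_divide)
  have iX: "integrable pair (\<lambda>z. (X n z)\<^sup>2)" for n using sq by (simp add: Xsq)
  define V where "V n l = psum (\<lambda>z. (X n z)\<^sup>2) l" for n l
  have V: "V n l = psum (\<lambda>z. (\<xi> z)\<^sup>2) l / real n" for n l
    using psum_cmult[of "1 / real n" "\<lambda>z. (\<xi> z)\<^sup>2" l] by (simp add: V_def Xsq)
  have V0: "0 \<le> V n l" for n l unfolding V_def by (rule psum_nonneg) simp
  define B where "B n l = psum (\<lambda>z. of_bool (\<bar>X n z\<bar> > e)) l" for n l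
  define a where "a n = (\<integral>l. \<bar>V n l - s\<bar> \<partial>chain n)" for n
  define b where "b n = (\<integral>l. B n l \<partial>chain n)" for n
  have a_lim: "a \<longlonglongrightarrow> 0"
    using chain_LLN[OF sq] by (simp add: a_def[abs_def] V s_def)
  have iV: "integrable (chain n) (V n)" for n
    unfolding V_def using integrable_psum[OF iX] .
  have iof: "integrable pair (\<lambda>z. of_bool (\<bar>X n z\<bar> > e) :: real)" for n
    by (rule integrable_pmf_bounded[where B = 1]) simp
  have iB: "integrable (chain n) (B n)" for n
    unfolding B_def by (rule integrable_psum[OF iof])
  \<comment> \<open>Lindeberg's condition: a rescaled step beyond e satisfies 1 \<le> x^2 / e^2, and
    the truncated second moment tends to 0 by dominated convergence.\<close>
  have b_lim: "b \<longlonglongrightarrow> 0"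
  proof (rule Lim_null_comparison)
    define w where "w n = (\<integral>z. (\<xi> z)\<^sup>2 * of_bool (\<bar>X n z\<bar> > e) \<partial>pair)" for n
    have iw: "integrable pair (\<lambda>z. (\<xi> z)\<^sup>2 * of_bool (\<bar>X n z\<bar> > e))" for n
      by (rule Bochner_Integration.integrable_bound[OF sq]) auto
    have "w \<longlonglongrightarrow> (\<integral>z. 0 \<partial>pair)"
      unfolding w_def
    proof (rule integral_dominated_convergence[where w = "\<lambda>z. (\<xi> z)\<^sup>2"])
      show "AE z in pair. (\<lambda>n. (\<xi> z)\<^sup>2 * of_bool (\<bar>X n z\<bar> > e)) \<longlonglongrightarrow> 0"
      proof (rule AE_pmfI)
        fix z
        have "(\<lambda>n. X n z) \<longlonglongrightarrow> 0"
          unfolding X_def by (intro real_tendsto_divide_at_top[OF tendsto_const] filterlim_compose[OF sqrt_at_top filterlim_real_sequentially])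
        then have "(\<lambda>n. \<bar>X n z\<bar>) \<longlonglongrightarrow> 0" by (rule tendsto_rabs_zero)
        from order_tendstoD(2)[OF this e(1)]
        have "\<forall>\<^sub>F n in sequentially. (\<xi> z)\<^sup>2 * of_bool (\<bar>X n z\<bar> > e) = 0"
          by eventually_elim auto
        then show "(\<lambda>n. (\<xi> z)\<^sup>2 * of_bool (\<bar>X n z\<bar> > e)) \<longlonglongrightarrow> 0" by (rule tendsto_eventually)
      qed
    qed (use sq in auto)
    then have "(\<lambda>n. 1 / (pmf p 0 * e\<^sup>2) * w n) \<longlonglongrightarrow> 1 / (pmf p 0 * e\<^sup>2) * 0"
      by (intro tendsto_mult tendsto_const) simp
    then show "(\<lambda>n. 1 / (pmf p 0 * e\<^sup>2) * w n) \<longlonglongrightarrow> 0" by simp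
    have "norm (b n) \<le> 1 / (pmf p 0 * e\<^sup>2) * w n" if "n > 0" for n
    proof -
      have "0 \<le> b n" unfolding b_def B_def by (intro integral_nonneg_AE AE_pmfI psum_nonneg) simp
      have "b n \<le> real n / pmf p 0 * (\<integral>z. of_bool (\<bar>X n z\<bar> > e) \<partial>pair)"
        unfolding b_def B_def by (rule expectation_psum_le[OF _ iof]) simp
      also have "\<dots> = 1 / pmf p 0 * (\<integral>z. real n * of_bool (\<bar>X n z\<bar> > e) \<partial>pair)"
        by simp
      also have "\<dots> \<le> 1 / pmf p 0 * (\<integral>z. (\<xi> z)\<^sup>2 * of_bool (\<bar>X n z\<bar> > e) / e\<^sup>2 \<partial>pair)"
      proof (intro mult_left_mono integral_mono)
        show "integrable pair (\<lambda>z. real n * of_bool (\<bar>X n z\<bar> > e))" using iof by simp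
        show "integrable pair (\<lambda>z. (\<xi> z)\<^sup>2 * of_bool (\<bar>X n z\<bar> > e) / e\<^sup>2)" using iw by simp
        fix z
        show "real n * of_bool (\<bar>X n z\<bar> > e) \<le> (\<xi> z)\<^sup>2 * of_bool (\<bar>X n z\<bar> > e) / e\<^sup>2"
        proof (cases "\<bar>X n z\<bar> > e")
          case True
          then have "e\<^sup>2 \<le> \<bar>X n z\<bar>\<^sup>2" using e by (intro power_mono) auto
          then have "e\<^sup>2 * real n \<le> (\<xi> z)\<^sup>2" using that by (simp add: Xsq field_simps)
          then show ?thesis using True e by (simp add: field_simps)
        qed auto
      qed simp
      also have "\<dots> = 1 / (pmf p 0 * e\<^sup>2) * w n" by (simp add: w_def)
      finally show ?thesis using \<open>0 \<le> b n\<close> by simp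
    qed
    then show "\<forall>\<^sub>F n in sequentially. norm (b n) \<le> 1 / (pmf p 0 * e\<^sup>2) * w n"
      by (rule eventually_mono[OF eventually_gt_at_top])
  qed
  define R where "R n = 2 * e * M + exp (M / 2) * a n + lam * E + (1 + 1 / lam) * (a n + b n)" for n
  have main: "cmod ((CLINT l|chain n. iexp (psum \<xi> l / sqrt (real n))) - complex_of_real (exp (- s / 2))) \<le> R n" if "n > 0" for n
  proof -
    have iT: "integrable (chain n) (tprod M (X n))"
      using M iX by (intro integrable_tprod) auto
    have ii: "integrable (chain n) (\<lambda>l. iexp (psum (X n) l))"
      by (rule integrable_pmf_bounded[where B = 1]) simp
    have ET: "(\<integral>l. tprod M (X n) l \<partial>chain n) = 1"
    proof (rule expectation_tprod)
      show "(\<integral>v. X n (u, v) \<partial>K u) = 0" for u unfolding X_def using mean[of u] by simp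
    qed (use M iX int in \<open>auto simp: X_def\<close>)
    have ps: "psum \<xi> l / sqrt (real n) = psum (X n) l" for l
      using psum_cmult[of "1 / sqrt (real n)" \<xi> l] by (simp add: X_def[abs_def])
    have "(CLINT l|chain n. iexp (psum \<xi> l / sqrt (real n))) - complex_of_real (exp (- s / 2)) =
          (CLINT l|chain n. iexp (psum (X n) l)) - (CLINT l|chain n. tprod M (X n) l * exp (- s / 2))"
      using iT by (simp only: ps) (simp add: ET)
    also have "\<dots> = (CLINT l|chain n. iexp (psum (X n) l) - tprod M (X n) l * exp (- s / 2))"
      using ii iT by (subst Bochner_Integration.integral_diff) auto
    also have "cmod \<dots> \<le> (\<integral>l. cmod (iexp (psum (X n) l) - tprod M (X n) l * exp (- s / 2)) \<partial>chain n)"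
      by (rule integral_norm_bound)
    also have "\<dots> \<le> (\<integral>l. 2 * e * M + exp (M / 2) * \<bar>V n l - s\<bar> + lam * (exp M * (1 + V n l)) + (1 + 1 / lam) * (\<bar>V n l - s\<bar> + B n l) \<partial>chain n)"
    proof (rule integral_mono)
      show "integrable (chain n) (\<lambda>l. cmod (iexp (psum (X n) l) - tprod M (X n) l * exp (- s / 2)))"
        using ii iT by (intro integrable_norm Bochner_Integration.integrable_diff) auto
      show "integrable (chain n) (\<lambda>l. 2 * e * M + exp (M / 2) * \<bar>V n l - s\<bar> + lam * (exp M * (1 + V n l)) + (1 + 1 / lam) * (\<bar>V n l - s\<bar> + B n l))"
        using iV[of n] iB[of n] by simp
      show "cmod (iexp (psum (X n) l) - tprod M (X n) l * exp (- s / 2)) \<le>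
        2 * e * M + exp (M / 2) * \<bar>V n l - s\<bar> + lam * (exp M * (1 + V n l)) + (1 + 1 / lam) * (\<bar>V n l - s\<bar> + B n l)" for l
        unfolding V_def B_def by (rule tprod_main_bound[OF e lam s M_def])
    qed
    also have "\<dots> = 2 * e * M + exp (M / 2) * a n + lam * (exp M * (1 + (\<integral>l. V n l \<partial>chain n))) + (1 + 1 / lam) * (a n + b n)"
      using iV[of n] iB[of n] by (simp add: a_def b_def)
    also have "\<dots> \<le> R n"
    proof -
      have "(\<integral>l. V n l \<partial>chain n) \<le> real n / pmf p 0 * (\<integral>z. (X n z)\<^sup>2 \<partial>pair)"
        unfolding V_def by (rule expectation_psum_le[OF _ iX]) simp
      also have "\<dots> = s / pmf p 0"
        using that by (simp add: Xsq s_def)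
      finally have "exp M * (1 + (\<integral>l. V n l \<partial>chain n)) \<le> E"
        unfolding E_def by (intro mult_left_mono) auto
      then show ?thesis unfolding R_def using lam by (intro add_mono mult_left_mono order_refl) auto
    qed
    finally show ?thesis .
  qed
  have "R \<longlonglongrightarrow> 2 * e * M + exp (M / 2) * 0 + lam * E + (1 + 1 / lam) * (0 + 0)"
    unfolding R_def by (intro tendsto_intros a_lim b_lim)
  moreover have "2 * e * M + exp (M / 2) * 0 + lam * E + (1 + 1 / lam) * (0 + 0) < r"
    using eM lamE \<open>0 < r\<close> by simp
  ultimately have "\<forall>\<^sub>F n in sequentially. R n < r" by (rule order_tendstoD(2))
  then have "\<forall>\<^sub>F n in sequentially. norm ((CLINT l|chain n. iexp (psum \<xi> l / sqrt (real n))) - complex_of_real (exp (- s / 2))) < r"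
    using eventually_gt_at_top[of 0]
  proof eventually_elim
    case (elim n)
    show ?case using main[OF elim(2)] elim(1) by linarith
  qed
  then show "\<exists>no. \<forall>n\<ge>no. norm ((CLINT l|chain n. iexp (psum \<xi> l / sqrt (real n))) - complex_of_real (exp (- (\<integral>z. (\<xi> z)\<^sup>2 \<partial>pair) / 2))) < r"
    by (simp add: eventually_sequentially s_def)
qed

end

section \<open>Walks and left steps\<close>

text \<open>Newest position first, as for \<open>chain\<close>. A list of length n holds the
  positions at the times 0 to n - 1.\<close>

primrec walk :: "environment \<Rightarrow> nat \<Rightarrow> int list pmf" where
  "walk \<omega> 0 = return_pmf []"
| "walk \<omega> (Suc n) = bind_pmf (walk \<omega> n)
     (\<lambda>l. map_pmf (\<lambda>x. x # l) (if l = [] then return_pmf 0 else jump_law \<omega> (hd l)))"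

lemma Ionescu_Tulcea_next_law: "Ionescu_Tulcea (next_law \<omega>) (\<lambda>_. count_space UNIV)"
proof (rule Ionescu_Tulcea.intro)
  fix i :: nat
  show "next_law \<omega> i \<in> PiM {0..<i} (\<lambda>_. count_space UNIV) \<rightarrow>\<^sub>M subprob_algebra (count_space UNIV)"
  proof (cases i)
    case 0
    then show ?thesis
      by (auto simp: next_law_def[abs_def] intro!: measurable_const)
  next
    case (Suc s)
    have "(\<lambda>X. measure_pmf (jump_law \<omega> (X s))) \<in> PiM {0..<i} (\<lambda>_. count_space UNIV) \<rightarrow>\<^sub>M subprob_algebra (count_space UNIV)"
      by (rule measurable_compose[OF _ measurable_measure_pmf[of "jump_law \<omega>"]],
          rule measurable_component_singleton) (simp add: Suc)
    then show ?thesis by (simp add: Suc next_law_def[abs_def])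
  qed
next
  show "prob_space (next_law \<omega> i x)" for i x
    by (simp add: next_law_def measure_pmf.prob_space_axioms)
qed

text \<open>There are countably many lists over a countable type, so one list at a time
  suffices.\<close>

lemma measurable_map_list:
  assumes "set xs \<subseteq> I"
  shows "(\<lambda>X. map X xs) \<in> PiM I (\<lambda>_. count_space (UNIV :: 'a::countable set)) \<rightarrow>\<^sub>M count_space UNIV"
proof (rule measurableI)
  have pred: "Measurable.pred (PiM I (\<lambda>_. count_space (UNIV :: 'a set))) (\<lambda>X. map X xs = ys)" for ys
    using assms
  proof (induction xs arbitrary: ys)
    case (Cons x xs)
    have [measurable]: "(\<lambda>X. X x) \<in> PiM I (\<lambda>_. count_space (UNIV :: 'a set)) \<rightarrow>\<^sub>M count_space UNIV"
      using Cons.prems by (intro measurable_component_singleton) auto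
    show ?case
    proof (cases ys)
      case (Cons y ys')
      have [measurable]: "Measurable.pred (PiM I (\<lambda>_. count_space (UNIV :: 'a set))) (\<lambda>X. map X xs = ys')"
        using Cons.IH Cons.prems \<open>set (x # xs) \<subseteq> I\<close> by simp
      show ?thesis by (simp add: Cons)
    qed simp
  qed auto
  fix A :: "'a list set"
  have "(\<lambda>X. map X xs) -` A \<inter> space (PiM I (\<lambda>_. count_space (UNIV :: 'a set))) =
      (\<Union>ys\<in>A. {X \<in> space (PiM I (\<lambda>_. count_space (UNIV :: 'a set))). map X xs = ys})" by auto
  also have "\<dots> \<in> sets (PiM I (\<lambda>_. count_space (UNIV :: 'a set)))"
    using pred by (intro sets.countable_UN') (auto simp: pred_def)
  finally show "(\<lambda>X. map X xs) -` A \<inter> space (PiM I (\<lambda>_. count_space (UNIV :: 'a set))) \<in> sets (PiM I (\<lambda>_. count_space (UNIV :: 'a set)))" .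
qed auto

abbreviation past :: "nat \<Rightarrow> (nat \<Rightarrow> 'a) \<Rightarrow> 'a list" where
  "past n X \<equiv> map X (rev [0..<n])"

lemma measurable_past [measurable]:
  "past n \<in> path_space \<rightarrow>\<^sub>M count_space UNIV"
  unfolding path_space_def by (rule measurable_map_list) simp

lemma sets_quenched_law [simp, measurable_cong]: "sets (quenched_law \<omega>) = sets path_space"
proof -
  interpret Ionescu_Tulcea "next_law \<omega>" "\<lambda>_. count_space UNIV"
    by (rule Ionescu_Tulcea_next_law)
  show ?thesis by (simp add: quenched_law_def path_space_def)
qed

lemma space_path_space [simp]: "space path_space = UNIV"
  by (auto simp: path_space_def space_PiM)

lemma space_quenched_law [simp]: "space (quenched_law \<omega>) = UNIV"
  using sets_eq_imp_space_eq[OF sets_quenched_law] by simp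

text \<open>Links the infinite path law to finite lists. Both sides add one step with the same
  kernel, so an induction over the finite compositions \<open>IT.C\<close> suffices; events on the
  past are cylinders of the projective limit.\<close>

lemma distr_quenched_law_past:
  "distr (quenched_law \<omega>) (count_space UNIV) (past n) = measure_pmf (walk \<omega> n)"
proof -
  interpret IT: Ionescu_Tulcea "next_law \<omega>" "\<lambda>_. count_space UNIV"
    by (rule Ionescu_Tulcea_next_law)
  let ?M = "\<lambda>n. PiM {0..<n} (\<lambda>_. count_space (UNIV :: int set))"
  \<comment> \<open>The only point of the empty product space, from which the compositions
    start.\<close>
  let ?u = "\<lambda>_::nat. undefined :: int"
  have u: "?u \<in> space (?M 0)" by (simp add: space_PiM)
  have meas [measurable]: "past n \<in> ?M n \<rightarrow>\<^sub>M count_space UNIV" for n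
    by (rule measurable_map_list) simp
  have C: "(\<integral>\<^sup>+f. F (past n f) \<partial>IT.C 0 n ?u) = (\<integral>\<^sup>+l. F l \<partial>walk \<omega> n)" for F :: "int list \<Rightarrow> ennreal"
  proof (induction n arbitrary: F)
    case 0
    then show ?case by (simp add: nn_integral_return u del: space_PiM_empty)
  next
    case (Suc n)
    let ?k = "\<lambda>l. if l = [] then return_pmf 0 else jump_law \<omega> (hd l)"
    have mF: "(\<lambda>f. F (past (Suc n) f)) \<in> borel_measurable (?M (Suc n))"
      by (rule measurable_compose[OF meas]) simp
    have sp: "space (IT.C 0 n ?u) = space (?M n)" using IT.space_C[OF u, of n] by simp
    have "(\<integral>\<^sup>+f. F (past (Suc n) f) \<partial>IT.C 0 (Suc n) ?u) =
        (\<integral>\<^sup>+f. (\<integral>\<^sup>+g. F (past (Suc n) g) \<partial>IT.eP n f) \<partial>IT.C 0 n ?u)"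
      using IT.measurable_eP[of n] IT.sets_C[OF u, of n]
      by (simp del: upt_Suc, subst nn_integral_bind[OF mF])
         (auto cong: measurable_cong_sets simp del: upt_Suc)
    also have "\<dots> = (\<integral>\<^sup>+f. (\<integral>\<^sup>+x. F (x # past n f) \<partial>?k (past n f)) \<partial>IT.C 0 n ?u)"
    proof (rule nn_integral_cong)
      fix f assume "f \<in> space (IT.C 0 n ?u)"
      then have f: "f \<in> space (?M n)" using sp by simp
      have k: "next_law \<omega> n f = measure_pmf (?k (past n f))"
        by (cases n) (simp_all add: next_law_def)
      have p: "past (Suc n) (f(n := x)) = x # past n f" for x
        by simp
      show "(\<integral>\<^sup>+g. F (past (Suc n) g) \<partial>IT.eP n f) = (\<integral>\<^sup>+x. F (x # past n f) \<partial>?k (past n f))"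
        unfolding IT.nn_integral_eP[OF f mF] p k ..
    qed
    also have "\<dots> = (\<integral>\<^sup>+l. (\<integral>\<^sup>+x. F (x # l) \<partial>?k l) \<partial>walk \<omega> n)"
      by (rule Suc.IH)
    finally show ?case by simp
  qed
  show ?thesis
  proof (rule measure_eqI)
    fix A :: "int list set" assume "A \<in> sets (distr (quenched_law \<omega>) (count_space UNIV) (past n))"
    define X' where "X' = past n -` A \<inter> space (?M n)"
    have X': "X' \<in> sets (?M n)" unfolding X'_def by (rule measurable_sets[OF meas]) simp
    have "past n -` A = prod_emb UNIV (\<lambda>_. count_space UNIV) {0..<n} X'"
    proof -
      have r: "past n (restrict X {0..<n}) = past n X" for X :: path
        by (intro map_cong) auto
      have "X \<in> prod_emb UNIV (\<lambda>_. count_space UNIV) {0..<n} X' \<longleftrightarrow> past n (restrict X {0..<n}) \<in> A" for X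
        by (simp add: prod_emb_def space_PiM X'_def)
      then show ?thesis unfolding r by auto
    qed
    then have "emeasure (distr (quenched_law \<omega>) (count_space UNIV) (past n)) A = emeasure (IT.CI {0..<n}) X'"
      using IT.lim[OF _ X'] by (simp add: emeasure_distr quenched_law_def path_space_def[symmetric] measurable_past[unfolded measurable_def])
         (subst emeasure_distr, auto simp: measurable_cong_sets[OF IT.PF.sets_lim refl] path_space_def[symmetric])
    also have "\<dots> = emeasure (IT.C 0 n ?u) X'"
    proof -
      have "X' \<subseteq> (\<Pi>\<^sub>E i\<in>{0..<n}. space (count_space UNIV))"
        using sets.sets_into_space[OF X'] by (simp add: space_PiM)
      then show ?thesis
        using X' by (subst IT.emeasure_CI[of _ n]) (auto simp: prod_emb_id)
    qed
    also have "\<dots> = (\<integral>\<^sup>+f. indicator A (past n f) \<partial>IT.C 0 n ?u)"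
    proof -
      have sp: "space (IT.C 0 n ?u) = space (?M n)" "sets (IT.C 0 n ?u) = sets (?M n)"
        using IT.space_C[OF u, of n] IT.sets_C[OF u, of n] by simp_all
      then have "emeasure (IT.C 0 n ?u) X' = (\<integral>\<^sup>+f. indicator X' f \<partial>IT.C 0 n ?u)"
        using X' by simp
      also have "\<dots> = (\<integral>\<^sup>+f. indicator A (past n f) \<partial>IT.C 0 n ?u)"
        by (intro nn_integral_cong) (auto simp: X'_def sp indicator_def)
      finally show ?thesis .
    qed
    also have "\<dots> = emeasure (walk \<omega> n) A"
      unfolding C by simp
    finally show "emeasure (distr (quenched_law \<omega>) (count_space UNIV) (past n)) A = emeasure (walk \<omega> n) A" .
  qed simp
qed

lemma prob_space_quenched_law: "prob_space (quenched_law \<omega>)"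
proof (rule prob_space_distrD[where f = "past 0" and N = "count_space UNIV"])
  show "past 0 \<in> quenched_law \<omega> \<rightarrow>\<^sub>M count_space UNIV"
    by (simp add: measurable_cong_sets[OF sets_quenched_law refl] measurable_past)
  show "prob_space (distr (quenched_law \<omega>) (count_space UNIV) (past 0))"
    unfolding distr_quenched_law_past by (rule measure_pmf.prob_space_axioms)
qed

subsection \<open>Measurability of the quenched law in the environment\<close>

text \<open>The integrand may depend on the environment, since each induction step moves the
  probabilities of one jump into it.\<close>

lemma measurable_nn_integral_walk:
  assumes coord: "\<And>x. (\<lambda>\<omega>. \<omega> x) \<in> borel_measurable M" and range: "\<And>\<omega> x. \<omega> \<in> space M \<Longrightarrow> \<omega> x \<in> {0<..<1}"
    and F: "\<And>l. (\<lambda>\<omega>. F \<omega> l) \<in> borel_measurable M"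
  shows "(\<lambda>\<omega>. \<integral>\<^sup>+l. F \<omega> l \<partial>walk \<omega> n) \<in> borel_measurable M"
  using F
proof (induction n arbitrary: F)
  case 0
  then show ?case by simp
next
  case (Suc n)
  note [measurable] = coord Suc.prems
  let ?F = "\<lambda>\<omega> l. if l = [] then F \<omega> [0] else F \<omega> ((hd l + 1) # l) * ennreal (\<omega> (hd l)) + F \<omega> ((hd l - 1) # l) * ennreal (1 - \<omega> (hd l))"
  have "(\<lambda>\<omega>. \<integral>\<^sup>+l. ?F \<omega> l \<partial>walk \<omega> n) \<in> borel_measurable M"
    by (rule Suc.IH) simp
  then show ?case
  proof (rule measurable_cong[THEN iffD2, rotated])
    fix \<omega> assume w: "\<omega> \<in> space M"
    have "0 \<le> \<omega> x" "\<omega> x \<le> 1" for x using range[OF w, of x] by auto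
    then show "(\<integral>\<^sup>+l. F \<omega> l \<partial>walk \<omega> (Suc n)) = (\<integral>\<^sup>+l. ?F \<omega> l \<partial>walk \<omega> n)"
      by (auto simp: jump_law_def nn_integral_bernoulli_pmf intro!: nn_integral_cong)
  qed
qed

text \<open>Events on the past generate the path space and are stable under intersection, because a
  shorter past is a final segment of a longer one.\<close>

lemma measurable_quenched_law:
  assumes coord: "\<And>x. (\<lambda>\<omega>. \<omega> x) \<in> borel_measurable M" and range: "\<And>\<omega> x. \<omega> \<in> space M \<Longrightarrow> \<omega> x \<in> {0<..<1}"
  shows "quenched_law \<in> M \<rightarrow>\<^sub>M subprob_algebra path_space"
proof -
  define G where "G = {past n -` A | n (A :: int list set). True}"
  have Gi: "past n -` A \<in> G" for n A by (auto simp: G_def)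
  have drop_past: "past n X = drop (m - n) (past m X)" if "n \<le> m" for n m and X :: path
  proof -
    have "[0..<m] = [0..<n] @ [n..<m]" using that by (metis le_add_diff_inverse upt_add_eq_append zero_le)
    then show ?thesis by (simp add: rev_map)
  qed
  have IntG: "a \<inter> b \<in> G" if a: "a = past n -` A" and b: "b = past m -` B" and "n \<le> m" for a b n m A B
  proof -
    have "a \<inter> b = past m -` (B \<inter> {l. drop (m - n) l \<in> A})"
      unfolding a b using drop_past[OF \<open>n \<le> m\<close>] by auto
    with Gi[of m "B \<inter> {l. drop (m - n) l \<in> A}"] show ?thesis by (simp only:)
  qed
  have Gsets: "sets path_space = sigma_sets UNIV G"
  proof
    show "sigma_sets UNIV G \<subseteq> sets path_space"
    proof (rule sets.sigma_sets_subset'[of _ path_space, simplified])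
      show "G \<subseteq> sets path_space"
        using measurable_sets[OF measurable_past] by (auto simp: G_def)
    qed (use sets.top[of path_space] in simp)
    have "sets path_space = sigma_sets UNIV {{X. X i \<in> A} | i A. i \<in> (UNIV :: nat set) \<and> A \<in> sets (count_space (UNIV :: int set))}"
      unfolding path_space_def sets_PiM_single by simp
    also have "\<dots> \<subseteq> sigma_sets UNIV G"
    proof (rule sigma_sets_mono, safe)
      fix t :: nat and A :: "int set"
      have "{X. X t \<in> A} = past (Suc t) -` {l. hd l \<in> A}" by auto
      with Gi[of "Suc t" "{l. hd l \<in> A}"] have "{X. X t \<in> A} \<in> G" by (simp only:)
      then show "{X. X t \<in> A} \<in> sigma_sets UNIV G" by (rule sigma_sets.Basic)
    qed
    finally show "sets path_space \<subseteq> sigma_sets UNIV G" .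
  qed
  show ?thesis
  proof (rule measurable_subprob_algebra_generated[OF Gsets])
    show "Int_stable G"
    proof (rule Int_stableI)
      fix a b assume "a \<in> G" "b \<in> G"
      then obtain n A m B where ab: "a = past n -` A" "b = past m -` B" by (auto simp: G_def)
      show "a \<inter> b \<in> G"
      proof (cases "n \<le> m")
        case True then show ?thesis by (rule IntG[OF ab])
      next
        case False then show ?thesis using IntG[OF ab(2) ab(1)] by (simp add: Int_commute)
      qed
    qed
    show "subprob_space (quenched_law \<omega>)" for \<omega>
      by (rule prob_space_imp_subprob_space[OF prob_space_quenched_law])
    show "sets (quenched_law \<omega>) = sets path_space" for \<omega> by simp
    have em: "emeasure (quenched_law \<omega>) (past n -` A) = (\<integral>\<^sup>+l. indicator A l \<partial>walk \<omega> n)" for \<omega> n A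
    proof -
      have "past n \<in> quenched_law \<omega> \<rightarrow>\<^sub>M count_space UNIV"
        by (simp add: measurable_cong_sets[OF sets_quenched_law refl] measurable_past)
      then have "emeasure (quenched_law \<omega>) (past n -` A) = emeasure (distr (quenched_law \<omega>) (count_space UNIV) (past n)) A"
        by (simp add: emeasure_distr)
      then show ?thesis by (simp add: distr_quenched_law_past)
    qed
    show "(\<lambda>\<omega>. emeasure (quenched_law \<omega>) A) \<in> borel_measurable M" if "A \<in> G" for A
    proof -
      from that obtain n B where A: "A = past n -` B" by (auto simp: G_def)
      show ?thesis
        unfolding A em
        by (rule measurable_nn_integral_walk[where F = "\<lambda>_. indicator B"], rule coord, rule range) simp_all
    qed
    show "(\<lambda>\<omega>. emeasure (quenched_law \<omega>) UNIV) \<in> borel_measurable M"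
      using prob_space.emeasure_space_1[OF prob_space_quenched_law] by simp
  qed auto
qed

subsection \<open>Generating function of the numbers of left steps\<close>

text \<open>Left steps from negative sites have weight 1, as the counts do not record them.\<close>

definition step_weight :: "(nat \<Rightarrow> real) \<Rightarrow> int \<Rightarrow> int \<Rightarrow> real" where
  "step_weight s x y = (if y = x - 1 \<and> 0 \<le> x then s (nat x) else 1)"

text \<open>Weights stop accumulating once n lies among the earlier positions, the one left by the
  current step included; so only steps before the hitting time count.\<close>

fun path_weight :: "(nat \<Rightarrow> real) \<Rightarrow> nat \<Rightarrow> int list \<Rightarrow> real" where
  "path_weight s n (y # x # l) = path_weight s n (x # l) * (if int n \<in> set (x # l) then 1 else step_weight s x y)"
| "path_weight s n _ = 1"

text \<open>Expected weight of the path from x up to its first visit to n, on the event that this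
  takes at most t steps, by conditioning on the first step.\<close>

primrec hit_gf :: "environment \<Rightarrow> (nat \<Rightarrow> real) \<Rightarrow> nat \<Rightarrow> nat \<Rightarrow> int \<Rightarrow> real" where
  "hit_gf \<omega> s n 0 x = of_bool (x = int n)"
| "hit_gf \<omega> s n (Suc t) x = (if x = int n then 1 else
     \<omega> x * hit_gf \<omega> s n t (x + 1) + (1 - \<omega> x) * (step_weight s x (x - 1) * hit_gf \<omega> s n t (x - 1)))"

lemma hit_gf_target [simp]: "hit_gf \<omega> s n t (int n) = 1"
  by (cases t) auto

context
  fixes \<omega> :: environment and s :: "nat \<Rightarrow> real"
  assumes env: "\<And>x. 0 < \<omega> x" "\<And>x. \<omega> x < 1" and s01: "\<And>x. 0 < s x" "\<And>x. s x \<le> 1"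
begin

lemma step_weight_01: "0 < step_weight s x y" "step_weight s x y \<le> 1"
  using s01 by (auto simp: step_weight_def)

lemma path_weight_01: "0 < path_weight s n l \<and> path_weight s n l \<le> 1"
proof (induction l rule: induct_list012)
  case (3 y x l)
  then show ?case using step_weight_01[of x y]
    by (auto intro: mult_le_one less_imp_le)
qed auto

lemma hit_gf_nonneg: "0 \<le> hit_gf \<omega> s n t x"
  using env step_weight_01 by (induction t arbitrary: x) (auto intro!: add_nonneg_nonneg mult_nonneg_nonneg simp: less_imp_le)

lemma hit_gf_le_1: "hit_gf \<omega> s n t x \<le> 1"
proof (induction t arbitrary: x)
  case (Suc t)
  have "\<omega> x * hit_gf \<omega> s n t (x + 1) + (1 - \<omega> x) * (step_weight s x (x - 1) * hit_gf \<omega> s n t (x - 1)) \<le> \<omega> x * 1 + (1 - \<omega> x) * (1 * 1)"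
    using env[of x] Suc step_weight_01[of x "x - 1"] hit_gf_nonneg by (intro add_mono mult_left_mono mult_mono) (auto simp: less_imp_le)
  then show ?case by simp
qed auto

lemma walk_nonempty: "l \<in> set_pmf (walk \<omega> (Suc m)) \<Longrightarrow> l \<noteq> []"
  by auto

lemma expectation_jump_law: "(\<integral>y. f y \<partial>jump_law \<omega> x) = \<omega> x * f (x + 1) + (1 - \<omega> x) * f (x - 1)" for f :: "int \<Rightarrow> real"
  using env[of x] by (simp add: jump_law_def integral_bernoulli_pmf)

text \<open>Weight collected in the first m steps times expected weight of the t steps still to
  come: moving one step across the split does not change the mean. For t = 0 the second factor
  becomes the indicator that n has been visited.\<close>

lemma expectation_walk:
  "(\<integral>l. path_weight s n l * (if int n \<in> set l then 1 else hit_gf \<omega> s n t (hd l)) \<partial>walk \<omega> (Suc m)) = hit_gf \<omega> s n (t + m) 0"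
proof (induction m arbitrary: t)
  case 0
  show ?case using hit_gf_target[of \<omega> s 0 t] by (cases "n = 0") (auto simp: bind_return_pmf)
next
  case (Suc m)
  let ?f = "\<lambda>t l. path_weight s n l * (if int n \<in> set l then 1 else hit_gf \<omega> s n t (hd l))"
  have f1: "\<bar>?f t l\<bar> \<le> 1" for t l
    using path_weight_01[of n l] hit_gf_nonneg[of n t "hd l"] hit_gf_le_1[of n t "hd l"]
    by (auto simp: abs_mult intro!: mult_le_one)
  have "(\<integral>l. ?f t l \<partial>walk \<omega> (Suc (Suc m))) =
      (\<integral>l. (\<integral>l'. ?f t l' \<partial>map_pmf (\<lambda>x. x # l) (if l = [] then return_pmf 0 else jump_law \<omega> (hd l))) \<partial>walk \<omega> (Suc m))"
    unfolding walk.simps(2)[of \<omega> "Suc m"]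
    by (intro integral_bind_pmf integrable_pmf_bounded[where B = 1]) (use f1 in simp)
  also have "\<dots> = (\<integral>l. ?f (Suc t) l \<partial>walk \<omega> (Suc m))"
  proof (intro integral_cong_AE AE_pmfI)
    fix l assume "l \<in> set_pmf (walk \<omega> (Suc m))"
    then obtain x l' where l: "l = x # l'" using walk_nonempty by (metis neq_Nil_conv)
    have pw: "path_weight s n (y # x # l') = path_weight s n (x # l') * (if int n \<in> set (x # l') then 1 else step_weight s x y)" for y
      by simp
    have "(\<integral>l''. ?f t l'' \<partial>map_pmf (\<lambda>x. x # l) (if l = [] then return_pmf 0 else jump_law \<omega> (hd l))) =
        (\<integral>y. ?f t (y # l) \<partial>jump_law \<omega> x)"
      unfolding l by simp
    also have "\<dots> = \<omega> x * ?f t ((x + 1) # l) + (1 - \<omega> x) * ?f t ((x - 1) # l)"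
      by (rule expectation_jump_law)
    also have "\<dots> = ?f (Suc t) l"
    proof (cases "int n \<in> set (x # l')")
      case True
      then show ?thesis unfolding l pw by (simp add: algebra_simps)
    next
      case False
      then have "x \<noteq> int n" by auto
      have sw: "step_weight s x (x + 1) = 1" by (simp add: step_weight_def)
      have t: "(if int n \<in> set (y # x # l') then 1 else hit_gf \<omega> s n t y) = hit_gf \<omega> s n t y" for y
        using False by auto
      show ?thesis unfolding l pw list.sel t using False \<open>x \<noteq> int n\<close> sw
        by (simp add: algebra_simps)
    qed
    finally show "(\<integral>l''. ?f t l'' \<partial>map_pmf (\<lambda>x. x # l) (if l = [] then return_pmf 0 else jump_law \<omega> (hd l))) = ?f (Suc t) l" .
  qed auto
  also have "\<dots> = hit_gf \<omega> s n (Suc t + m) 0"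
    by (rule Suc.IH)
  finally show ?case by simp
qed

end

subsection \<open>Path functionals\<close>

lemma less_hitting_time_iff: "enat t < hitting_time X n \<longleftrightarrow> (\<forall>r\<le>t. X r \<noteq> int n)"
proof
  assume a: "enat t < hitting_time X n"
  show "\<forall>r\<le>t. X r \<noteq> int n"
  proof (intro allI impI notI)
    fix r assume "r \<le> t" "X r = int n"
    then have "hitting_time X n \<le> enat r" unfolding hitting_time_def by (intro Inf_lower) auto
    also have "\<dots> \<le> enat t" using \<open>r \<le> t\<close> by simp
    finally show False using a by simp
  qed
next
  assume a: "\<forall>r\<le>t. X r \<noteq> int n"
  have "enat (Suc t) \<le> hitting_time X n"
    unfolding hitting_time_def
  proof (rule Inf_greatest)
    fix e assume "e \<in> {enat t |t. X t = int n}"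
    then obtain r where "e = enat r" "X r = int n" by auto
    with a show "enat (Suc t) \<le> e" by (metis Suc_leI enat_ord_simps(1) not_le)
  qed
  then show "enat t < hitting_time X n" by (metis Suc_ile_eq)
qed

lemma left_steps_target [simp]: "left_steps X n n = 0"
proof -
  have eq: "{t. enat t < hitting_time X n \<and> X t = int n \<and> X (Suc t) = int n - 1} = {}"
    by (auto simp: less_hitting_time_iff)
  show ?thesis unfolding left_steps_def eq by simp
qed

lemma path_weight_past:
  "path_weight s n (past (Suc m) X) = (\<Prod>t\<in>{t. t < m \<and> (\<forall>r\<le>t. X r \<noteq> int n)}. step_weight s (X t) (X (Suc t)))"
proof (induction m)
  case (Suc m)
  let ?A = "\<lambda>m. {t. t < m \<and> (\<forall>r\<le>t. X r \<noteq> int n)}"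
  have mem: "int n \<in> set (X m # past m X) \<longleftrightarrow> \<not> (\<forall>r\<le>m. X r \<noteq> int n)"
    by (force simp: le_less)
  have p: "past (Suc (Suc m)) X = X (Suc m) # X m # past m X" "past (Suc m) X = X m # past m X" by simp_all
  have "path_weight s n (past (Suc (Suc m)) X) = path_weight s n (past (Suc m) X) * (if int n \<in> set (X m # past m X) then 1 else step_weight s (X m) (X (Suc m)))"
    unfolding p by (rule path_weight.simps)
  also have "\<dots> = (\<Prod>t\<in>?A (Suc m). step_weight s (X t) (X (Suc t)))"
  proof (cases "\<forall>r\<le>m. X r \<noteq> int n")
    case True
    then have "?A (Suc m) = insert m (?A m)" by (auto simp: less_Suc_eq)
    then show ?thesis using True Suc.IH mem by simp
  next
    case False
    then have "?A (Suc m) = ?A m" by (auto simp: less_Suc_eq)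
    then show ?thesis using False Suc.IH mem by simp
  qed
  finally show ?case .
qed simp

text \<open>Once n has been visited, all steps before the hitting time are seen, and grouping them
  by site gives the powers. The path is arbitrary here and could pass over n, so sites from n on get
  weight 1.\<close>

lemma path_weight_past_hit:
  assumes s: "\<And>x. x \<ge> n \<Longrightarrow> s x = 1" and hit: "\<exists>t\<le>m. X t = int n"
  shows "path_weight s n (past (Suc m) X) = (\<Prod>x<n. s x ^ left_steps X n x)"
proof -
  define A where "A = {t. \<forall>r\<le>t. X r \<noteq> int n}"
  have A: "{t. t < m \<and> (\<forall>r\<le>t. X r \<noteq> int n)} = A"
    using hit by (auto simp: A_def) (meson le_trans linorder_not_le)
  have "finite {t. t < m \<and> (\<forall>r\<le>t. X r \<noteq> int n)}" by simp
  then have fin: "finite A" unfolding A .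
  define A' where "A' = {t\<in>A. X (Suc t) = X t - 1 \<and> 0 \<le> X t \<and> nat (X t) < n}"
  have fin': "finite A'" unfolding A'_def by (rule finite_subset[OF _ fin]) auto
  have "(\<Prod>t\<in>A. step_weight s (X t) (X (Suc t))) = (\<Prod>t\<in>A'. s (nat (X t)))"
    by (rule prod.mono_neutral_cong_right[OF fin]) (auto simp: A'_def step_weight_def intro!: s)
  also have "\<dots> = (\<Prod>x<n. \<Prod>t\<in>{t\<in>A'. nat (X t) = x}. s (nat (X t)))"
    by (rule prod.group[OF fin', symmetric]) (auto simp: A'_def)
  also have "\<dots> = (\<Prod>x<n. s x ^ left_steps X n x)"
  proof (rule prod.cong[OF refl])
    fix x assume "x \<in> {..<n}"
    then have "{t\<in>A'. nat (X t) = x} = {t. enat t < hitting_time X n \<and> X t = int x \<and> X (Suc t) = int x - 1}"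
      by (auto simp: A'_def A_def less_hitting_time_iff)
    moreover have "(\<Prod>t\<in>{t\<in>A'. nat (X t) = x}. s (nat (X t))) = (\<Prod>t\<in>{t\<in>A'. nat (X t) = x}. s x)"
      by (rule prod.cong) auto
    ultimately show "(\<Prod>t\<in>{t\<in>A'. nat (X t) = x}. s (nat (X t))) = s x ^ left_steps X n x"
      by (simp add: left_steps_def)
  qed
  finally show ?thesis unfolding path_weight_past A .
qed

lemma measurable_left_steps [measurable]: "(\<lambda>X. left_steps X n x) \<in> path_space \<rightarrow>\<^sub>M count_space UNIV"
proof -
  have [measurable]: "(\<lambda>X. X t) \<in> path_space \<rightarrow>\<^sub>M count_space UNIV" for t
    unfolding path_space_def by (rule measurable_component_singleton) simp
  show ?thesis
    unfolding left_steps_def less_hitting_time_iff by measurable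
qed

lemma measurable_coordinate [measurable]: "(\<lambda>X. X t) \<in> path_space \<rightarrow>\<^sub>M count_space UNIV"
  unfolding path_space_def by (rule measurable_component_singleton) simp

text \<open>\<open>expectation_walk\<close> with no steps to come covers the paths that hit n by
  time m; then m tends to infinity.\<close>

lemma integral_quenched_left_steps:
  assumes env: "\<And>x. 0 < \<omega> x" "\<And>x. \<omega> x < 1" and s01: "\<And>x. 0 < s x" "\<And>x. s x \<le> 1"
    and s: "\<And>x. x \<ge> n \<Longrightarrow> s x = 1" and lim: "(\<lambda>m. hit_gf \<omega> s n m 0) \<longlonglongrightarrow> h"
  shows "(\<integral>X. of_bool (\<exists>t. X t = int n) * (\<Prod>x<n. s x ^ left_steps X n x) \<partial>quenched_law \<omega>) = h"
proof -
  interpret prob_space "quenched_law \<omega>" by (rule prob_space_quenched_law)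
  let ?W = "\<lambda>X. \<Prod>x<n. s x ^ left_steps X n x"
  have W01: "0 \<le> ?W X" "?W X \<le> 1" for X
    using s01 by (auto intro!: prod_nonneg prod_le_1 power_le_one simp: less_imp_le)
  have eq: "(\<integral>X. of_bool (\<exists>t\<le>m. X t = int n) * ?W X \<partial>quenched_law \<omega>) = hit_gf \<omega> s n m 0" for m
  proof -
    let ?f = "\<lambda>l. path_weight s n l * (if int n \<in> set l then 1 else hit_gf \<omega> s n 0 (hd l))"
    have "hit_gf \<omega> s n m 0 = (\<integral>l. ?f l \<partial>walk \<omega> (Suc m))"
      using expectation_walk[OF env s01, where n = n and t = 0 and m = m] by simp
    also have "\<dots> = (\<integral>X. ?f (past (Suc m) X) \<partial>quenched_law \<omega>)"
      unfolding distr_quenched_law_past[symmetric]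
      by (rule integral_distr) (simp_all add: measurable_cong_sets[OF sets_quenched_law refl] measurable_past del: upt_Suc)
    also have "\<dots> = (\<integral>X. of_bool (\<exists>t\<le>m. X t = int n) * ?W X \<partial>quenched_law \<omega>)"
    proof (rule Bochner_Integration.integral_cong[OF refl])
      fix X :: path
      have mem: "int n \<in> set (past (Suc m) X) \<longleftrightarrow> (\<exists>t\<le>m. X t = int n)"
        by (force simp: le_less)
      show "?f (past (Suc m) X) = of_bool (\<exists>t\<le>m. X t = int n) * ?W X"
      proof (cases "\<exists>t\<le>m. X t = int n")
        case True
        then show ?thesis unfolding mem using path_weight_past_hit[OF s True] by simp
      next
        case False
        then have "X m \<noteq> int n" by auto
        then show ?thesis unfolding mem using False by (auto simp: )
      qed
    qed
    finally show ?thesis by simp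
  qed
  have "(\<lambda>m. \<integral>X. of_bool (\<exists>t\<le>m. X t = int n) * ?W X \<partial>quenched_law \<omega>) \<longlonglongrightarrow> (\<integral>X. of_bool (\<exists>t. X t = int n) * ?W X \<partial>quenched_law \<omega>)"
  proof (rule integral_dominated_convergence[where w = "\<lambda>_. 1"])
    show "AE X in quenched_law \<omega>. (\<lambda>m. of_bool (\<exists>t\<le>m. X t = int n) * ?W X) \<longlonglongrightarrow> of_bool (\<exists>t. X t = int n) * ?W X"
    proof (rule AE_I2)
      fix X :: path
      show "(\<lambda>m. of_bool (\<exists>t\<le>m. X t = int n) * ?W X) \<longlonglongrightarrow> of_bool (\<exists>t. X t = int n) * ?W X"
      proof (cases "\<exists>t. X t = int n")
        case True
        then obtain t where "X t = int n" by auto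
        then have "\<forall>m\<ge>t. of_bool (\<exists>t\<le>m. X t = int n) * ?W X = of_bool (\<exists>t. X t = int n) * ?W X" by auto
        then show ?thesis by (intro tendsto_eventually) (auto simp: eventually_sequentially)
      qed simp
    qed
    show "AE X in quenched_law \<omega>. norm (of_bool (\<exists>t\<le>m. X t = int n) * ?W X) \<le> 1" for m
      using W01 by auto
  qed auto
  then show ?thesis unfolding eq using lim LIMSEQ_unique by blast
qed

section \<open>The transient environment and the invariant law\<close>

locale env_site =
  fixes \<mu> :: "real measure"
  assumes unit_law: "unit_law \<mu>"
begin

lemma prob_space_site: "prob_space \<mu>" and sets_site: "sets \<mu> = sets (restrict_space borel {0<..<1})"
  using unit_law by (auto simp: unit_law_def)

lemma space_site: "space \<mu> = {0<..<1}"
  using sets_eq_imp_space_eq[OF sets_site] by (simp add: space_restrict_space)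

sublocale site: prob_space \<mu> by (rule prob_space_site)

lemma measurable_site [measurable (raw)]: "f \<in> borel_measurable borel \<Longrightarrow> f \<in> borel_measurable \<mu>" for f :: "real \<Rightarrow> 'b::topological_space"
  using measurable_cong_sets[OF sets_site refl] measurable_restrict_space1 by blast

lemma site_range: "a \<in> space \<mu> \<Longrightarrow> 0 < a \<and> a < 1"
  by (simp add: space_site)

sublocale seq: sequence_space \<mu> ..

abbreviation seq_law :: "(nat \<Rightarrow> real) measure" where
  "seq_law \<equiv> PiM UNIV (\<lambda>_. \<mu>)"

lemma prob_space_seq_law: "prob_space seq_law"
  by (rule prob_space_PiM) (rule prob_space_site)

lemma seq_coordinate [measurable]: "(\<lambda>\<sigma>. \<sigma> j) \<in> borel_measurable seq_law"
  by (rule measurable_compose[OF measurable_component_singleton[of j UNIV "\<lambda>_. \<mu>"]]) (simp_all add: measurable_site)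

lemma seq_range: "\<sigma> \<in> space seq_law \<Longrightarrow> 0 < \<sigma> j \<and> \<sigma> j < 1"
  by (auto simp: space_PiM space_site)

lemma case_nat_measurable: "(\<lambda>(a, \<sigma>). case_nat a \<sigma>) \<in> \<mu> \<Otimes>\<^sub>M seq_law \<rightarrow>\<^sub>M seq_law"
  by measurable

lemma nn_integral_seq_law:
  assumes [measurable]: "F \<in> borel_measurable seq_law"
  shows "(\<integral>\<^sup>+\<sigma>. F \<sigma> \<partial>seq_law) = (\<integral>\<^sup>+a. \<integral>\<^sup>+\<sigma>. F (case_nat a \<sigma>) \<partial>seq_law \<partial>\<mu>)"
proof -
  have sf: "sigma_finite_measure seq_law"
    by (rule prob_space_imp_sigma_finite) (rule prob_space_seq_law)
  have "(\<integral>\<^sup>+\<sigma>. F \<sigma> \<partial>seq_law) = (\<integral>\<^sup>+z. F (case z of (a, \<sigma>) \<Rightarrow> case_nat a \<sigma>) \<partial>(\<mu> \<Otimes>\<^sub>M seq_law))"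
    by (subst seq.PiM_iter[symmetric], rule nn_integral_distr[OF case_nat_measurable]) simp
  also have "\<dots> = (\<integral>\<^sup>+a. \<integral>\<^sup>+\<sigma>. F (case_nat a \<sigma>) \<partial>seq_law \<partial>\<mu>)"
    by (subst sigma_finite_measure.nn_integral_fst[OF sf, symmetric])
       (auto intro: measurable_compose[OF case_nat_measurable assms])
  finally show ?thesis .
qed

text \<open>An i.i.d. environment read along distinct sites is an i.i.d. sequence. It is read
  rightwards from 1 for \<open>S\<close>, rightwards from 0 for the continued fraction, and
  leftwards from n - 1 for the products of odds that must vanish.\<close>

lemma distr_env_law_seq:
  assumes "inj f"
  shows "distr (env_law \<mu>) seq_law (\<lambda>\<omega> n. \<omega> (f n)) = seq_law"
  using distr_PiM_reindex[of "UNIV :: int set" "\<lambda>_. \<mu>" f UNIV] assms prob_space_site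
  by (simp add: env_law_def restrict_UNIV)

lemma measurable_env_law_seq [measurable]: "(\<lambda>\<omega> n. \<omega> (f n)) \<in> env_law \<mu> \<rightarrow>\<^sub>M seq_law"
  unfolding env_law_def by (rule measurable_PiM_single') (auto simp: space_PiM)

lemma env_range: "\<omega> \<in> space (env_law \<mu>) \<Longrightarrow> 0 < \<omega> x \<and> \<omega> x < 1"
  by (auto simp: env_law_def space_PiM space_site)

sublocale env: prob_space "env_law \<mu>"
  unfolding env_law_def by (rule prob_space_PiM) (rule prob_space_site)

definition odds :: "real \<Rightarrow> real" where "odds a = (1 - a) / a"

lemma odds_pos: "0 < a \<Longrightarrow> a < 1 \<Longrightarrow> 0 < odds a"
  by (simp add: odds_def)

lemma odds_borel [measurable]: "odds \<in> borel_measurable borel"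
  unfolding odds_def by measurable

end

text \<open>The paper's assumptions (1.i), (1.ii) and the integrability part of (1.iii).\<close>

locale transient_site = env_site +
  assumes ln_int: "integrable (env_law \<mu>) (\<lambda>\<omega>. ln (rho \<omega> 0))"
    and ln_neg: "(\<integral>\<omega>. ln (rho \<omega> 0) \<partial>env_law \<mu>) < 0"
    and rho_int: "integrable (env_law \<mu>) (\<lambda>\<omega>. rho \<omega> 0)"
begin

lemma distr_env_0: "distr (env_law \<mu>) \<mu> (\<lambda>\<omega>. \<omega> 0) = \<mu>"
  unfolding env_law_def by (rule distr_PiM_component) (auto simp: prob_space_site)

text \<open>A strictly negative mean of \<open>ln \<rho>\<close> forces a fractional moment of \<open>\<rho>\<close> below one,
  which replaces the strong law of large numbers.\<close>

lemma fractional_moment: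
  obtains k :: nat and r :: real where "0 < k" "r < 1" "0 \<le> r"
    "(\<integral>\<^sup>+a. ennreal (odds a powr (1 / real k)) \<partial>\<mu>) = ennreal r"
proof -
  have c: "(\<lambda>\<omega>. \<omega> 0) \<in> env_law \<mu> \<rightarrow>\<^sub>M \<mu>"
    unfolding env_law_def by (rule measurable_component_singleton) simp
  have i1: "integrable \<mu> (\<lambda>a. ln (odds a))" and m1: "(\<integral>a. ln (odds a) \<partial>\<mu>) < 0" and i2: "integrable \<mu> odds"
    using ln_int ln_neg rho_int
      integrable_distr_eq[OF c, of "\<lambda>a. ln (odds a)"] integral_distr[OF c, of "\<lambda>a. ln (odds a)"]
      integrable_distr_eq[OF c, of odds]
    by (simp_all add: distr_env_0 rho_def odds_def[symmetric])
  \<comment> \<open>With k in place of k + 1: k (rho^(1/k) - 1) tends to ln rho and lies between ln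
    rho and rho - 1, which gives a dominating function. A negative mean for some k says that the
    fractional moment is below 1.\<close>
  define f where "f k a = real (Suc k) * (odds a powr (1 / real (Suc k)) - 1)" for k a
  have lower: "ln (odds a) \<le> f k a" if "0 < a" "a < 1" for a k
  proof -
    have "1 + ln (odds a) / real (Suc k) \<le> exp (ln (odds a) / real (Suc k))"
      by (rule exp_ge_add_one_self)
    also have "\<dots> = odds a powr (1 / real (Suc k))"
      using odds_pos[OF that] by (simp add: powr_def)
    finally show ?thesis unfolding f_def by (simp add: field_simps)
  qed
  have upper: "f k a \<le> odds a - 1" if "0 < a" "a < 1" for a k
  proof -
    define y where "y = odds a powr (1 / real (Suc k))"
    have "0 < y" using odds_pos[OF that] by (simp add: y_def)
    have "1 + real (Suc k) * (y - 1) \<le> (1 + (y - 1)) ^ Suc k"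
      using \<open>0 < y\<close> by (intro Bernoulli_inequality) auto
    also have "(1 + (y - 1)) ^ Suc k = odds a"
      using odds_pos[OF that] \<open>0 < y\<close> by (simp add: y_def powr_realpow[symmetric] powr_powr del: power_Suc of_nat_Suc)
    finally show ?thesis unfolding f_def y_def by simp
  qed
  have "(\<lambda>k. \<integral>a. f k a \<partial>\<mu>) \<longlonglongrightarrow> (\<integral>a. ln (odds a) \<partial>\<mu>)"
  proof (rule integral_dominated_convergence[where w = "\<lambda>a. \<bar>ln (odds a)\<bar> + \<bar>odds a - 1\<bar>"])
    show "AE a in \<mu>. (\<lambda>k. f k a) \<longlonglongrightarrow> ln (odds a)"
    proof (rule AE_I2)
      fix a assume "a \<in> space \<mu>"
      then have "0 < odds a" using site_range odds_pos by auto
      then have "f k a = real (Suc k) * (exp (ln (odds a) / real (Suc k)) - 1)" for k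
        by (simp add: f_def powr_def)
      moreover have "(\<lambda>k. real (Suc k) * (exp (x / real (Suc k)) - 1)) \<longlonglongrightarrow> x" for x
        by real_asymp
      ultimately show "(\<lambda>k. f k a) \<longlonglongrightarrow> ln (odds a)" by simp
    qed
    show "AE a in \<mu>. norm (f k a) \<le> \<bar>ln (odds a)\<bar> + \<bar>odds a - 1\<bar>" for k
    proof (rule AE_I2)
      fix a assume "a \<in> space \<mu>"
      then have "0 < a" "a < 1" using site_range by auto
      from lower[OF this, of k] upper[OF this, of k] show "norm (f k a) \<le> \<bar>ln (odds a)\<bar> + \<bar>odds a - 1\<bar>"
        unfolding real_norm_def abs_le_iff by linarith
    qed
    show "integrable \<mu> (\<lambda>a. \<bar>ln (odds a)\<bar> + \<bar>odds a - 1\<bar>)" using i1 i2 by simp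
  qed (auto simp: f_def)
  from order_tendstoD(2)[OF this m1] obtain k where k: "(\<integral>a. f k a \<partial>\<mu>) < 0"
    by (auto simp: eventually_sequentially)
  let ?g = "\<lambda>a. odds a powr (1 / real (Suc k))"
  have ig: "integrable \<mu> ?g"
  proof (rule Bochner_Integration.integrable_bound[where f = "\<lambda>a. 1 + \<bar>odds a\<bar>"])
    show "integrable \<mu> (\<lambda>a. 1 + \<bar>odds a\<bar>)" using i2 by simp
    show "AE a in \<mu>. norm (?g a) \<le> norm (1 + \<bar>odds a\<bar>)"
    proof (rule AE_I2)
      fix a assume "a \<in> space \<mu>"
      then have p: "0 < odds a" using site_range odds_pos by auto
      show "norm (?g a) \<le> norm (1 + \<bar>odds a\<bar>)"
      proof (cases "odds a \<le> 1")
        case True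
        then have "?g a \<le> 1" using p by (intro powr_le1) auto
        then show ?thesis using p by simp
      next
        case False
        then have "?g a \<le> odds a powr 1" by (intro powr_mono) auto
        then show ?thesis using p by simp
      qed
    qed
  qed measurable
  have "(\<integral>a. f k a \<partial>\<mu>) = real (Suc k) * ((\<integral>a. ?g a \<partial>\<mu>) - 1)"
    unfolding f_def using ig by (simp add: site.prob_space)
  with k have "(\<integral>a. ?g a \<partial>\<mu>) < 1" by (simp add: mult_less_0_iff del: of_nat_Suc)
  moreover have "0 \<le> (\<integral>a. ?g a \<partial>\<mu>)" by simp
  moreover have "(\<integral>\<^sup>+a. ennreal (?g a) \<partial>\<mu>) = ennreal (\<integral>a. ?g a \<partial>\<mu>)"
    using ig by (intro nn_integral_eq_integral) auto
  ultimately show thesis by (intro that[of "Suc k"]) auto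
qed

text \<open>By independence the K-th roots of the products have geometrically decaying means, so
  their sum is finite almost surely. The roots are then eventually below 1 and dominate their own
  K-th powers.\<close>

lemma AE_summable_prod_odds: "AE \<sigma> in seq_law. summable (\<lambda>k. \<Prod>j<k. odds (\<sigma> j))"
proof -
  obtain K r where K: "0 < K" "r < 1" "0 \<le> r" and r: "(\<integral>\<^sup>+a. ennreal (odds a powr (1 / real K)) \<partial>\<mu>) = ennreal r"
    using fractional_moment .
  define R where "R k \<sigma> = (\<Prod>j<k. odds (\<sigma> j) powr (1 / real K))" for k and \<sigma> :: "nat \<Rightarrow> real"
  have [measurable]: "R k \<in> borel_measurable seq_law" for k
    unfolding R_def by measurable
  have R0: "0 \<le> R k \<sigma>" for k \<sigma> unfolding R_def by (intro prod_nonneg) auto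
  have E: "(\<integral>\<^sup>+\<sigma>. ennreal (R k \<sigma>) \<partial>seq_law) = ennreal (r ^ k)" for k
  proof (induction k)
    case 0
    then show ?case
      using prob_space.emeasure_space_1[OF prob_space_seq_law] by (simp add: R_def)
  next
    case (Suc k)
    have RS: "R (Suc k) (case_nat a \<sigma>) = odds a powr (1 / real K) * R k \<sigma>" for a \<sigma>
      unfolding R_def by (subst prod.lessThan_Suc_shift) simp
    have "(\<integral>\<^sup>+\<sigma>. ennreal (R (Suc k) \<sigma>) \<partial>seq_law) = (\<integral>\<^sup>+a. \<integral>\<^sup>+\<sigma>. ennreal (R (Suc k) (case_nat a \<sigma>)) \<partial>seq_law \<partial>\<mu>)"
      by (rule nn_integral_seq_law) measurable
    also have "\<dots> = (\<integral>\<^sup>+a. ennreal (odds a powr (1 / real K)) * (\<integral>\<^sup>+\<sigma>. ennreal (R k \<sigma>) \<partial>seq_law) \<partial>\<mu>)"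
      unfolding RS using R0 by (simp add: ennreal_mult nn_integral_cmult)
    also have "\<dots> = ennreal r * ennreal (r ^ k)"
      unfolding Suc.IH by (subst nn_integral_multc) (auto simp: r)
    finally show ?case using K by (simp add: ennreal_mult)
  qed
  have "(\<integral>\<^sup>+\<sigma>. (\<Sum>k. ennreal (R k \<sigma>)) \<partial>seq_law) = (\<Sum>k. ennreal (r ^ k))"
    by (subst nn_integral_suminf) (auto simp: E)
  also have "\<dots> = ennreal (\<Sum>k. r ^ k)"
    using K by (intro suminf_ennreal2) (auto intro: summable_geometric)
  also have "\<dots> < \<infinity>" by simp
  finally have "AE \<sigma> in seq_law. (\<Sum>k. ennreal (R k \<sigma>)) \<noteq> \<infinity>"
    by (intro nn_integral_PInf_AE) auto
  then show ?thesis
  proof (rule AE_mp, intro AE_I2 impI)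
    fix \<sigma> assume s: "\<sigma> \<in> space seq_law" and fin: "(\<Sum>k. ennreal (R k \<sigma>)) \<noteq> \<infinity>"
    have pos: "0 < odds (\<sigma> j)" for j using seq_range[OF s, of j] odds_pos by auto
    have sum: "summable (\<lambda>k. R k \<sigma>)"
      using fin R0 by (intro summable_suminf_not_top) (auto simp: top_unique)
    have pw: "(\<Prod>j<k. odds (\<sigma> j)) = R k \<sigma> ^ K" for k
    proof -
      have "R k \<sigma> ^ K = (\<Prod>j<k. (odds (\<sigma> j) powr (1 / real K)) ^ K)"
        unfolding R_def by (rule prod_power_distrib)
      also have "\<dots> = (\<Prod>j<k. odds (\<sigma> j))"
      proof (rule prod.cong[OF refl])
        fix j
        have "(odds (\<sigma> j) powr (1 / real K)) ^ K = odds (\<sigma> j) powr (1 / real K * real K)"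
          using pos[of j] by (simp add: powr_realpow[symmetric] powr_powr)
        then show "(odds (\<sigma> j) powr (1 / real K)) ^ K = odds (\<sigma> j)" using K(1) pos[of j] by simp
      qed
      finally show ?thesis by simp
    qed
    have "R k \<sigma> \<le> 1 \<Longrightarrow> R k \<sigma> ^ K \<le> R k \<sigma>" for k
      using power_decreasing[of 1 K "R k \<sigma>"] K(1) R0 by simp
    moreover have "\<forall>\<^sub>F k in sequentially. R k \<sigma> < 1"
      using order_tendstoD(2)[OF summable_LIMSEQ_zero[OF sum], of 1] by simp
    ultimately have "\<forall>\<^sub>F k in sequentially. norm (\<Prod>j<k. odds (\<sigma> j)) \<le> R k \<sigma>"
      using R0 by (auto simp: pw elim!: eventually_mono)
    then show "summable (\<lambda>k. \<Prod>j<k. odds (\<sigma> j))"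
      using sum by (rule summable_comparison_test_ev)
  qed
qed

lemma AE_env_prod_odds:
  assumes "inj f"
  shows "AE \<omega> in env_law \<mu>. summable (\<lambda>k. \<Prod>j<k. odds (\<omega> (f j)))"
proof -
  have "AE \<sigma> in distr (env_law \<mu>) seq_law (\<lambda>\<omega> n. \<omega> (f n)). summable (\<lambda>k. \<Prod>j<k. odds (\<sigma> j))"
    unfolding distr_env_law_seq[OF assms] by (rule AE_summable_prod_odds)
  then show ?thesis
    by (rule AE_distrD[OF measurable_env_law_seq])
qed

end

text \<open>Induction over u by the Cauchy product with the geometric series; the coefficients add
  up by the hockey-stick identity.\<close>

lemma neg_binomial_sums:
  fixes x :: real
  assumes "0 \<le> x" "x < 1"
  shows "(\<lambda>v. real ((u + v) choose v) * x ^ v) sums (1 / (1 - x) ^ Suc u)"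
proof (induction u)
  case 0
  then show ?case using geometric_sums[of x] assms by simp
next
  case (Suc u)
  let ?a = "\<lambda>v. real ((u + v) choose v) * x ^ v"
  have a: "summable (\<lambda>k. norm (?a k))"
    using sums_summable[OF Suc.IH] assms by (simp add: abs_mult)
  have b: "summable (\<lambda>k. norm (x ^ k))"
    using assms by (simp add: summable_geometric)
  have "(\<lambda>k. \<Sum>i\<le>k. ?a i * x ^ (k - i)) sums ((\<Sum>k. ?a k) * (\<Sum>k. x ^ k))"
    by (rule Cauchy_product_sums[OF a b])
  moreover have "(\<Sum>i\<le>k. ?a i * x ^ (k - i)) = real ((Suc u + k) choose k) * x ^ k" for k
  proof -
    have "(\<Sum>i\<le>k. ?a i * x ^ (k - i)) = (\<Sum>i\<le>k. real ((u + i) choose i) * x ^ k)"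
      by (intro sum.cong refl) (simp add: power_add[symmetric] mult.assoc)
    also have "\<dots> = real (\<Sum>i\<le>k. (u + i) choose i) * x ^ k"
      by (simp add: sum_distrib_right)
    also have "(\<Sum>i\<le>k. (u + i) choose i) = (Suc u + k) choose k"
      using sum_choose_lower[of u k] by simp
    finally show ?thesis .
  qed
  moreover have "(\<Sum>k. ?a k) * (\<Sum>k. x ^ k) = 1 / (1 - x) ^ Suc (Suc u)"
  proof -
    have e1: "(\<Sum>k. ?a k) = 1 / (1 - x) ^ Suc u"
      by (rule sums_unique[OF Suc.IH, symmetric])
    have e2: "(\<Sum>k. x ^ k) = 1 / (1 - x)"
      using assms by (intro suminf_geometric) simp
    show ?thesis unfolding e1 e2 by simp
  qed
  ultimately show ?case by simp
qed

section \<open>The transition kernel \<open>Q\<close> and its stationary law\<close>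

context env_site
begin

lemma integrable_monomial: "integrable \<mu> (\<lambda>a. a ^ i * (1 - a) ^ j)"
proof (rule site.integrable_const_bound[where B = 1])
  show "AE a in \<mu>. norm (a ^ i * (1 - a) ^ j) \<le> 1"
  proof (rule AE_I2)
    fix a assume "a \<in> space \<mu>"
    then have "0 < a" "a < 1" using site_range by auto
    then show "norm (a ^ i * (1 - a) ^ j) \<le> 1"
      by (auto simp: abs_mult power_abs intro!: mult_le_one power_le_one)
  qed
qed measurable

lemma integral_monomial_pos: "0 < (\<integral>a. a ^ i * (1 - a) ^ j \<partial>\<mu>)"
proof -
  have nn: "0 \<le> a ^ i * (1 - a) ^ j" if "a \<in> space \<mu>" for a
    using site_range[OF that] by (intro mult_nonneg_nonneg) auto
  have "(\<integral>a. a ^ i * (1 - a) ^ j \<partial>\<mu>) \<noteq> 0"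
  proof
    assume "(\<integral>a. a ^ i * (1 - a) ^ j \<partial>\<mu>) = 0"
    then have "AE a in \<mu>. a ^ i * (1 - a) ^ j = 0"
      using integral_nonneg_eq_0_iff_AE[OF integrable_monomial, of i j] nn by auto
    then have "AE a in \<mu>. False"
    proof (rule AE_mp, intro AE_I2 impI)
      fix a assume "a \<in> space \<mu>" "a ^ i * (1 - a) ^ j = 0"
      then show False using site_range[of a] by auto
    qed
    then show False by simp
  qed
  moreover have "0 \<le> (\<integral>a. a ^ i * (1 - a) ^ j \<partial>\<mu>)"
    using nn by (intro integral_nonneg_AE) auto
  ultimately show ?thesis by linarith
qed

lemma Q_pos: "0 < Q \<mu> u v"
  unfolding Q_def using integral_monomial_pos[of "u + 1" v] by (intro mult_pos_pos) auto

lemma Q_eq_exp_phi: "Q \<mu> u v = real ((u + v) choose v) * exp (phi \<mu> u v)"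
  using integral_monomial_pos[of "u + 1" v] by (simp add: Q_def phi_def)

lemma ennreal_Q: "ennreal (Q \<mu> u v) = (\<integral>\<^sup>+a. ennreal (real ((u + v) choose v) * (a ^ (u + 1) * (1 - a) ^ v)) \<partial>\<mu>)"
  unfolding Q_def
  using site_range
  by (subst nn_integral_eq_integral)
     (auto intro!: integrable_mult_right integrable_monomial AE_I2 mult_nonneg_nonneg simp: less_imp_le simp del: power_Suc)

lemma nn_sum_Q:
  "(\<Sum>v. ennreal (Q \<mu> u v) * F v) = (\<integral>\<^sup>+a. (\<Sum>v. ennreal (real ((u + v) choose v) * (a ^ (u + 1) * (1 - a) ^ v)) * F v) \<partial>\<mu>)"
proof -
  have m: "(\<lambda>a. ennreal (real ((u + v) choose v) * (a ^ (u + 1) * (1 - a) ^ v))) \<in> borel_measurable \<mu>" for v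
    by (rule measurable_site) measurable
  show ?thesis
    unfolding ennreal_Q nn_integral_multc[OF m, symmetric]
    by (rule nn_integral_suminf[symmetric]) (intro borel_measurable_times_ennreal m measurable_const, simp)
qed

text \<open>Given the site value a, \<open>Q\<close> is the law of the number of failures before
  success number u + 1. This is thus the generating function of a negative binomial law, averaged
  over a.\<close>

lemma nn_sum_Q_power:
  assumes "0 \<le> t" "t \<le> 1"
  shows "(\<Sum>v. ennreal (Q \<mu> u v) * ennreal (t ^ v)) = (\<integral>\<^sup>+a. ennreal ((a / (1 - (1 - a) * t)) ^ Suc u) \<partial>\<mu>)"
  unfolding nn_sum_Q
proof (rule nn_integral_cong)
  fix a assume "a \<in> space \<mu>"
  then have a: "0 < a" "a < 1" using site_range by auto
  have "(1 - a) * t \<le> (1 - a) * 1"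
    using a assms by (intro mult_left_mono) auto
  then have x: "0 \<le> (1 - a) * t" "(1 - a) * t < 1"
    using a assms by (simp_all add: less_le_trans[of _ 1] le_less_trans[of _ "1 - a" 1])
  have "(\<lambda>v. a ^ Suc u * (real ((u + v) choose v) * ((1 - a) * t) ^ v)) sums (a ^ Suc u * (1 / (1 - (1 - a) * t) ^ Suc u))"
    by (intro sums_mult neg_binomial_sums x)
  then have "(\<Sum>v. ennreal (a ^ Suc u * (real ((u + v) choose v) * ((1 - a) * t) ^ v))) = ennreal ((a / (1 - (1 - a) * t)) ^ Suc u)"
    using a x by (subst suminf_ennreal_eq) (auto intro!: mult_nonneg_nonneg simp: power_divide)
  moreover have "ennreal (real ((u + v) choose v) * (a ^ (u + 1) * (1 - a) ^ v)) * ennreal (t ^ v) =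
      ennreal (a ^ Suc u * (real ((u + v) choose v) * ((1 - a) * t) ^ v))" for v
    using a assms by (subst ennreal_mult[symmetric]) (auto simp: power_mult_distrib mult_ac)
  ultimately show "(\<Sum>v. ennreal (real ((u + v) choose v) * (a ^ (u + 1) * (1 - a) ^ v)) * ennreal (t ^ v)) = ennreal ((a / (1 - (1 - a) * t)) ^ Suc u)"
    by simp
qed

lemma nn_sum_Q_1: "(\<Sum>v. ennreal (Q \<mu> u v)) = 1"
proof -
  have "(\<Sum>v. ennreal (Q \<mu> u v)) = (\<integral>\<^sup>+a. ennreal ((a / (1 - (1 - a) * 1)) ^ Suc u) \<partial>\<mu>)"
    using nn_sum_Q_power[of 1 u] by simp
  also have "\<dots> = (\<integral>\<^sup>+a. 1 \<partial>\<mu>)"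
    by (intro nn_integral_cong) (use site_range in force)
  finally show ?thesis by (simp add: site.emeasure_space_1)
qed

definition KQ :: "nat \<Rightarrow> nat pmf" where "KQ u = embed_pmf (Q \<mu> u)"

lemma pmf_KQ: "pmf (KQ u) v = Q \<mu> u v"
  unfolding KQ_def
  by (rule pmf_embed_pmf) (use Q_pos nn_sum_Q_1 in \<open>auto simp: nn_integral_count_space_nat less_imp_le\<close>)

lemma nn_integral_KQ: "(\<integral>\<^sup>+v. F v \<partial>KQ u) = (\<Sum>v. ennreal (Q \<mu> u v) * F v)"
  by (simp add: nn_integral_measure_pmf pmf_KQ nn_integral_count_space_nat)

text \<open>\<open>S\<close> as a function of the sequence of sites to the right of the origin, so
  that a site can be put in front.\<close>

definition Sq :: "(nat \<Rightarrow> real) \<Rightarrow> real" where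
  "Sq \<sigma> = enn2real (inverse (\<Sum>k. ennreal (\<Prod>j<k. odds (\<sigma> j))))"

lemma Sq_measurable [measurable]: "Sq \<in> borel_measurable seq_law"
  unfolding Sq_def by measurable

lemma S_eq_Sq: "S \<omega> = Sq (\<lambda>j. \<omega> (int j + 1))"
proof -
  have "(\<Prod>j=1..k. rho \<omega> (int j)) = (\<Prod>j<k. odds (\<omega> (int j + 1)))" for k
    unfolding One_nat_def prod.atLeast1_atMost_eq by (simp add: rho_def odds_def add.commute)
  then show ?thesis by (simp add: S_def Sq_def)
qed

lemma Sq_01: "0 \<le> Sq \<sigma>" "Sq \<sigma> \<le> 1"
proof -
  let ?f = "\<lambda>k. ennreal (\<Prod>j<k. odds (\<sigma> j))"
  have "(\<Sum>k<1. ?f k) \<le> (\<Sum>k. ?f k)" by (rule sum_le_suminf) auto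
  then have "1 \<le> (\<Sum>k. ?f k)" by simp
  then have "1 * inverse (\<Sum>k. ?f k) \<le> (\<Sum>k. ?f k) * inverse (\<Sum>k. ?f k)" by (intro mult_right_mono) auto
  also have "\<dots> \<le> 1"
  proof (cases "\<Sum>k. ?f k")
    case (real r)
    then show ?thesis
      by (cases "r = 0") (auto simp: inverse_ennreal ennreal_mult[symmetric])
  qed (auto simp: top_unique)
  finally have "inverse (\<Sum>k. ?f k) \<le> 1" by simp
  then have "Sq \<sigma> \<le> enn2real 1" unfolding Sq_def by (intro enn2real_mono) auto
  then show "0 \<le> Sq \<sigma>" "Sq \<sigma> \<le> 1" by (auto simp: Sq_def)
qed

lemma inv_law_nonneg: "0 \<le> inv_law \<mu> u"
  unfolding inv_law_def S_eq_Sq using Sq_01 by (intro integral_nonneg_AE AE_I2 mult_nonneg_nonneg) auto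

lemma ennreal_inv_law: "ennreal (inv_law \<mu> u) = (\<integral>\<^sup>+\<sigma>. ennreal (Sq \<sigma> * (1 - Sq \<sigma>) ^ u) \<partial>seq_law)"
proof -
  have inj: "inj (\<lambda>j. int j + 1)" by (auto simp: inj_def)
  interpret S: prob_space seq_law by (rule prob_space_seq_law)
  have m: "(\<lambda>\<sigma>. Sq \<sigma> * (1 - Sq \<sigma>) ^ u) \<in> borel_measurable seq_law" by measurable
  have "inv_law \<mu> u = (\<integral>\<sigma>. Sq \<sigma> * (1 - Sq \<sigma>) ^ u \<partial>distr (env_law \<mu>) seq_law (\<lambda>\<omega> j. \<omega> (int j + 1)))"
    unfolding inv_law_def S_eq_Sq by (rule integral_distr[symmetric, OF measurable_env_law_seq m])
  also have "\<dots> = (\<integral>\<sigma>. Sq \<sigma> * (1 - Sq \<sigma>) ^ u \<partial>seq_law)"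
    unfolding distr_env_law_seq[OF inj] ..
  finally have "inv_law \<mu> u = (\<integral>\<sigma>. Sq \<sigma> * (1 - Sq \<sigma>) ^ u \<partial>seq_law)" .
  moreover have "integrable seq_law (\<lambda>\<sigma>. Sq \<sigma> * (1 - Sq \<sigma>) ^ u)"
  proof (rule finite_measure.integrable_const_bound[where B = 1, OF prob_space.finite_measure[OF prob_space_seq_law] _ m])
    show "AE \<sigma> in seq_law. norm (Sq \<sigma> * (1 - Sq \<sigma>) ^ u) \<le> 1"
      using Sq_01 by (intro AE_I2) (auto simp: abs_mult power_abs intro!: mult_le_one power_le_one)
  qed
  ultimately show ?thesis
    using Sq_01 by (subst nn_integral_eq_integral) (auto intro!: AE_I2 mult_nonneg_nonneg)
qed

text \<open>The sum Z = 1 / S of the products of odds exceeds 1, and putting a site a in front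
  replaces it by 1 plus the odds of a times Z.\<close>

lemma Sq_summable:
  assumes \<sigma>: "\<And>j. 0 < \<sigma> j \<and> \<sigma> j < 1" and sum: "summable (\<lambda>k. \<Prod>j<k. odds (\<sigma> j))" and a: "0 < a" "a < 1"
  shows "0 < Sq \<sigma>" "Sq \<sigma> < 1" "Sq (case_nat a \<sigma>) = a * Sq \<sigma> / (1 - a + a * Sq \<sigma>)"
proof -
  let ?f = "\<lambda>k. \<Prod>j<k. odds (\<sigma> j)"
  define Z where "Z = (\<Sum>k. ?f k)"
  have pos: "0 < odds (\<sigma> j)" for j using \<sigma>[of j] odds_pos by auto
  have f0: "0 \<le> ?f k" for k using pos by (intro prod_nonneg) (auto simp: less_imp_le)
  have inv: "enn2real (inverse (\<Sum>k. ennreal (g k))) = 1 / z" if "g sums z" "\<And>k. 0 \<le> g k" "0 < z" for g z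
    using that by (subst suminf_ennreal_eq) (auto simp: inverse_ennreal divide_inverse)
  have "(\<Sum>k<2. ?f k) \<le> Z" unfolding Z_def using sum f0 by (intro sum_le_suminf) auto
  then have "1 + odds (\<sigma> 0) \<le> Z" by (simp add: numeral_2_eq_2)
  with pos[of 0] have Z: "1 < Z" by linarith
  have sZ: "?f sums Z" unfolding Z_def using sum by (rule summable_sums)
  have S: "Sq \<sigma> = 1 / Z" unfolding Sq_def using Z by (intro inv sZ f0) auto
  show "0 < Sq \<sigma>" "Sq \<sigma> < 1" using Z by (auto simp: S)
  let ?g = "\<lambda>k. \<Prod>j<k. odds (case_nat a \<sigma> j)"
  have gS: "?g (Suc k) = odds a * ?f k" for k by (subst prod.lessThan_Suc_shift) simp
  have "(\<lambda>k. ?g (Suc k)) sums (odds a * Z)" unfolding gS by (intro sums_mult sZ)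
  from sums_Suc[OF this] have "?g sums (odds a * Z + 1)" by simp
  moreover have "0 \<le> ?g k" for k
    using pos odds_pos[OF a] by (intro prod_nonneg) (auto simp: less_imp_le split: nat.split)
  moreover have "0 < odds a * Z + 1" using odds_pos[OF a] Z by (intro add_nonneg_pos mult_nonneg_nonneg) auto
  ultimately have "Sq (case_nat a \<sigma>) = 1 / (odds a * Z + 1)" unfolding Sq_def by (rule inv)
  also have "\<dots> = a * Sq \<sigma> / (1 - a + a * Sq \<sigma>)"
    using a Z by (simp add: S odds_def field_simps)
  finally show "Sq (case_nat a \<sigma>) = a * Sq \<sigma> / (1 - a + a * Sq \<sigma>)" .
qed

end

context transient_site
begin

text \<open>Given the environment the invariant law is geometric with parameter S, which is positive
  because the series converges almost surely.\<close>

lemma nn_sum_inv_law: "(\<Sum>u. ennreal (inv_law \<mu> u)) = 1"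
proof -
  have "(\<Sum>u. ennreal (inv_law \<mu> u)) = (\<integral>\<^sup>+\<sigma>. (\<Sum>u. ennreal (Sq \<sigma> * (1 - Sq \<sigma>) ^ u)) \<partial>seq_law)"
    unfolding ennreal_inv_law by (subst nn_integral_suminf) auto
  also have "\<dots> = (\<integral>\<^sup>+\<sigma>. 1 \<partial>seq_law)"
  proof (rule nn_integral_cong_AE)
    show "AE \<sigma> in seq_law. (\<Sum>u. ennreal (Sq \<sigma> * (1 - Sq \<sigma>) ^ u)) = 1"
      using AE_summable_prod_odds
    proof (rule AE_mp, intro AE_I2 impI)
      fix \<sigma> assume s: "\<sigma> \<in> space seq_law" and sum: "summable (\<lambda>k. \<Prod>j<k. odds (\<sigma> j))"
      have S: "0 < Sq \<sigma>" "Sq \<sigma> < 1" using Sq_summable(1,2)[of \<sigma> "1 / 2", OF seq_range[OF s] sum] by auto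
      have "(\<lambda>u. Sq \<sigma> * (1 - Sq \<sigma>) ^ u) sums (Sq \<sigma> * (1 / (1 - (1 - Sq \<sigma>))))"
        using S by (intro sums_mult geometric_sums) auto
      then have "(\<lambda>u. Sq \<sigma> * (1 - Sq \<sigma>) ^ u) sums 1" using S by simp
      then show "(\<Sum>u. ennreal (Sq \<sigma> * (1 - Sq \<sigma>) ^ u)) = 1"
        using S by (subst suminf_ennreal_eq) auto
    qed
  qed
  also have "\<dots> = 1" using prob_space.emeasure_space_1[OF prob_space_seq_law] by simp
  finally show ?thesis .
qed

definition inv_pmf :: "nat pmf" where "inv_pmf = embed_pmf (inv_law \<mu>)"

lemma pmf_inv_pmf: "pmf inv_pmf u = inv_law \<mu> u"
  unfolding inv_pmf_def
  by (rule pmf_embed_pmf) (use inv_law_nonneg nn_sum_inv_law in \<open>auto simp: nn_integral_count_space_nat\<close>)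

lemma nn_integral_inv_pmf: "(\<integral>\<^sup>+u. F u \<partial>inv_pmf) = (\<Sum>u. ennreal (inv_law \<mu> u) * F u)"
  by (simp add: nn_integral_measure_pmf pmf_inv_pmf nn_integral_count_space_nat)

text \<open>A geometric law of parameter S followed by the negative binomial step with site value a
  is again geometric, with the parameter of the environment in which a has been put in front. That
  environment has the same law as the old one.\<close>

lemma inv_pmf_stationary: "bind_pmf inv_pmf KQ = inv_pmf"
proof (rule pmf_eqI)
  fix v
  let ?q = "\<lambda>u a. ennreal (real ((u + v) choose v) * (a ^ (u + 1) * (1 - a) ^ v))"
  let ?s = "\<lambda>u \<sigma>. ennreal (Sq \<sigma> * (1 - Sq \<sigma>) ^ u)"
  have mq: "?q u \<in> borel_measurable \<mu>" for u by (rule measurable_site) measurable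
  have ms [measurable]: "?s u \<in> borel_measurable seq_law" for u by measurable
  have sf: "sigma_finite_measure seq_law"
    by (rule prob_space_imp_sigma_finite[OF prob_space_seq_law])
  have mm: "(\<lambda>a. \<integral>\<^sup>+\<sigma>. ?q u a * ?s u \<sigma> \<partial>seq_law) \<in> borel_measurable \<mu>" for u
    by (simp add: nn_integral_cmult mq)
  have "ennreal (pmf (bind_pmf inv_pmf KQ) v) = (\<Sum>u. ennreal (inv_law \<mu> u) * ennreal (Q \<mu> u v))"
    unfolding ennreal_pmf_bind nn_integral_inv_pmf pmf_KQ ..
  also have "\<dots> = (\<Sum>u. \<integral>\<^sup>+a. \<integral>\<^sup>+\<sigma>. ?q u a * ?s u \<sigma> \<partial>seq_law \<partial>\<mu>)"
    unfolding ennreal_inv_law ennreal_Q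
    by (subst nn_integral_cmult[OF ms], subst nn_integral_multc[OF mq]) (simp only: mult.commute)
  also have "\<dots> = (\<integral>\<^sup>+a. (\<Sum>u. \<integral>\<^sup>+\<sigma>. ?q u a * ?s u \<sigma> \<partial>seq_law) \<partial>\<mu>)"
    by (rule nn_integral_suminf[symmetric]) (rule mm)
  also have "\<dots> = (\<integral>\<^sup>+a. \<integral>\<^sup>+\<sigma>. ennreal (Sq (case_nat a \<sigma>) * (1 - Sq (case_nat a \<sigma>)) ^ v) \<partial>seq_law \<partial>\<mu>)"
  proof (rule nn_integral_cong)
    fix a assume "a \<in> space \<mu>"
    then have a: "0 < a" "a < 1" using site_range by auto
    have "(\<Sum>u. \<integral>\<^sup>+\<sigma>. ?q u a * ?s u \<sigma> \<partial>seq_law) = (\<integral>\<^sup>+\<sigma>. (\<Sum>u. ?q u a * ?s u \<sigma>) \<partial>seq_law)"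
      by (rule nn_integral_suminf[symmetric]) measurable
    also have "\<dots> = (\<integral>\<^sup>+\<sigma>. ennreal (Sq (case_nat a \<sigma>) * (1 - Sq (case_nat a \<sigma>)) ^ v) \<partial>seq_law)"
    proof (rule nn_integral_cong_AE)
      show "AE \<sigma> in seq_law. (\<Sum>u. ?q u a * ?s u \<sigma>) = ennreal (Sq (case_nat a \<sigma>) * (1 - Sq (case_nat a \<sigma>)) ^ v)"
        using AE_summable_prod_odds
      proof (rule AE_mp, intro AE_I2 impI)
        fix \<sigma> assume s: "\<sigma> \<in> space seq_law" and sum: "summable (\<lambda>k. \<Prod>j<k. odds (\<sigma> j))"
        define x where "x = Sq \<sigma>"
        note S = Sq_summable[of \<sigma> a, OF seq_range[OF s] sum a, folded x_def]
        have y: "0 \<le> (1 - x) * a" "(1 - x) * a < 1"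
          using S a mult_strict_mono[of "1 - x" 1 a 1] by auto
        have d: "0 < 1 - a + a * x" using a S by (intro add_pos_pos) auto
        have "(\<lambda>u. (x * a * (1 - a) ^ v) * (real ((v + u) choose u) * ((1 - x) * a) ^ u)) sums ((x * a * (1 - a) ^ v) * (1 / (1 - (1 - x) * a) ^ Suc v))"
          by (intro sums_mult neg_binomial_sums y)
        also have "(x * a * (1 - a) ^ v) * (1 / (1 - (1 - x) * a) ^ Suc v) = Sq (case_nat a \<sigma>) * (1 - Sq (case_nat a \<sigma>)) ^ v"
        proof -
          have e1: "1 - (1 - x) * a = 1 - a + a * x" by (simp add: algebra_simps)
          have e2: "1 - Sq (case_nat a \<sigma>) = (1 - a) / (1 - a + a * x)"
            using d by (simp add: S(3) field_simps)
          show ?thesis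
            unfolding e1 e2 unfolding S(3) using d by (simp add: power_divide mult.commute)
        qed
        finally have sums: "(\<lambda>u. (x * a * (1 - a) ^ v) * (real ((v + u) choose u) * ((1 - x) * a) ^ u)) sums (Sq (case_nat a \<sigma>) * (1 - Sq (case_nat a \<sigma>)) ^ v)" .
        have "?q u a * ?s u \<sigma> = ennreal ((x * a * (1 - a) ^ v) * (real ((v + u) choose u) * ((1 - x) * a) ^ u))" for u
        proof -
          \<comment> \<open>\<open>Q\<close> is summed over its first argument here, so u and v
            exchange their roles in \<open>neg_binomial_sums\<close>.\<close>
          have "(u + v) choose v = (v + u) choose u"
            using binomial_symmetric[of v "u + v"] by (simp add: add.commute)
          then show ?thesis
            using a S by (subst ennreal_mult[symmetric]) (auto simp: x_def[symmetric] power_mult_distrib mult_ac)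
        qed
        then show "(\<Sum>u. ?q u a * ?s u \<sigma>) = ennreal (Sq (case_nat a \<sigma>) * (1 - Sq (case_nat a \<sigma>)) ^ v)"
          using sums a S by (simp, subst suminf_ennreal_eq) auto
      qed
    qed
    finally show "(\<Sum>u. \<integral>\<^sup>+\<sigma>. ?q u a * ?s u \<sigma> \<partial>seq_law) = (\<integral>\<^sup>+\<sigma>. ennreal (Sq (case_nat a \<sigma>) * (1 - Sq (case_nat a \<sigma>)) ^ v) \<partial>seq_law)" .
  qed
  also have "\<dots> = (\<integral>\<^sup>+\<sigma>. ennreal (Sq \<sigma> * (1 - Sq \<sigma>) ^ v) \<partial>seq_law)"
    by (rule nn_integral_seq_law[symmetric]) (rule ms)
  also have "\<dots> = ennreal (pmf inv_pmf v)"
    by (simp add: pmf_inv_pmf ennreal_inv_law)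
  finally show "pmf (bind_pmf inv_pmf KQ) v = pmf inv_pmf v"
    by simp
qed

sublocale pos_chain KQ inv_pmf
  by standard (auto simp: pmf_KQ Q_pos inv_pmf_stationary)

lemma pmf_pair: "pmf pair (u, v) = inv_pair \<mu> u v"
proof -
  have "pmf pair (u, v) = (\<integral>u'. pmf (map_pmf (Pair u') (KQ u')) (u, v) \<partial>inv_pmf)"
    unfolding pair_def by (rule pmf_bind)
  also have "\<dots> = (\<integral>u'. pmf (KQ u) v * indicator {u} u' \<partial>inv_pmf)"
  proof (rule Bochner_Integration.integral_cong[OF refl])
    fix u'
    show "pmf (map_pmf (Pair u') (KQ u')) (u, v) = pmf (KQ u) v * indicator {u} u'"
    proof (cases "u' = u")
      case True
      then show ?thesis using pmf_map_inj'[of "Pair u" "KQ u" v] by (simp add: inj_def)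
    next
      case False
      then show ?thesis by (auto simp: indicator_def pmf_eq_0_set_pmf)
    qed
  qed
  also have "\<dots> = inv_pair \<mu> u v"
    by (simp add: measure_pmf_single pmf_inv_pmf pmf_KQ inv_pair_def)
  finally show ?thesis .
qed

end

section \<open>Generating functions\<close>

text \<open>At the lowest index where the coefficients differ, dividing by the power of x leaves a
  constant term bounded by a multiple of x, which is impossible for small x.\<close>

lemma power_series_coeffs_eq:
  fixes c d :: "nat \<Rightarrow> real"
  assumes c: "summable c" and d: "summable d" and nn: "\<And>k. 0 \<le> c k" "\<And>k. 0 \<le> d k"
    and eq: "\<And>x. 0 < x \<Longrightarrow> x \<le> 1 \<Longrightarrow> (\<Sum>k. c k * x ^ k) = (\<Sum>k. d k * x ^ k)"
  shows "c k = d k"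
proof (rule ccontr)
  assume "c k \<noteq> d k"
  define e where "e k = c k - d k" for k
  have ex: "\<exists>m. e m \<noteq> 0" using \<open>c k \<noteq> d k\<close> by (auto simp: e_def)
  define m where "m = (LEAST m. e m \<noteq> 0)"
  have em: "e m \<noteq> 0" unfolding m_def by (rule LeastI_ex[OF ex])
  have below: "e j = 0" if "j < m" for j using not_less_Least[of j "\<lambda>m. e m \<noteq> 0"] that by (auto simp: m_def)
  define b where "b j = e (j + m)" for j
  have sum_abs: "summable (\<lambda>k. \<bar>e k\<bar>)"
  proof (rule summable_comparison_test')
    show "summable (\<lambda>k. c k + d k)" by (intro summable_add c d)
    show "norm \<bar>e k\<bar> \<le> c k + d k" if "k \<ge> 0" for k using nn[of k] by (auto simp: e_def abs_le_iff)
  qed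
  then have b: "summable (\<lambda>j. \<bar>b j\<bar>)" unfolding b_def by (subst summable_iff_shift)
  have pw: "summable (\<lambda>k. f k * x ^ k)" if "summable (\<lambda>k. \<bar>f k\<bar>)" "0 \<le> x" "x \<le> 1" for f :: "nat \<Rightarrow> real" and x
  proof (rule summable_comparison_test'[OF that(1)])
    show "norm (f k * x ^ k) \<le> \<bar>f k\<bar>" if "k \<ge> 0" for k
      using \<open>0 \<le> x\<close> \<open>x \<le> 1\<close> by (auto simp: abs_mult power_abs intro!: mult_left_le power_le_one)
  qed
  have zero: "(\<Sum>j. b j * x ^ j) = 0" if x: "0 < x" "x \<le> 1" for x
  proof -
    have cs: "summable (\<lambda>k. c k * x ^ k)" "summable (\<lambda>k. d k * x ^ k)"
      using c d nn x by (auto intro!: pw)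
    have "0 = (\<Sum>k. e k * x ^ k)"
      using eq[OF x] suminf_diff[OF cs] by (simp add: e_def left_diff_distrib)
    also have "\<dots> = (\<Sum>j. e (j + m) * x ^ (j + m)) + (\<Sum>j<m. e j * x ^ j)"
      using x by (intro suminf_split_initial_segment pw sum_abs) auto
    also have "(\<Sum>j<m. e j * x ^ j) = 0" by (simp add: below)
    also have "(\<Sum>j. e (j + m) * x ^ (j + m)) = x ^ m * (\<Sum>j. b j * x ^ j)"
      using x pw[OF b, of x] by (subst suminf_mult[symmetric]) (auto simp: b_def power_add mult_ac)
    finally show ?thesis using x by simp
  qed
  have bS: "summable (\<lambda>j. \<bar>b (Suc j)\<bar>)"
    using b summable_Suc_iff[of "\<lambda>j. \<bar>b j\<bar>"] by simp
  have small: "\<bar>b 0\<bar> \<le> x * (\<Sum>j. \<bar>b (Suc j)\<bar>)" if x: "0 < x" "x \<le> 1" for x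
  proof -
    have "0 = b 0 + (\<Sum>j. b (Suc j) * x ^ Suc j)"
      using zero[OF x] suminf_split_head[OF pw[OF b, of x]] x by simp
    then have "b 0 = - (\<Sum>j. b (Suc j) * x ^ Suc j)" by linarith
    then have "\<bar>b 0\<bar> = \<bar>\<Sum>j. b (Suc j) * x ^ Suc j\<bar>" by simp
    also have s1: "summable (\<lambda>j. \<bar>b (Suc j) * x ^ Suc j\<bar>)"
    proof (rule summable_comparison_test')
      show "summable (\<lambda>j. \<bar>b (Suc j)\<bar>)" by (rule bS)
      show "norm \<bar>b (Suc j) * x ^ Suc j\<bar> \<le> \<bar>b (Suc j)\<bar>" if "j \<ge> 0" for j
        using x power_le_one[of x "Suc j"] by (auto simp: abs_mult simp del: power_Suc intro!: mult_left_le)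
    qed
    have "\<bar>\<Sum>j. b (Suc j) * x ^ Suc j\<bar> \<le> (\<Sum>j. \<bar>b (Suc j) * x ^ Suc j\<bar>)"
      by (rule summable_rabs[OF s1])
    also have "\<dots> \<le> (\<Sum>j. x * \<bar>b (Suc j)\<bar>)"
    proof (rule suminf_le[OF _ s1])
      show "\<bar>b (Suc j) * x ^ Suc j\<bar> \<le> x * \<bar>b (Suc j)\<bar>" for j
        using x power_le_one[of x j] by (auto simp: abs_mult power_abs mult_ac intro!: mult_left_mono mult_left_le_one_le)
      show "summable (\<lambda>j. x * \<bar>b (Suc j)\<bar>)"
        by (intro summable_mult bS)
    qed
    also have "\<dots> = x * (\<Sum>j. \<bar>b (Suc j)\<bar>)"
      by (intro suminf_mult bS)
    finally show ?thesis .
  qed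
  define T where "T = (\<Sum>j. \<bar>b (Suc j)\<bar>)"
  have T: "0 \<le> T" unfolding T_def by (intro suminf_nonneg bS) auto
  \<comment> \<open>Makes x times the sum T of the higher coefficients at most half of the leading
    one.\<close>
  define x where "x = min 1 (\<bar>b 0\<bar> / (2 * (T + 1)))"
  have b0: "0 < \<bar>b 0\<bar>" using em by (simp add: b_def)
  have x: "0 < x" "x \<le> 1" using b0 T by (auto simp: x_def)
  have "\<bar>b 0\<bar> \<le> x * T" using small[OF x] by (simp add: T_def)
  also have "\<dots> \<le> \<bar>b 0\<bar> / (2 * (T + 1)) * (T + 1)" using T x by (intro mult_mono) (auto simp: x_def)
  also have "\<dots> = \<bar>b 0\<bar> / 2" using T by (simp add: field_simps)
  finally show False using b0 by simp
qed

lemma power_series_coeffs_eq_ennreal: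
  fixes c d :: "nat \<Rightarrow> ennreal"
  assumes c: "(\<Sum>k. c k) < \<infinity>" and d: "(\<Sum>k. d k) < \<infinity>"
    and eq: "\<And>x. 0 < x \<Longrightarrow> x \<le> 1 \<Longrightarrow> (\<Sum>k. c k * ennreal (x ^ k)) = (\<Sum>k. d k * ennreal (x ^ k))"
  shows "c k = d k"
proof -
  have fin: "f k < \<infinity>" if "(\<Sum>k. f k) < \<infinity>" for f :: "nat \<Rightarrow> ennreal" and k
    using that ennreal_suminf_lessD by blast
  define c' d' where "c' k = enn2real (c k)" and "d' k = enn2real (d k)" for k
  have cc: "c k = ennreal (c' k)" "d k = ennreal (d' k)" for k
    using fin[OF c, of k] fin[OF d, of k] by (simp_all add: c'_def d'_def)
  have nn: "0 \<le> c' k" "0 \<le> d' k" for k by (simp_all add: c'_def d'_def)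
  have cc_fun: "(\<lambda>k. ennreal (c' k)) = c" "(\<lambda>k. ennreal (d' k)) = d"
    by (rule ext, rule cc(1)[symmetric], rule ext, rule cc(2)[symmetric])
  have sc: "summable c'" "summable d'"
    by (rule summable_suminf_not_top[OF nn(1)], use c in \<open>simp add: cc_fun\<close>)
       (rule summable_suminf_not_top[OF nn(2)], use d in \<open>simp add: cc_fun\<close>)
  have ser: "(\<Sum>k. ennreal (f k) * ennreal (x ^ k)) = ennreal (\<Sum>k. f k * x ^ k)" and ser0: "0 \<le> (\<Sum>k. f k * x ^ k)"
    if "summable f" "\<And>k. 0 \<le> f k" "0 < x" "x \<le> 1" for f x
  proof -
    have "summable (\<lambda>k. f k * x ^ k)"
    proof (rule summable_comparison_test'[OF that(1)])
      show "norm (f k * x ^ k) \<le> f k" if "k \<ge> 0" for k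
        using \<open>0 < x\<close> \<open>x \<le> 1\<close> \<open>\<And>k. 0 \<le> f k\<close> by (auto simp: abs_mult power_abs intro!: mult_left_le power_le_one)
    qed
    then show "(\<Sum>k. ennreal (f k) * ennreal (x ^ k)) = ennreal (\<Sum>k. f k * x ^ k)" "0 \<le> (\<Sum>k. f k * x ^ k)"
      using that by (auto simp: ennreal_mult[symmetric] suminf_ennreal2 intro!: suminf_nonneg)
  qed
  have "c' k = d' k"
  proof (rule power_series_coeffs_eq[OF sc nn])
    fix x :: real assume x: "0 < x" "x \<le> 1"
    from eq[OF x] show "(\<Sum>k. c' k * x ^ k) = (\<Sum>k. d' k * x ^ k)"
      unfolding cc using ser[OF sc(1) nn(1) x] ser[OF sc(2) nn(2) x]
        ser0[OF sc(1) nn(1) x] ser0[OF sc(2) nn(2) x] by simp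
  qed
  then show ?thesis by (simp only: cc)
qed

text \<open>Coordinates are identified one at a time: the first \<open>j\<close> through indicators, the rest through
  generating functions.\<close>

lemma generating_function_unique:
  fixes N1 :: "'a measure" and N2 :: "'b measure" and L1 :: "nat \<Rightarrow> 'a \<Rightarrow> nat" and L2 :: "nat \<Rightarrow> 'b \<Rightarrow> nat"
  assumes fin: "emeasure N1 (space N1) < \<infinity>" "emeasure N2 (space N2) < \<infinity>"
    and meas [measurable]: "\<And>i. L1 i \<in> N1 \<rightarrow>\<^sub>M count_space UNIV" "\<And>i. L2 i \<in> N2 \<rightarrow>\<^sub>M count_space UNIV"
    and eq: "\<And>s. (\<And>i. 0 < s i \<and> s i \<le> 1) \<Longrightarrow>
        (\<integral>\<^sup>+\<omega>. ennreal (\<Prod>i<n. s i ^ L1 i \<omega>) \<partial>N1) = (\<integral>\<^sup>+\<omega>. ennreal (\<Prod>i<n. s i ^ L2 i \<omega>) \<partial>N2)"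
  shows "emeasure N1 {\<omega>\<in>space N1. \<forall>i<n. L1 i \<omega> = l i} = emeasure N2 {\<omega>\<in>space N2. \<forall>i<n. L2 i \<omega> = l i}"
proof -
  define w where "w j s (L :: nat \<Rightarrow> nat) = (\<Prod>i<n. if i < j then of_bool (L i = l i) else s i ^ L i)" for j and s :: "nat \<Rightarrow> real" and L
  have w01: "0 \<le> w j s L" "w j s L \<le> 1" if "\<And>i. 0 < s i \<and> s i \<le> 1" for j s L
    unfolding w_def using that by (auto intro!: prod_nonneg prod_le_1 power_le_one simp: less_imp_le)
  have main: "(\<integral>\<^sup>+\<omega>. ennreal (w j s (\<lambda>i. L1 i \<omega>)) \<partial>N1) = (\<integral>\<^sup>+\<omega>. ennreal (w j s (\<lambda>i. L2 i \<omega>)) \<partial>N2)"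
    if "j \<le> n" and s: "\<And>i. 0 < s i \<and> s i \<le> 1" for j s
    using that
  proof (induction j arbitrary: s)
    case 0
    then show ?case using eq[of s] by (simp add: w_def)
  next
    case (Suc j)
    then have j: "j < n" by simp
    define v where "v L = (\<Prod>i\<in>{..<n} - {j}. if i < j then of_bool (L i = l i) else s i ^ L i)" for L :: "nat \<Rightarrow> nat"
    have v01: "0 \<le> v L" "v L \<le> 1" for L
    proof -
      have f: "0 \<le> (if i < j then of_bool (L i = l i) else s i ^ L i)" "(if i < j then of_bool (L i = l i) else s i ^ L i) \<le> 1" for i
        using Suc.prems(2)[of i] by (auto intro!: power_le_one simp: less_imp_le)
      show "0 \<le> v L" "v L \<le> 1"
        unfolding v_def using f by (auto intro!: prod_nonneg prod_le_1 simp del: if_split_asm)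
    qed
    have wv: "w j (s(j := x)) L = x ^ L j * v L" for x L
    proof -
      have "(\<Prod>i\<in>{..<n} - {j}. if i < j then of_bool (L i = l i) else (s(j := x)) i ^ L i) = v L"
        unfolding v_def by (rule prod.cong) auto
      then show ?thesis unfolding w_def using j by (subst prod.remove[of _ j]) auto
    qed
    have wS: "w (Suc j) s L = of_bool (L j = l j) * v L" for L
    proof -
      have "(\<Prod>i\<in>{..<n} - {j}. if i < Suc j then of_bool (L i = l i) else s i ^ L i) = v L"
        unfolding v_def by (rule prod.cong) auto
      then show ?thesis unfolding w_def using j by (subst prod.remove[of _ j]) auto
    qed
    \<comment> \<open>Varying the weight of coordinate j alone gives a power series in x; its
      coefficients carry an indicator at j in place of the power.\<close>
    have expand: "(\<integral>\<^sup>+\<omega>. ennreal (w j (s(j := x)) (\<lambda>i. L i \<omega>)) \<partial>N) = (\<Sum>k. (\<integral>\<^sup>+\<omega>. ennreal (of_bool (L j \<omega> = k) * v (\<lambda>i. L i \<omega>)) \<partial>N) * ennreal (x ^ k))"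
      if [measurable]: "\<And>i. L i \<in> N \<rightarrow>\<^sub>M count_space UNIV" and x: "0 < x" "x \<le> 1" for N :: "'c measure" and L :: "nat \<Rightarrow> 'c \<Rightarrow> nat" and x
    proof -
      have [measurable]: "(\<lambda>\<omega>. v (\<lambda>i. L i \<omega>)) \<in> borel_measurable N" unfolding v_def by measurable
      have "ennreal (x ^ m * a) = (\<Sum>k. ennreal (of_bool (m = k) * a) * ennreal (x ^ k))" if "0 \<le> a" for m a
        using that x by (subst suminf_finite[of "{m}"]) (auto simp: ennreal_mult[symmetric] mult.commute)
      then have "(\<integral>\<^sup>+\<omega>. ennreal (w j (s(j := x)) (\<lambda>i. L i \<omega>)) \<partial>N) = (\<integral>\<^sup>+\<omega>. (\<Sum>k. ennreal (of_bool (L j \<omega> = k) * v (\<lambda>i. L i \<omega>)) * ennreal (x ^ k)) \<partial>N)"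
        unfolding wv using v01 by simp
      also have "\<dots> = (\<Sum>k. (\<integral>\<^sup>+\<omega>. ennreal (of_bool (L j \<omega> = k) * v (\<lambda>i. L i \<omega>)) * ennreal (x ^ k) \<partial>N))"
        by (rule nn_integral_suminf) measurable
      also have "\<dots> = (\<Sum>k. (\<integral>\<^sup>+\<omega>. ennreal (of_bool (L j \<omega> = k) * v (\<lambda>i. L i \<omega>)) \<partial>N) * ennreal (x ^ k))"
        by (intro suminf_cong nn_integral_multc) measurable
      finally show ?thesis .
    qed
    have finite_sum: "(\<Sum>k. (\<integral>\<^sup>+\<omega>. ennreal (of_bool (L j \<omega> = k) * v (\<lambda>i. L i \<omega>)) \<partial>N)) < \<infinity>"
      if [measurable]: "\<And>i. L i \<in> N \<rightarrow>\<^sub>M count_space UNIV" and f: "emeasure N (space N) < \<infinity>" for N :: "'c measure" and L :: "nat \<Rightarrow> 'c \<Rightarrow> nat"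
    proof -
      have "(\<Sum>k. (\<integral>\<^sup>+\<omega>. ennreal (of_bool (L j \<omega> = k) * v (\<lambda>i. L i \<omega>)) \<partial>N)) = (\<integral>\<^sup>+\<omega>. ennreal (w j (s(j := 1)) (\<lambda>i. L i \<omega>)) \<partial>N)"
        by (subst expand) auto
      also have "\<dots> \<le> (\<integral>\<^sup>+\<omega>. 1 \<partial>N)"
        using w01[of "s(j := 1)"] Suc.prems(2) by (intro nn_integral_mono) (auto intro!: ennreal_le_1[THEN iffD2])
      also have "\<dots> < \<infinity>" using f by simp
      finally show ?thesis .
    qed
    have "(\<integral>\<^sup>+\<omega>. ennreal (of_bool (L1 j \<omega> = l j) * v (\<lambda>i. L1 i \<omega>)) \<partial>N1) = (\<integral>\<^sup>+\<omega>. ennreal (of_bool (L2 j \<omega> = l j) * v (\<lambda>i. L2 i \<omega>)) \<partial>N2)"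
    proof (rule power_series_coeffs_eq_ennreal[of
        "\<lambda>k. \<integral>\<^sup>+\<omega>. ennreal (of_bool (L1 j \<omega> = k) * v (\<lambda>i. L1 i \<omega>)) \<partial>N1" "\<lambda>k. \<integral>\<^sup>+\<omega>. ennreal (of_bool (L2 j \<omega> = k) * v (\<lambda>i. L2 i \<omega>)) \<partial>N2"])
      show "(\<Sum>k. (\<integral>\<^sup>+\<omega>. ennreal (of_bool (L1 j \<omega> = k) * v (\<lambda>i. L1 i \<omega>)) \<partial>N1)) < \<infinity>"
        by (rule finite_sum[OF meas(1) fin(1)])
      show "(\<Sum>k. (\<integral>\<^sup>+\<omega>. ennreal (of_bool (L2 j \<omega> = k) * v (\<lambda>i. L2 i \<omega>)) \<partial>N2)) < \<infinity>"
        by (rule finite_sum[OF meas(2) fin(2)])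
      fix x :: real assume x: "0 < x" "x \<le> 1"
      have "(\<integral>\<^sup>+\<omega>. ennreal (w j (s(j := x)) (\<lambda>i. L1 i \<omega>)) \<partial>N1) = (\<integral>\<^sup>+\<omega>. ennreal (w j (s(j := x)) (\<lambda>i. L2 i \<omega>)) \<partial>N2)"
        using Suc.prems x by (intro Suc.IH) auto
      then show "(\<Sum>k. (\<integral>\<^sup>+\<omega>. ennreal (of_bool (L1 j \<omega> = k) * v (\<lambda>i. L1 i \<omega>)) \<partial>N1) * ennreal (x ^ k)) =
          (\<Sum>k. (\<integral>\<^sup>+\<omega>. ennreal (of_bool (L2 j \<omega> = k) * v (\<lambda>i. L2 i \<omega>)) \<partial>N2) * ennreal (x ^ k))"
        unfolding expand[OF meas(1) x] expand[OF meas(2) x] .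
    qed
    then show ?case unfolding wS .
  qed
  have ind: "(\<integral>\<^sup>+\<omega>. ennreal (w n (\<lambda>_. 1) (\<lambda>i. L i \<omega>)) \<partial>N) = emeasure N {\<omega>\<in>space N. \<forall>i<n. L i \<omega> = l i}"
    if [measurable]: "\<And>i. L i \<in> N \<rightarrow>\<^sub>M count_space UNIV" for N :: "'c measure" and L :: "nat \<Rightarrow> 'c \<Rightarrow> nat"
  proof -
    have "w n (\<lambda>_. 1) L' = of_bool (\<forall>i<n. L' i = l i)" for L'
      unfolding w_def by (cases "\<forall>i<n. L' i = l i") (auto intro!: prod_zero)
    then have "(\<integral>\<^sup>+\<omega>. ennreal (w n (\<lambda>_. 1) (\<lambda>i. L i \<omega>)) \<partial>N) = (\<integral>\<^sup>+\<omega>. indicator {\<omega>\<in>space N. \<forall>i<n. L i \<omega> = l i} \<omega> \<partial>N)"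
      by (intro nn_integral_cong) (auto simp: indicator_def)
    also have "\<dots> = emeasure N {\<omega>\<in>space N. \<forall>i<n. L i \<omega> = l i}"
      by (rule nn_integral_indicator) measurable
    finally show ?thesis .
  qed
  show ?thesis
    using main[of n "\<lambda>_. 1"] unfolding ind[OF meas(1)] ind[OF meas(2)] by simp
qed

subsection \<open>Solving the hitting recursion\<close>

text \<open>Index x + 1 is the expected weight of the passage from x to x + 1: the walk jumps right
  at once, or it pays s x for a left step, returns to x and tries again. Index 0 is the passage from
  -1 to 0, with value r; for the walk it is 1, since negative sites carry no weight and the passage
  is almost surely completed.\<close>

primrec cont_frac :: "(nat \<Rightarrow> real) \<Rightarrow> real \<Rightarrow> (nat \<Rightarrow> real) \<Rightarrow> nat \<Rightarrow> real" where
  "cont_frac s r \<sigma> 0 = r"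
| "cont_frac s r \<sigma> (Suc x) = \<sigma> x / (1 - (1 - \<sigma> x) * (s x * cont_frac s r \<sigma> x))"

lemma cont_frac_01:
  assumes "\<And>x. 0 < \<sigma> x \<and> \<sigma> x < 1" "\<And>x. 0 < s x \<and> s x \<le> 1" "0 < r" "r \<le> 1"
  shows "0 < cont_frac s r \<sigma> x \<and> cont_frac s r \<sigma> x \<le> 1"
proof (induction x)
  case (Suc x)
  define t where "t = s x * cont_frac s r \<sigma> x"
  have t: "0 < t" "t \<le> 1" using Suc assms(2)[of x] by (auto simp: t_def intro!: mult_le_one)
  have "(1 - \<sigma> x) * t \<le> (1 - \<sigma> x) * 1" using t assms(1)[of x] by (intro mult_left_mono) auto
  then have "\<sigma> x \<le> 1 - (1 - \<sigma> x) * t" by simp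
  then show ?case using assms(1)[of x] by (auto simp: t_def[symmetric] divide_le_eq)
qed (use assms in auto)

text \<open>Removing the first site amounts to a new start value; in this form the recursion meets
  that of the chain.\<close>

lemma cont_frac_shift:
  "cont_frac s r \<sigma> (Suc x) = cont_frac (\<lambda>i. s (Suc i)) (\<sigma> 0 / (1 - (1 - \<sigma> 0) * (s 0 * r))) (\<lambda>i. \<sigma> (Suc i)) x"
  by (induction x) simp_all

declare cont_frac.simps(2) [simp del]

text \<open>The product \<open>H\<close> of continued fractions and the limit \<open>l\<close> of
  \<open>hit_gf\<close> solve the same recursion with the same value at n. Their difference
  \<open>D\<close> lies between 0 and 1 up to n, and its increment at a site is at most the odds
  times the increment one site further left. Iterating brings in the products of
  \<open>lim0\<close>, so \<open>D\<close> vanishes next to n and then, by the recursion, everywhere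
  to the left.\<close>

lemma hit_gf_limit:
  assumes env: "\<And>x. 0 < \<omega> x" "\<And>x. \<omega> x < 1" and s01: "\<And>x. 0 < s x" "\<And>x. s x \<le> 1"
    and lim0: "(\<lambda>k. \<Prod>j<k. (1 - \<omega> (int n - 1 - int j)) / \<omega> (int n - 1 - int j)) \<longlonglongrightarrow> 0"
  shows "(\<lambda>m. hit_gf \<omega> s n m 0) \<longlonglongrightarrow> (\<Prod>y<n. cont_frac s 1 (\<lambda>i. \<omega> (int i)) (Suc y))"
proof -
  let ?g = "cont_frac s 1 (\<lambda>i. \<omega> (int i))"
  let ?h = "hit_gf \<omega> s n"
  have g01: "0 < ?g x" "?g x \<le> 1" for x
    using cont_frac_01[of "\<lambda>i. \<omega> (int i)" s 1 x] env s01 by auto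
  have h0: "0 \<le> ?h t x" and h1: "?h t x \<le> 1" for t x
    using hit_gf_nonneg[OF env s01] hit_gf_le_1[OF env s01] by auto
  note sw = step_weight_01[where s = s, OF env s01]
  \<comment> \<open>\<open>nat\<close> sends negative sites to 0, so \<open>H\<close> is constant
    there, as it must be where steps carry no weight.\<close>
  define H where "H x = (\<Prod>y\<in>{nat x..<n}. ?g (Suc y))" for x :: int
  have H01: "0 < H x" "H x \<le> 1" for x
    unfolding H_def using g01 by (auto intro!: prod_pos prod_le_1 simp: less_imp_le)
  have Hn: "H (int n) = 1" by (simp add: H_def)
  have H: "H x = \<omega> x * H (x + 1) + (1 - \<omega> x) * (step_weight s x (x - 1) * H (x - 1))" if "x < int n" for x
  proof (cases "0 \<le> x")
    case True
    then obtain k where k: "x = int k" using nonneg_int_cases by blast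
    then have kn: "k < n" using that by simp
    have Hx: "H x = ?g (Suc k) * H (x + 1)"
      unfolding H_def k using kn by (simp add: prod.atLeast_Suc_lessThan nat_add_distrib)
    have Hm: "H (x - 1) = ?g k * H x"
    proof (cases k)
      case 0 then show ?thesis by (simp add: H_def k)
    next
      case (Suc k')
      then have "nat (x - 1) = k'" "nat x = Suc k'" using k by auto
      then show ?thesis unfolding H_def using kn Suc by (simp add: prod.atLeast_Suc_lessThan[of k'])
    qed
    have sk: "step_weight s x (x - 1) = s k" by (simp add: step_weight_def k)
    define t where "t = s k * ?g k"
    have t: "0 < t" "t \<le> 1" using g01[of k] s01[of k] by (auto simp: t_def intro!: mult_le_one)
    have "(1 - \<omega> x) * t \<le> (1 - \<omega> x) * 1" using t env[of x] by (intro mult_left_mono) auto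
    then have den: "0 < 1 - (1 - \<omega> x) * t" using env(1)[of x] by simp
    have gk: "?g (Suc k) * (1 - (1 - \<omega> x) * t) = \<omega> x"
      using den by (simp add: t_def k cont_frac.simps)
    have "\<omega> x * H (x + 1) + (1 - \<omega> x) * (step_weight s x (x - 1) * H (x - 1)) = (\<omega> x + (1 - \<omega> x) * t * ?g (Suc k)) * H (x + 1)"
      unfolding sk Hm Hx t_def by (simp add: algebra_simps)
    also have "\<omega> x + (1 - \<omega> x) * t * ?g (Suc k) = ?g (Suc k)"
      using gk by (simp add: algebra_simps)
    finally show ?thesis using Hx by simp
  next
    case False
    then have "nat x = 0" "nat (x + 1) = 0" "nat (x - 1) = 0" by auto
    then show ?thesis using False by (simp add: H_def step_weight_def algebra_simps)
  qed
  have hH: "?h t x \<le> H x" if "x \<le> int n" for t x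
    using that
  proof (induction t arbitrary: x)
    case 0
    then show ?case using H01[of x] Hn by (auto simp: less_imp_le)
  next
    case (Suc t)
    show ?case
    proof (cases "x = int n")
      case True then show ?thesis using Hn by simp
    next
      case False
      with Suc.prems have x: "x < int n" by simp
      have "?h (Suc t) x \<le> \<omega> x * H (x + 1) + (1 - \<omega> x) * (step_weight s x (x - 1) * H (x - 1))"
        using False x env[of x] sw[of x "x - 1"] Suc.IH[of "x + 1"] Suc.IH[of "x - 1"]
        by (auto intro!: add_mono mult_left_mono simp: less_imp_le)
      then show ?thesis using H[OF x] by simp
    qed
  qed
  have mono: "?h t x \<le> ?h (Suc t) x" for t x
  proof (induction t arbitrary: x)
    case 0
    then show ?case using h0[of "Suc 0" x] by (cases "x = int n") (simp_all del: hit_gf.simps(2))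
  next
    case (Suc t)
    show ?case
    proof (cases "x = int n")
      case False
      have "?h (Suc t) x = \<omega> x * ?h t (x + 1) + (1 - \<omega> x) * (step_weight s x (x - 1) * ?h t (x - 1))"
        using False by simp
      also have "\<dots> \<le> \<omega> x * ?h (Suc t) (x + 1) + (1 - \<omega> x) * (step_weight s x (x - 1) * ?h (Suc t) (x - 1))"
        using env[of x] sw[of x "x - 1"] Suc.IH by (intro add_mono mult_left_mono) (auto simp: less_imp_le)
      also have "\<dots> = ?h (Suc (Suc t)) x" using False by simp
      finally show ?thesis .
    qed simp
  qed
  define l where "l x = lim (\<lambda>t. ?h t x)" for x
  have conv: "(\<lambda>t. ?h t x) \<longlonglongrightarrow> l x" for x
  proof -
    have "incseq (\<lambda>t. ?h t x)" using mono by (intro incseq_SucI)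
    then obtain L where "(\<lambda>t. ?h t x) \<longlonglongrightarrow> L"
      using incseq_convergent[of "\<lambda>t. ?h t x" 1] h1 by metis
    then show ?thesis unfolding l_def by (simp add: limI)
  qed
  have ln: "l (int n) = 1" using conv[of "int n"] by (simp add: LIMSEQ_const_iff)
  have l: "l x = \<omega> x * l (x + 1) + (1 - \<omega> x) * (step_weight s x (x - 1) * l (x - 1))" if "x < int n" for x
  proof (rule LIMSEQ_unique)
    show "(\<lambda>t. ?h (Suc t) x) \<longlonglongrightarrow> l x" using conv by (rule LIMSEQ_Suc)
    have "(\<lambda>t. \<omega> x * ?h t (x + 1) + (1 - \<omega> x) * (step_weight s x (x - 1) * ?h t (x - 1))) \<longlonglongrightarrow>
        \<omega> x * l (x + 1) + (1 - \<omega> x) * (step_weight s x (x - 1) * l (x - 1))"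
      by (intro tendsto_intros conv)
    then show "(\<lambda>t. ?h (Suc t) x) \<longlonglongrightarrow> \<omega> x * l (x + 1) + (1 - \<omega> x) * (step_weight s x (x - 1) * l (x - 1))"
      using that by simp
  qed
  define D where "D x = H x - l x" for x
  have D0: "0 \<le> D x" if "x \<le> int n" for x
  proof -
    have "l x \<le> H x" using LIMSEQ_le_const2[OF conv[of x], of "H x"] hH[OF that] by blast
    then show ?thesis unfolding D_def by simp
  qed
  have D1: "D x \<le> 1" for x
  proof -
    have "0 \<le> l x" using LIMSEQ_le_const[OF conv[of x], of 0] h0 by blast
    then show ?thesis unfolding D_def using H01(2)[of x] by linarith
  qed
  have Dn: "D (int n) = 0" using Hn ln by (simp add: D_def)
  have D: "D x = \<omega> x * D (x + 1) + (1 - \<omega> x) * (step_weight s x (x - 1) * D (x - 1))" if "x < int n" for x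
    using H[OF that] l[OF that] by (simp add: D_def algebra_simps)
  have Dsub: "D x - D (x + 1) \<le> (1 - \<omega> x) / \<omega> x * (D (x - 1) - D x)" if "x < int n" for x
  proof -
    have "step_weight s x (x - 1) * D (x - 1) \<le> 1 * D (x - 1)"
      using sw[of x "x - 1"] D0[of "x - 1"] that by (intro mult_right_mono) auto
    then have "D x \<le> \<omega> x * D (x + 1) + (1 - \<omega> x) * D (x - 1)"
      using D[OF that] env[of x] mult_left_mono[of "step_weight s x (x - 1) * D (x - 1)" "D (x - 1)" "1 - \<omega> x"] by simp
    then have "\<omega> x * (D x - D (x + 1)) \<le> (1 - \<omega> x) * (D (x - 1) - D x)"
      by (simp add: algebra_simps)
    then show ?thesis using env[of x] by (simp add: field_simps)
  qed
  define R where "R k = (\<Prod>j<k. (1 - \<omega> (int n - 1 - int j)) / \<omega> (int n - 1 - int j))" for k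
  have R0: "0 \<le> R k" for k unfolding R_def using env by (intro prod_nonneg) (auto simp: less_imp_le)
  have chain: "D (int n - 1) \<le> R k * (D (int n - 1 - int k) - D (int n - int k))" for k
  proof (induction k)
    case 0 then show ?case by (simp add: R_def Dn)
  next
    case (Suc k)
    define x where "x = int n - 1 - int k"
    have e: "int n - int k = x + 1" "int n - int (Suc k) = x" "int n - 1 - int (Suc k) = x - 1"
      by (simp_all add: x_def)
    have "x < int n" by (simp add: x_def)
    have "D (int n - 1) \<le> R k * (D x - D (x + 1))"
      using Suc.IH unfolding e x_def[symmetric] .
    moreover have "R k * (D x - D (x + 1)) \<le> R k * ((1 - \<omega> x) / \<omega> x * (D (x - 1) - D x))"
      using R0 by (intro mult_left_mono Dsub \<open>x < int n\<close>)
    moreover have "R k * ((1 - \<omega> x) / \<omega> x * (D (x - 1) - D x)) = R (Suc k) * (D (x - 1) - D x)"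
      unfolding R_def prod.lessThan_Suc x_def[symmetric] mult.assoc ..
    ultimately show ?case unfolding e by linarith
  qed
  have "D (int n - 1) \<le> 0"
  proof (rule LIMSEQ_le_const)
    show "R \<longlonglongrightarrow> 0" unfolding R_def by (rule lim0)
    have "D (int n - 1) \<le> R k" for k
    proof -
      have "D (int n - 1 - int k) - D (int n - int k) \<le> 1"
        using D1[of "int n - 1 - int k"] D0[of "int n - int k"] by simp
      then have "R k * (D (int n - 1 - int k) - D (int n - int k)) \<le> R k * 1"
        using R0 by (intro mult_left_mono) auto
      then show ?thesis using chain[of k] by simp
    qed
    then show "\<exists>N. \<forall>k\<ge>N. D (int n - 1) \<le> R k" by blast
  qed
  then have Dn1: "D (int n - 1) = 0" using D0[of "int n - 1"] by simp
  \<comment> \<open>Two neighbouring zeros propagate leftwards, since the left neighbour enters the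
    recursion with a positive coefficient.\<close>
  have "D (int n - int k) = 0 \<and> D (int n - int k - 1) = 0" for k
  proof (induction k)
    case (Suc k)
    define x where "x = int n - int k - 1"
    have e: "int n - int k = x + 1" "int n - int (Suc k) = x"
      by (simp_all add: x_def)
    have "x < int n" by (simp add: x_def)
    have "D x = 0" "D (x + 1) = 0"
      using Suc.IH unfolding e x_def[symmetric] by simp_all
    then have "(1 - \<omega> x) * (step_weight s x (x - 1) * D (x - 1)) = 0"
      using D[OF \<open>x < int n\<close>] by simp
    then have "D (x - 1) = 0" using env(2)[of x] sw(1)[of x "x - 1"] by simp
    then show ?case unfolding e using \<open>D x = 0\<close> by simp
  qed (simp add: Dn Dn1)
  from this[of n] have "D 0 = 0" by simp
  then show ?thesis using conv[of 0] by (simp add: D_def H_def atLeast0LessThan)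
qed

section \<open>The law of the left steps\<close>

context transient_site
begin

lemma cont_frac_measurable [measurable]: "(\<lambda>\<sigma>. cont_frac s r \<sigma> y) \<in> borel_measurable seq_law"
  by (induction y) (simp_all add: cont_frac.simps)

text \<open>The additional power of r makes the induction close. Summing out the newest state v
  turns r^(v+1) (s 0)^v into r times the power u + 1 of the next start value \<open>g a\<close>,
  where u is the preceding state and a an independent site. This matches
  \<open>cont_frac_shift\<close> with a as the first site.\<close>

lemma chain_generating_function:
  assumes "\<And>i. 0 < s i \<and> s i \<le> 1" "0 < r" "r \<le> 1"
  shows "(\<integral>\<^sup>+l. ennreal (r ^ Suc (l ! 0) * (\<Prod>x<n. s x ^ (l ! x))) \<partial>chain n) =
         (\<integral>\<^sup>+\<sigma>. ennreal (\<Prod>y\<le>n. cont_frac s r \<sigma> y) \<partial>seq_law)"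
  using assms
proof (induction n arbitrary: s r)
  case 0
  then show ?case
    using prob_space.emeasure_space_1[OF prob_space_seq_law] by simp
next
  case (Suc n)
  let ?s = "\<lambda>i. s (Suc i)"
  define g where "g a = a / (1 - (1 - a) * (s 0 * r))" for a
  have t: "0 \<le> s 0 * r" "s 0 * r \<le> 1" using Suc.prems(1)[of 0] Suc.prems(2,3) by (auto intro!: mult_le_one)
  have g01: "0 < g a \<and> g a \<le> 1" if "a \<in> space \<mu>" for a
    using cont_frac_01[of "\<lambda>_. a" s r 1] site_range[OF that] Suc.prems by (simp add: g_def cont_frac.simps)
  have g_meas [measurable]: "g \<in> borel_measurable \<mu>" unfolding g_def by (rule measurable_site) measurable
  define Pr where "Pr l = (\<Prod>x<n. ?s x ^ (l ! x))" for l :: "nat list"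
  have Pr0: "0 \<le> Pr l" for l unfolding Pr_def using Suc.prems(1) by (auto intro!: prod_nonneg simp: less_imp_le)
  have "(\<integral>\<^sup>+l. ennreal (r ^ Suc (l ! 0) * (\<Prod>x<Suc n. s x ^ (l ! x))) \<partial>chain (Suc n)) =
      (\<integral>\<^sup>+l. \<integral>\<^sup>+v. ennreal (r * Pr l) * ennreal ((s 0 * r) ^ v) \<partial>KQ (hd l) \<partial>chain n)"
  proof -
    have "ennreal (r ^ Suc ((v # l) ! 0) * (\<Prod>x<Suc n. s x ^ ((v # l) ! x))) = ennreal (r * Pr l) * ennreal ((s 0 * r) ^ v)" for v l
    proof -
      have "r ^ Suc ((v # l) ! 0) * (\<Prod>x<Suc n. s x ^ ((v # l) ! x)) = (r * Pr l) * (s 0 * r) ^ v"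
        unfolding prod.lessThan_Suc_shift by (simp add: Pr_def power_mult_distrib)
      then show ?thesis using Pr0[of l] t Suc.prems by (simp only: ennreal_mult[symmetric] mult_nonneg_nonneg zero_le_power less_imp_le)
    qed
    then show ?thesis by (simp only: chain.simps nn_integral_bind_pmf nn_integral_map_pmf)
  qed
  also have "\<dots> = (\<integral>\<^sup>+l. \<integral>\<^sup>+a. ennreal (r * Pr l) * ennreal (g a ^ Suc (hd l)) \<partial>\<mu> \<partial>chain n)"
  proof (rule nn_integral_cong)
    fix l
    have m: "(\<lambda>a. ennreal (g a ^ Suc (hd l))) \<in> borel_measurable \<mu>" by measurable
    have "(\<integral>\<^sup>+v. ennreal (r * Pr l) * ennreal ((s 0 * r) ^ v) \<partial>KQ (hd l)) = ennreal (r * Pr l) * (\<integral>\<^sup>+v. ennreal ((s 0 * r) ^ v) \<partial>KQ (hd l))"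
      by (rule nn_integral_cmult) simp
    also have "(\<integral>\<^sup>+v. ennreal ((s 0 * r) ^ v) \<partial>KQ (hd l)) = (\<integral>\<^sup>+a. ennreal (g a ^ Suc (hd l)) \<partial>\<mu>)"
      unfolding nn_integral_KQ g_def by (rule nn_sum_Q_power[OF t])
    finally show "(\<integral>\<^sup>+v. ennreal (r * Pr l) * ennreal ((s 0 * r) ^ v) \<partial>KQ (hd l)) = (\<integral>\<^sup>+a. ennreal (r * Pr l) * ennreal (g a ^ Suc (hd l)) \<partial>\<mu>)"
      unfolding nn_integral_cmult[OF m] .
  qed
  also have "\<dots> = (\<integral>\<^sup>+a. \<integral>\<^sup>+l. ennreal (r * Pr l) * ennreal (g a ^ Suc (hd l)) \<partial>chain n \<partial>\<mu>)"
  proof -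
    interpret pair_sigma_finite "measure_pmf (chain n)" \<mu> ..
    have "(\<lambda>z. ennreal (r * Pr (fst z)) * ennreal (g (snd z) ^ Suc (hd (fst z)))) \<in> borel_measurable (count_space UNIV \<Otimes>\<^sub>M \<mu>)"
      by (rule measurable_pair_measure_countable1) (simp_all del: power_Suc)
    then have m: "(\<lambda>(l, a). ennreal (r * Pr l) * ennreal (g a ^ Suc (hd l))) \<in> borel_measurable (measure_pmf (chain n) \<Otimes>\<^sub>M \<mu>)"
      unfolding case_prod_unfold by (simp only: measurable_cong_sets[OF sets_pair_measure_cong[OF sets_measure_pmf_count_space refl] refl])
    show ?thesis by (rule Fubini'[OF m, symmetric])
  qed
  also have "\<dots> = (\<integral>\<^sup>+a. ennreal r * (\<integral>\<^sup>+\<sigma>. ennreal (\<Prod>y\<le>n. cont_frac ?s (g a) \<sigma> y) \<partial>seq_law) \<partial>\<mu>)"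
  proof (rule nn_integral_cong)
    fix a assume a: "a \<in> space \<mu>"
    have "(\<integral>\<^sup>+l. ennreal (r * Pr l) * ennreal (g a ^ Suc (hd l)) \<partial>chain n) =
        (\<integral>\<^sup>+l. ennreal r * ennreal (g a ^ Suc (l ! 0) * Pr l) \<partial>chain n)"
    proof (intro nn_integral_cong_AE AE_pmfI)
      fix l assume "l \<in> set_pmf (chain n)"
      then have "l \<noteq> []" using chain_length by fastforce
      then have "hd l = l ! 0" by (rule hd_conv_nth)
      then show "ennreal (r * Pr l) * ennreal (g a ^ Suc (hd l)) = ennreal r * ennreal (g a ^ Suc (l ! 0) * Pr l)"
        using Pr0[of l] g01[OF a] Suc.prems by (subst (1 2) ennreal_mult[symmetric]) (auto simp: mult_ac)
    qed
    also have "\<dots> = ennreal r * (\<integral>\<^sup>+l. ennreal (g a ^ Suc (l ! 0) * Pr l) \<partial>chain n)"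
      by (rule nn_integral_cmult) simp
    also have "(\<integral>\<^sup>+l. ennreal (g a ^ Suc (l ! 0) * Pr l) \<partial>chain n) = (\<integral>\<^sup>+\<sigma>. ennreal (\<Prod>y\<le>n. cont_frac ?s (g a) \<sigma> y) \<partial>seq_law)"
      unfolding Pr_def using g01[OF a] Suc.prems(1) by (intro Suc.IH) auto
    finally show "(\<integral>\<^sup>+l. ennreal (r * Pr l) * ennreal (g a ^ Suc (hd l)) \<partial>chain n) =
        ennreal r * (\<integral>\<^sup>+\<sigma>. ennreal (\<Prod>y\<le>n. cont_frac ?s (g a) \<sigma> y) \<partial>seq_law)" .
  qed
  also have "\<dots> = (\<integral>\<^sup>+a. \<integral>\<^sup>+\<sigma>. ennreal (\<Prod>y\<le>Suc n. cont_frac s r (case_nat a \<sigma>) y) \<partial>seq_law \<partial>\<mu>)"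
  proof (rule nn_integral_cong)
    fix a assume a: "a \<in> space \<mu>"
    have eq: "(\<Prod>y\<le>Suc n. cont_frac s r (case_nat a \<sigma>) y) = r * (\<Prod>y\<le>n. cont_frac ?s (g a) \<sigma> y)" for \<sigma>
      unfolding prod.atMost_Suc_shift cont_frac_shift by (simp add: g_def)
    have pos: "0 \<le> (\<Prod>y\<le>n. cont_frac ?s (g a) \<sigma> y)" if "\<sigma> \<in> space seq_law" for \<sigma>
    proof (intro prod_nonneg ballI)
      fix y
      have "0 < cont_frac ?s (g a) \<sigma> y \<and> cont_frac ?s (g a) \<sigma> y \<le> 1"
        using seq_range[OF that] Suc.prems(1) g01[OF a] by (intro cont_frac_01) auto
      then show "0 \<le> cont_frac ?s (g a) \<sigma> y" by simp
    qed
    have "(\<integral>\<^sup>+\<sigma>. ennreal (\<Prod>y\<le>Suc n. cont_frac s r (case_nat a \<sigma>) y) \<partial>seq_law) = (\<integral>\<^sup>+\<sigma>. ennreal r * ennreal (\<Prod>y\<le>n. cont_frac ?s (g a) \<sigma> y) \<partial>seq_law)"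
      unfolding eq using pos Suc.prems by (intro nn_integral_cong) (simp add: ennreal_mult)
    then show "ennreal r * (\<integral>\<^sup>+\<sigma>. ennreal (\<Prod>y\<le>n. cont_frac ?s (g a) \<sigma> y) \<partial>seq_law) = (\<integral>\<^sup>+\<sigma>. ennreal (\<Prod>y\<le>Suc n. cont_frac s r (case_nat a \<sigma>) y) \<partial>seq_law)"
      by (simp add: nn_integral_cmult)
  qed
  also have "\<dots> = (\<integral>\<^sup>+\<sigma>. ennreal (\<Prod>y\<le>Suc n. cont_frac s r \<sigma> y) \<partial>seq_law)"
    by (rule nn_integral_seq_law[symmetric]) measurable
  finally show ?case .
qed

lemma quenched_law_measurable [measurable]: "quenched_law \<in> env_law \<mu> \<rightarrow>\<^sub>M subprob_algebra path_space"
  by (rule measurable_quenched_law) (use env_range in auto)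

lemma space_env_not_empty: "space (env_law \<mu>) \<noteq> {}"
  by (rule env.not_empty)

lemma sets_annealed_law [simp, measurable_cong]: "sets (annealed_law \<mu>) = sets path_space"
  unfolding annealed_law_def by (rule sets_bind[OF _ space_env_not_empty]) simp

lemma space_annealed_law [simp]: "space (annealed_law \<mu>) = UNIV"
  using sets_eq_imp_space_eq[OF sets_annealed_law] by simp

lemma prob_space_annealed_law: "prob_space (annealed_law \<mu>)"
  unfolding annealed_law_def
  by (rule env.prob_space_bind[OF _ quenched_law_measurable]) (simp add: prob_space_quenched_law)

lemma nn_integral_annealed_law:
  assumes "F \<in> borel_measurable path_space"
  shows "(\<integral>\<^sup>+X. F X \<partial>annealed_law \<mu>) = (\<integral>\<^sup>+\<omega>. \<integral>\<^sup>+X. F X \<partial>quenched_law \<omega> \<partial>env_law \<mu>)"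
  unfolding annealed_law_def by (rule nn_integral_bind[OF assms quenched_law_measurable])

lemma measurable_prod_left_steps [measurable]:
  "(\<lambda>X. \<Prod>x<n. (s x :: real) ^ left_steps X n x) \<in> borel_measurable path_space"
  by (intro borel_measurable_prod measurable_compose[OF measurable_left_steps]) simp

text \<open>For almost every environment the quenched value is the product of continued fractions
  with start value 1, and by \<open>chain_generating_function\<close> the chain has the same
  average.\<close>

lemma annealed_generating_function:
  assumes s01: "\<And>i. 0 < s i \<and> s i \<le> 1"
  shows "(\<integral>\<^sup>+X. ennreal (of_bool (\<exists>t. X t = int n) * (\<Prod>x<n. s x ^ left_steps X n x)) \<partial>annealed_law \<mu>) =
         (\<integral>\<^sup>+l. ennreal (\<Prod>x<n. s x ^ (l ! x)) \<partial>chain n)"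
proof -
  \<comment> \<open>Weights from n on are reset to 1, as \<open>integral_quenched_left_steps\<close>
    requires; the products over sites below n do not see them.\<close>
  define s' where "s' i = (if i < n then s i else 1)" for i
  have s': "0 < s' i" "s' i \<le> 1" "i \<ge> n \<Longrightarrow> s' i = 1" for i using s01 by (auto simp: s'_def)
  have inj: "inj int" "inj (\<lambda>j. int n - 1 - int j)" by (auto simp: inj_def)
  let ?C = "\<lambda>\<sigma>. \<Prod>y<n. cont_frac s' 1 \<sigma> (Suc y)"
  have [measurable]: "?C \<in> borel_measurable seq_law" by measurable
  have "(\<integral>\<^sup>+X. ennreal (of_bool (\<exists>t. X t = int n) * (\<Prod>x<n. s x ^ left_steps X n x)) \<partial>annealed_law \<mu>) =
      (\<integral>\<^sup>+X. ennreal (of_bool (\<exists>t. X t = int n) * (\<Prod>x<n. s' x ^ left_steps X n x)) \<partial>annealed_law \<mu>)"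
    by (simp add: s'_def)
  also have "\<dots> = (\<integral>\<^sup>+\<omega>. \<integral>\<^sup>+X. ennreal (of_bool (\<exists>t. X t = int n) * (\<Prod>x<n. s' x ^ left_steps X n x)) \<partial>quenched_law \<omega> \<partial>env_law \<mu>)"
    by (rule nn_integral_annealed_law) (intro measurable_compose[OF _ measurable_ennreal] borel_measurable_times measurable_prod_left_steps, simp)
  also have "\<dots> = (\<integral>\<^sup>+\<omega>. ennreal (?C (\<lambda>i. \<omega> (int i))) \<partial>env_law \<mu>)"
  proof (rule nn_integral_cong_AE)
    show "AE \<omega> in env_law \<mu>. (\<integral>\<^sup>+X. ennreal (of_bool (\<exists>t. X t = int n) * (\<Prod>x<n. s' x ^ left_steps X n x)) \<partial>quenched_law \<omega>) = ennreal (?C (\<lambda>i. \<omega> (int i)))"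
      using AE_env_prod_odds[OF inj(2)]
    proof (rule AE_mp, intro AE_I2 impI)
      fix \<omega> assume w: "\<omega> \<in> space (env_law \<mu>)" and sum: "summable (\<lambda>k. \<Prod>j<k. odds (\<omega> (int n - 1 - int j)))"
      have env: "0 < \<omega> x" "\<omega> x < 1" for x using env_range[OF w] by auto
      have W01: "0 \<le> (\<Prod>x<n. s' x ^ left_steps X n x)" "(\<Prod>x<n. s' x ^ left_steps X n x) \<le> 1" for X
        using s' by (auto intro!: prod_nonneg prod_le_1 power_le_one simp: less_imp_le)
      have int: "integrable (quenched_law \<omega>) (\<lambda>X. of_bool (\<exists>t. X t = int n) * (\<Prod>x<n. s' x ^ left_steps X n x))"
        by (rule finite_measure.integrable_const_bound[where B = 1, OF prob_space.finite_measure[OF prob_space_quenched_law]])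
           (use W01 in auto)
      have "(\<integral>X. of_bool (\<exists>t. X t = int n) * (\<Prod>x<n. s' x ^ left_steps X n x) \<partial>quenched_law \<omega>) = ?C (\<lambda>i. \<omega> (int i))"
        by (rule integral_quenched_left_steps[OF env s'(1,2,3) hit_gf_limit[OF env s'(1,2)]])
           (use summable_LIMSEQ_zero[OF sum] in \<open>simp_all add: odds_def\<close>)
      then show "(\<integral>\<^sup>+X. ennreal (of_bool (\<exists>t. X t = int n) * (\<Prod>x<n. s' x ^ left_steps X n x)) \<partial>quenched_law \<omega>) = ennreal (?C (\<lambda>i. \<omega> (int i)))"
        using W01 by (subst nn_integral_eq_integral[OF int]) auto
    qed
  qed
  also have "\<dots> = (\<integral>\<^sup>+\<sigma>. ennreal (?C \<sigma>) \<partial>distr (env_law \<mu>) seq_law (\<lambda>\<omega> i. \<omega> (int i)))"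
    by (rule nn_integral_distr[symmetric, OF measurable_env_law_seq]) measurable
  also have "\<dots> = (\<integral>\<^sup>+\<sigma>. ennreal (\<Prod>y\<le>n. cont_frac s' 1 \<sigma> y) \<partial>seq_law)"
    unfolding distr_env_law_seq[OF inj(1)] lessThan_Suc_atMost[symmetric] prod.lessThan_Suc_shift by simp
  also have "\<dots> = (\<integral>\<^sup>+l. ennreal (1 ^ Suc (l ! 0) * (\<Prod>x<n. s' x ^ (l ! x))) \<partial>chain n)"
    using s' by (intro chain_generating_function[symmetric]) auto
  also have "\<dots> = (\<integral>\<^sup>+l. ennreal (\<Prod>x<n. s x ^ (l ! x)) \<partial>chain n)"
    by (simp add: s'_def)
  finally show ?thesis .
qed

text \<open>Domination at points gives domination on every set and on its complement, and total mass
  1 on both sides leaves no room. A lower bound that ignores the paths missing n is therefore enough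
  below.\<close>

lemma measure_eq_pmfI:
  assumes "prob_space D" "sets D = UNIV" and ge: "\<And>x. ennreal (pmf q x) \<le> emeasure D {x}"
  shows "D = measure_pmf (q :: 'b::countable pmf)"
proof (rule measure_eqI)
  interpret D: prob_space D by fact
  have sp: "space D = UNIV" using sets_eq_imp_space_eq[of D "count_space UNIV"] assms(2) by simp
  have le: "emeasure q A \<le> emeasure D A" for A
  proof -
    have "emeasure q A = (\<integral>\<^sup>+x. emeasure q {x} \<partial>count_space A)"
      by (rule emeasure_countable_singleton) auto
    also have "\<dots> \<le> (\<integral>\<^sup>+x. emeasure D {x} \<partial>count_space A)"
      using ge by (intro nn_integral_mono) (simp add: emeasure_pmf_single)
    also have "\<dots> = emeasure D A"
      by (rule emeasure_countable_singleton[symmetric]) (auto simp: assms(2))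
    finally show ?thesis .
  qed
  fix A assume A: "A \<in> sets D"
  have "measure D A \<ge> measure q A" "measure D (- A) \<ge> measure q (- A)"
    using le[of A] le[of "- A"] by (simp_all add: D.emeasure_eq_measure measure_pmf.emeasure_eq_measure)
  moreover have "measure D (- A) = 1 - measure D A" "measure q (- A) = 1 - measure q A"
    using D.prob_compl[OF A] measure_pmf.prob_compl[of A q] by (simp_all add: sp Compl_eq_Diff_UNIV)
  ultimately show "emeasure D A = emeasure q A"
    by (simp add: D.emeasure_eq_measure measure_pmf.emeasure_eq_measure)
qed (simp add: assms)

abbreviation left_step_list :: "nat \<Rightarrow> path \<Rightarrow> nat list" where
  "left_step_list n X \<equiv> map (left_steps X n) [0..<Suc n]"

lemma measurable_left_step_list [measurable]: "left_step_list n \<in> path_space \<rightarrow>\<^sub>M count_space UNIV"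
proof -
  have "(\<lambda>X x. left_steps X n x) \<in> path_space \<rightarrow>\<^sub>M PiM UNIV (\<lambda>_. count_space UNIV)"
    by (rule measurable_PiM_single') auto
  from measurable_compose[OF this measurable_map_list[of "[0..<Suc n]" UNIV]]
  show ?thesis by simp
qed

text \<open>Since the right-hand side is a probability, the walk reaches \<open>n\<close> almost surely, although this is
  not assumed on the left.\<close>

theorem distr_left_step_list:
  "distr (annealed_law \<mu>) (count_space UNIV) (left_step_list n) = measure_pmf (chain n)"
proof (rule measure_eq_pmfI)
  have ml: "left_step_list n \<in> annealed_law \<mu> \<rightarrow>\<^sub>M count_space UNIV"
    by (simp only: measurable_cong_sets[OF sets_annealed_law refl] measurable_left_step_list)
  show "prob_space (distr (annealed_law \<mu>) (count_space UNIV) (left_step_list n))"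
    by (rule prob_space.prob_space_distr[OF prob_space_annealed_law ml])
  fix ll :: "nat list"
  define hit where "hit X \<longleftrightarrow> (\<exists>t. X t = int n)" for X :: path
  have [measurable]: "Measurable.pred path_space hit" unfolding hit_def by measurable
  \<comment> \<open>The walk law restricted to paths that reach n, which is what
    \<open>annealed_generating_function\<close> describes.\<close>
  define N1 where "N1 = density (annealed_law \<mu>) (\<lambda>X. ennreal (of_bool (hit X)))"
  interpret A: prob_space "annealed_law \<mu>" by (rule prob_space_annealed_law)
  have N1_int: "(\<integral>\<^sup>+X. F X \<partial>N1) = (\<integral>\<^sup>+X. ennreal (of_bool (hit X)) * F X \<partial>annealed_law \<mu>)"
    if "F \<in> borel_measurable path_space" for F
    unfolding N1_def by (rule nn_integral_density) (use that in \<open>simp_all add: measurable_cong_sets[OF sets_annealed_law refl]\<close>)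
  have N1_le: "emeasure N1 B \<le> emeasure (annealed_law \<mu>) B" if "B \<in> sets path_space" for B
  proof -
    have "emeasure N1 B = (\<integral>\<^sup>+X. indicator B X \<partial>N1)" using that by (simp add: N1_def)
    also have "\<dots> = (\<integral>\<^sup>+X. ennreal (of_bool (hit X)) * indicator B X \<partial>annealed_law \<mu>)"
      by (rule N1_int) (use that in simp)
    also have "\<dots> \<le> (\<integral>\<^sup>+X. indicator B X \<partial>annealed_law \<mu>)"
      by (rule nn_integral_mono) (auto simp: indicator_def)
    finally show ?thesis using that by simp
  qed
  have main: "emeasure N1 {X \<in> space N1. \<forall>i<n. left_steps X n i = ll ! i} = emeasure (chain n) {l \<in> space (chain n). \<forall>i<n. l ! i = ll ! i}"
  proof (rule generating_function_unique)
    show "emeasure N1 (space N1) < \<infinity>"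
      using N1_le[of UNIV] sets.top[of path_space] A.emeasure_space_1 by (simp add: N1_def le_less_trans[OF _ ennreal_one_less_top])
    show "(\<lambda>X. left_steps X n i) \<in> N1 \<rightarrow>\<^sub>M count_space UNIV" for i
      unfolding N1_def by (simp add: measurable_cong_sets[OF sets_annealed_law refl] measurable_left_steps)
    fix s :: "nat \<Rightarrow> real" assume s: "\<And>i. 0 < s i \<and> s i \<le> 1"
    have "0 \<le> (\<Prod>i<n. s i ^ left_steps X n i)" for X
      using s by (auto intro!: prod_nonneg simp: less_imp_le)
    then have "(\<integral>\<^sup>+X. ennreal (\<Prod>i<n. s i ^ left_steps X n i) \<partial>N1) = (\<integral>\<^sup>+X. ennreal (of_bool (hit X) * (\<Prod>i<n. s i ^ left_steps X n i)) \<partial>annealed_law \<mu>)"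
      by (subst N1_int) (auto simp: ennreal_mult)
    then show "(\<integral>\<^sup>+X. ennreal (\<Prod>i<n. s i ^ left_steps X n i) \<partial>N1) = (\<integral>\<^sup>+l. ennreal (\<Prod>i<n. s i ^ (l ! i)) \<partial>chain n)"
      unfolding hit_def using annealed_generating_function[OF s] by simp
  qed auto
  show "ennreal (pmf (chain n) ll) \<le> emeasure (distr (annealed_law \<mu>) (count_space UNIV) (left_step_list n)) {ll}"
  proof (cases "ll \<in> set_pmf (chain n)")
    case True
    then have len: "length ll = Suc n" and last: "last ll = 0" using chain_length chain_last by auto
    \<comment> \<open>The last entry is 0 on both sides, so the first n coordinates, those seen by
      the generating function, determine the list.\<close>
    then have lln: "ll ! n = 0" by (metis diff_Suc_1 last_conv_nth length_0_conv nat.simps(3))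
    have "(\<forall>i<n. left_steps X n i = ll ! i) \<longleftrightarrow> left_step_list n X = ll" for X
    proof
      assume a: "\<forall>i<n. left_steps X n i = ll ! i"
      show "left_step_list n X = ll"
      proof (rule nth_equalityI)
        fix i assume "i < length (left_step_list n X)"
        then have "i < n \<or> i = n" by auto
        then show "left_step_list n X ! i = ll ! i"
          using a lln by (auto simp: nth_append simp del: upt_Suc)
      qed (simp add: len del: upt_Suc)
    next
      assume "left_step_list n X = ll"
      then show "\<forall>i<n. left_steps X n i = ll ! i" by (auto simp: nth_append)
    qed
    then have eq: "{X \<in> space N1. \<forall>i<n. left_steps X n i = ll ! i} = left_step_list n -` {ll} \<inter> space (annealed_law \<mu>)"
      by (auto simp: N1_def)
    have "ennreal (pmf (chain n) ll) = emeasure (chain n) {ll}" by (simp add: emeasure_pmf_single)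
    also have "\<dots> \<le> emeasure (chain n) {l \<in> space (chain n). \<forall>i<n. l ! i = ll ! i}"
      by (rule emeasure_mono) auto
    also have "\<dots> \<le> emeasure (annealed_law \<mu>) (left_step_list n -` {ll} \<inter> space (annealed_law \<mu>))"
      unfolding main[symmetric] eq
      using measurable_sets[OF ml, of "{ll}"] by (intro N1_le) (simp del: upt_Suc)
    also have "\<dots> = emeasure (distr (annealed_law \<mu>) (count_space UNIV) (left_step_list n)) {ll}"
      by (rule emeasure_distr[OF ml, symmetric]) simp
    finally show ?thesis .
  next
    case False
    then have "pmf (chain n) ll = 0" by (simp add: set_pmf_iff)
    then show ?thesis by simp
  qed
qed simp

end

section \<open>Consistency and asymptotic normality\<close>

subsection \<open>Moments determine a law on the unit interval\<close>

text \<open>On the unit interval the Taylor remainder of exp (i t a) is at most |t|^(n+1) / (n+1)!,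
  so the moments determine the characteristic function.\<close>

lemma env_site_eqI_moments:
  assumes M: "env_site M" and N: "env_site N" and eq: "\<And>k. (\<integral>a. a ^ k \<partial>M) = (\<integral>a. a ^ k \<partial>N)"
  shows "M = N"
proof -
  interpret M: env_site M by fact
  interpret N: env_site N by fact
  have id: "(\<lambda>a. a) \<in> borel_measurable M" "(\<lambda>a. a) \<in> borel_measurable N"
    by (auto intro!: M.measurable_site N.measurable_site)
  \<comment> \<open>The laws have the open interval as their whole space, and are moved to the real
    line to be compared there.\<close>
  define D where "D P = distr P borel (\<lambda>a::real. a)" for P
  have rd: "real_distribution (D M)" "real_distribution (D N)"
    unfolding D_def real_distribution_def real_distribution_axioms_def
    using M.site.prob_space_distr[OF id(1)] N.site.prob_space_distr[OF id(2)] by auto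
  have approx: "cmod ((CLINT a|P. iexp (t * a)) - (\<Sum>k\<le>n. (\<i> * t) ^ k / fact k * complex_of_real (\<integral>a. a ^ k \<partial>P))) \<le> \<bar>t\<bar> ^ Suc n / fact (Suc n)"
    if "env_site P" for P and t :: real and n
  proof -
    interpret P: env_site P by fact
    have idP: "(\<lambda>a. a) \<in> borel_measurable P" by (auto intro!: P.measurable_site)
    have ik: "integrable P (\<lambda>a. a ^ k)" for k using P.integrable_monomial[of k 0] by simp
    have i1: "integrable P (\<lambda>a. iexp (t * a))"
      using idP by (intro P.site.integrable_const_bound[where B = 1]) auto
    have i2: "integrable P (\<lambda>a. (\<i> * t) ^ k / fact k * complex_of_real (a ^ k))" for k
      by (intro integrable_mult_right integrable_of_real ik)
    have "(CLINT a|P. iexp (t * a)) - (\<Sum>k\<le>n. (\<i> * t) ^ k / fact k * complex_of_real (\<integral>a. a ^ k \<partial>P)) =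
        (CLINT a|P. iexp (t * a) - (\<Sum>k\<le>n. (\<i> * t) ^ k / fact k * complex_of_real (a ^ k)))"
      using i1 i2 ik by (simp add: Bochner_Integration.integral_sum del: of_real_power)
    also have "cmod \<dots> \<le> (\<integral>a. cmod (iexp (t * a) - (\<Sum>k\<le>n. (\<i> * t) ^ k / fact k * complex_of_real (a ^ k))) \<partial>P)"
      by (rule integral_norm_bound)
    also have "\<dots> \<le> (\<integral>a. \<bar>t\<bar> ^ Suc n / fact (Suc n) \<partial>P)"
    proof (rule integral_mono)
      show "integrable P (\<lambda>a. cmod (iexp (t * a) - (\<Sum>k\<le>n. (\<i> * t) ^ k / fact k * complex_of_real (a ^ k))))"
        by (intro integrable_norm Bochner_Integration.integrable_diff Bochner_Integration.integrable_sum i1 i2)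
      fix a assume a: "a \<in> space P"
      have "cmod (iexp (t * a) - (\<Sum>k\<le>n. (\<i> * t) ^ k / fact k * complex_of_real (a ^ k))) = cmod (iexp (t * a) - (\<Sum>k\<le>n. (\<i> * complex_of_real (t * a)) ^ k / fact k))"
        by (simp add: power_mult_distrib mult.assoc)
      also have "\<dots> \<le> \<bar>t * a\<bar> ^ Suc n / fact (Suc n)" by (rule iexp_approx1)
      also have "\<dots> \<le> \<bar>t\<bar> ^ Suc n / fact (Suc n)"
        using P.site_range[OF a] by (intro divide_right_mono power_mono) (auto simp: abs_mult mult_left_le)
      finally show "cmod (iexp (t * a) - (\<Sum>k\<le>n. (\<i> * t) ^ k / fact k * complex_of_real (a ^ k))) \<le> \<bar>t\<bar> ^ Suc n / fact (Suc n)" .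
    qed simp
    finally show ?thesis by (simp add: P.site.prob_space)
  qed
  have "char (D M) t = char (D N) t" for t
  proof -
    have char: "char (D P) t = (CLINT a|P. iexp (t * a))" if "(\<lambda>a. a) \<in> borel_measurable P" for P
      unfolding char_def D_def using that by (subst integral_distr) auto
    have le: "cmod (char (D M) t - char (D N) t) \<le> 2 * (\<bar>t\<bar> ^ Suc n / fact (Suc n))" for n
      using norm_triangle_ineq4[of "(CLINT a|M. iexp (t * a)) - (\<Sum>k\<le>n. (\<i> * t) ^ k / fact k * complex_of_real (\<integral>a. a ^ k \<partial>M))" "(CLINT a|N. iexp (t * a)) - (\<Sum>k\<le>n. (\<i> * t) ^ k / fact k * complex_of_real (\<integral>a. a ^ k \<partial>N))"]
        approx[OF M, of t n] approx[OF N, of t n]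
      unfolding char[OF id(1)] char[OF id(2)] eq by simp
    have "(\<lambda>n. \<bar>t\<bar> ^ n / fact n) \<longlonglongrightarrow> 0"
      using summable_LIMSEQ_zero[OF summable_exp[of "\<bar>t\<bar>"]] by (simp add: field_simps)
    then have "(\<lambda>n. 2 * (\<bar>t\<bar> ^ Suc n / fact (Suc n))) \<longlonglongrightarrow> 2 * 0"
      by (intro tendsto_mult tendsto_const) (rule LIMSEQ_Suc)
    then have "cmod (char (D M) t - char (D N) t) \<le> 2 * 0"
      by (rule LIMSEQ_le_const) (use le in blast)
    then show ?thesis by simp
  qed
  then have "D M = D N"
    by (intro Levy_uniqueness rd ext)
  show ?thesis
  proof (rule measure_eqI)
    show "sets M = sets N" by (simp add: M.sets_site N.sets_site)
    fix A assume A: "A \<in> sets M"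
    then have "A \<in> sets borel"
      by (auto simp: M.sets_site sets_restrict_space)
    then have "emeasure (D M) A = emeasure M (A \<inter> space M)" "emeasure (D N) A = emeasure N (A \<inter> space N)"
      by (simp_all add: D_def emeasure_distr id)
    moreover have "A \<inter> space M = A" "A \<inter> space N = A"
      using sets.sets_into_space[OF A] by (auto simp: M.space_site N.space_site)
    ultimately show "emeasure M A = emeasure N A" using \<open>D M = D N\<close> by simp
  qed
qed

subsection \<open>The functionals of the statement as integrals\<close>

lemma infsum_ennreal_eq_nn_integral:
  fixes f :: "'a::countable \<Rightarrow> ennreal"
  assumes "bij_betw h (UNIV :: nat set) (UNIV :: 'a set)"
  shows "infsum f UNIV = (\<integral>\<^sup>+x. f x \<partial>count_space UNIV)"
proof -
  have "infsum f UNIV = infsum (\<lambda>i. f (h i)) UNIV"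
    by (rule infsum_reindex_bij_betw[symmetric, OF assms])
  also have "\<dots> = (\<Sum>i. f (h i))"
  proof -
    have "(\<lambda>i. f (h i)) summable_on UNIV" by (rule nonneg_summable_on_complete) simp
    then have "((\<lambda>i. f (h i)) has_sum infsum (\<lambda>i. f (h i)) UNIV) UNIV" by (rule has_sum_infsum)
    from has_sum_imp_sums[OF this] show ?thesis by (rule sums_unique)
  qed
  also have "\<dots> = (\<integral>\<^sup>+i. f (h i) \<partial>count_space UNIV)"
    by (rule nn_integral_count_space_nat[symmetric])
  also have "\<dots> = (\<integral>\<^sup>+x. f x \<partial>count_space UNIV)"
    by (rule nn_integral_bij_count_space[OF assms])
  finally show ?thesis .
qed

context transient_site
begin

lemma pair_pos: "0 < pmf pair z"
proof (cases z)
  case (Pair u v)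
  have "pmf pair z = pmf inv_pmf u * pmf (KQ u) v"
    unfolding Pair pmf_pair by (simp add: inv_pair_def pmf_inv_pmf pmf_KQ)
  then show ?thesis using p_pos[of u] K_pos[of u v] by simp
qed

text \<open>Every pair has positive mass. Almost sure statements under \<open>pair\<close> thus hold
  at each point, which turns vanishing integrals into identities in u and v.\<close>

lemma AE_pair: "(AE z in pair. R z) \<longleftrightarrow> (\<forall>z. R z)"
proof -
  have "set_pmf pair = UNIV"
  proof (rule set_eqI)
    show "z \<in> set_pmf pair \<longleftrightarrow> z \<in> UNIV" for z
      using pair_pos[of z] by (simp add: set_pmf_iff)
  qed
  then show ?thesis by (simp add: AE_measure_pmf_iff)
qed

lemma inv_nn_eq: "inv_nn \<mu> g = (\<integral>\<^sup>+z. g (fst z) (snd z) \<partial>pair)"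
proof -
  have "inv_nn \<mu> g = (\<integral>\<^sup>+z. ennreal (pmf pair z) * g (fst z) (snd z) \<partial>count_space UNIV)"
    unfolding inv_nn_def
    by (subst infsum_ennreal_eq_nn_integral[OF bij_prod_decode]) (auto intro!: nn_integral_cong simp: pmf_pair)
  then show ?thesis by (simp add: nn_integral_measure_pmf)
qed

lemma inv_mat_nth:
  assumes "integrable pair (\<lambda>z. g (fst z) (snd z) $ i $ j)"
  shows "inv_mat \<mu> g $ i $ j = (\<integral>z. g (fst z) (snd z) $ i $ j \<partial>pair)"
proof -
  let ?f = "\<lambda>z. g (fst z) (snd z) $ i $ j"
  have "integrable (count_space UNIV) (\<lambda>z. pmf pair z *\<^sub>R ?f z)"
    using assms unfolding measure_pmf_eq_density by (subst (asm) integrable_density) auto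
  then have abs: "Infinite_Set_Sum.abs_summable_on (\<lambda>z. pmf pair z * ?f z) UNIV"
    by (simp add: Infinite_Set_Sum.abs_summable_on_def)
  have "(\<integral>z. ?f z \<partial>pair) = infsetsum (\<lambda>z. pmf pair z * ?f z) UNIV"
    by (simp add: pmf_expectation_eq_infsetsum)
  also have "\<dots> = infsum (\<lambda>z. pmf pair z * ?f z) UNIV"
    by (rule infsetsum_infsum[OF abs])
  also have "(\<lambda>z. pmf pair z * ?f z) = (\<lambda>(x, y). inv_pair \<mu> x y * g x y $ i $ j)"
    by (auto simp: pmf_pair fun_eq_iff)
  finally show ?thesis by (simp add: inv_mat_def)
qed

text \<open>A supremum with finite mean is finite at every point, again because all points have
  mass; it then serves as a real dominating function.\<close>

lemma sup_dominated:
  fixes f :: "'t \<Rightarrow> nat \<times> nat \<Rightarrow> real"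
  assumes fin: "(\<integral>\<^sup>+z. (SUP t\<in>T. ennreal (f t z)) \<partial>pair) < \<infinity>"
  obtains G where "integrable pair G" "\<And>z. 0 \<le> G z" "\<And>t z. t \<in> T \<Longrightarrow> f t z \<le> G z"
proof -
  define G where "G z = enn2real (SUP t\<in>T. ennreal (f t z))" for z
  have "AE z in pair. (SUP t\<in>T. ennreal (f t z)) \<noteq> \<infinity>"
    using fin by (intro nn_integral_PInf_AE) auto
  then have "(SUP t\<in>T. ennreal (f t z)) \<noteq> \<infinity>" for z by (simp only: AE_pair) blast
  then have eq: "ennreal (G z) = (SUP t\<in>T. ennreal (f t z))" for z
    unfolding G_def infinity_ennreal_def by (intro ennreal_enn2real) (simp only: less_top)
  show thesis
  proof (rule that[of G])
    show G0: "0 \<le> G z" for z by (simp add: G_def)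
    have "(\<integral>\<^sup>+z. ennreal (G z) \<partial>pair) < \<infinity>"
      unfolding eq by (rule fin)
    then show "integrable pair G"
      using G0 by (simp add: integrable_iff_bounded)
    fix t z assume "t \<in> T"
    then have "ennreal (f t z) \<le> ennreal (G z)" unfolding eq by (rule SUP_upper)
    then show "f t z \<le> G z" using G0[of z] by (simp add: ennreal_le_iff)
  qed
qed

end

section \<open>Second moments of martingales, Markov's inequality and local suprema\<close>

context pos_chain
begin

lemma integrable_pair_inner:
  fixes g :: "nat \<times> nat \<Rightarrow> real"
  assumes "integrable pair g"
  shows "integrable (K u) (\<lambda>v. g (u, v))"
proof -
  have "u \<in> set_pmf p" using p_pos[of u] by (simp add: set_pmf_iff)
  from integrable_bind_pmf_inner[OF assms[unfolded pair_def] this] show ?thesis by simp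
qed

lemma integrable_of_square:
  fixes f :: "'a \<Rightarrow> real" and q :: "'a pmf"
  assumes "integrable q (\<lambda>x. (f x)\<^sup>2)" shows "integrable q f"
proof (rule Bochner_Integration.integrable_bound)
  show "integrable q (\<lambda>x. 1 + (f x)\<^sup>2)" using assms by simp
  have "\<bar>t\<bar> \<le> 1 + t\<^sup>2" for t :: real
    using zero_le_power2[of "\<bar>t\<bar> - 1"] by (simp add: power2_diff)
  then show "AE x in q. norm (f x) \<le> norm (1 + (f x)\<^sup>2)" by auto
qed simp

text \<open>Orthogonality of martingale differences, as in
  \<open>expectation_martingale_sq_le\<close>, but from square integrability alone; this is the form
  that fits the score.\<close>

lemma expectation_martingale_sq:
  assumes sq: "integrable pair (\<lambda>z. (d z)\<^sup>2)" and mean: "\<And>u. (\<integral>v. d (u, v) \<partial>K u) = 0"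
  shows "integrable (chain n) (\<lambda>l. (psum d l)\<^sup>2)"
    and "(\<integral>l. (psum d l)\<^sup>2 \<partial>chain n) = (\<integral>l. psum (\<lambda>z. (d z)\<^sup>2) l \<partial>chain n)"
proof -
  have i2: "integrable (chain n) (psum (\<lambda>z. (d z)\<^sup>2))" for n by (rule integrable_psum[OF sq])
  show i1: "integrable (chain n) (\<lambda>l. (psum d l)\<^sup>2)" for n
  proof (rule Bochner_Integration.integrable_bound)
    show "integrable (chain n) (\<lambda>l. real n * psum (\<lambda>z. (d z)\<^sup>2) l)" using i2 by simp
    show "AE l in chain n. norm ((psum d l)\<^sup>2) \<le> norm (real n * psum (\<lambda>z. (d z)\<^sup>2) l)"
    proof (rule AE_pmfI)
      fix l assume "l \<in> set_pmf (chain n)"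
      then have "length l - 1 = n" using chain_length by force
      then have "(psum d l)\<^sup>2 \<le> real n * psum (\<lambda>z. (d z)\<^sup>2) l"
        unfolding psum_conv_sum using sum_squared_le_sum_of_squares[of "\<lambda>x. d (l ! Suc x, l ! x)" "{..<n}"] by (simp add: mult.commute)
      then show "norm ((psum d l)\<^sup>2) \<le> norm (real n * psum (\<lambda>z. (d z)\<^sup>2) l)" by simp
    qed
  qed simp
  show "(\<integral>l. (psum d l)\<^sup>2 \<partial>chain n) = (\<integral>l. psum (\<lambda>z. (d z)\<^sup>2) l \<partial>chain n)"
  proof (induction n)
    case (Suc n)
    define h where "h u = (\<integral>v. (d (u, v))\<^sup>2 \<partial>K u)" for u
    have id2: "integrable (K u) (\<lambda>v. (d (u, v))\<^sup>2)" for u by (rule integrable_pair_inner[OF sq])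
    have id1: "integrable (K u) (\<lambda>v. d (u, v))" for u by (rule integrable_of_square[OF id2])
    have in1: "(\<integral>v. (psum d (v # l))\<^sup>2 \<partial>K (hd l)) = h (hd l) + (psum d l)\<^sup>2"
      and in2: "(\<integral>v. psum (\<lambda>z. (d z)\<^sup>2) (v # l) \<partial>K (hd l)) = h (hd l) + psum (\<lambda>z. (d z)\<^sup>2) l"
      if "l \<in> set_pmf (chain n)" for l
    proof -
      have "l \<noteq> []" using chain_length[OF that] by auto
      have "(\<integral>v. (psum d (v # l))\<^sup>2 \<partial>K (hd l)) = (\<integral>v. (d (hd l, v))\<^sup>2 + 2 * psum d l * d (hd l, v) + (psum d l)\<^sup>2 \<partial>K (hd l))"
        using \<open>l \<noteq> []\<close> by (simp add: psum_Cons power2_sum algebra_simps)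
      also have "\<dots> = h (hd l) + (psum d l)\<^sup>2"
        using id1[of "hd l"] id2[of "hd l"] by (simp add: mean h_def)
      finally show "(\<integral>v. (psum d (v # l))\<^sup>2 \<partial>K (hd l)) = h (hd l) + (psum d l)\<^sup>2" .
      show "(\<integral>v. psum (\<lambda>z. (d z)\<^sup>2) (v # l) \<partial>K (hd l)) = h (hd l) + psum (\<lambda>z. (d z)\<^sup>2) l"
        using \<open>l \<noteq> []\<close> id2[of "hd l"] by (simp add: psum_Cons h_def)
    qed
    have o1: "integrable (chain n) (\<lambda>l. \<integral>v. (psum d (v # l))\<^sup>2 \<partial>K (hd l))"
      using integrable_bind_pmf_outer[OF i1[of "Suc n", unfolded chain.simps]] by simp
    have ih: "integrable (chain n) (\<lambda>l. h (hd l))"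
    proof -
      have "integrable (chain n) (\<lambda>l. (\<integral>v. (psum d (v # l))\<^sup>2 \<partial>K (hd l)) - (psum d l)\<^sup>2)"
        using o1 i1[of n] by simp
      then show ?thesis
        by (subst (asm) integrable_cong_AE[where g = "\<lambda>l. h (hd l)"]) (auto simp: AE_measure_pmf_iff in1)
    qed
    have "(\<integral>l. (psum d l)\<^sup>2 \<partial>chain (Suc n)) = (\<integral>l. (\<integral>v. (psum d (v # l))\<^sup>2 \<partial>K (hd l)) \<partial>chain n)"
      using integral_bind_pmf[OF i1[of "Suc n", unfolded chain.simps]] by simp
    also have "\<dots> = (\<integral>l. h (hd l) + (psum d l)\<^sup>2 \<partial>chain n)"
      by (intro integral_cong_AE AE_pmfI) (auto simp: in1)
    also have "\<dots> = (\<integral>l. h (hd l) + psum (\<lambda>z. (d z)\<^sup>2) l \<partial>chain n)"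
      using ih i1[of n] i2[of n] Suc.IH by simp
    also have "\<dots> = (\<integral>l. (\<integral>v. psum (\<lambda>z. (d z)\<^sup>2) (v # l) \<partial>K (hd l)) \<partial>chain n)"
      by (intro integral_cong_AE AE_pmfI) (auto simp: in2)
    also have "\<dots> = (\<integral>l. psum (\<lambda>z. (d z)\<^sup>2) l \<partial>chain (Suc n))"
      using integral_bind_pmf[OF i2[of "Suc n", unfolded chain.simps]] by simp
    finally show ?case .
  qed simp
qed

end

lemma measure_pmf_Markov:
  fixes f :: "'a \<Rightarrow> real"
  assumes "integrable (measure_pmf q) f" "\<And>x. 0 \<le> f x" "0 < c"
  shows "measure q {x. c \<le> f x} \<le> (\<integral>x. f x \<partial>q) / c"
proof -
  have i: "integrable (measure_pmf q) (\<lambda>x. c * indicator {x. c \<le> f x} x)"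
    by (rule integrable_pmf_bounded[where B = "\<bar>c\<bar>"]) (auto simp: indicator_def)
  have "c * measure q {x. c \<le> f x} = (\<integral>x. c * indicator {x. c \<le> f x} x \<partial>q)"
    by simp
  also have "\<dots> \<le> (\<integral>x. f x \<partial>q)"
    using assms by (intro integral_mono i) (auto simp: indicator_def)
  finally show ?thesis using assms(3) by (simp add: field_simps)
qed

text \<open>Suprema over neighbourhoods \<open>T k\<close> of c, with \<open>usc\<close> expressing
  that they shrink. Semicontinuity from above and a common dominating function make the means
  converge to the mean at c. Serves both the likelihood ratio and the oscillation of the
  Hessian.\<close>

lemma local_sup_tendsto:
  fixes f :: "'t \<Rightarrow> 'a \<Rightarrow> real" and q :: "'a pmf" and T :: "nat \<Rightarrow> 't set"
  assumes c: "\<And>k. c \<in> T k" and dom: "\<And>k \<theta> z. \<theta> \<in> T k \<Longrightarrow> \<bar>f \<theta> z\<bar> \<le> G z" and G: "integrable q G"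
    and usc: "\<And>z e. 0 < e \<Longrightarrow> \<forall>\<^sub>F k in sequentially. \<forall>\<theta>\<in>T k. f \<theta> z \<le> f c z + e"
  obtains g where "\<And>k. integrable q (g k)" "\<And>k \<theta> z. \<theta> \<in> T k \<Longrightarrow> f \<theta> z \<le> g k z"
    "(\<lambda>k. \<integral>z. g k z \<partial>q) \<longlonglongrightarrow> (\<integral>z. f c z \<partial>q)"
proof -
  define g where "g k z = (SUP \<theta>\<in>T k. f \<theta> z)" for k z
  have bdd: "bdd_above ((\<lambda>\<theta>. f \<theta> z) ` T k)" for k z
    using dom by (intro bdd_aboveI2[where M = "G z"]) (auto simp: abs_le_iff)
  have le: "f \<theta> z \<le> g k z" if "\<theta> \<in> T k" for \<theta> z k
    unfolding g_def by (rule cSUP_upper[OF that bdd])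
  have gG: "\<bar>g k z\<bar> \<le> G z" for k z
  proof -
    have "g k z \<le> G z" unfolding g_def using c[of k] dom[of _ k z] by (intro cSUP_least) (auto simp: abs_le_iff)
    moreover have "- G z \<le> f c z" using dom[OF c[of k], of z] by (simp add: abs_le_iff)
    ultimately show ?thesis using le[OF c[of k], of z] by (simp add: abs_le_iff)
  qed
  have ig: "integrable q (g k)" for k
    by (rule Bochner_Integration.integrable_bound[OF G]) (use gG in \<open>auto intro: order_trans[OF _ abs_ge_self]\<close>)
  have "(\<lambda>k. \<integral>z. g k z \<partial>q) \<longlonglongrightarrow> (\<integral>z. f c z \<partial>q)"
  proof (rule integral_dominated_convergence[where w = G])
    show "AE z in q. (\<lambda>k. g k z) \<longlonglongrightarrow> f c z"
    proof (rule AE_I2)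
      fix z
      show "(\<lambda>k. g k z) \<longlonglongrightarrow> f c z"
      proof (rule tendstoI)
        fix e :: real assume "0 < e"
        then have "\<forall>\<^sub>F k in sequentially. \<forall>\<theta>\<in>T k. f \<theta> z \<le> f c z + e / 2" by (intro usc) simp
        then show "\<forall>\<^sub>F k in sequentially. dist (g k z) (f c z) < e"
        proof eventually_elim
          case (elim k)
          then have "g k z \<le> f c z + e / 2" unfolding g_def using c[of k] by (intro cSUP_least) auto
          then show ?case using le[OF c[of k], of z] \<open>0 < e\<close> by (simp add: dist_real_def)
        qed
      qed
    qed
    show "AE z in q. norm (g k z) \<le> G z" for k using gG by simp
  qed (use G in auto)
  with ig le show thesis by (rule that)
qed

context pos_chain
begin

lemma LLN_in_probability:
  assumes g: "integrable pair g" and "0 < c"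
  shows "(\<lambda>n. measure (chain n) {l. c \<le> \<bar>psum g l / real n - (\<integral>z. g z \<partial>pair)\<bar>}) \<longlonglongrightarrow> 0"
proof (rule Lim_null_comparison)
  let ?D = "\<lambda>n l. \<bar>psum g l / real n - (\<integral>z. g z \<partial>pair)\<bar>"
  have "measure (chain n) {l. c \<le> ?D n l} \<le> (\<integral>l. ?D n l \<partial>chain n) / c" for n
    using integrable_psum[OF g, of n] \<open>0 < c\<close> by (intro measure_pmf_Markov) auto
  then show "\<forall>\<^sub>F n in sequentially. norm (measure (chain n) {l. c \<le> ?D n l}) \<le> (\<integral>l. ?D n l \<partial>chain n) / c"
    by simp
  show "(\<lambda>n. (\<integral>l. ?D n l \<partial>chain n) / c) \<longlonglongrightarrow> 0"
    using tendsto_divide[OF chain_LLN[OF g] tendsto_const[of c]] \<open>0 < c\<close> by simp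
qed

end

text \<open>Moment conditions are taken at the true parameter, under which the data are generated;
  regularity of \<open>phi\<close> is kept on the whole parameter set.\<close>

locale mle_setting =
  fixes \<Theta> :: "(real ^ 'd) set"
    and \<nu> :: "real ^ 'd \<Rightarrow> real measure"
    and \<theta>_star \<theta>\<^sub>0 :: "real ^ 'd"
    and d\<phi> :: "real ^ 'd \<Rightarrow> nat \<Rightarrow> nat \<Rightarrow> real ^ 'd"
    and dd\<phi> :: "real ^ 'd \<Rightarrow> nat \<Rightarrow> nat \<Rightarrow> real ^ 'd ^ 'd"
    and dQ :: "real ^ 'd \<Rightarrow> nat \<Rightarrow> nat \<Rightarrow> real ^ 'd"
  assumes compact: "compact \<Theta>"
    and law: "\<And>\<theta>. \<theta> \<in> \<Theta> \<Longrightarrow> unit_law (\<nu> \<theta>)"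
    and star: "\<theta>_star \<in> interior \<Theta>"
    and A1i: "integrable (env_law (\<nu> \<theta>_star)) (\<lambda>\<omega>. ln (rho \<omega> 0))"
    and A1ii: "(\<integral>\<omega>. ln (rho \<omega> 0) \<partial>env_law (\<nu> \<theta>_star)) < 0"
    and A1iii: "integrable (env_law (\<nu> \<theta>_star)) (\<lambda>\<omega>. rho \<omega> 0)"
    and A2i: "\<And>x y. continuous_on \<Theta> (\<lambda>\<theta>. phi (\<nu> \<theta>) x y)"
    and A2ii: "\<And>\<theta> \<theta>'. \<theta> \<in> \<Theta> \<Longrightarrow> \<theta>' \<in> \<Theta> \<Longrightarrow> \<nu> \<theta> = \<nu> \<theta>' \<Longrightarrow> \<theta> = \<theta>'"
    and A2iii: "inv_nn (\<nu> \<theta>_star) (\<lambda>x y. SUP \<theta>'\<in>\<Theta>. ennreal \<bar>phi (\<nu> \<theta>') x y - phi (\<nu> \<theta>\<^sub>0) x y\<bar>) < \<infinity>"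
    and A3i_grad: "\<And>\<theta> x y. \<theta> \<in> \<Theta> \<Longrightarrow>
                  ((\<lambda>\<theta>'. phi (\<nu> \<theta>') x y) has_derivative (\<lambda>h. d\<phi> \<theta> x y \<bullet> h)) (at \<theta> within \<Theta>)"
    and A3i_hess: "\<And>\<theta> x y. \<theta> \<in> \<Theta> \<Longrightarrow>
                  ((\<lambda>\<theta>'. d\<phi> \<theta>' x y) has_derivative (\<lambda>h. dd\<phi> \<theta> x y *v h)) (at \<theta> within \<Theta>)"
    and A3i_cont: "\<And>x y. continuous_on \<Theta> (\<lambda>\<theta>. dd\<phi> \<theta> x y)"
    and dQ: "\<And>u v. ((\<lambda>\<theta>'. Q (\<nu> \<theta>') u v) has_derivative (\<lambda>h. dQ \<theta>_star u v \<bullet> h)) (at \<theta>_star within \<Theta>)"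
    and A3iii: "\<And>u. summable (dQ \<theta>_star u) \<and>
                  ((\<lambda>\<theta>'. \<Sum>v. Q (\<nu> \<theta>') u v) has_derivative (\<lambda>h. (\<Sum>v. dQ \<theta>_star u v) \<bullet> h)) (at \<theta>_star within \<Theta>)"
    and A3iv: "\<exists>V. open V \<and> \<theta>_star \<in> V \<and>
                    inv_nn (\<nu> \<theta>_star) (\<lambda>x y. SUP \<theta>'\<in>V \<inter> \<Theta>. ennreal ((norm (d\<phi> \<theta>' x y))\<^sup>2)) < \<infinity> \<and>
                    inv_nn (\<nu> \<theta>_star) (\<lambda>x y. SUP \<theta>'\<in>V \<inter> \<Theta>. ennreal (norm (dd\<phi> \<theta>' x y))) < \<infinity>"
    and A3v_eq: "inv_mat (\<nu> \<theta>_star) (\<lambda>x y. outer (d\<phi> \<theta>_star x y)) = - inv_mat (\<nu> \<theta>_star) (dd\<phi> \<theta>_star)"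
    and A3v: "invertible (inv_mat (\<nu> \<theta>_star) (\<lambda>x y. outer (d\<phi> \<theta>_star x y)))"
begin

section \<open>Likelihood ratios and consistency\<close>

lemma star_in: "\<theta>_star \<in> \<Theta>"
  using star interior_subset by blast

lemma site: "\<theta> \<in> \<Theta> \<Longrightarrow> env_site (\<nu> \<theta>)"
  by (simp add: env_site_def law)

sublocale star: transient_site "\<nu> \<theta>_star"
  using site[OF star_in] A1i A1ii A1iii by (simp add: transient_site_def transient_site_axioms_def)

abbreviation Ph :: "real ^ 'd \<Rightarrow> nat \<times> nat \<Rightarrow> real" where
  "Ph \<theta> z \<equiv> phi (\<nu> \<theta>) (fst z) (snd z)"

text \<open>The supremum is centred at \<open>\<theta>\<^sub>0\<close>; moving the centre to the
  true parameter costs a factor 2.\<close>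

lemma phi_dominated:
  obtains G where "integrable star.pair G" "\<And>z. 0 \<le> G z"
    "\<And>\<theta> z. \<theta> \<in> \<Theta> \<Longrightarrow> \<bar>Ph \<theta> z - Ph \<theta>_star z\<bar> \<le> G z"
proof -
  obtain G where G: "integrable star.pair G" "\<And>z. 0 \<le> G z"
      "\<And>\<theta> z. \<theta> \<in> \<Theta> \<Longrightarrow> \<bar>Ph \<theta> z - Ph \<theta>\<^sub>0 z\<bar> \<le> G z"
    using star.sup_dominated[where T = \<Theta> and f = "\<lambda>\<theta> z. \<bar>Ph \<theta> z - Ph \<theta>\<^sub>0 z\<bar>"] A2iii[unfolded star.inv_nn_eq] by blast
  show thesis
  proof (rule that[of "\<lambda>z. 2 * G z"])
    show "\<bar>Ph \<theta> z - Ph \<theta>_star z\<bar> \<le> 2 * G z" if "\<theta> \<in> \<Theta>" for \<theta> z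
      using G(3)[OF that, of z] G(3)[OF star_in, of z] by linarith
  qed (use G in auto)
qed

lemma integrable_phi_diff:
  assumes "\<theta> \<in> \<Theta>" shows "integrable star.pair (\<lambda>z. Ph \<theta> z - Ph \<theta>_star z)"
proof -
  obtain G where G: "integrable star.pair G" "\<And>z. 0 \<le> G z"
    "\<And>\<theta> z. \<theta> \<in> \<Theta> \<Longrightarrow> \<bar>Ph \<theta> z - Ph \<theta>_star z\<bar> \<le> G z"
    using phi_dominated by blast
  show ?thesis
    by (rule Bochner_Integration.integrable_bound[OF G(1)])
       (use G(2) in \<open>auto intro: order_trans[OF G(3)[OF assms]]\<close>)
qed

text \<open>Identifiability enters through the equality case of \<open>1 + x \<le> exp x\<close>.\<close>

lemma kl_negative:
  assumes "\<theta> \<in> \<Theta>" "\<theta> \<noteq> \<theta>_star"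
  shows "(\<integral>z. Ph \<theta> z - Ph \<theta>_star z \<partial>star.pair) < 0"
proof (rule ccontr)
  interpret T: env_site "\<nu> \<theta>" by (rule site[OF assms(1)])
  define D where "D z = Ph \<theta> z - Ph \<theta>_star z" for z
  assume "\<not> (\<integral>z. Ph \<theta> z - Ph \<theta>_star z \<partial>star.pair) < 0"
  then have ge: "0 \<le> (\<integral>z. D z \<partial>star.pair)" by (simp add: D_def)
  have iD: "integrable star.pair D" unfolding D_def by (rule integrable_phi_diff[OF assms(1)])
  have R: "Q (\<nu> \<theta>_star) u v * exp (D (u, v)) = Q (\<nu> \<theta>) u v" for u v
    by (simp add: D_def star.Q_eq_exp_phi T.Q_eq_exp_phi exp_diff)
  \<comment> \<open>The exponential of \<open>D\<close> is the ratio of the kernels at the two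
    parameters, and both kernels sum to 1 over v.\<close>
  have inner: "(\<integral>\<^sup>+v. ennreal (exp (D (u, v))) \<partial>star.KQ u) = 1" for u
  proof -
    have "(\<integral>\<^sup>+v. ennreal (exp (D (u, v))) \<partial>star.KQ u) = (\<Sum>v. ennreal (Q (\<nu> \<theta>) u v))"
      unfolding star.nn_integral_KQ
      by (intro suminf_cong) (simp add: ennreal_mult[symmetric] star.Q_pos less_imp_le R)
    then show ?thesis by (simp add: T.nn_sum_Q_1)
  qed
  have nn: "(\<integral>\<^sup>+z. ennreal (exp (D z)) \<partial>star.pair) = 1"
    unfolding star.nn_integral_pair inner by simp
  then have iR: "integrable star.pair (\<lambda>z. exp (D z))" by (simp add: integrable_iff_bounded)
  have ER: "(\<integral>z. exp (D z) \<partial>star.pair) = 1"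
    using nn by (subst integral_eq_nn_integral) auto
  have "(\<integral>z. exp (D z) - 1 - D z \<partial>star.pair) = - (\<integral>z. D z \<partial>star.pair)"
    using iR iD by (simp add: ER)
  moreover have pos: "0 \<le> exp (D z) - 1 - D z" for z
    using exp_ge_add_one_self[of "D z"] by linarith
  moreover have "0 \<le> (\<integral>z. exp (D z) - 1 - D z \<partial>star.pair)"
    using pos by (intro integral_nonneg_AE AE_I2) auto
  ultimately have "(\<integral>z. exp (D z) - 1 - D z \<partial>star.pair) = 0" using ge by linarith
  then have "AE z in star.pair. exp (D z) - 1 - D z = 0"
    using iR iD pos by (subst (asm) integral_nonneg_eq_0_iff_AE) auto
  then have E: "exp (D z) - 1 - D z = 0" for z by (simp only: star.AE_pair)
  have "ln (exp (D z)) = exp (D z) - 1" for z using E[of z] unfolding ln_exp by linarith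
  then have "exp (D z) = 1" for z by (intro ln_eq_minus_one) auto
  then have D0: "phi (\<nu> \<theta>) u v = phi (\<nu> \<theta>_star) u v" for u v
    using \<open>\<And>z. exp (D z) = 1\<close>[of "(u, v)"] by (simp add: D_def)
  \<comment> \<open>For k > 0 the value of \<open>phi\<close> at k - 1 and 0 is the logarithm of the
    k-th moment, so equality of \<open>phi\<close> identifies the site law.\<close>
  have "(\<integral>a. a ^ k \<partial>\<nu> \<theta>) = (\<integral>a. a ^ k \<partial>\<nu> \<theta>_star)" for k
  proof (cases k)
    case 0
    then show ?thesis by (simp add: T.site.prob_space star.site.prob_space)
  next
    case (Suc u)
    then show ?thesis
      using D0[of u 0] T.integral_monomial_pos[of "Suc u" 0] star.integral_monomial_pos[of "Suc u" 0]
      by (simp add: phi_def)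
  qed
  then have "\<nu> \<theta> = \<nu> \<theta>_star"
    by (rule env_site_eqI_moments[OF site[OF assms(1)] site[OF star_in]])
  then show False using A2ii[OF assms(1) star_in] assms(2) by simp
qed

text \<open>Wald's argument: every parameter away from the truth has a small ball on which the
  log-likelihood ratios have a common upper bound with negative mean. By compactness finitely many
  balls suffice, and the law of large numbers makes all these bounds negative. The exceptional set
  of lists is the same for all n.\<close>

lemma consistency:
  assumes "0 < \<epsilon>"
  obtains B :: "nat list set" where "(\<lambda>n. measure (star.chain n) B) \<longlonglongrightarrow> 0"
    "\<And>l \<theta>. l \<notin> B \<Longrightarrow> \<theta> \<in> \<Theta> \<Longrightarrow> \<epsilon> \<le> dist \<theta> \<theta>_star \<Longrightarrow> psum (\<lambda>z. Ph \<theta> z - Ph \<theta>_star z) l < 0"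
proof -
  obtain G where G: "integrable star.pair G" "\<And>z. 0 \<le> G z"
    "\<And>\<theta> z. \<theta> \<in> \<Theta> \<Longrightarrow> \<bar>Ph \<theta> z - Ph \<theta>_star z\<bar> \<le> G z"
    using phi_dominated by blast
  define C where "C = \<Theta> - ball \<theta>_star \<epsilon>"
  have "compact C" unfolding C_def by (rule compact_diff[OF compact open_ball])
  have "\<exists>r g. 0 < r \<and> integrable star.pair g \<and> (\<integral>z. g z \<partial>star.pair) < 0 \<and>
      (\<forall>\<theta>\<in>\<Theta> \<inter> ball \<theta>c r. \<forall>z. Ph \<theta> z - Ph \<theta>_star z \<le> g z)" if "\<theta>c \<in> C" for \<theta>c
  proof -
    have tc: "\<theta>c \<in> \<Theta>" "\<theta>c \<noteq> \<theta>_star" using that \<open>0 < \<epsilon>\<close> by (auto simp: C_def)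
    define T where "T k = \<Theta> \<inter> ball \<theta>c (1 / real (Suc k))" for k
    obtain g where g: "\<And>k. integrable star.pair (g k)"
        "\<And>k \<theta> z. \<theta> \<in> T k \<Longrightarrow> Ph \<theta> z - Ph \<theta>_star z \<le> g k z"
        "(\<lambda>k. \<integral>z. g k z \<partial>star.pair) \<longlonglongrightarrow> (\<integral>z. Ph \<theta>c z - Ph \<theta>_star z \<partial>star.pair)"
    proof (rule local_sup_tendsto[where c = \<theta>c and T = T and f = "\<lambda>\<theta> z. Ph \<theta> z - Ph \<theta>_star z" and G = G and q = star.pair])
      show "\<theta>c \<in> T k" for k using tc by (simp add: T_def)
      show "\<bar>Ph \<theta> z - Ph \<theta>_star z\<bar> \<le> G z" if "\<theta> \<in> T k" for k \<theta> z using that G(3) by (simp add: T_def)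
      fix z and e :: real assume "0 < e"
      then obtain d where d: "d > 0" "\<And>\<theta>. \<theta> \<in> \<Theta> \<Longrightarrow> dist \<theta> \<theta>c < d \<Longrightarrow> dist (Ph \<theta> z) (Ph \<theta>c z) < e"
        using A2i[of "fst z" "snd z"] tc(1) unfolding continuous_on_iff by metis
      have "(\<lambda>k. 1 / real (Suc k)) \<longlonglongrightarrow> 0" by (rule LIMSEQ_Suc[OF lim_1_over_n])
      from order_tendstoD(2)[OF this d(1)]
      show "\<forall>\<^sub>F k in sequentially. \<forall>\<theta>\<in>T k. Ph \<theta> z - Ph \<theta>_star z \<le> Ph \<theta>c z - Ph \<theta>_star z + e"
      proof eventually_elim
        case (elim k)
        show ?case
        proof
          fix \<theta> assume "\<theta> \<in> T k"
          then have "\<theta> \<in> \<Theta>" "dist \<theta> \<theta>c < d" using elim by (auto simp: T_def dist_commute)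
          from d(2)[OF this] show "Ph \<theta> z - Ph \<theta>_star z \<le> Ph \<theta>c z - Ph \<theta>_star z + e"
            by (simp add: dist_real_def)
        qed
      qed
    qed (use G in auto)
    from order_tendstoD(2)[OF g(3) kl_negative[OF tc]] obtain k where "(\<integral>z. g k z \<partial>star.pair) < 0"
      by (auto simp: eventually_sequentially)
    then show ?thesis using g(1,2) by (intro exI[of _ "1 / real (Suc k)"] exI[of _ "g k"]) (auto simp: T_def)
  qed
  then obtain r g where rg: "\<And>\<theta>c. \<theta>c \<in> C \<Longrightarrow> 0 < r \<theta>c" "\<And>\<theta>c. \<theta>c \<in> C \<Longrightarrow> integrable star.pair (g \<theta>c)"
      "\<And>\<theta>c. \<theta>c \<in> C \<Longrightarrow> (\<integral>z. g \<theta>c z \<partial>star.pair) < 0"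
      "\<And>\<theta>c \<theta> z. \<theta>c \<in> C \<Longrightarrow> \<theta> \<in> \<Theta> \<Longrightarrow> \<theta> \<in> ball \<theta>c (r \<theta>c) \<Longrightarrow> Ph \<theta> z - Ph \<theta>_star z \<le> g \<theta>c z"
  proof -
    assume "\<And>\<theta>c. \<theta>c \<in> C \<Longrightarrow> \<exists>r g. 0 < r \<and> integrable star.pair g \<and> (\<integral>z. g z \<partial>star.pair) < 0 \<and>
      (\<forall>\<theta>\<in>\<Theta> \<inter> ball \<theta>c r. \<forall>z. Ph \<theta> z - Ph \<theta>_star z \<le> g z)"
    then have "\<forall>\<theta>c\<in>C. \<exists>r g. 0 < r \<and> integrable star.pair g \<and> (\<integral>z. g z \<partial>star.pair) < 0 \<and>
      (\<forall>\<theta>\<in>\<Theta> \<inter> ball \<theta>c r. \<forall>z. Ph \<theta> z - Ph \<theta>_star z \<le> g z)" by blast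
    from bchoice[OF this] obtain r where "\<forall>\<theta>c\<in>C. \<exists>g. 0 < r \<theta>c \<and> integrable star.pair g \<and> (\<integral>z. g z \<partial>star.pair) < 0 \<and>
      (\<forall>\<theta>\<in>\<Theta> \<inter> ball \<theta>c (r \<theta>c). \<forall>z. Ph \<theta> z - Ph \<theta>_star z \<le> g z)" by blast
    from bchoice[OF this] obtain g where "\<forall>\<theta>c\<in>C. 0 < r \<theta>c \<and> integrable star.pair (g \<theta>c) \<and> (\<integral>z. g \<theta>c z \<partial>star.pair) < 0 \<and>
      (\<forall>\<theta>\<in>\<Theta> \<inter> ball \<theta>c (r \<theta>c). \<forall>z. Ph \<theta> z - Ph \<theta>_star z \<le> g \<theta>c z)" by blast
    then show thesis by (intro that[of r g]) auto
  qed
  obtain I where I: "I \<subseteq> C" "finite I" "C \<subseteq> (\<Union>\<theta>c\<in>I. ball \<theta>c (r \<theta>c))"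
  proof (rule compactE_image[OF \<open>compact C\<close>, of C "\<lambda>\<theta>c. ball \<theta>c (r \<theta>c)"])
    show "C \<subseteq> (\<Union>\<theta>c\<in>C. ball \<theta>c (r \<theta>c))" using rg(1) by fastforce
  qed auto
  define B where "B = (\<Union>\<theta>c\<in>I. {l. 0 \<le> psum (g \<theta>c) l})"
  show thesis
  proof (rule that[of B])
    show "(\<lambda>n. measure (star.chain n) B) \<longlonglongrightarrow> 0"
    proof (rule Lim_null_comparison)
      let ?m = "\<lambda>\<theta>c. (\<integral>z. g \<theta>c z \<partial>star.pair)"
      let ?b = "\<lambda>n \<theta>c. measure (star.chain n) {l. - ?m \<theta>c \<le> \<bar>psum (g \<theta>c) l / real n - ?m \<theta>c\<bar>}"
      have "(\<lambda>n. \<Sum>\<theta>c\<in>I. ?b n \<theta>c) \<longlonglongrightarrow> (\<Sum>\<theta>c\<in>I. 0)"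
        using I(1) rg(2,3) by (intro tendsto_sum star.LLN_in_probability) auto
      then show "(\<lambda>n. \<Sum>\<theta>c\<in>I. ?b n \<theta>c) \<longlonglongrightarrow> 0" by simp
      have "measure (star.chain n) B \<le> (\<Sum>\<theta>c\<in>I. ?b n \<theta>c)" for n
      proof -
        have "measure (star.chain n) B \<le> (\<Sum>\<theta>c\<in>I. measure (star.chain n) {l. 0 \<le> psum (g \<theta>c) l})"
          unfolding B_def using I(2) by (intro measure_pmf.finite_measure_subadditive_finite) auto
        also have "\<dots> \<le> (\<Sum>\<theta>c\<in>I. ?b n \<theta>c)"
        proof (intro sum_mono measure_pmf.finite_measure_mono)
          fix \<theta>c
          show "{l. 0 \<le> psum (g \<theta>c) l} \<subseteq> {l. - ?m \<theta>c \<le> \<bar>psum (g \<theta>c) l / real n - ?m \<theta>c\<bar>}"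
          proof safe
            fix l assume "0 \<le> psum (g \<theta>c) l"
            then have "0 \<le> psum (g \<theta>c) l / real n" by simp
            then show "- ?m \<theta>c \<le> \<bar>psum (g \<theta>c) l / real n - ?m \<theta>c\<bar>" by linarith
          qed
        qed auto
        finally show ?thesis .
      qed
      then show "\<forall>\<^sub>F n in sequentially. norm (measure (star.chain n) B) \<le> (\<Sum>\<theta>c\<in>I. ?b n \<theta>c)" by simp
    qed
    fix l \<theta> assume l: "l \<notin> B" and t: "\<theta> \<in> \<Theta>" "\<epsilon> \<le> dist \<theta> \<theta>_star"
    then have "\<theta> \<in> C" by (simp add: C_def dist_commute)
    then obtain \<theta>c where c: "\<theta>c \<in> I" "\<theta> \<in> ball \<theta>c (r \<theta>c)" using I(3) by auto
    have "psum (\<lambda>z. Ph \<theta> z - Ph \<theta>_star z) l \<le> psum (g \<theta>c) l"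
      using rg(4)[OF _ t(1) c(2)] c(1) I(1) by (intro psum_mono) auto
    also have "\<dots> < 0" using l c(1) by (auto simp: B_def not_le)
    finally show "psum (\<lambda>z. Ph \<theta> z - Ph \<theta>_star z) l < 0" .
  qed
qed

subsection \<open>The score\<close>

abbreviation score :: "nat \<times> nat \<Rightarrow> real ^ 'd" where
  "score z \<equiv> d\<phi> \<theta>_star (fst z) (snd z)"

abbreviation Info :: "real ^ 'd ^ 'd" where
  "Info \<equiv> inv_mat (\<nu> \<theta>_star) (\<lambda>x y. outer (d\<phi> \<theta>_star x y))"

lemma integrable_score_sq: "integrable star.pair (\<lambda>z. (norm (score z))\<^sup>2)"
proof -
  obtain V where V: "\<theta>_star \<in> V" "inv_nn (\<nu> \<theta>_star) (\<lambda>x y. SUP \<theta>'\<in>V \<inter> \<Theta>. ennreal ((norm (d\<phi> \<theta>' x y))\<^sup>2)) < \<infinity>"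
    using A3iv by blast
  obtain G where G: "integrable star.pair G" "\<And>z. 0 \<le> G z"
      "\<And>\<theta> z. \<theta> \<in> V \<inter> \<Theta> \<Longrightarrow> (norm (d\<phi> \<theta> (fst z) (snd z)))\<^sup>2 \<le> G z"
    using star.sup_dominated[where T = "V \<inter> \<Theta>" and f = "\<lambda>\<theta> z. (norm (d\<phi> \<theta> (fst z) (snd z)))\<^sup>2"] V(2)[unfolded star.inv_nn_eq] by blast
  show ?thesis
    by (rule Bochner_Integration.integrable_bound[OF G(1)]) (use G(2,3) V(1) star_in in auto)
qed

lemma integrable_score_dir_sq: "integrable star.pair (\<lambda>z. (s \<bullet> score z)\<^sup>2)"
proof (rule Bochner_Integration.integrable_bound)
  show "integrable star.pair (\<lambda>z. (norm s)\<^sup>2 * (norm (score z))\<^sup>2)" using integrable_score_sq by simp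
  have "(s \<bullet> score z)\<^sup>2 \<le> (norm s)\<^sup>2 * (norm (score z))\<^sup>2" for z
    using power_mono[OF Cauchy_Schwarz_ineq2[of s "score z"] abs_ge_zero, of 2] by (simp add: power_mult_distrib)
  then show "AE z in star.pair. norm ((s \<bullet> score z)\<^sup>2) \<le> norm ((norm s)\<^sup>2 * (norm (score z))\<^sup>2)" by simp
qed simp

text \<open>Differentiate, term by term as assumed, the identity that \<open>Q\<close> sums to 1
  over v; the derivative of \<open>Q\<close> is \<open>Q\<close> times the score. The true parameter
  is interior, which makes these derivatives unique.\<close>

lemma score_mean:
  shows "(\<integral>v. s \<bullet> score (u, v) \<partial>star.KQ u) = 0"
proof -
  have at: "at \<theta>_star within \<Theta> = at \<theta>_star" by (rule at_within_interior[OF star])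
  have dQ_eq: "dQ \<theta>_star u v = Q (\<nu> \<theta>_star) u v *\<^sub>R score (u, v)" for v
  proof -
    let ?c = "real ((u + v) choose v)"
    have "((\<lambda>\<theta>. ?c * exp (phi (\<nu> \<theta>) u v)) has_derivative (\<lambda>h. ?c * (exp (phi (\<nu> \<theta>_star) u v) * (d\<phi> \<theta>_star u v \<bullet> h)))) (at \<theta>_star within \<Theta>)"
      by (auto intro!: derivative_eq_intros A3i_grad[OF star_in] simp: mult_ac)
    then have "((\<lambda>\<theta>. Q (\<nu> \<theta>) u v) has_derivative (\<lambda>h. ?c * (exp (phi (\<nu> \<theta>_star) u v) * (d\<phi> \<theta>_star u v \<bullet> h)))) (at \<theta>_star within \<Theta>)"
      by (rule has_derivative_transform[OF star_in, rotated]) (use env_site.Q_eq_exp_phi[OF site] in auto)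
    then have "(\<lambda>h. dQ \<theta>_star u v \<bullet> h) = (\<lambda>h. ?c * (exp (phi (\<nu> \<theta>_star) u v) * (d\<phi> \<theta>_star u v \<bullet> h)))"
      using dQ[of u v] unfolding at by (intro has_derivative_unique)
    then have "dQ \<theta>_star u v \<bullet> h = (Q (\<nu> \<theta>_star) u v *\<^sub>R score (u, v)) \<bullet> h" for h
      by (simp add: fun_eq_iff star.Q_eq_exp_phi)
    then show ?thesis using vector_eq_rdot[of "dQ \<theta>_star u v"] by blast
  qed
  have sum1: "(\<Sum>v. Q (\<nu> \<theta>) u v) = 1" if "\<theta> \<in> \<Theta>" for \<theta>
  proof -
    interpret T: env_site "\<nu> \<theta>" by (rule site[OF that])
    have s: "summable (Q (\<nu> \<theta>) u)"
      using T.nn_sum_Q_1[of u] T.Q_pos by (intro summable_suminf_not_top) (auto simp: less_imp_le)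
    have "ennreal (\<Sum>v. Q (\<nu> \<theta>) u v) = 1"
      using T.nn_sum_Q_1[of u] T.Q_pos s by (subst suminf_ennreal2[symmetric]) (auto simp: less_imp_le)
    then show ?thesis using suminf_nonneg[OF s] T.Q_pos by (simp add: less_imp_le)
  qed
  have "((\<lambda>\<theta>. 1) has_derivative (\<lambda>h. (\<Sum>v. dQ \<theta>_star u v) \<bullet> h)) (at \<theta>_star within \<Theta>)"
    by (rule has_derivative_transform[where f = "\<lambda>\<theta>. \<Sum>v. Q (\<nu> \<theta>) u v"]) (use A3iii[of u] sum1 star_in in auto)
  then have "(\<lambda>h. (\<Sum>v. dQ \<theta>_star u v) \<bullet> h) = (\<lambda>h. 0)"
    unfolding at by (intro has_derivative_unique[OF _ has_derivative_const])
  from fun_cong[OF this, of "\<Sum>v. dQ \<theta>_star u v"] have zero: "(\<Sum>v. dQ \<theta>_star u v) = 0" by simp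
  have sums: "(\<lambda>v. s \<bullet> dQ \<theta>_star u v) sums (s \<bullet> 0)"
    using A3iii[of u] zero summable_sums[of "dQ \<theta>_star u"]
    by (intro bounded_linear.sums[OF bounded_linear_inner_right]) auto
  have "integrable (star.KQ u) (\<lambda>v. (s \<bullet> score (u, v))\<^sup>2)"
    using star.integrable_pair_inner[OF integrable_score_dir_sq[of s]] by simp
  then have int: "integrable (star.KQ u) (\<lambda>v. s \<bullet> score (u, v))" by (rule star.integrable_of_square)
  have ci: "integrable (count_space UNIV) (\<lambda>v. pmf (star.KQ u) v *\<^sub>R (s \<bullet> score (u, v)))"
    using int unfolding measure_pmf_eq_density by (subst (asm) integrable_density) auto
  have eq: "(\<lambda>v. pmf (star.KQ u) v *\<^sub>R (s \<bullet> score (u, v))) = (\<lambda>v. s \<bullet> dQ \<theta>_star u v)"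
    by (simp add: dQ_eq star.pmf_KQ)
  have "(\<integral>v. s \<bullet> score (u, v) \<partial>star.KQ u) = (\<integral>v. pmf (star.KQ u) v *\<^sub>R (s \<bullet> score (u, v)) \<partial>count_space UNIV)"
    unfolding measure_pmf_eq_density by (subst integral_density) auto
  \<comment> \<open>Two evaluations of one series: as an integral over the counting measure, and as
    the series of derivatives, which is 0.\<close>
  also have "\<dots> = s \<bullet> 0"
    by (rule sums_unique2[OF sums_integral_count_space_nat[OF ci, unfolded eq] sums, folded eq])
  finally show ?thesis by simp
qed

lemma integrable_score_dir: "integrable (star.KQ u) (\<lambda>v. s \<bullet> score (u, v))"
  using star.integrable_pair_inner[OF integrable_score_dir_sq[of s], of u]
  by (rule star.integrable_of_square)

lemma integrable_outer: "integrable star.pair (\<lambda>z. outer (score z) $ i $ j)"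
proof (rule Bochner_Integration.integrable_bound[OF integrable_score_sq])
  have "\<bar>score z $ i * score z $ j\<bar> \<le> (norm (score z))\<^sup>2" for z
    unfolding abs_mult power2_eq_square by (intro mult_mono component_le_norm_cart) auto
  then show "AE z in star.pair. norm (outer (score z) $ i $ j) \<le> norm ((norm (score z))\<^sup>2)"
    by (simp add: outer_def)
qed simp

lemma Info_nth: "Info $ i $ j = (\<integral>z. score z $ i * score z $ j \<partial>star.pair)"
  using star.inv_mat_nth[OF integrable_outer] by (simp add: outer_def)

lemma Info_sym: "transpose Info = Info"
  by (simp add: transpose_def vec_eq_iff Info_nth mult.commute)

lemma Info_vec: "(Info *v s) $ i = (\<integral>z. score z $ i * (s \<bullet> score z) \<partial>star.pair)"
proof -
  have int: "integrable star.pair (\<lambda>z. score z $ i * score z $ j * s $ j)" for j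
    using integrable_outer[of i j] by (simp add: outer_def)
  have "(Info *v s) $ i = (\<Sum>j\<in>UNIV. (\<integral>z. score z $ i * score z $ j * s $ j \<partial>star.pair))"
    by (simp add: matrix_vector_mult_def Info_nth)
  also have "\<dots> = (\<integral>z. (\<Sum>j\<in>UNIV. score z $ i * score z $ j * s $ j) \<partial>star.pair)"
    by (rule Bochner_Integration.integral_sum[symmetric]) (rule int)
  also have "\<dots> = (\<integral>z. score z $ i * (s \<bullet> score z) \<partial>star.pair)"
    by (rule Bochner_Integration.integral_cong[OF refl]) (simp add: inner_vec_def sum_distrib_left mult_ac)
  finally show ?thesis .
qed

lemma Info_quadratic: "s \<bullet> (Info *v s) = (\<integral>z. (s \<bullet> score z)\<^sup>2 \<partial>star.pair)"
proof -
  have int: "integrable star.pair (\<lambda>z. s $ i * (score z $ i * (s \<bullet> score z)))" for i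
  proof (rule Bochner_Integration.integrable_bound)
    show "integrable star.pair (\<lambda>z. (norm s)\<^sup>2 * (norm (score z))\<^sup>2)" using integrable_score_sq by simp
    have "\<bar>s $ i * (score z $ i * (s \<bullet> score z))\<bar> \<le> norm s * (norm (score z) * (norm s * norm (score z)))" for z
      unfolding abs_mult by (intro mult_mono component_le_norm_cart Cauchy_Schwarz_ineq2) auto
    then show "AE z in star.pair. norm (s $ i * (score z $ i * (s \<bullet> score z))) \<le> norm ((norm s)\<^sup>2 * (norm (score z))\<^sup>2)"
      by (simp add: power2_eq_square mult_ac)
  qed simp
  have "s \<bullet> (Info *v s) = (\<Sum>i\<in>UNIV. (\<integral>z. s $ i * (score z $ i * (s \<bullet> score z)) \<partial>star.pair))"
    by (simp add: inner_vec_def Info_vec[unfolded inner_vec_def])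
  also have "\<dots> = (\<integral>z. (\<Sum>i\<in>UNIV. s $ i * (score z $ i * (s \<bullet> score z))) \<partial>star.pair)"
    by (rule Bochner_Integration.integral_sum[symmetric]) (rule int)
  also have "\<dots> = (\<integral>z. (s \<bullet> score z)\<^sup>2 \<partial>star.pair)"
  proof (rule Bochner_Integration.integral_cong[OF refl])
    fix z
    have "(\<Sum>i\<in>UNIV. s $ i * (score z $ i * (s \<bullet> score z))) = (\<Sum>i\<in>UNIV. s $ i * score z $ i) * (s \<bullet> score z)"
      by (simp add: sum_distrib_right mult.assoc)
    then show "(\<Sum>i\<in>UNIV. s $ i * (score z $ i * (s \<bullet> score z))) = (s \<bullet> score z)\<^sup>2"
      by (simp add: inner_vec_def power2_eq_square)
  qed
  finally show ?thesis .
qed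

text \<open>A direction in which the quadratic form vanishes is orthogonal to the score at every
  pair, hence lies in the kernel of an invertible matrix.\<close>

lemma Info_pos:
  assumes "s \<noteq> 0" shows "0 < s \<bullet> (Info *v s)"
proof (rule ccontr)
  assume "\<not> 0 < s \<bullet> (Info *v s)"
  then have "(\<integral>z. (s \<bullet> score z)\<^sup>2 \<partial>star.pair) = 0"
    unfolding Info_quadratic by (simp add: not_less order.antisym)
  then have "AE z in star.pair. (s \<bullet> score z)\<^sup>2 = 0"
    using integrable_score_dir_sq[of s] by (subst (asm) integral_nonneg_eq_0_iff_AE) auto
  then have "s \<bullet> score z = 0" for z by (simp only: star.AE_pair) simp
  then have "Info *v s = 0" by (simp add: vec_eq_iff Info_vec)
  then show False using A3v assms by (metis invertible_def matrix_vector_mul_assoc matrix_vector_mul_lid matrix_vector_mult_0_right)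
qed

end

section \<open>Taylor expansion of the score equation\<close>

lemma psum_sum: "psum (\<lambda>z. \<Sum>i\<in>I. g i z) l = (\<Sum>i\<in>I. psum (g i) l)"
  unfolding psum_conv_sum by (rule sum.swap)

lemma inner_matrix_entries:
  fixes A :: "real ^ 'n ^ 'm"
  shows "s \<bullet> (A *v y) = (\<Sum>i\<in>UNIV. \<Sum>j\<in>UNIV. s $ i * y $ j * A $ i $ j)"
  by (simp add: inner_vec_def matrix_vector_mult_def sum_distrib_left mult_ac)

text \<open>Dominates the bilinear form and splits into scalar entries, to which laws of large
  numbers apply.\<close>

definition entry_norm :: "real ^ 'n ^ 'm \<Rightarrow> real" where
  "entry_norm A = (\<Sum>i\<in>UNIV. \<Sum>j\<in>UNIV. \<bar>A $ i $ j\<bar>)"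

lemma entry_norm_nonneg: "0 \<le> entry_norm A"
  unfolding entry_norm_def by (intro sum_nonneg) simp

lemma inner_matrix_bound:
  fixes A :: "real ^ 'n ^ 'm"
  shows "\<bar>s \<bullet> (A *v y)\<bar> \<le> entry_norm A * (norm s * norm y)"
proof -
  have "\<bar>s \<bullet> (A *v y)\<bar> \<le> (\<Sum>i\<in>UNIV. \<Sum>j\<in>UNIV. \<bar>s $ i * y $ j * A $ i $ j\<bar>)"
    unfolding inner_matrix_entries by (intro order_trans[OF sum_abs] sum_mono sum_abs)
  also have "\<dots> \<le> (\<Sum>i\<in>UNIV. \<Sum>j\<in>UNIV. (norm s * norm y) * \<bar>A $ i $ j\<bar>)"
    unfolding abs_mult by (intro sum_mono mult_right_mono mult_mono component_le_norm_cart) auto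
  finally show ?thesis by (simp add: entry_norm_def sum_distrib_left mult.commute)
qed

lemma entry_le_norm:
  fixes A :: "real ^ 'n ^ 'm"
  shows "\<bar>A $ i $ j\<bar> \<le> norm A"
  using component_le_norm_cart[of "A $ i" j] Finite_Cartesian_Product.norm_nth_le[of A i] by linarith

lemma entry_norm_le:
  fixes A :: "real ^ 'n ^ 'm"
  shows "entry_norm A \<le> real CARD('m) * real CARD('n) * norm A"
proof -
  have "entry_norm A \<le> (\<Sum>i\<in>(UNIV::'m set). \<Sum>j\<in>(UNIV::'n set). norm A)"
    unfolding entry_norm_def by (intro sum_mono entry_le_norm)
  then show ?thesis by simp
qed

context mle_setting
begin

abbreviation Sc :: "real ^ 'd \<Rightarrow> nat \<times> nat \<Rightarrow> real ^ 'd" where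
  "Sc \<theta> z \<equiv> d\<phi> \<theta> (fst z) (snd z)"

abbreviation Hs :: "real ^ 'd \<Rightarrow> nat \<times> nat \<Rightarrow> real ^ 'd ^ 'd" where
  "Hs \<theta> z \<equiv> dd\<phi> \<theta> (fst z) (snd z)"

text \<open>The neighbourhood is cut down to the interior, so that balls inside it lie in
  \<open>\<Theta>\<close>.\<close>

lemma hess_dominated:
  "\<exists>V G. open V \<and> \<theta>_star \<in> V \<and> V \<subseteq> \<Theta> \<and> integrable star.pair G \<and> (\<forall>z. 0 \<le> G z) \<and>
    (\<forall>\<theta>\<in>V. \<forall>z. norm (Hs \<theta> z) \<le> G z)"
proof -
  obtain V where V: "open V" "\<theta>_star \<in> V" "inv_nn (\<nu> \<theta>_star) (\<lambda>x y. SUP \<theta>'\<in>V \<inter> \<Theta>. ennreal (norm (dd\<phi> \<theta>' x y))) < \<infinity>"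
    using A3iv by blast
  obtain G where G: "integrable star.pair G" "\<And>z. 0 \<le> G z" "\<And>\<theta> z. \<theta> \<in> V \<inter> \<Theta> \<Longrightarrow> norm (Hs \<theta> z) \<le> G z"
    using star.sup_dominated[where T = "V \<inter> \<Theta>" and f = "\<lambda>\<theta> z. norm (Hs \<theta> z)"] V(3)[unfolded star.inv_nn_eq] by blast
  show ?thesis
  proof (intro exI[of _ "V \<inter> interior \<Theta>"] exI[of _ G] conjI ballI allI)
    show "norm (Hs \<theta> z) \<le> G z" if "\<theta> \<in> V \<inter> interior \<Theta>" for \<theta> z
      using that interior_subset by (intro G(3)) blast
  qed (use V G star interior_subset[of \<Theta>] in auto)
qed

lemma integrable_hess: "integrable star.pair (\<lambda>z. Hs \<theta>_star z $ i $ j)"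
proof -
  obtain V G where G: "open V" "\<theta>_star \<in> V" "V \<subseteq> \<Theta>" "integrable star.pair G" "\<And>z. 0 \<le> G z"
    "\<And>\<theta> z. \<theta> \<in> V \<Longrightarrow> norm (Hs \<theta> z) \<le> G z"
    using hess_dominated by blast
  have "\<bar>Hs \<theta>_star z $ i $ j\<bar> \<le> G z" for z by (rule order_trans[OF entry_le_norm G(6)[OF G(2)]])
  then show ?thesis using G(5) by (intro Bochner_Integration.integrable_bound[OF G(4)]) auto
qed

lemma Info_hess: "(\<integral>z. Hs \<theta>_star z $ i $ j \<partial>star.pair) = - Info $ i $ j"
  unfolding A3v_eq using star.inv_mat_nth[OF integrable_hess] by simp

text \<open>A modulus of continuity of the Hessian at the truth that is integrable; its mean becomes
  small on small balls by continuity and domination.\<close>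

lemma hess_modulus:
  assumes "0 < \<eta>"
  obtains \<delta> m where "0 < \<delta>" "ball \<theta>_star \<delta> \<subseteq> \<Theta>" "integrable star.pair m" "(\<integral>z. m z \<partial>star.pair) < \<eta>"
    "\<And>\<theta> z. \<theta> \<in> ball \<theta>_star \<delta> \<Longrightarrow> entry_norm (Hs \<theta> z - Hs \<theta>_star z) \<le> m z"
proof -
  obtain V G where VG: "open V" "\<theta>_star \<in> V" "V \<subseteq> \<Theta>" "integrable star.pair G" "\<And>z. 0 \<le> G z"
    "\<And>\<theta> z. \<theta> \<in> V \<Longrightarrow> norm (Hs \<theta> z) \<le> G z"
    using hess_dominated by blast
  obtain r where r: "0 < r" "ball \<theta>_star r \<subseteq> V" using VG(1,2) open_contains_ball by blast
  define T where "T k = ball \<theta>_star (r / real (Suc k))" for k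
  have TV: "T k \<subseteq> V" for k
  proof -
    have "r / real (Suc k) \<le> r" using r(1) by (simp add: field_simps)
    then show ?thesis unfolding T_def using r(2) subset_ball by blast
  qed
  let ?f = "\<lambda>\<theta> z. entry_norm (Hs \<theta> z - Hs \<theta>_star z)"
  let ?c = "real CARD('d) * real CARD('d)"
  obtain g where g: "\<And>k. integrable star.pair (g k)" "\<And>k \<theta> z. \<theta> \<in> T k \<Longrightarrow> ?f \<theta> z \<le> g k z"
      "(\<lambda>k. \<integral>z. g k z \<partial>star.pair) \<longlonglongrightarrow> (\<integral>z. ?f \<theta>_star z \<partial>star.pair)"
  proof (rule local_sup_tendsto[where c = \<theta>_star and T = T and f = ?f and G = "\<lambda>z. ?c * (2 * G z)" and q = star.pair])
    show "\<theta>_star \<in> T k" for k using r by (simp add: T_def)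
    show "\<bar>?f \<theta> z\<bar> \<le> ?c * (2 * G z)" if "\<theta> \<in> T k" for k \<theta> z
    proof -
      have "norm (Hs \<theta> z - Hs \<theta>_star z) \<le> norm (Hs \<theta> z) + norm (Hs \<theta>_star z)" by (rule norm_triangle_ineq4)
      also have "\<dots> \<le> 2 * G z"
        using VG(6)[of \<theta> z] VG(6)[OF VG(2), of z] that TV by fastforce
      finally have "?c * norm (Hs \<theta> z - Hs \<theta>_star z) \<le> ?c * (2 * G z)" by (intro mult_left_mono) auto
      then show ?thesis using entry_norm_le[of "Hs \<theta> z - Hs \<theta>_star z"] entry_norm_nonneg[of "Hs \<theta> z - Hs \<theta>_star z"] by linarith
    qed
    fix z and e :: real assume "0 < e"
    have "continuous_on \<Theta> (\<lambda>\<theta>. ?f \<theta> z)"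
      unfolding entry_norm_def
      by (simp only: vector_minus_component) (intro continuous_intros A3i_cont)
    then obtain d where d: "d > 0" "\<And>\<theta>. \<theta> \<in> \<Theta> \<Longrightarrow> dist \<theta> \<theta>_star < d \<Longrightarrow> dist (?f \<theta> z) (?f \<theta>_star z) < e"
      using star_in \<open>0 < e\<close> unfolding continuous_on_iff by metis
    have "(\<lambda>k. r / real (Suc k)) \<longlonglongrightarrow> 0" by (rule LIMSEQ_Suc[OF lim_const_over_n])
    from order_tendstoD(2)[OF this d(1)]
    show "\<forall>\<^sub>F k in sequentially. \<forall>\<theta>\<in>T k. ?f \<theta> z \<le> ?f \<theta>_star z + e"
    proof eventually_elim
      case (elim k)
      show ?case
      proof
        fix \<theta> assume "\<theta> \<in> T k"
        then have "dist \<theta> \<theta>_star < d" using elim by (simp add: T_def dist_commute)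
        moreover have "\<theta> \<in> \<Theta>" using \<open>\<theta> \<in> T k\<close> TV VG(3) by blast
        ultimately show "?f \<theta> z \<le> ?f \<theta>_star z + e" using d(2)[of \<theta>] by (simp add: dist_real_def)
      qed
    qed
  qed (use VG in auto)
  have "(\<integral>z. ?f \<theta>_star z \<partial>star.pair) < \<eta>" using \<open>0 < \<eta>\<close> by (simp add: entry_norm_def)
  from order_tendstoD(2)[OF g(3) this] obtain k where k: "(\<integral>z. g k z \<partial>star.pair) < \<eta>"
    by (auto simp: eventually_sequentially)
  show thesis
  proof (rule that[of "r / real (Suc k)" "g k"])
    show "ball \<theta>_star (r / real (Suc k)) \<subseteq> \<Theta>" using TV[of k] VG(3) by (simp add: T_def)
    show "entry_norm (Hs \<theta> z - Hs \<theta>_star z) \<le> g k z" if "\<theta> \<in> ball \<theta>_star (r / real (Suc k))" for \<theta> z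
      using that by (intro g(2)) (simp add: T_def)
  qed (use r g k in auto)
qed

definition score_sum :: "nat list \<Rightarrow> real ^ 'd" where
  "score_sum l = (\<chi> i. psum (\<lambda>z. score z $ i) l)"

lemma inner_score_sum: "s \<bullet> score_sum l = psum (\<lambda>z. s \<bullet> score z) l"
  by (simp add: score_sum_def inner_vec_def psum_sum psum_cmult)

lemma has_derivative_psum:
  assumes "\<And>z. ((\<lambda>x. g x z) has_derivative (\<lambda>h. g' h z)) F"
  shows "((\<lambda>x. psum (g x) l) has_derivative (\<lambda>h. psum (g' h) l)) F"
  unfolding psum_conv_sum by (rule has_derivative_sum) (rule assms)

text \<open>The gradient vanishes at the interior maximiser t, so the mean value theorem on the
  segment from the truth to t expresses the score through an intermediate Hessian. It needs a real
  function, hence the inner product with s. The error splits into the oscillation of the Hessian and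
  the deviation of the Hessian sum at the truth from -n times \<open>Info\<close>.\<close>

lemma score_expansion:
  assumes ball: "ball \<theta>_star \<delta> \<subseteq> \<Theta>"
    and m: "\<And>\<theta> z. \<theta> \<in> ball \<theta>_star \<delta> \<Longrightarrow> entry_norm (Hs \<theta> z - Hs \<theta>_star z) \<le> m z"
    and t: "t \<in> ball \<theta>_star \<delta>" and max: "\<And>\<theta>. \<theta> \<in> \<Theta> \<Longrightarrow> psum (Ph \<theta>) l \<le> psum (Ph t) l"
  defines "y \<equiv> t - \<theta>_star" and "n \<equiv> real (length l - 1)"
  shows "\<bar>s \<bullet> (score_sum l - n *\<^sub>R (Info *v y))\<bar> \<le>
      (psum m l + (\<Sum>i\<in>UNIV. \<Sum>j\<in>UNIV. \<bar>psum (\<lambda>z. Hs \<theta>_star z $ i $ j) l + n * Info $ i $ j\<bar>)) * (norm s * norm y)"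
proof -
  have at: "at \<theta> within \<Theta> = at \<theta>" if "\<theta> \<in> ball \<theta>_star \<delta>" for \<theta>
    using that ball by (intro at_within_interior) (metis interior_maximal open_ball subsetD)
  have d: "((\<lambda>\<theta>. psum (Ph \<theta>) l) has_derivative (\<lambda>h. psum (\<lambda>z. Sc t z \<bullet> h) l)) (at t)"
    using A3i_grad[of t] at[OF t] t ball by (intro has_derivative_psum) auto
  have "\<forall>\<theta>\<in>ball \<theta>_star \<delta>. psum (Ph \<theta>) l \<le> psum (Ph t) l" using max ball by blast
  from differential_zero_maxmin[OF t open_ball d disjI1[OF this]]
  have grad0: "psum (\<lambda>z. Sc t z \<bullet> h) l = 0" for h by (rule fun_cong)
  define p where "p \<tau> = \<theta>_star + \<tau> *\<^sub>R y" for \<tau>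
  have p_ball: "p \<tau> \<in> ball \<theta>_star \<delta>" if "0 \<le> \<tau>" "\<tau> \<le> 1" for \<tau>
  proof -
    have "\<tau> * norm y \<le> norm y" using that by (intro mult_left_le_one_le) auto
    then show ?thesis using t that by (simp add: p_def y_def dist_norm norm_minus_commute)
  qed
  define g where "g \<tau> = psum (\<lambda>z. s \<bullet> Sc (p \<tau>) z) l" for \<tau>
  have "DERIV g \<tau> :> psum (\<lambda>z. s \<bullet> (Hs (p \<tau>) z *v y)) l" if "0 \<le> \<tau>" "\<tau> \<le> 1" for \<tau>
  proof -
    have "(p has_derivative (\<lambda>r. r *\<^sub>R y)) (at \<tau>)"
      unfolding p_def by (auto intro!: derivative_eq_intros)
    moreover have "((\<lambda>\<theta>. Sc \<theta> z) has_derivative (\<lambda>h. Hs (p \<tau>) z *v h)) (at (p \<tau>))" for z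
      using A3i_hess[of "p \<tau>"] at[OF p_ball[OF that]] p_ball[OF that] ball by auto
    ultimately have "((\<lambda>\<tau>. Sc (p \<tau>) z) has_derivative (\<lambda>r. Hs (p \<tau>) z *v (r *\<^sub>R y))) (at \<tau>)" for z
      by (rule has_derivative_compose)
    then have "((\<lambda>\<tau>. s \<bullet> Sc (p \<tau>) z) has_derivative (\<lambda>r. s \<bullet> (Hs (p \<tau>) z *v (r *\<^sub>R y)))) (at \<tau>)" for z
      by (rule has_derivative_inner_right)
    then have "(g has_derivative (\<lambda>r. psum (\<lambda>z. s \<bullet> (Hs (p \<tau>) z *v (r *\<^sub>R y))) l)) (at \<tau>)"
      unfolding g_def by (rule has_derivative_psum)
    then show ?thesis
      by (simp add: has_field_derivative_def matrix_vector_mult_scaleR psum_cmult mult_commute_abs)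
  qed
  with MVT2[of 0 1 g "\<lambda>\<tau>. psum (\<lambda>z. s \<bullet> (Hs (p \<tau>) z *v y)) l"]
  obtain \<tau> where tau: "0 < \<tau>" "\<tau> < 1" "g 1 - g 0 = psum (\<lambda>z. s \<bullet> (Hs (p \<tau>) z *v y)) l" by auto
  have "g 1 = 0" unfolding g_def using grad0[of s] by (simp add: p_def y_def inner_commute)
  moreover have "g 0 = s \<bullet> score_sum l" by (simp add: g_def p_def inner_score_sum)
  ultimately have sc: "s \<bullet> score_sum l = - psum (\<lambda>z. s \<bullet> (Hs (p \<tau>) z *v y)) l" using tau(3) by simp
  define A :: "real ^ 'd ^ 'd" where "A = (\<chi> i j. psum (\<lambda>z. Hs \<theta>_star z $ i $ j) l + n * Info $ i $ j)"
  have "psum (\<lambda>z. s \<bullet> (Hs \<theta>_star z *v y)) l = (\<Sum>i\<in>UNIV. \<Sum>j\<in>UNIV. s $ i * y $ j * psum (\<lambda>z. Hs \<theta>_star z $ i $ j) l)"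
    unfolding inner_matrix_entries by (simp add: psum_sum psum_cmult)
  moreover have "s \<bullet> (n *\<^sub>R (Info *v y)) = (\<Sum>i\<in>UNIV. \<Sum>j\<in>UNIV. s $ i * y $ j * (n * Info $ i $ j))"
    unfolding inner_scaleR_right inner_matrix_entries by (simp add: sum_distrib_left mult_ac)
  ultimately have A: "psum (\<lambda>z. s \<bullet> (Hs \<theta>_star z *v y)) l + s \<bullet> (n *\<^sub>R (Info *v y)) = s \<bullet> (A *v y)"
    unfolding inner_matrix_entries A_def by (simp add: sum.distrib distrib_left)
  define R where "R z = s \<bullet> ((Hs (p \<tau>) z - Hs \<theta>_star z) *v y)" for z
  have "psum (\<lambda>z. s \<bullet> (Hs (p \<tau>) z *v y)) l = psum R l + psum (\<lambda>z. s \<bullet> (Hs \<theta>_star z *v y)) l"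
    unfolding psum_add[symmetric] R_def by (simp add: matrix_vector_mult_diff_rdistrib inner_diff_right)
  then have "s \<bullet> (score_sum l - n *\<^sub>R (Info *v y)) = - (psum R l + s \<bullet> (A *v y))"
    unfolding inner_diff_right sc using A by linarith
  moreover have "\<bar>psum R l\<bar> \<le> psum m l * (norm s * norm y)"
  proof -
    have "\<bar>R z\<bar> \<le> (norm s * norm y) * m z" for z
    proof -
      have "\<bar>R z\<bar> \<le> entry_norm (Hs (p \<tau>) z - Hs \<theta>_star z) * (norm s * norm y)"
        unfolding R_def by (rule inner_matrix_bound)
      also have "\<dots> \<le> m z * (norm s * norm y)"
        using tau by (intro mult_right_mono m p_ball) auto
      finally show ?thesis by (simp add: mult.commute)
    qed
    then have "psum (\<lambda>z. \<bar>R z\<bar>) l \<le> psum (\<lambda>z. (norm s * norm y) * m z) l" by (rule psum_mono)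
    then show ?thesis using psum_abs[of R l] unfolding psum_cmult[of _ m] by (simp add: mult.commute)
  qed
  moreover have "\<bar>s \<bullet> (A *v y)\<bar> \<le> entry_norm A * (norm s * norm y)" by (rule inner_matrix_bound)
  ultimately have "\<bar>s \<bullet> (score_sum l - n *\<^sub>R (Info *v y))\<bar> \<le> (psum m l + entry_norm A) * (norm s * norm y)"
    unfolding distrib_right by linarith
  then show ?thesis by (simp add: entry_norm_def A_def)
qed

end

lemma cmod_iexp_diff_le: "cmod (iexp a - iexp b) \<le> \<bar>a - b\<bar>"
proof -
  have "iexp a - iexp b = iexp b * (iexp (a - b) - 1)"
    by (simp add: right_diff_distrib exp_add[symmetric])
  then have "cmod (iexp a - iexp b) = cmod (iexp (a - b) - 1)" by (simp add: norm_mult)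
  then show ?thesis using iexp_approx1[of "a - b" 0] by simp
qed

context mle_setting
begin

text \<open>Three causes of failure are excluded: a maximiser away from the truth, a large average
  modulus of the Hessian, and Hessian averages far from their means. The error is relative to the
  unknown distance of t from the truth, so no rate has to be known beforehand.\<close>

lemma estimating_equation:
  assumes "0 < \<eta>"
  shows "\<exists>Bad. (\<lambda>n. measure (star.chain n) (Bad n)) \<longlonglongrightarrow> 0 \<and>
    (\<forall>n l t. 0 < n \<longrightarrow> length l = Suc n \<longrightarrow> l \<notin> Bad n \<longrightarrow> t \<in> \<Theta> \<longrightarrow>
      (\<forall>\<theta>\<in>\<Theta>. psum (Ph \<theta>) l \<le> psum (Ph t) l) \<longrightarrow>
      norm (score_sum l /\<^sub>R real n - Info *v (t - \<theta>_star)) \<le> \<eta> * norm (t - \<theta>_star))"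
proof -
  \<comment> \<open>The number of matrix entries. The modulus has mean below \<eta> / 3 and deviates
    by less than \<eta> / 3; each entry deviates by at most \<eta> / (3 c). Together this is
    \<eta>.\<close>
  define c where "c = real CARD('d) * real CARD('d)"
  have c: "0 < c" by (simp add: c_def)
  have e: "0 < \<eta> / 3" "0 < \<eta> / (3 * c)" using assms c by auto
  show ?thesis
  proof (rule hess_modulus[OF e(1)])
    fix \<delta> m
    assume d: "0 < \<delta>" "ball \<theta>_star \<delta> \<subseteq> \<Theta>" and m: "integrable star.pair m" "(\<integral>z. m z \<partial>star.pair) < \<eta> / 3"
      and dom: "\<And>\<theta> z. \<theta> \<in> ball \<theta>_star \<delta> \<Longrightarrow> entry_norm (Hs \<theta> z - Hs \<theta>_star z) \<le> m z"
    show ?thesis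
    proof (rule consistency[OF d(1)])
      fix B assume B: "(\<lambda>n. measure (star.chain n) B) \<longlonglongrightarrow> 0"
        and BD: "\<And>l \<theta>. l \<notin> B \<Longrightarrow> \<theta> \<in> \<Theta> \<Longrightarrow> \<delta> \<le> dist \<theta> \<theta>_star \<Longrightarrow> psum (\<lambda>z. Ph \<theta> z - Ph \<theta>_star z) l < 0"
      define H where "H i j z = Hs \<theta>_star z $ i $ j" for i j z
      define Bm where "Bm n = {l. \<eta> / 3 \<le> \<bar>psum m l / real n - (\<integral>z. m z \<partial>star.pair)\<bar>}" for n
      define BH where "BH i j n = {l. \<eta> / (3 * c) \<le> \<bar>psum (H i j) l / real n - (\<integral>z. H i j z \<partial>star.pair)\<bar>}" for i j n
      define Bad where "Bad n = B \<union> Bm n \<union> (\<Union>i. \<Union>j. BH i j n)" for n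
      have "(\<lambda>n. measure (star.chain n) (Bad n)) \<longlonglongrightarrow> 0"
      proof (rule Lim_null_comparison)
        let ?b = "\<lambda>n. measure (star.chain n) B + measure (star.chain n) (Bm n) + (\<Sum>i\<in>UNIV. \<Sum>j\<in>UNIV. measure (star.chain n) (BH i j n))"
        have "measure (star.chain n) (Bad n) \<le> ?b n" for n
        proof -
          have "measure (star.chain n) (\<Union>i. \<Union>j. BH i j n) \<le> (\<Sum>i\<in>UNIV. measure (star.chain n) (\<Union>j. BH i j n))"
            by (rule measure_pmf.finite_measure_subadditive_finite) auto
          also have "\<dots> \<le> (\<Sum>i\<in>UNIV. \<Sum>j\<in>UNIV. measure (star.chain n) (BH i j n))"
            by (intro sum_mono measure_pmf.finite_measure_subadditive_finite) auto
          finally have "measure (star.chain n) (\<Union>i. \<Union>j. BH i j n) \<le> (\<Sum>i\<in>UNIV. \<Sum>j\<in>UNIV. measure (star.chain n) (BH i j n))" .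
          moreover have "measure (star.chain n) (Bad n) \<le> measure (star.chain n) (B \<union> Bm n) + measure (star.chain n) (\<Union>i. \<Union>j. BH i j n)"
            unfolding Bad_def by (rule measure_Un_le) auto
          moreover have "measure (star.chain n) (B \<union> Bm n) \<le> measure (star.chain n) B + measure (star.chain n) (Bm n)"
            by (rule measure_Un_le) auto
          ultimately show ?thesis by linarith
        qed
        then show "\<forall>\<^sub>F n in sequentially. norm (measure (star.chain n) (Bad n)) \<le> ?b n" by simp
        have "(\<lambda>n. measure (star.chain n) (Bm n)) \<longlonglongrightarrow> 0"
          unfolding Bm_def by (rule star.LLN_in_probability[OF m(1) e(1)])
        moreover have "(\<lambda>n. measure (star.chain n) (BH i j n)) \<longlonglongrightarrow> 0" for i j
          unfolding BH_def by (rule star.LLN_in_probability[OF _ e(2)]) (simp only: H_def[abs_def] integrable_hess)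
        ultimately have "?b \<longlonglongrightarrow> 0 + 0 + (\<Sum>i\<in>(UNIV::'d set). \<Sum>j\<in>(UNIV::'d set). 0)"
          using B by (intro tendsto_add tendsto_sum)
        then show "?b \<longlonglongrightarrow> 0" by simp
      qed
      moreover have "norm (score_sum l /\<^sub>R real n - Info *v (t - \<theta>_star)) \<le> \<eta> * norm (t - \<theta>_star)"
        if n: "0 < n" and len: "length l = Suc n" and l: "l \<notin> Bad n" and t: "t \<in> \<Theta>"
          and max: "\<forall>\<theta>\<in>\<Theta>. psum (Ph \<theta>) l \<le> psum (Ph t) l" for n l t
      proof -
        have "\<not> \<delta> \<le> dist t \<theta>_star"
          using BD[of l t] l t max star_in by (force simp: Bad_def psum_diff)
        then have tb: "t \<in> ball \<theta>_star \<delta>" by (simp add: dist_commute)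
        define y where "y = t - \<theta>_star"
        \<comment> \<open>The error vector itself is taken as direction, so that the inner product
          is its squared norm.\<close>
        define s where "s = score_sum l - real n *\<^sub>R (Info *v y)"
        let ?E = "psum m l + (\<Sum>i\<in>UNIV. \<Sum>j\<in>UNIV. \<bar>psum (H i j) l + real n * Info $ i $ j\<bar>)"
        have "s \<bullet> s \<le> \<bar>s \<bullet> s\<bar>" by simp
        also have "\<dots> \<le> ?E * (norm s * norm y)"
          using score_expansion[OF d(2) dom tb, of l s] max len unfolding s_def y_def H_def by simp
        finally have ss: "norm s * norm s \<le> ?E * (norm s * norm y)" by (simp add: dot_square_norm power2_eq_square)
        have "\<not> \<eta> / 3 \<le> \<bar>psum m l / real n - (\<integral>z. m z \<partial>star.pair)\<bar>"
          using l unfolding Bad_def Bm_def by blast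
        then have "psum m l / real n < 2 * \<eta> / 3" using m(2) by linarith
        then have E1: "psum m l \<le> real n * (2 * \<eta> / 3)" using n by (simp add: field_simps)
        have E2: "\<bar>psum (H i j) l + real n * Info $ i $ j\<bar> \<le> real n * (\<eta> / (3 * c))" for i j
        proof -
          have "\<bar>psum (H i j) l / real n + Info $ i $ j\<bar> \<le> \<eta> / (3 * c)"
          proof -
            have "\<not> \<eta> / (3 * c) \<le> \<bar>psum (H i j) l / real n - (\<integral>z. H i j z \<partial>star.pair)\<bar>"
              using l unfolding Bad_def BH_def by blast
            moreover have "(\<integral>z. H i j z \<partial>star.pair) = - Info $ i $ j" unfolding H_def by (rule Info_hess)
            ultimately show ?thesis by simp
          qed
          then have "real n * \<bar>psum (H i j) l / real n + Info $ i $ j\<bar> \<le> real n * (\<eta> / (3 * c))"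
            by (rule mult_left_mono) simp
          moreover have "real n * \<bar>psum (H i j) l / real n + Info $ i $ j\<bar> = \<bar>real n * (psum (H i j) l / real n + Info $ i $ j)\<bar>"
            by (simp add: abs_mult)
          moreover have "real n * (psum (H i j) l / real n + Info $ i $ j) = psum (H i j) l + real n * Info $ i $ j"
            using n by (simp add: distrib_left)
          ultimately show ?thesis by simp
        qed
        have "(\<Sum>i\<in>(UNIV::'d set). \<Sum>j\<in>(UNIV::'d set). \<bar>psum (H i j) l + real n * Info $ i $ j\<bar>)
            \<le> (\<Sum>i\<in>(UNIV::'d set). \<Sum>j\<in>(UNIV::'d set). real n * (\<eta> / (3 * c)))"
          by (intro sum_mono E2)
        also have "\<dots> = c * (real n * (\<eta> / (3 * c)))" by (simp add: c_def)
        also have "\<dots> = real n * (\<eta> / 3)" using c by simp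
        finally have "?E \<le> real n * \<eta>" using E1 by (simp add: field_simps)
        then have "?E * (norm s * norm y) \<le> (real n * \<eta>) * (norm s * norm y)" by (rule mult_right_mono) simp
        with ss have "norm s * norm s \<le> norm s * (real n * (\<eta> * norm y))" by (simp add: mult_ac)
        then have ns: "norm s \<le> real n * (\<eta> * norm y)"
        proof (cases "s = 0")
          case False
          then show ?thesis using \<open>norm s * norm s \<le> norm s * (real n * (\<eta> * norm y))\<close> by simp
        qed (use assms in auto)
        have "score_sum l /\<^sub>R real n - Info *v y = s /\<^sub>R real n"
          using n by (simp add: s_def scaleR_diff_right)
        then have "norm (score_sum l /\<^sub>R real n - Info *v y) = norm s / real n" by (simp add: divide_inverse mult.commute)
        also have "\<dots> \<le> \<eta> * norm y" using ns n by (simp add: divide_le_eq mult.commute)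
        finally show ?thesis by (simp add: y_def)
      qed
      ultimately show ?thesis by blast
    qed
  qed
qed

abbreviation Cov :: "real ^ 'd ^ 'd" where
  "Cov \<equiv> matrix_inv Info"

lemma Info_Cov: "Info *v (Cov *v x) = x" and Cov_Info: "Cov *v (Info *v x) = x"
proof -
  have "Info ** Cov = mat 1 \<and> Cov ** Info = mat 1"
    using A3v unfolding matrix_inv_def invertible_def by (rule someI_ex)
  then show "Info *v (Cov *v x) = x" "Cov *v (Info *v x) = x" by (simp_all add: matrix_vector_mul_assoc)
qed

lemma inner_Cov: "x \<bullet> (Cov *v w) = (Cov *v x) \<bullet> w"
proof -
  have "x \<bullet> (Cov *v w) = (Info *v (Cov *v x)) \<bullet> (Cov *v w)" by (simp only: Info_Cov)
  also have "\<dots> = (Cov *v x) \<bullet> (Info *v (Cov *v w))"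
    unfolding inner_matrix_vector[of "Cov *v x"] Info_sym ..
  finally show ?thesis by (simp only: Info_Cov)
qed

text \<open>Invertibility of the information bounds the distance to the truth by the score, so the
  error in \<open>estimating_equation\<close> becomes relative to the normalised score, whose size
  is under control.\<close>

lemma estimator_linearisation:
  assumes "0 < e"
  shows "\<exists>Bad. (\<lambda>n. measure (star.chain n) (Bad n)) \<longlonglongrightarrow> 0 \<and>
    (\<forall>n l t. 0 < n \<longrightarrow> length l = Suc n \<longrightarrow> l \<notin> Bad n \<longrightarrow> t \<in> \<Theta> \<longrightarrow>
      (\<forall>\<theta>\<in>\<Theta>. psum (Ph \<theta>) l \<le> psum (Ph t) l) \<longrightarrow>
      norm (sqrt (real n) *\<^sub>R (t - \<theta>_star) - Cov *v (score_sum l /\<^sub>R sqrt (real n)))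
        \<le> e * norm (score_sum l /\<^sub>R sqrt (real n)))"
proof -
  have "linear ((*v) Info)" by simp
  moreover have "inj ((*v) Info)" by (rule inj_on_inverseI[of _ "(*v) Cov"]) (rule Cov_Info)
  ultimately obtain k where k: "0 < k" "\<And>x. k * norm x \<le> norm (Info *v x)"
    by (rule linear_inj_bounded_below_pos) blast
  \<comment> \<open>With \<eta> \<le> k / 2 the error is absorbed and k |y| \<le> 2 |q|; with \<eta>
    \<le> e k^2 / 2 the final bound is e |q|.\<close>
  define \<eta> where "\<eta> = min (k / 2) (e * k\<^sup>2 / 2)"
  have \<eta>: "0 < \<eta>" "\<eta> \<le> k / 2" "\<eta> \<le> e * k\<^sup>2 / 2" using k(1) assms by (auto simp: \<eta>_def)
  obtain Bad where Bad: "(\<lambda>n. measure (star.chain n) (Bad n)) \<longlonglongrightarrow> 0"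
    "\<forall>n l t. 0 < n \<longrightarrow> length l = Suc n \<longrightarrow> l \<notin> Bad n \<longrightarrow> t \<in> \<Theta> \<longrightarrow>
      (\<forall>\<theta>\<in>\<Theta>. psum (Ph \<theta>) l \<le> psum (Ph t) l) \<longrightarrow>
      norm (score_sum l /\<^sub>R real n - Info *v (t - \<theta>_star)) \<le> \<eta> * norm (t - \<theta>_star)"
    using estimating_equation[OF \<eta>(1)] by blast
  have "norm (sqrt (real n) *\<^sub>R (t - \<theta>_star) - Cov *v (score_sum l /\<^sub>R sqrt (real n))) \<le> e * norm (score_sum l /\<^sub>R sqrt (real n))"
    if n: "0 < n" and "length l = Suc n" "l \<notin> Bad n" "t \<in> \<Theta>" "\<forall>\<theta>\<in>\<Theta>. psum (Ph \<theta>) l \<le> psum (Ph t) l" for n l t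
  proof -
    define y where "y = t - \<theta>_star"
    define q where "q = score_sum l /\<^sub>R real n"
    have est: "norm (q - Info *v y) \<le> \<eta> * norm y" using Bad(2) that unfolding q_def y_def by blast
    have "k * norm y \<le> norm q + norm (q - Info *v y)"
      using k(2)[of y] norm_triangle_ineq4[of q "q - Info *v y"] by simp
    moreover have "\<eta> * norm y \<le> k / 2 * norm y" using \<eta>(2) by (rule mult_right_mono) simp
    ultimately have y: "k * norm y \<le> 2 * norm q" using est by (simp add: field_simps)
    have "k * norm (y - Cov *v q) \<le> norm (Info *v y - q)"
      using k(2)[of "y - Cov *v q"] by (simp add: matrix_vector_mult_diff_distrib Info_Cov)
    also have "\<dots> \<le> \<eta> * norm y" using est by (simp add: norm_minus_commute)
    also have "\<dots> \<le> e * k\<^sup>2 / 2 * norm y" using \<eta>(3) by (rule mult_right_mono) simp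
    also have "\<dots> = e * k / 2 * (k * norm y)" by (simp add: power2_eq_square)
    also have "\<dots> \<le> e * k / 2 * (2 * norm q)" using y assms k(1) by (intro mult_left_mono) auto
    finally have "k * norm (y - Cov *v q) \<le> k * (e * norm q)" by (simp add: mult_ac)
    then have yq: "norm (y - Cov *v q) \<le> e * norm q" using k(1) by simp
    have r: "sqrt (real n) * inverse (real n) = inverse (sqrt (real n))"
      using n by (simp add: field_simps)
    have sq: "sqrt (real n) *\<^sub>R q = score_sum l /\<^sub>R sqrt (real n)" by (simp add: q_def r)
    have "sqrt (real n) *\<^sub>R y - Cov *v (score_sum l /\<^sub>R sqrt (real n)) = sqrt (real n) *\<^sub>R (y - Cov *v q)"
      unfolding sq[symmetric] by (simp only: matrix_vector_mult_scaleR scaleR_diff_right)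
    then have "norm (sqrt (real n) *\<^sub>R y - Cov *v (score_sum l /\<^sub>R sqrt (real n))) = sqrt (real n) * norm (y - Cov *v q)" by simp
    also have "\<dots> \<le> sqrt (real n) * (e * norm q)" using yq by (rule mult_left_mono) simp
    also have "\<dots> = e * norm (sqrt (real n) *\<^sub>R q)" by simp
    finally show ?thesis unfolding sq y_def .
  qed
  with Bad(1) show ?thesis by blast
qed

text \<open>Symmetry moves the covariance onto t, which leaves a scalar central limit theorem for
  the score in direction \<open>Cov *v t\<close>.\<close>

lemma char_score:
  "(\<lambda>n. CLINT l|star.chain n. iexp (t \<bullet> (Cov *v (score_sum l /\<^sub>R sqrt (real n))))) \<longlonglongrightarrow>
    complex_of_real (exp (- (t \<bullet> (Cov *v t)) / 2))"
proof -
  let ?s = "Cov *v t"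
  have "(\<lambda>n. CLINT l|star.chain n. iexp (psum (\<lambda>z. ?s \<bullet> score z) l / sqrt (real n))) \<longlonglongrightarrow>
      complex_of_real (exp (- (\<integral>z. (?s \<bullet> score z)\<^sup>2 \<partial>star.pair) / 2))"
    by (rule star.chain_CLT) (rule integrable_score_dir_sq integrable_score_dir score_mean)+
  moreover have "t \<bullet> (Cov *v (score_sum l /\<^sub>R r)) = psum (\<lambda>z. ?s \<bullet> score z) l / r" for l r
    unfolding inner_Cov by (simp add: inner_score_sum divide_inverse mult.commute)
  moreover have "(\<integral>z. (?s \<bullet> score z)\<^sup>2 \<partial>star.pair) = t \<bullet> (Cov *v t)"
    unfolding Info_quadratic[symmetric] Info_Cov by (rule inner_commute)
  ultimately show ?thesis by simp
qed

text \<open>The linearisation error is proportional to the normalised score; a second moment bounded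
  in n is what makes it negligible.\<close>

lemma score_sum_second_moment:
  "\<exists>C\<ge>0. \<forall>n. integrable (star.chain n) (\<lambda>l. (norm (score_sum l /\<^sub>R sqrt (real n)))\<^sup>2) \<and>
    (\<integral>l. (norm (score_sum l /\<^sub>R sqrt (real n)))\<^sup>2 \<partial>star.chain n) \<le> C"
proof -
  have nth: "score z $ i = axis i 1 \<bullet> score z" for z i by (simp add: inner_axis')
  have sq: "integrable star.pair (\<lambda>z. (score z $ i)\<^sup>2)" for i
    unfolding nth by (rule integrable_score_dir_sq)
  have mean: "(\<integral>v. score (u, v) $ i \<partial>star.KQ u) = 0" for u i
    unfolding nth by (rule score_mean)
  let ?e = "\<lambda>i. (\<integral>z. (score z $ i)\<^sup>2 \<partial>star.pair) / pmf star.inv_pmf 0"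
  have "(norm (x /\<^sub>R sqrt (real n)))\<^sup>2 = (norm x)\<^sup>2 / real n" for x :: "real ^ 'd" and n
    by (simp add: power_mult_distrib power_inverse divide_inverse)
  moreover have "(norm (score_sum l))\<^sup>2 = (\<Sum>i\<in>UNIV. (psum (\<lambda>z. score z $ i) l)\<^sup>2)" for l
    by (simp only: power2_norm_eq_inner) (simp add: inner_vec_def score_sum_def power2_eq_square)
  ultimately have norm_eq: "(norm (score_sum l /\<^sub>R sqrt (real n)))\<^sup>2 = (\<Sum>i\<in>UNIV. (psum (\<lambda>z. score z $ i) l)\<^sup>2 / real n)" for l n
    by (simp only: sum_divide_distrib)
  have int: "integrable (star.chain n) (\<lambda>l. (psum (\<lambda>z. score z $ i) l)\<^sup>2 / real n)" for i n
    using star.expectation_martingale_sq(1)[OF sq mean] by simp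
  have bd: "(\<integral>l. (psum (\<lambda>z. score z $ i) l)\<^sup>2 / real n \<partial>star.chain n) \<le> ?e i" for i n
  proof -
    have "(\<integral>l. (psum (\<lambda>z. score z $ i) l)\<^sup>2 \<partial>star.chain n) \<le> real n / pmf star.inv_pmf 0 * (\<integral>z. (score z $ i)\<^sup>2 \<partial>star.pair)"
      unfolding star.expectation_martingale_sq(2)[OF sq mean] by (rule star.expectation_psum_le[OF _ sq]) simp
    then have "(\<integral>l. (psum (\<lambda>z. score z $ i) l)\<^sup>2 \<partial>star.chain n) / real n \<le> real n / pmf star.inv_pmf 0 * (\<integral>z. (score z $ i)\<^sup>2 \<partial>star.pair) / real n"
      by (rule divide_right_mono) simp
    \<comment> \<open>For n = 0 division by zero gives 0 on the left.\<close>
    also have "\<dots> \<le> ?e i" by (cases "n = 0") auto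
    finally show ?thesis by simp
  qed
  show ?thesis
  proof (intro exI[of _ "\<Sum>i\<in>UNIV. ?e i"] conjI allI)
    show "0 \<le> (\<Sum>i\<in>UNIV. ?e i)" by (intro sum_nonneg divide_nonneg_nonneg integral_nonneg_AE) auto
    show "integrable (star.chain n) (\<lambda>l. (norm (score_sum l /\<^sub>R sqrt (real n)))\<^sup>2)" for n
      unfolding norm_eq by (rule Bochner_Integration.integrable_sum) (rule int)
    fix n
    have "(\<integral>l. (norm (score_sum l /\<^sub>R sqrt (real n)))\<^sup>2 \<partial>star.chain n) =
        (\<Sum>i\<in>UNIV. \<integral>l. (psum (\<lambda>z. score z $ i) l)\<^sup>2 / real n \<partial>star.chain n)"
      unfolding norm_eq by (rule Bochner_Integration.integral_sum) (rule int)
    also have "\<dots> \<le> (\<Sum>i\<in>UNIV. ?e i)" by (intro sum_mono bd)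
    finally show "(\<integral>l. (norm (score_sum l /\<^sub>R sqrt (real n)))\<^sup>2 \<partial>star.chain n) \<le> (\<Sum>i\<in>UNIV. ?e i)" .
  qed
qed

section \<open>From lists back to the walk\<close>

abbreviation walk_law :: "path measure" where
  "walk_law \<equiv> annealed_law (\<nu> \<theta>_star)"

text \<open>The term at \<open>\<theta>\<^sub>0\<close> is constant in \<theta>, so maximising the
  criterion is maximising \<open>psum (Ph \<theta>)\<close>. Position x of the list is site x, hence
  the newest state is the count at site 0.\<close>

lemma criterion_eq_psum:
  "criterion \<nu> \<theta>\<^sub>0 n X \<theta> = psum (Ph \<theta>) (star.left_step_list n X) - psum (Ph \<theta>\<^sub>0) (star.left_step_list n X)"
  unfolding psum_conv_sum criterion_def sum_subtractf[symmetric]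
  by (intro sum.cong) (auto simp: nth_append simp del: upt_Suc)

lemma
  fixes F :: "nat list \<Rightarrow> 'b::{banach, second_countable_topology}"
  shows integral_left_step_list: "(\<integral>X. F (star.left_step_list n X) \<partial>walk_law) = (\<integral>l. F l \<partial>star.chain n)"
    and integrable_left_step_list: "integrable (star.chain n) F \<Longrightarrow> integrable walk_law (\<lambda>X. F (star.left_step_list n X))"
proof -
  have m: "star.left_step_list n \<in> walk_law \<rightarrow>\<^sub>M count_space UNIV"
    by (simp only: measurable_cong_sets[OF star.sets_annealed_law refl] star.measurable_left_step_list)
  show "(\<integral>X. F (star.left_step_list n X) \<partial>walk_law) = (\<integral>l. F l \<partial>star.chain n)"
    unfolding star.distr_left_step_list[symmetric] by (rule integral_distr[OF m, symmetric]) simp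
  show "integrable walk_law (\<lambda>X. F (star.left_step_list n X))" if "integrable (star.chain n) F"
    using that unfolding star.distr_left_step_list[symmetric] by (simp only: integrable_distr[OF m])
qed

context
  fixes est :: "nat \<Rightarrow> path \<Rightarrow> real ^ 'd"
  assumes est_meas: "\<And>n. est n \<in> path_space \<rightarrow>\<^sub>M borel"
    and est_argmax: "\<And>n. AE X in walk_law. is_arg_max (criterion \<nu> \<theta>\<^sub>0 n X) (\<lambda>\<theta>. \<theta> \<in> \<Theta>) (est n X)"
begin

lemma measurable_scaled_error: "(\<lambda>X. sqrt (real n) *\<^sub>R (est n X - \<theta>_star)) \<in> borel_measurable walk_law"
proof -
  have [measurable]: "est n \<in> borel_measurable walk_law"
    by (simp only: measurable_cong_sets[OF star.sets_annealed_law refl] est_meas)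
  show ?thesis by measurable
qed

text \<open>The estimator is compared with its linearisation under the same walk law; the latter is
  a function of the list, with known limiting characteristic function. The exponentials differ by at
  most 2 on exceptional lists, and elsewhere by at most e times \<open>norm t\<close> times the norm
  of the normalised score.\<close>

lemma char_limit:
  "(\<lambda>n. CLINT X|walk_law. iexp (t \<bullet> (sqrt (real n) *\<^sub>R (est n X - \<theta>_star)))) \<longlonglongrightarrow>
    complex_of_real (exp (- (t \<bullet> (Cov *v t)) / 2))"
proof -
  interpret W: prob_space walk_law by (rule star.prob_space_annealed_law)
  have le_sq: "x \<le> 1 + x\<^sup>2" if "0 \<le> x" for x :: real
    using zero_le_power2[of "x - 1"] that by (simp add: power2_diff)
  define V where "V n l = score_sum l /\<^sub>R sqrt (real n)" for n l
  define Y where "Y n X = sqrt (real n) *\<^sub>R (est n X - \<theta>_star)" for n X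
  define a where "a n = (CLINT X|walk_law. iexp (t \<bullet> Y n X))" for n
  define b where "b n = (CLINT l|star.chain n. iexp (t \<bullet> (Cov *v V n l)))" for n
  obtain C where C: "0 \<le> C" "\<And>n. integrable (star.chain n) (\<lambda>l. (norm (V n l))\<^sup>2)"
    "\<And>n. (\<integral>l. (norm (V n l))\<^sup>2 \<partial>star.chain n) \<le> C"
    using score_sum_second_moment unfolding V_def by blast
  have [measurable]: "Y n \<in> borel_measurable walk_law" for n
    unfolding Y_def by (rule measurable_scaled_error)
  have "(\<lambda>n. a n - b n) \<longlonglongrightarrow> 0"
  proof (rule LIMSEQ_I)
    fix r :: real assume "0 < r"
    \<comment> \<open>With e = r / (2 q) the part outside the exceptional lists is at most r / 2;
      the 1 added to \<open>norm t\<close> covers t = 0.\<close>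
    define q where "q = (norm t + 1) * (1 + C)"
    have q: "0 < q" unfolding q_def using C(1) by (intro mult_pos_pos add_nonneg_pos add_pos_nonneg) auto
    define e where "e = r / (2 * q)"
    have e1: "0 < e" unfolding e_def using q \<open>0 < r\<close> by simp
    have "norm t * e * (1 + C) \<le> (norm t + 1) * e * (1 + C)"
      using e1 C(1) by (intro mult_right_mono) auto
    also have "\<dots> = q * e" by (simp add: q_def mult_ac)
    also have "\<dots> = r / 2" unfolding e_def using q by simp
    finally have "norm t * e * (1 + C) \<le> r / 2" .
    with e1 have e: "0 < e" "norm t * e * (1 + C) \<le> r / 2" by auto
    obtain Bad where Bad: "(\<lambda>n. measure (star.chain n) (Bad n)) \<longlonglongrightarrow> 0"
      "\<forall>n l u. 0 < n \<longrightarrow> length l = Suc n \<longrightarrow> l \<notin> Bad n \<longrightarrow> u \<in> \<Theta> \<longrightarrow>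
        (\<forall>\<theta>\<in>\<Theta>. psum (Ph \<theta>) l \<le> psum (Ph u) l) \<longrightarrow>
        norm (sqrt (real n) *\<^sub>R (u - \<theta>_star) - Cov *v V n l) \<le> e * norm (V n l)"
      using estimator_linearisation[OF e(1)] unfolding V_def by blast
    have le: "cmod (a n - b n) \<le> 2 * measure (star.chain n) (Bad n) + r / 2" if "0 < n" for n
    proof -
      \<comment> \<open>A bound that depends on the list only, although the estimator depends on the
        whole path; its mean can thus be computed under \<open>chain n\<close>.\<close>
      define H where "H l = 2 * indicator (Bad n) l + norm t * e * (1 + (norm (V n l))\<^sup>2)" for l
      have iI: "integrable (star.chain n) (\<lambda>l. 2 * indicator (Bad n) l :: real)"
        by (rule integrable_pmf_bounded[where B = 2]) (auto simp: indicator_def)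
      have iH: "integrable (star.chain n) H"
        unfolding H_def using iI C(2)[of n] by (intro Bochner_Integration.integrable_add) auto
      define f where "f X = iexp (t \<bullet> Y n X) - iexp (t \<bullet> (Cov *v V n (star.left_step_list n X)))" for X
      have i1: "integrable walk_law (\<lambda>X. iexp (t \<bullet> Y n X))"
        by (rule W.integrable_const_bound[where B = 1]) auto
      have i2: "integrable walk_law (\<lambda>X. iexp (t \<bullet> (Cov *v V n (star.left_step_list n X))))"
        by (rule integrable_left_step_list) (rule integrable_pmf_bounded[where B = 1], simp)
      have "a n - b n = (CLINT X|walk_law. f X)"
        unfolding a_def b_def f_def integral_left_step_list[symmetric] using i1 i2
        by (rule Bochner_Integration.integral_diff[symmetric])
      then have "cmod (a n - b n) \<le> (\<integral>X. cmod (f X) \<partial>walk_law)" by simp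
      also have "\<dots> \<le> (\<integral>X. H (star.left_step_list n X) \<partial>walk_law)"
      proof (rule integral_mono_AE)
        show "integrable walk_law (\<lambda>X. cmod (f X))" unfolding f_def using i1 i2 by simp
        show "integrable walk_law (\<lambda>X. H (star.left_step_list n X))" by (rule integrable_left_step_list[OF iH])
        show "AE X in walk_law. cmod (f X) \<le> H (star.left_step_list n X)"
          using est_argmax[of n]
        proof eventually_elim
          case (elim X)
          let ?l = "star.left_step_list n X"
          have nn: "0 \<le> norm t * e * (1 + (norm (V n ?l))\<^sup>2)" using e(1) by simp
          show ?case
          proof (cases "?l \<in> Bad n")
            case True
            have "cmod (f X) \<le> 2" unfolding f_def by (rule order_trans[OF norm_triangle_ineq4]) simp
            then show ?thesis unfolding H_def using True nn by simp
          next
            case False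
            have "est n X \<in> \<Theta>" "\<forall>\<theta>\<in>\<Theta>. psum (Ph \<theta>) ?l \<le> psum (Ph (est n X)) ?l"
              using elim unfolding is_arg_max_linorder criterion_eq_psum by auto
            then have *: "norm (Y n X - Cov *v V n ?l) \<le> e * norm (V n ?l)"
              using Bad(2) \<open>0 < n\<close> False unfolding Y_def by simp
            have "cmod (f X) \<le> \<bar>t \<bullet> Y n X - t \<bullet> (Cov *v V n ?l)\<bar>"
              unfolding f_def by (rule cmod_iexp_diff_le)
            also have "\<dots> \<le> norm t * norm (Y n X - Cov *v V n ?l)"
              unfolding inner_diff_right[symmetric] by (rule Cauchy_Schwarz_ineq2)
            also have "\<dots> \<le> norm t * (e * norm (V n ?l))" using * by (rule mult_left_mono) simp
            also have "\<dots> \<le> norm t * (e * (1 + (norm (V n ?l))\<^sup>2))"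
            proof (intro mult_left_mono)
              show "norm (V n ?l) \<le> 1 + (norm (V n ?l))\<^sup>2"
                using le_sq[OF norm_ge_zero] .
            qed (use e in auto)
            finally show ?thesis unfolding H_def using False by (simp add: mult.assoc)
          qed
        qed
      qed
      also have "\<dots> = (\<integral>l. H l \<partial>star.chain n)" by (rule integral_left_step_list)
      also have "\<dots> = 2 * measure (star.chain n) (Bad n) + norm t * e * (1 + (\<integral>l. (norm (V n l))\<^sup>2 \<partial>star.chain n))"
        unfolding H_def using iI C(2)[of n] by simp
      also have "\<dots> \<le> 2 * measure (star.chain n) (Bad n) + norm t * e * (1 + C)"
        using C(3)[of n] e(1) by (intro add_left_mono mult_left_mono) auto
      finally show ?thesis using e(2) by linarith
    qed
    have "\<forall>\<^sub>F n in sequentially. measure (star.chain n) (Bad n) < r / 4"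
      by (rule order_tendstoD(2)[OF Bad(1)]) (use \<open>0 < r\<close> in simp)
    then have "\<forall>\<^sub>F n in sequentially. norm (a n - b n - 0) < r"
      using eventually_gt_at_top[of 0]
    proof eventually_elim
      case (elim n)
      then show ?case using le[of n] by simp
    qed
    then show "\<exists>N. \<forall>n\<ge>N. norm (a n - b n - 0) < r" by (simp add: eventually_sequentially)
  qed
  moreover have "b \<longlonglongrightarrow> complex_of_real (exp (- (t \<bullet> (Cov *v t)) / 2))"
    unfolding b_def V_def by (rule char_score)
  ultimately have "(\<lambda>n. (a n - b n) + b n) \<longlonglongrightarrow> 0 + complex_of_real (exp (- (t \<bullet> (Cov *v t)) / 2))"
    by (rule tendsto_add)
  then show ?thesis by (simp add: a_def Y_def)
qed

lemma asymptotic_normality: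
  "conv_in_distr walk_law (\<lambda>n X. sqrt (real n) *\<^sub>R (est n X - \<theta>_star)) (centered_gaussian Cov)"
proof -
  have "prob_space (centered_gaussian Cov)" by (rule prob_space_centered_gaussian[OF Info_sym Info_pos])
  moreover have "(CLINT z|centered_gaussian Cov. iexp (t \<bullet> z)) = complex_of_real (exp (- (t \<bullet> (Cov *v t)) / 2))" for t
    by (rule integral_iexp_centered_gaussian[OF Info_sym Info_pos])
  ultimately have "char_conv walk_law (centered_gaussian Cov) (\<lambda>n X. sqrt (real n) *\<^sub>R (est n X - \<theta>_star))"
    unfolding char_conv_def char_conv_axioms_def
    using star.prob_space_annealed_law measurable_scaled_error char_limit by (simp add: centered_gaussian_def)
  then show ?thesis by (rule char_conv.conv_in_distr)
qed

end

end

theorem theorem2p6: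
  fixes \<Theta> :: "(real ^ 'd) set"
    and \<nu> :: "real ^ 'd \<Rightarrow> real measure"
    and \<theta>_star \<theta>\<^sub>0 :: "real ^ 'd"
    and d\<phi> :: "real ^ 'd \<Rightarrow> nat \<Rightarrow> nat \<Rightarrow> real ^ 'd"
    and dd\<phi> :: "real ^ 'd \<Rightarrow> nat \<Rightarrow> nat \<Rightarrow> real ^ 'd ^ 'd"
    and dQ :: "real ^ 'd \<Rightarrow> nat \<Rightarrow> nat \<Rightarrow> real ^ 'd"
    and est :: "nat \<Rightarrow> path \<Rightarrow> real ^ 'd"
  assumes compact: "compact \<Theta>"
    and law: "\<And>\<theta>. \<theta> \<in> \<Theta> \<Longrightarrow> unit_law (\<nu> \<theta>)"
    and star: "\<theta>_star \<in> interior \<Theta>"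
    and base: "\<theta>\<^sub>0 \<in> \<Theta>"
    and A1i: "\<And>\<theta>. \<theta> \<in> \<Theta> \<Longrightarrow> integrable (env_law (\<nu> \<theta>)) (\<lambda>\<omega>. ln (rho \<omega> 0))"
    and A1ii: "\<And>\<theta>. \<theta> \<in> \<Theta> \<Longrightarrow> (\<integral>\<omega>. ln (rho \<omega> 0) \<partial>env_law (\<nu> \<theta>)) < 0"
    and A1iii: "\<And>\<theta>. \<theta> \<in> \<Theta> \<Longrightarrow> integrable (env_law (\<nu> \<theta>)) (\<lambda>\<omega>. rho \<omega> 0) \<and>
                  1 \<le> (\<integral>\<omega>. rho \<omega> 0 \<partial>env_law (\<nu> \<theta>))"
    and A2i: "\<And>x y. continuous_on \<Theta> (\<lambda>\<theta>. phi (\<nu> \<theta>) x y)"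
    and A2ii: "\<And>\<theta> \<theta>'. \<theta> \<in> \<Theta> \<Longrightarrow> \<theta>' \<in> \<Theta> \<Longrightarrow> \<nu> \<theta> \<noteq> \<nu> \<theta>' \<longleftrightarrow> \<theta> \<noteq> \<theta>'"
    and A2iii: "\<And>\<theta>. \<theta> \<in> \<Theta> \<Longrightarrow>
                  inv_nn (\<nu> \<theta>) (\<lambda>x y. SUP \<theta>'\<in>\<Theta>. ennreal \<bar>phi (\<nu> \<theta>') x y - phi (\<nu> \<theta>\<^sub>0) x y\<bar>) < \<infinity>"
    and A3i_grad: "\<And>\<theta> x y. \<theta> \<in> \<Theta> \<Longrightarrow>
                  ((\<lambda>\<theta>'. phi (\<nu> \<theta>') x y) has_derivative (\<lambda>h. d\<phi> \<theta> x y \<bullet> h)) (at \<theta> within \<Theta>)"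
    and A3i_hess: "\<And>\<theta> x y. \<theta> \<in> \<Theta> \<Longrightarrow>
                  ((\<lambda>\<theta>'. d\<phi> \<theta>' x y) has_derivative (\<lambda>h. dd\<phi> \<theta> x y *v h)) (at \<theta> within \<Theta>)"
    and A3i_cont: "\<And>x y. continuous_on \<Theta> (\<lambda>\<theta>. dd\<phi> \<theta> x y)"
    and A3ii: "\<And>\<theta>. \<theta> \<in> \<Theta> \<Longrightarrow>
                  \<exists>q>1. inv_nn (\<nu> \<theta>) (\<lambda>x y. ennreal (norm (d\<phi> \<theta> x y) powr (2 * q))) < \<infinity>"
    and dQ: "\<And>\<theta> u v. \<theta> \<in> \<Theta> \<Longrightarrow>
                  ((\<lambda>\<theta>'. Q (\<nu> \<theta>') u v) has_derivative (\<lambda>h. dQ \<theta> u v \<bullet> h)) (at \<theta> within \<Theta>)"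
    and A3iii: "\<And>\<theta> u. \<theta> \<in> \<Theta> \<Longrightarrow>
                  summable (dQ \<theta> u) \<and>
                  ((\<lambda>\<theta>'. \<Sum>v. Q (\<nu> \<theta>') u v) has_derivative (\<lambda>h. (\<Sum>v. dQ \<theta> u v) \<bullet> h)) (at \<theta> within \<Theta>)"
    and A3iv: "\<And>\<theta>. \<theta> \<in> \<Theta> \<Longrightarrow>
                  \<exists>V. open V \<and> \<theta> \<in> V \<and>
                    inv_nn (\<nu> \<theta>) (\<lambda>x y. SUP \<theta>'\<in>V \<inter> \<Theta>. ennreal ((norm (d\<phi> \<theta>' x y))\<^sup>2)) < \<infinity> \<and>
                    inv_nn (\<nu> \<theta>) (\<lambda>x y. SUP \<theta>'\<in>V \<inter> \<Theta>. ennreal (norm (dd\<phi> \<theta>' x y))) < \<infinity>"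
    and A3v_eq: "\<And>\<theta>. \<theta> \<in> \<Theta> \<Longrightarrow>
                  inv_mat (\<nu> \<theta>) (\<lambda>x y. outer (d\<phi> \<theta> x y)) = - inv_mat (\<nu> \<theta>) (dd\<phi> \<theta>)"
    and A3v: "\<And>\<theta>. \<theta> \<in> \<Theta> \<Longrightarrow> invertible (inv_mat (\<nu> \<theta>) (\<lambda>x y. outer (d\<phi> \<theta> x y)))"
    and est_meas: "\<And>n. est n \<in> path_space \<rightarrow>\<^sub>M borel"
    and est_argmax: "\<And>n. AE X in annealed_law (\<nu> \<theta>_star).
                  is_arg_max (criterion \<nu> \<theta>\<^sub>0 n X) (\<lambda>\<theta>. \<theta> \<in> \<Theta>) (est n X)"
  shows "conv_in_distr (annealed_law (\<nu> \<theta>_star))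
           (\<lambda>n X. sqrt (real n) *\<^sub>R (est n X - \<theta>_star))
           (centered_gaussian (matrix_inv
              (inv_mat (\<nu> \<theta>_star) (\<lambda>x y. outer (d\<phi> \<theta>_star x y)))))"
proof -
  have st: "\<theta>_star \<in> \<Theta>" using star interior_subset by blast
  have ident: "\<theta> = \<theta>'" if "\<theta> \<in> \<Theta>" "\<theta>' \<in> \<Theta>" "\<nu> \<theta> = \<nu> \<theta>'" for \<theta> \<theta>'
    using A2ii that by blast
  interpret mle_setting \<Theta> \<nu> \<theta>_star \<theta>\<^sub>0 d\<phi> dd\<phi> dQ
    by (rule mle_setting.intro; fact compact law star A1i[OF st] A1ii[OF st] conjunct1[OF A1iii[OF st]]
        A2i ident A2iii[OF st] A3i_grad A3i_hess A3i_cont dQ[OF st] A3iii[OF st] A3iv[OF st]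
        A3v_eq[OF st] A3v[OF st])
  show ?thesis using est_meas est_argmax by (rule asymptotic_normality)
qed

end
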